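(* For every fixed $T>0$, there exists $V_T^*\in\mathcal S(H,K;\beta)$ such that $$J_T(V_T^* )=\max_{V\in\mathcal S(H,K;\beta)}J_T(V).$$ Equivalently, $$\omega_T(V_T^* )=\max_{V\in\mathcal S(H,K;\beta)}\omega_T(V).$$
   Context: Setting. Let $N$ be a positive integer, $\mathbb R^N_+=\{x\in\mathbb R^N: x_N>0\}$, and let $\Omega\subset\overline{\mathbb R^N_+}$ be a bounded $C^2$ domain such that $\partial\Omega\cap\{x_N=0\}$ is a nonempty relatively open subset of $\partial\Omega$. Let $\alpha\in(0,1)$, $w=x_N^\alpha$, and $A=\mathrm{diag}(1,\dots,1,w)$ (with $N-1$ ones). Functions are real valued. Spaces. $H^1(\Omega;w)=\{u\in L^2(\Omega):\int_\Omega\nabla u\cdot A\nabla u\,dx<+\infty\}$ (weak derivatives), with inner product $\int_\Omega(uv+\nabla u\cdot A\nabla v)\,dx$; $H^1_0(\Omega;w)$ is the closure of $C_0^\infty(\Omega)$ in $H^1(\Omega;w)$. With $a(u,v)=\int_\Omega\nabla u\cdot A\nabla v\,dx$, the space $H_0^1(\Omega;w)$ is equipped with the equivalent norm $\|u\|_{H_0^1(\Omega;w)}=a(u,u)^{1/2}$. $\mathcal A u=-\mathrm{div}(A\nabla u)$ with $D(\mathcal A)=\{u\in H_0^1(\Omega;w):\mathcal A u\in L^2(\Omega)\}$. $\mathcal H=H_0^1(\Omega;w)\times L^2(\Omega)$ with inner product $\langle(u,v),(z,q)\rangle_{\mathcal H}=a(u,z)+(v,q)_{L^2(\Omega)}$.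 Admissible dampings. For constants $0<H<K$ and $\beta\in(H,K)$, $\mathcal S(H,K;\beta)=\{W\in L^\infty(\Omega): H\le W\le K \text{ a.e. in }\Omega,\ \int_\Omega W\,dx=\beta|\Omega|\}$. Semigroup. For $V\in\mathcal S(H,K;\beta)$, $\mathfrak A_V(u,v)=(-v,\ \mathcal A u+Vv)$ with domain $D(\mathcal A)\times H_0^1(\Omega;w)$; $-\mathfrak A_V$ generates a $C_0$-semigroup of contractions $S_V(t)=e^{-t\mathfrak A_V}$ on $\mathcal H$. $\|\cdot\|_{\mathcal L(\mathcal H)}$ is the operator norm. Functionals. Fix a constant $C_0>1$. For $T>0$ and $V\in\mathcal S(H,K;\beta)$, $$J_T(V)=-\tfrac12\|S_V(T)\|_{\mathcal L(\mathcal H)}^2,\qquad \omega_T(V)=\frac1T\log\frac{C_0}{\|S_V(T)\|_{\mathcal L(\mathcal H)}}.$$ *)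

theory Defs
  imports "HOL-Analysis.Analysis"
begin

section \<open>Square-integrable functions modulo equality almost everywhere\<close>

definition square_integrable :: "('a::euclidean_space \<Rightarrow> real) \<Rightarrow> bool" where
  "square_integrable f \<longleftrightarrow>
     f \<in> borel_measurable lebesgue \<and> integrable lebesgue (\<lambda>x. (f x)\<^sup>2)"

lemma square_integrable_zero: "square_integrable (\<lambda>x. 0)"
  by (simp add: square_integrable_def)

lemma square_integrable_mult:
  assumes "square_integrable f" "square_integrable g"
  shows "integrable lebesgue (\<lambda>x. f x * g x)"
proof (rule Bochner_Integration.integrable_bound)
  show "integrable lebesgue (\<lambda>x. (f x)\<^sup>2 + (g x)\<^sup>2)"
    using assms by (simp add: square_integrable_def)
  show "(\<lambda>x. f x * g x) \<in> borel_measurable lebesgue"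
    using assms by (auto simp: square_integrable_def intro: borel_measurable_times)
  have "\<bar>a * b\<bar> \<le> a\<^sup>2 + b\<^sup>2" for a b :: real
  proof -
    have "0 \<le> (\<bar>a\<bar> - \<bar>b\<bar>)\<^sup>2" by simp
    then have "2 * (\<bar>a\<bar> * \<bar>b\<bar>) \<le> a\<^sup>2 + b\<^sup>2" by (simp add: power2_diff)
    moreover have "0 \<le> \<bar>a\<bar> * \<bar>b\<bar>" by simp
    ultimately show ?thesis unfolding abs_mult by linarith
  qed
  then show "AE x in lebesgue. norm (f x * g x) \<le> norm ((f x)\<^sup>2 + (g x)\<^sup>2)"
    by simp
qed

lemma square_integrable_add:
  assumes "square_integrable f" "square_integrable g"
  shows "square_integrable (\<lambda>x. f x + g x)"
proof -
  have "integrable lebesgue (\<lambda>x. (f x)\<^sup>2 + (g x)\<^sup>2 + 2 * (f x * g x))"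
    using assms square_integrable_mult[OF assms] by (simp add: square_integrable_def)
  then show ?thesis
    using assms unfolding square_integrable_def
    by (auto simp: power2_sum mult.assoc intro: borel_measurable_add)
qed

lemma square_integrable_scale:
  assumes "square_integrable f"
  shows "square_integrable (\<lambda>x. c * f x)"
  using assms
  by (auto simp: square_integrable_def power_mult_distrib intro: borel_measurable_times)

lemma square_integrable_uminus:
  assumes "square_integrable f"
  shows "square_integrable (\<lambda>x. - f x)"
  using square_integrable_scale[OF assms, of "-1"] by simp

lemma square_integrable_diff:
  assumes "square_integrable f" "square_integrable g"
  shows "square_integrable (\<lambda>x. f x - g x)"
  using square_integrable_add[OF assms(1) square_integrable_uminus[OF assms(2)]] by simp

quotient_type (overloaded) 'a L2 = "'a::euclidean_space \<Rightarrow> real" / partial: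
  "\<lambda>f g. square_integrable f \<and> square_integrable g \<and> (AE x in lebesgue. f x = g x)"
proof (rule part_equivpI)
  show "\<exists>f :: 'a \<Rightarrow> real. square_integrable f \<and> square_integrable f \<and> (AE x in lebesgue. f x = f x)"
    using square_integrable_zero by auto
  show "symp (\<lambda>f g :: 'a \<Rightarrow> real.
      square_integrable f \<and> square_integrable g \<and> (AE x in lebesgue. f x = g x))"
    by (auto simp: symp_def elim: AE_mp)
  show "transp (\<lambda>f g :: 'a \<Rightarrow> real.
      square_integrable f \<and> square_integrable g \<and> (AE x in lebesgue. f x = g x))"
  proof (rule transpI, elim conjE, intro conjI)
    fix f g h :: "'a \<Rightarrow> real"
    assume "AE x in lebesgue. f x = g x" "AE x in lebesgue. g x = h x"
    then show "AE x in lebesgue. f x = h x" by eventually_elim simp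
  qed
qed

instantiation L2 :: (euclidean_space) real_inner
begin

lift_definition zero_L2 :: "'a L2" is "\<lambda>x. 0"
  by (simp add: square_integrable_zero)

lift_definition plus_L2 :: "'a L2 \<Rightarrow> 'a L2 \<Rightarrow> 'a L2" is "\<lambda>f g x. f x + g x"
  by (auto intro: square_integrable_add)

lift_definition uminus_L2 :: "'a L2 \<Rightarrow> 'a L2" is "\<lambda>f x. - f x"
  by (auto intro: square_integrable_uminus)

lift_definition minus_L2 :: "'a L2 \<Rightarrow> 'a L2 \<Rightarrow> 'a L2" is "\<lambda>f g x. f x - g x"
  by (auto intro: square_integrable_diff)

lift_definition scaleR_L2 :: "real \<Rightarrow> 'a L2 \<Rightarrow> 'a L2" is "\<lambda>c f x. c * f x"
  by (auto intro: square_integrable_scale)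

lift_definition inner_L2 :: "'a L2 \<Rightarrow> 'a L2 \<Rightarrow> real" is "\<lambda>f g. LINT x|lebesgue. f x * g x"
proof -
  fix f f' g g' :: "'a \<Rightarrow> real"
  assume f: "square_integrable f \<and> square_integrable f' \<and> (AE x in lebesgue. f x = f' x)"
    and g: "square_integrable g \<and> square_integrable g' \<and> (AE x in lebesgue. g x = g' x)"
  show "(LINT x|lebesgue. f x * g x) = (LINT x|lebesgue. f' x * g' x)"
  proof (rule integral_cong_AE)
    show "(\<lambda>x. f x * g x) \<in> borel_measurable lebesgue"
      "(\<lambda>x. f' x * g' x) \<in> borel_measurable lebesgue"
      using f g square_integrable_mult by blast+
    from f g have "AE x in lebesgue. f x = f' x" "AE x in lebesgue. g x = g' x" by auto
    then show "AE x in lebesgue. f x * g x = f' x * g' x" by eventually_elim simp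
  qed
qed

definition norm_L2 :: "'a L2 \<Rightarrow> real" where "norm_L2 f = sqrt (f \<bullet> f)"
definition dist_L2 :: "'a L2 \<Rightarrow> 'a L2 \<Rightarrow> real" where "dist_L2 f g = norm (f - g)"
definition sgn_L2 :: "'a L2 \<Rightarrow> 'a L2" where "sgn_L2 f = inverse (norm f) *\<^sub>R f"
definition uniformity_L2 :: "('a L2 \<times> 'a L2) filter" where
  "uniformity_L2 = (INF e\<in>{0<..}. principal {(x, y). dist x y < e})"
definition open_L2 :: "'a L2 set \<Rightarrow> bool" where
  "open_L2 U \<longleftrightarrow> (\<forall>x\<in>U. eventually (\<lambda>(x', y). x' = x \<longrightarrow> y \<in> U) uniformity)"

instance
proof
  fix a b c :: real and f g h :: "'a L2"
  show "f + g + h = f + (g + h)"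
    by transfer (auto simp: algebra_simps intro!: square_integrable_add)
  show "f + g = g + f"
    by transfer (auto simp: algebra_simps intro!: square_integrable_add)
  show "0 + f = f"
    by transfer auto
  show "- f + f = 0"
    by transfer (auto simp: square_integrable_zero)
  show "f - g = f + - g"
    by transfer (auto intro!: square_integrable_diff)
  show "a *\<^sub>R (f + g) = a *\<^sub>R f + a *\<^sub>R g"
    by transfer (auto simp: algebra_simps intro!: square_integrable_scale square_integrable_add)
  show "(a + b) *\<^sub>R f = a *\<^sub>R f + b *\<^sub>R f"
    by transfer (auto simp: distrib_right intro!: square_integrable_scale square_integrable_add)
  show "a *\<^sub>R b *\<^sub>R f = (a * b) *\<^sub>R f"
    by transfer (auto simp: mult.assoc intro!: square_integrable_scale)
  show "1 *\<^sub>R f = f"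
    by transfer auto
  show "dist f g = norm (f - g)" by (simp add: dist_L2_def)
  show "sgn f = inverse (norm f) *\<^sub>R f" by (simp add: sgn_L2_def)
  show "(uniformity :: ('a L2 \<times> 'a L2) filter) = (INF e\<in>{0<..}. principal {(x, y). dist x y < e})"
    by (simp add: uniformity_L2_def)
  show "open U = (\<forall>x\<in>U. \<forall>\<^sub>F (x', y) in uniformity. x' = x \<longrightarrow> y \<in> U)" for U :: "'a L2 set"
    by (simp add: open_L2_def)
  show "f \<bullet> g = g \<bullet> f" by transfer (simp add: mult.commute)
  show "(f + g) \<bullet> h = f \<bullet> h + g \<bullet> h"
  proof transfer
    fix f g h :: "'a \<Rightarrow> real"
    assume "square_integrable f \<and> square_integrable f \<and> (AE x in lebesgue. f x = f x)"
      "square_integrable g \<and> square_integrable g \<and> (AE x in lebesgue. g x = g x)"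
      "square_integrable h \<and> square_integrable h \<and> (AE x in lebesgue. h x = h x)"
    then have "integrable lebesgue (\<lambda>x. f x * h x)" "integrable lebesgue (\<lambda>x. g x * h x)"
      by (auto intro: square_integrable_mult)
    then show "(LINT x|lebesgue. (f x + g x) * h x)
        = (LINT x|lebesgue. f x * h x) + (LINT x|lebesgue. g x * h x)"
      by (simp add: distrib_right)
  qed
  show "a *\<^sub>R f \<bullet> g = a * (f \<bullet> g)" by transfer (simp add: mult.assoc)
  show "0 \<le> f \<bullet> f" by transfer simp
  show "(f \<bullet> f = 0) = (f = 0)"
  proof transfer
    fix f :: "'a \<Rightarrow> real"
    assume "square_integrable f \<and> square_integrable f \<and> (AE x in lebesgue. f x = f x)"
    then have f: "square_integrable f" by simp
    have "((LINT x|lebesgue. f x * f x) = 0) \<longleftrightarrow> (AE x in lebesgue. f x * f x = 0)"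
      by (rule integral_nonneg_eq_0_iff_AE) (use square_integrable_mult[OF f f] in auto)
    then show "((LINT x|lebesgue. f x * f x) = 0) =
        (square_integrable f \<and> square_integrable (\<lambda>x. 0 :: real) \<and> (AE x in lebesgue. f x = 0))"
      using f square_integrable_zero by auto
  qed
  show "norm f = sqrt (f \<bullet> f)" by (simp add: norm_L2_def)
qed

end

text \<open>\<open>L\<^sup>2(\<Omega>)\<close> is identified, by extension by zero, with the closed subspace of those elements of
  \<open>L\<^sup>2\<close> of the whole space that vanish a.e. outside \<open>\<Omega>\<close>; norm and inner product are inherited.\<close>

definition L2_on :: "'a::euclidean_space set \<Rightarrow> 'a L2 set" where
  "L2_on \<Omega> = {f. AE x in lebesgue. x \<notin> \<Omega> \<longrightarrow> rep_L2 f x = 0}"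

definition mult_L2 :: "'a::euclidean_space set \<Rightarrow> ('a \<Rightarrow> real) \<Rightarrow> 'a L2 \<Rightarrow> 'a L2" where
  "mult_L2 \<Omega> V f = abs_L2 (\<lambda>x. if x \<in> \<Omega> then V x * rep_L2 f x else 0)"


section \<open>Smooth functions and \<open>C\<^sup>2\<close> domains\<close>

definition partial_derivative :: "'n::finite \<Rightarrow> (real^'n \<Rightarrow> real) \<Rightarrow> real^'n \<Rightarrow> real" where
  "partial_derivative i f x = frechet_derivative f (at x) (axis i 1)"

definition gradient :: "(real^'n::finite \<Rightarrow> real) \<Rightarrow> real^'n \<Rightarrow> real^'n" where
  "gradient f x = (\<chi> i. partial_derivative i f x)"

primrec C_k :: "nat \<Rightarrow> (real^'n::finite \<Rightarrow> real) \<Rightarrow> bool" where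
  "C_k 0 f \<longleftrightarrow> continuous_on UNIV f"
| "C_k (Suc m) f \<longleftrightarrow> f differentiable_on UNIV \<and> (\<forall>i. C_k m (partial_derivative i f))"

definition test_functions :: "(real^'n::finite) set \<Rightarrow> (real^'n \<Rightarrow> real) set" where
  "test_functions \<Omega> = {\<phi>. (\<forall>m. C_k m \<phi>) \<and>
     compact (closure {x. \<phi> x \<noteq> 0}) \<and> closure {x. \<phi> x \<noteq> 0} \<subseteq> \<Omega>}"

text \<open>Near each boundary point the domain is the part of a ball lying above the graph of a \<open>C\<^sup>2\<close>
  function in some direction \<open>e\<close>. The function \<open>\<gamma>\<close> is evaluated only on the hyperplane orthogonal
  to \<open>e\<close>; composing with the orthogonal projection extends any \<open>C\<^sup>2\<close> function on that hyperplane
  to the whole space.\<close>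

definition C2_domain :: "(real^'n::finite) set \<Rightarrow> bool" where
  "C2_domain \<Omega> \<longleftrightarrow> open \<Omega> \<and> connected \<Omega> \<and> \<Omega> \<noteq> {} \<and>
     (\<forall>p \<in> frontier \<Omega>. \<exists>r>0. \<exists>e. norm e = 1 \<and> (\<exists>\<gamma>. C_k 2 \<gamma> \<and>
        \<Omega> \<inter> ball p r = {x \<in> ball p r. x \<bullet> e > \<gamma> (x - (x \<bullet> e) *\<^sub>R e)}))"

text \<open>Here and below \<open>k\<close> is the distinguished coordinate, written \<open>N\<close> on paper. The last conjunct
  says that \<open>\<partial>\<Omega> \<inter> {x\<^sub>N = 0}\<close> contains a nonempty relatively open subset of \<open>\<partial>\<Omega>\<close>. It is implied by
  the requirement that this closed set itself be nonempty and relatively open in \<open>\<partial>\<Omega>\<close>, but that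
  requirement would make it a union of components of \<open>\<partial>\<Omega>\<close>, which a bounded \<open>C\<^sup>2\<close> domain can
  satisfy only in dimension one.\<close>

definition admissible_domain :: "'n::finite \<Rightarrow> (real^'n) set \<Rightarrow> bool" where
  "admissible_domain k \<Omega> \<longleftrightarrow>
     C2_domain \<Omega> \<and> bounded \<Omega> \<and> \<Omega> \<subseteq> closure {x. x $ k > 0} \<and>
     (\<exists>U. U \<noteq> {} \<and> openin (top_of_set (frontier \<Omega>)) U \<and> U \<subseteq> frontier \<Omega> \<inter> {x. x $ k = 0})"


section \<open>Weighted Sobolev spaces and the degenerate operator\<close>

definition weight_matrix :: "'n::finite \<Rightarrow> real \<Rightarrow> real^'n \<Rightarrow> real^'n^'n" where
  "weight_matrix k \<alpha> x =
     (\<chi> i j. if i = j then (if i = k then (x $ k) powr \<alpha> else 1) else 0)"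

definition is_weak_gradient ::
    "(real^'n::finite) set \<Rightarrow> (real^'n) L2 \<Rightarrow> (real^'n \<Rightarrow> real^'n) \<Rightarrow> bool" where
  "is_weak_gradient \<Omega> u g \<longleftrightarrow>
     g \<in> borel_measurable (lebesgue_on \<Omega>) \<and>
     (\<forall>K. compact K \<and> K \<subseteq> \<Omega> \<longrightarrow> integrable (lebesgue_on K) g) \<and>
     (\<forall>\<phi> \<in> test_functions \<Omega>.
        (LINT x|lebesgue_on \<Omega>. rep_L2 u x *\<^sub>R gradient \<phi> x)
          = - (LINT x|lebesgue_on \<Omega>. \<phi> x *\<^sub>R g x))"

text \<open>Weak gradients are unique up to null sets, so the choice is immaterial.\<close>

definition weak_gradient ::
    "(real^'n::finite) set \<Rightarrow> (real^'n) L2 \<Rightarrow> real^'n \<Rightarrow> real^'n" where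
  "weak_gradient \<Omega> u = (SOME g. is_weak_gradient \<Omega> u g)"

definition H1w :: "'n::finite \<Rightarrow> real \<Rightarrow> (real^'n) set \<Rightarrow> (real^'n) L2 set" where
  "H1w k \<alpha> \<Omega> = {u \<in> L2_on \<Omega>. \<exists>g. is_weak_gradient \<Omega> u g \<and>
     integrable (lebesgue_on \<Omega>) (\<lambda>x. g x \<bullet> (weight_matrix k \<alpha> x *v g x))}"

definition energy_form ::
    "'n::finite \<Rightarrow> real \<Rightarrow> (real^'n) set \<Rightarrow> (real^'n) L2 \<Rightarrow> (real^'n) L2 \<Rightarrow> real" where
  "energy_form k \<alpha> \<Omega> u v =
     (LINT x|lebesgue_on \<Omega>. weak_gradient \<Omega> u x \<bullet> (weight_matrix k \<alpha> x *v weak_gradient \<Omega> v x))"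

definition H1w_norm :: "'n::finite \<Rightarrow> real \<Rightarrow> (real^'n) set \<Rightarrow> (real^'n) L2 \<Rightarrow> real" where
  "H1w_norm k \<alpha> \<Omega> u = sqrt (u \<bullet> u + energy_form k \<alpha> \<Omega> u u)"

definition H10w :: "'n::finite \<Rightarrow> real \<Rightarrow> (real^'n) set \<Rightarrow> (real^'n) L2 set" where
  "H10w k \<alpha> \<Omega> = {u \<in> H1w k \<alpha> \<Omega>.
     \<forall>\<epsilon>>0. \<exists>\<phi> \<in> test_functions \<Omega>. H1w_norm k \<alpha> \<Omega> (u - abs_L2 \<phi>) < \<epsilon>}"

text \<open>\<open>- div (A \<nabla>u) = f\<close> in the sense of distributions on \<open>\<Omega>\<close>\<close>

definition has_neg_div ::
    "'n::finite \<Rightarrow> real \<Rightarrow> (real^'n) set \<Rightarrow> (real^'n) L2 \<Rightarrow> (real^'n) L2 \<Rightarrow> bool" where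
  "has_neg_div k \<alpha> \<Omega> u f \<longleftrightarrow>
     (\<forall>\<phi> \<in> test_functions \<Omega>.
        (LINT x|lebesgue_on \<Omega>. (weight_matrix k \<alpha> x *v weak_gradient \<Omega> u x) \<bullet> gradient \<phi> x)
          = (LINT x|lebesgue_on \<Omega>. rep_L2 f x * \<phi> x))"

definition dom_op :: "'n::finite \<Rightarrow> real \<Rightarrow> (real^'n) set \<Rightarrow> (real^'n) L2 set" where
  "dom_op k \<alpha> \<Omega> = {u \<in> H10w k \<alpha> \<Omega>. \<exists>f \<in> L2_on \<Omega>. has_neg_div k \<alpha> \<Omega> u f}"

definition deg_op :: "'n::finite \<Rightarrow> real \<Rightarrow> (real^'n) set \<Rightarrow> (real^'n) L2 \<Rightarrow> (real^'n) L2" where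
  "deg_op k \<alpha> \<Omega> u = (THE f. f \<in> L2_on \<Omega> \<and> has_neg_div k \<alpha> \<Omega> u f)"


section \<open>Contraction semigroups on a subspace with its own norm\<close>

text \<open>The energy space carries a norm different from that of the ambient type, so the notions are
  relative to a carrier \<open>X\<close> and a norm \<open>nrm\<close> on it. Values \<open>S t x\<close> with \<open>t < 0\<close> or \<open>x \<notin> X\<close> are
  irrelevant.\<close>

definition contraction_semigroup ::
    "'a::real_vector set \<Rightarrow> ('a \<Rightarrow> real) \<Rightarrow> (real \<Rightarrow> 'a \<Rightarrow> 'a) \<Rightarrow> bool" where
  "contraction_semigroup X nrm S \<longleftrightarrow>
     (\<forall>t\<ge>0. \<forall>x\<in>X. S t x \<in> X \<and> nrm (S t x) \<le> nrm x) \<and>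
     (\<forall>t\<ge>0. \<forall>x\<in>X. \<forall>y\<in>X. S t (x + y) = S t x + S t y) \<and>
     (\<forall>t\<ge>0. \<forall>c. \<forall>x\<in>X. S t (c *\<^sub>R x) = c *\<^sub>R S t x) \<and>
     (\<forall>x\<in>X. S 0 x = x) \<and>
     (\<forall>s\<ge>0. \<forall>t\<ge>0. \<forall>x\<in>X. S (s + t) x = S s (S t x)) \<and>
     (\<forall>x\<in>X. ((\<lambda>t. nrm (S t x - x)) \<longlongrightarrow> 0) (at_right 0))"

definition generator_graph ::
    "'a::real_vector set \<Rightarrow> ('a \<Rightarrow> real) \<Rightarrow> (real \<Rightarrow> 'a \<Rightarrow> 'a) \<Rightarrow> ('a \<times> 'a) set" where
  "generator_graph X nrm S = {(x, y). x \<in> X \<and> y \<in> X \<and>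
     ((\<lambda>t. nrm ((1 / t) *\<^sub>R (S t x - x) - y)) \<longlongrightarrow> 0) (at_right 0)}"

definition operator_norm :: "'a set \<Rightarrow> ('a \<Rightarrow> real) \<Rightarrow> ('a \<Rightarrow> 'a) \<Rightarrow> real" where
  "operator_norm X nrm B = (SUP x \<in> {x \<in> X. nrm x \<le> 1}. nrm (B x))"


section \<open>The damped equation\<close>

type_synonym 'n state = "(real^'n) L2 \<times> (real^'n) L2"

definition energy_space :: "'n::finite \<Rightarrow> real \<Rightarrow> (real^'n) set \<Rightarrow> 'n state set" where
  "energy_space k \<alpha> \<Omega> = H10w k \<alpha> \<Omega> \<times> L2_on \<Omega>"

definition energy_inner ::
    "'n::finite \<Rightarrow> real \<Rightarrow> (real^'n) set \<Rightarrow> 'n state \<Rightarrow> 'n state \<Rightarrow> real" where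
  "energy_inner k \<alpha> \<Omega> x y = energy_form k \<alpha> \<Omega> (fst x) (fst y) + snd x \<bullet> snd y"

definition energy_norm :: "'n::finite \<Rightarrow> real \<Rightarrow> (real^'n) set \<Rightarrow> 'n state \<Rightarrow> real" where
  "energy_norm k \<alpha> \<Omega> x = sqrt (energy_inner k \<alpha> \<Omega> x x)"

definition admissible_dampings ::
    "'a::euclidean_space set \<Rightarrow> real \<Rightarrow> real \<Rightarrow> real \<Rightarrow> ('a \<Rightarrow> real) set" where
  "admissible_dampings \<Omega> H K \<beta> =
     {W. W \<in> borel_measurable (lebesgue_on \<Omega>) \<and>
         (AE x in lebesgue_on \<Omega>. H \<le> W x \<and> W x \<le> K) \<and>
         (LINT x|lebesgue_on \<Omega>. W x) = \<beta> * measure lebesgue \<Omega>}"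

definition damped_op ::
    "'n::finite \<Rightarrow> real \<Rightarrow> (real^'n) set \<Rightarrow> (real^'n \<Rightarrow> real) \<Rightarrow> 'n state \<Rightarrow> 'n state" where
  "damped_op k \<alpha> \<Omega> V = (\<lambda>(u, v). (- v, deg_op k \<alpha> \<Omega> u + mult_L2 \<Omega> V v))"

text \<open>A semigroup is determined on its carrier, for nonnegative times, by its generator; hence the
  choice affects only the irrelevant values.\<close>

definition damped_semigroup ::
    "'n::finite \<Rightarrow> real \<Rightarrow> (real^'n) set \<Rightarrow> (real^'n \<Rightarrow> real) \<Rightarrow> real \<Rightarrow> 'n state \<Rightarrow> 'n state" where
  "damped_semigroup k \<alpha> \<Omega> V =
     (SOME S. contraction_semigroup (energy_space k \<alpha> \<Omega>) (energy_norm k \<alpha> \<Omega>) S \<and>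
        generator_graph (energy_space k \<alpha> \<Omega>) (energy_norm k \<alpha> \<Omega>) S
          = {(x, - damped_op k \<alpha> \<Omega> V x) | x. x \<in> dom_op k \<alpha> \<Omega> \<times> H10w k \<alpha> \<Omega>})"

definition semigroup_norm ::
    "'n::finite \<Rightarrow> real \<Rightarrow> (real^'n) set \<Rightarrow> real \<Rightarrow> (real^'n \<Rightarrow> real) \<Rightarrow> real" where
  "semigroup_norm k \<alpha> \<Omega> T V =
     operator_norm (energy_space k \<alpha> \<Omega>) (energy_norm k \<alpha> \<Omega>) (damped_semigroup k \<alpha> \<Omega> V T)"

definition J_functional ::
    "'n::finite \<Rightarrow> real \<Rightarrow> (real^'n) set \<Rightarrow> real \<Rightarrow> (real^'n \<Rightarrow> real) \<Rightarrow> real" where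
  "J_functional k \<alpha> \<Omega> T V = - (1 / 2) * (semigroup_norm k \<alpha> \<Omega> T V)\<^sup>2"

definition omega_functional ::
    "'n::finite \<Rightarrow> real \<Rightarrow> (real^'n) set \<Rightarrow> real \<Rightarrow> real \<Rightarrow> (real^'n \<Rightarrow> real) \<Rightarrow> real" where
  "omega_functional k \<alpha> \<Omega> C\<^sub>0 T V = (1 / T) * ln (C\<^sub>0 / semigroup_norm k \<alpha> \<Omega> T V)"

definition maximizes_on :: "('a \<Rightarrow> real) \<Rightarrow> 'a set \<Rightarrow> 'a \<Rightarrow> bool" where
  "maximizes_on F A v \<longleftrightarrow> v \<in> A \<and> (\<forall>w\<in>A. F w \<le> F v)"

end

theory Submission
  imports Defs "HOL-Library.Diagonal_Subsequence" "HOL-Computational_Algebra.Polynomial"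
begin

text \<open>The state \<open>(u, v)\<close> is identified with \<open>(A\<^sup>1\<^sup>/\<^sup>2 \<nabla>u, v)\<close>, which makes the energy space isometric to a closed
  subspace of a power of \<open>L\<^sup>2\<close>. There the damped wave operator is m-dissipative by the Lax--Milgram
  theorem, and the semigroup is the strong limit of the powers \<open>J (t / m)\<^sup>m\<close> of its resolvents.
  Since \<open>x\<^sub>N\<^sup>-\<^sup>\<alpha>\<close> is integrable near \<open>0\<close>, the \<open>L\<^sup>2\<close> norm of a translation difference of \<open>u\<close>
  is controlled by the energy, hence \<open>H\<^sub>0\<^sup>1(\<Omega>; w)\<close> embeds compactly in \<open>L\<^sup>2\<close>. Consequently, if
  dampings \<open>V\<^sub>n\<close> converge weakly to \<open>V\<close>, then the resolvents and with them the semigroups converge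
  strongly. The admissible dampings are weakly compact and the operator norm is lower semicontinuous
  under strong convergence, so \<open>\<parallel>S\<^sub>V(T)\<parallel>\<close> attains its minimum. This minimum is positive because the
  energy decays at most exponentially, so the minimizers are exactly the maximizers of either
  functional.\<close>

section \<open>Hilbert space preliminaries\<close>

text \<open>Weak convergence of dampings gives no control of products with functions that vary as
  well. In the variables (weighted gradient, velocity) the resolvent equation reduces to one
  coercive equation for the weighted gradient \<open>\<kappa>\<close> of the velocity, in which the
  damping occurs only as \<open>Es (V (E \<kappa>))\<close>. Here \<open>E\<close> inverts the
  weighted gradient and \<open>Es\<close> is its adjoint, which inherits the compactness. Weak
  convergence of \<open>V\<^sub>n f\<close> for one fixed \<open>f\<close> thus becomes norm
  convergence of \<open>Es (V\<^sub>n f)\<close>, and coercivity does the rest. Adjointness also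
  makes the undamped part skew, which gives dissipativity. The degeneracy at the boundary is
  absorbed in one constant, a bound for the integrals of the reciprocal weight along lines parallel
  to the axes; both the Poincare inequality and the compactness rest on it. Powers of resolvents
  come with error bounds that are uniform along a sequence of generators, and a uniqueness result
  ties their limit to the semigroup that the definition selects by its generator graph.\<close>

lemma subspace_0_le_quadratic_imp:
  fixes d q :: real
  assumes "\<And>t. 0 \<le> 2 * t * d + t\<^sup>2 * q" "0 \<le> q"
  shows "d = 0"
proof -
  \<comment> \<open>The test value is \<open>t = - d / c\<close>; every \<open>c > q / 2\<close>
    gives the contradiction, and \<open>c = q + 1\<close> is in addition nonzero when
    \<open>q = 0\<close>.\<close>
  define e where "e = d / (q + 1)"
  have d: "d = e * (q + 1)" using assms(2) by (simp add: e_def)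
  have "0 \<le> 2 * (- e) * d + (- e)\<^sup>2 * q" by (rule assms(1))
  then have "e\<^sup>2 * (q + 2) \<le> 0" unfolding d by (simp add: power2_eq_square algebra_simps)
  then have "e = 0" using assms(2) by (simp add: mult_le_0_iff)
  then show ?thesis using d by simp
qed

lemma subspace_closure:
  fixes S :: "'a::real_normed_vector set"
  assumes "subspace S"
  shows "subspace (closure S)"
proof (rule subspaceI)
  show "0 \<in> closure S" using assms subspace_0 closure_subset by blast
next
  fix x y assume "x \<in> closure S" "y \<in> closure S"
  then obtain a b where "\<And>n. a n \<in> S" "a \<longlonglongrightarrow> x" "\<And>n. b n \<in> S" "b \<longlonglongrightarrow> y"
    unfolding closure_sequential by blast
  then show "x + y \<in> closure S"
    unfolding closure_sequential using assms
    by (intro exI[of _ "\<lambda>n. a n + b n"]) (auto intro: tendsto_add subspace_add)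
next
  fix c :: real and x assume "x \<in> closure S"
  then obtain a where "\<And>n. a n \<in> S" "a \<longlonglongrightarrow> x" unfolding closure_sequential by blast
  then show "c *\<^sub>R x \<in> closure S"
    unfolding closure_sequential using assms
    by (intro exI[of _ "\<lambda>n. c *\<^sub>R a n"]) (auto intro: tendsto_scaleR subspace_scale)
qed

text \<open>Direct method: the energy \<open>F\<close> is bounded below on \<open>S\<close>, its
  minimizing sequences are Cauchy by the parallelogram identity, and the vanishing first variation
  at the minimum says that the minimizer represents \<open>l\<close>. Linearity is asked for on
  \<open>S\<close> alone, since the functionals built from the inverse gradient are linear only
  there.\<close>

lemma riesz_closed_subspace:
  fixes S :: "'a::{real_inner,complete_space} set"
  assumes S: "closed S" "subspace S"
    and add: "\<And>x y. x \<in> S \<Longrightarrow> y \<in> S \<Longrightarrow> l (x + y) = l x + l y"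
    and scale: "\<And>c x. x \<in> S \<Longrightarrow> l (c *\<^sub>R x) = c * l x"
    and bound: "\<And>x. x \<in> S \<Longrightarrow> \<bar>l x\<bar> \<le> B * norm x"
  shows "\<exists>r\<in>S. \<forall>x\<in>S. r \<bullet> x = l x"
proof -
  define F where "F x = (norm x)\<^sup>2 - 2 * l x" for x
  define m where "m = Inf (F ` S)"
  have S0: "0 \<in> S" using S(2) by (rule subspace_0)
  have Fge: "- B\<^sup>2 \<le> F x" if "x \<in> S" for x
  proof -
    have "0 \<le> (norm x - B)\<^sup>2" by simp
    then show ?thesis using bound[OF that] unfolding F_def power2_diff by (simp add: algebra_simps)
  qed
  have bdd: "bdd_below (F ` S)" using Fge by (auto intro!: bdd_belowI)
  have mle: "m \<le> F x" if "x \<in> S" for x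
    unfolding m_def using bdd that by (auto intro: cINF_lower)
  have "\<exists>x\<in>S. F x < m + inverse (Suc n)" for n
  proof -
    have "\<exists>y\<in>F ` S. y < m + inverse (Suc n)"
      unfolding m_def by (rule cInf_lessD) (use S0 in auto)
    then show ?thesis by auto
  qed
  then obtain x where x: "\<And>n. x n \<in> S" "\<And>n. F (x n) < m + inverse (Suc n)" by metis
  \<comment> \<open>Parallelogram identity with the midpoint as competitor: \<open>l\<close>
    contributes equally to both sides and cancels, and \<open>F\<close> of the midpoint is at least
    \<open>m\<close>.\<close>
  have par: "(norm (a - b))\<^sup>2 \<le> 2 * (F a - m) + 2 * (F b - m)" if "a \<in> S" "b \<in> S" for a b
  proof -
    have h: "(1/2) *\<^sub>R (a + b) \<in> S" using S(2) that by (simp add: subspace_add subspace_scale)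
    have "l ((1/2) *\<^sub>R (a + b)) = (l a + l b) / 2"
      using that S(2) by (simp add: scale add subspace_add)
    then have F: "4 * F ((1/2) *\<^sub>R (a + b)) = (norm (a + b))\<^sup>2 - 4 * l a - 4 * l b"
      unfolding F_def by (simp add: power_mult_distrib power_divide)
    have "(norm (a - b))\<^sup>2 = 2 * F a + 2 * F b - 4 * F ((1/2) *\<^sub>R (a + b))"
      unfolding F unfolding F_def power2_norm_eq_inner
      by (simp add: inner_add_left inner_add_right inner_diff_left inner_diff_right inner_commute)
    then show ?thesis using mle[OF h] by simp
  qed
  have inv0: "(\<lambda>n. inverse (real (Suc n))) \<longlonglongrightarrow> 0" by (rule LIMSEQ_inverse_real_of_nat)
  have "Cauchy x"
  proof (rule metric_CauchyI)
    fix e :: real assume e: "0 < e"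
    have "\<forall>\<^sub>F n in sequentially. inverse (real (Suc n)) < e\<^sup>2 / 4"
      using inv0 e by (intro order_tendstoD) auto
    then obtain M where M: "\<And>n. n \<ge> M \<Longrightarrow> inverse (real (Suc n)) < e\<^sup>2 / 4"
      by (auto simp: eventually_sequentially)
    show "\<exists>M. \<forall>i\<ge>M. \<forall>j\<ge>M. dist (x i) (x j) < e"
    proof (intro exI allI impI)
      fix i j assume "M \<le> i" "M \<le> j"
      then have "(norm (x i - x j))\<^sup>2 < e\<^sup>2"
        using par[OF x(1) x(1), of i j] x(2)[of i] x(2)[of j] M[of i] M[of j] by simp
      then show "dist (x i) (x j) < e" using e by (simp add: dist_norm power_less_imp_less_base)
    qed
  qed
  then obtain r where r: "x \<longlonglongrightarrow> r" using Cauchy_convergent_iff convergent_def by blast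
  have rS: "r \<in> S" using S(1) x(1) r closed_sequentially by blast
  have ldiff: "l (a - b) = l a - l b" if "a \<in> S" "b \<in> S" for a b
    using add[of a "(-1) *\<^sub>R b"] scale[of b "-1"] that S(2) by (simp add: subspace_neg)
  have "(\<lambda>n. l (x n) - l r) \<longlonglongrightarrow> 0"
  proof (rule Lim_null_comparison)
    show "\<forall>\<^sub>F n in sequentially. norm (l (x n) - l r) \<le> B * norm (x n - r)"
      using bound[of "x _ - r"] x(1) rS S(2) by (auto simp: ldiff[symmetric] subspace_diff)
    show "(\<lambda>n. B * norm (x n - r)) \<longlonglongrightarrow> 0"
      using tendsto_mult_right_zero[OF tendsto_norm_zero[OF LIM_zero[OF r]]] by simp
  qed
  then have "(\<lambda>n. l (x n)) \<longlonglongrightarrow> l r" by (simp add: LIM_zero_iff)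
  then have lim: "(\<lambda>n. F (x n)) \<longlonglongrightarrow> F r" unfolding F_def by (intro tendsto_intros r)
  have "(\<lambda>n. m + inverse (real (Suc n))) \<longlonglongrightarrow> m + 0" by (intro tendsto_intros inv0)
  from LIMSEQ_le[OF lim this] x(2) have Fr: "F r \<le> m" by (auto intro: less_imp_le)
  have "r \<bullet> y = l y" if y: "y \<in> S" for y
  proof -
    have "r \<bullet> y - l y = 0"
    proof (rule subspace_0_le_quadratic_imp)
      fix t
      have tS: "t *\<^sub>R y \<in> S" "r + t *\<^sub>R y \<in> S" using S(2) y rS by (auto simp: subspace_add subspace_scale)
      have "F r \<le> F (r + t *\<^sub>R y)" using Fr mle[OF tS(2)] by simp
      then show "0 \<le> 2 * t * (r \<bullet> y - l y) + t\<^sup>2 * (norm y)\<^sup>2"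
        unfolding F_def power2_norm_eq_inner add[OF rS tS(1)] scale[OF y]
        by (simp add: inner_add_left inner_add_right inner_commute algebra_simps power2_eq_square)
    qed simp
    then show ?thesis by simp
  qed
  then show ?thesis using rS by blast
qed

lemma orthogonal_projection_exists:
  fixes S :: "'a::{real_inner,complete_space} set"
  assumes "closed S" "subspace S"
  shows "\<exists>p\<in>S. \<forall>y\<in>S. p \<bullet> y = x \<bullet> y"
  by (rule riesz_closed_subspace[OF assms, of _ "norm x"])
    (auto simp: inner_add_right Cauchy_Schwarz_ineq2)

text \<open>The difference between \<open>x\<close> and its projection onto \<open>closure S\<close>
  lies in \<open>X\<close> and is orthogonal to \<open>S\<close>, hence vanishes. This turns density
  of the domain of the wave generator into an orthogonality check.\<close>

lemma subset_closure_if_orthogonal_trivial: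
  fixes X S :: "'a::{real_inner,complete_space} set"
  assumes "subspace X" "subspace S" "closed X" "S \<subseteq> X"
    and orth: "\<And>z. z \<in> X \<Longrightarrow> (\<And>y. y \<in> S \<Longrightarrow> z \<bullet> y = 0) \<Longrightarrow> z = 0"
  shows "X \<subseteq> closure S"
proof
  fix x assume x: "x \<in> X"
  obtain p where p: "p \<in> closure S" "\<And>y. y \<in> closure S \<Longrightarrow> p \<bullet> y = x \<bullet> y"
    using orthogonal_projection_exists[OF closed_closure subspace_closure[OF assms(2)], of x] by blast
  have "closure S \<subseteq> X" using assms by (simp add: closure_minimal)
  then have "x - p = 0"
    using p x assms closure_subset[of S]
    by (intro orth) (auto simp: subspace_diff inner_diff_left)
  then show "x \<in> closure S" using p by simp
qed

text \<open>A uniform limit of convergent sequences is Cauchy. It serves to show that the vectors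
  against which a bounded sequence converges weakly form a closed set.\<close>

lemma real_seq_Cauchy_by_approx:
  fixes a :: "nat \<Rightarrow> real"
  assumes "\<And>e. 0 < e \<Longrightarrow> \<exists>b. convergent b \<and> (\<forall>n. \<bar>a n - b n\<bar> \<le> e)"
  shows "convergent a"
proof -
  have "Cauchy a"
  proof (rule metric_CauchyI)
    fix e :: real assume "0 < e"
    then obtain b where b: "convergent b" "\<And>n. \<bar>a n - b n\<bar> \<le> e / 4"
      using assms[of "e/4"] by auto
    then have "Cauchy b" by (simp add: Cauchy_convergent_iff)
    then obtain M where M: "\<And>m n. m \<ge> M \<Longrightarrow> n \<ge> M \<Longrightarrow> dist (b m) (b n) < e / 4"
      using \<open>0 < e\<close> by (metis metric_CauchyD zero_less_divide_iff zero_less_numeral)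
    have "dist (a m) (a n) < e" if "m \<ge> M" "n \<ge> M" for m n
      using M[OF that] b(2)[of m] b(2)[of n] \<open>0 < e\<close> unfolding dist_real_def by linarith
    then show "\<exists>M. \<forall>m\<ge>M. \<forall>n\<ge>M. dist (a m) (a n) < e" by blast
  qed
  then show ?thesis by (simp add: Cauchy_convergent_iff)
qed

text \<open>The countable family for the diagonal argument is the sequence itself. Convergence of
  the inner products extends from \<open>range f\<close> to its closed span, and any
  \<open>y\<close> may be replaced by its projection onto this span without changing
  \<open>f (r n) \<bullet> y\<close>. The limit functional is bounded by \<open>B\<close> and is
  represented by Riesz.\<close>

lemma bounded_imp_weakly_convergent_subsequence:
  fixes f :: "nat \<Rightarrow> 'a::{real_inner,complete_space}"
  assumes B: "\<And>n. norm (f n) \<le> B"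
  shows "\<exists>r l. strict_mono (r :: nat \<Rightarrow> nat) \<and> (\<forall>y. (\<lambda>n. f (r n) \<bullet> y) \<longlonglongrightarrow> l \<bullet> y)"
proof -
  have B0: "0 \<le> B" using B[of 0] norm_ge_zero order_trans by blast
  interpret subseqs "\<lambda>n s. convergent (\<lambda>i. f (s i) \<bullet> f n)"
  proof
    fix n and s :: "nat \<Rightarrow> nat" assume "strict_mono s"
    have "bounded (range (\<lambda>i. f (s i) \<bullet> f n))"
    proof (rule boundedI)
      fix x assume "x \<in> range (\<lambda>i. f (s i) \<bullet> f n)"
      then obtain i where "x = f (s i) \<bullet> f n" by auto
      then show "norm x \<le> B * B"
        using Cauchy_Schwarz_ineq2[of "f (s i)" "f n"] mult_mono[OF B B B0 norm_ge_zero, of "s i" n]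
        by simp
    qed
    then obtain l r where "strict_mono r" "((\<lambda>i. f (s i) \<bullet> f n) \<circ> r) \<longlonglongrightarrow> l"
      using bounded_imp_convergent_subsequence by blast
    then show "\<exists>r'. strict_mono r' \<and> convergent (\<lambda>i. f ((s \<circ> r') i) \<bullet> f n)"
      by (auto simp: o_def convergent_def)
  qed
  define r where "r = diagseq"
  have r: "strict_mono r" unfolding r_def by (rule subseq_diagseq)
  have conv_f: "convergent (\<lambda>i. f (r i) \<bullet> f n)" for n
  proof -
    \<comment> \<open>The diagonal sequence is a subsequence of the \<open>n\<close>-th extracted
      one only from index \<open>Suc n\<close> on; the initial segment does not affect
      convergence.\<close>
    have "convergent (\<lambda>i. f ((diagseq \<circ> (+) (Suc n)) i) \<bullet> f n)"
    proof (rule diagseq_holds)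
      fix r s n assume "strict_mono (r :: nat \<Rightarrow> nat)" "convergent (\<lambda>i. f (s i) \<bullet> f n)"
      then show "convergent (\<lambda>i. f ((s \<circ> r) i) \<bullet> f n)"
        using convergent_subseq_convergent[of "\<lambda>i. f (s i) \<bullet> f n" r] by (simp add: o_def)
    qed
    then have "convergent (\<lambda>i. f (r (i + Suc n)) \<bullet> f n)"
      by (simp add: r_def o_def add.commute)
    then show ?thesis using convergent_ignore_initial_segment[of "\<lambda>i. f (r i) \<bullet> f n" "Suc n"] by simp
  qed
  define W where "W = {y. convergent (\<lambda>n. f (r n) \<bullet> y)}"
  have subW: "subspace W"
    unfolding subspace_def W_def
    by (auto simp: inner_add_right intro: convergent_add convergent_mult convergent_const)
  have closedW: "closed W"
  proof (unfold closed_sequential_limits, intro allI impI, elim conjE)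
    fix y l assume y: "\<forall>n. y n \<in> W" "y \<longlonglongrightarrow> l"
    have "convergent (\<lambda>n. f (r n) \<bullet> l)"
    proof (rule real_seq_Cauchy_by_approx)
      fix e :: real assume e: "0 < e"
      then have "0 < e / (B + 1)" using B0 by simp
      then obtain N where N: "norm (y N - l) < e / (B + 1)"
        using y(2) by (meson LIMSEQ_D order.refl)
      have "\<bar>f (r n) \<bullet> l - f (r n) \<bullet> y N\<bar> \<le> e" for n
      proof -
        have "\<bar>f (r n) \<bullet> (l - y N)\<bar> \<le> norm (f (r n)) * norm (l - y N)" by (rule Cauchy_Schwarz_ineq2)
        also have "\<dots> \<le> (B + 1) * (e / (B + 1))"
          using N B[of "r n"] B0 by (intro mult_mono) (auto simp: norm_minus_commute)
        finally show ?thesis using B0 by (simp add: inner_diff_right)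
      qed
      then show "\<exists>b. convergent b \<and> (\<forall>n. \<bar>f (r n) \<bullet> l - b n\<bar> \<le> e)"
        using y(1) by (intro exI[of _ "\<lambda>n. f (r n) \<bullet> y N"]) (auto simp: W_def)
    qed
    then show "l \<in> W" by (simp add: W_def)
  qed
  have "closure (span (range f)) \<subseteq> W"
  proof (rule closure_minimal[OF _ closedW], rule span_minimal[OF _ subW])
    show "range f \<subseteq> W" using conv_f by (auto simp: W_def)
  qed
  have W: "y \<in> W" for y
  proof -
    have "closed (closure (span (range f)))" "subspace (closure (span (range f)))"
      by (simp_all add: subspace_closure)
    from orthogonal_projection_exists[OF this, of y] obtain p
      where p: "p \<in> closure (span (range f))" "\<And>z. z \<in> closure (span (range f)) \<Longrightarrow> p \<bullet> z = y \<bullet> z"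
      by blast
    have "f (r n) \<in> closure (span (range f))" for n
      by (rule subsetD[OF closure_subset]) (simp add: span_base)
    then have "f (r n) \<bullet> y = f (r n) \<bullet> p" for n using p(2) by (metis inner_commute)
    then show ?thesis using p(1) \<open>closure (span (range f)) \<subseteq> W\<close> by (auto simp: W_def)
  qed
  define L where "L y = lim (\<lambda>n. f (r n) \<bullet> y)" for y
  have L: "(\<lambda>n. f (r n) \<bullet> y) \<longlonglongrightarrow> L y" for y
    using W[of y] by (simp add: W_def L_def convergent_LIMSEQ_iff)
  have "\<exists>l\<in>UNIV. \<forall>y\<in>UNIV. l \<bullet> y = L y"
  proof (rule riesz_closed_subspace)
    show "L (x + y) = L x + L y" for x y
      using tendsto_add[OF L[of x] L[of y]] LIMSEQ_unique[OF L[of "x + y"]]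
      by (simp add: inner_add_right)
    show "L (c *\<^sub>R x) = c * L x" for c x
      using tendsto_mult_left[OF L[of x], of c] LIMSEQ_unique[OF L[of "c *\<^sub>R x"]] by simp
    show "\<bar>L x\<bar> \<le> B * norm x" for x
    proof (rule tendsto_upperbound[OF tendsto_rabs[OF L[of x]]])
      show "\<forall>\<^sub>F n in sequentially. \<bar>f (r n) \<bullet> x\<bar> \<le> B * norm x"
        using Cauchy_Schwarz_ineq2 mult_right_mono[OF B norm_ge_zero] by (metis (lifting) eventuallyI order_trans)
    qed simp
  qed auto
  then obtain l where "\<And>y. l \<bullet> y = L y" by auto
  then show ?thesis using r L by metis
qed

text \<open>Solutions are the fixed points of \<open>x - \<tau> *\<^sub>R (B x - y)\<close>.
  Coercivity and the bound \<open>N\<close> make the squared Lipschitz constant at most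
  \<open>1 - 2 * \<tau> + \<tau>\<^sup>2 * N\<^sup>2\<close>, which is \<open>1 - \<tau>\<close> for
  \<open>\<tau> = 1 / N\<^sup>2\<close>, so Banach's theorem applies.\<close>

lemma lax_milgram:
  fixes B :: "'a::{real_inner,complete_space} \<Rightarrow> 'a"
  assumes lin: "bounded_linear B" and coercive: "\<And>x. (norm x)\<^sup>2 \<le> B x \<bullet> x"
  shows "\<exists>!x. B x = y"
proof -
  interpret bounded_linear B by (rule lin)
  obtain M where M: "0 < M" "\<And>x. norm (B x) \<le> norm x * M" using pos_bounded by blast
  \<comment> \<open>Enlarging the bound beyond 1 forces \<tau> < 1, so that the square root of 1 -
    \<tau> is a genuine contraction constant.\<close>
  define N where "N = M + 1"
  have N: "N > 1" "\<And>x. norm (B x) \<le> N * norm x"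
    using M by (auto simp: N_def algebra_simps intro: order_trans[OF M(2)])
  define \<tau> where "\<tau> = 1 / N\<^sup>2"
  have \<tau>: "0 < \<tau>" "\<tau> < 1" "\<tau> * N\<^sup>2 = 1" unfolding \<tau>_def using N by auto
  define G where "G x = x - \<tau> *\<^sub>R (B x - y)" for x
  have contr: "dist (G a) (G b) \<le> sqrt (1 - \<tau>) * dist a b" for a b
  proof -
    define z where "z = a - b"
    have eq: "G a - G b = z - \<tau> *\<^sub>R B z" unfolding G_def z_def by (simp add: diff algebra_simps)
    have "(norm (z - \<tau> *\<^sub>R B z))\<^sup>2 = (norm z)\<^sup>2 - 2 * \<tau> * (B z \<bullet> z) + \<tau>\<^sup>2 * (norm (B z))\<^sup>2"
      unfolding power2_norm_eq_inner
      by (simp add: inner_diff_left inner_diff_right inner_commute power2_eq_square algebra_simps)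
    also have "\<dots> \<le> (norm z)\<^sup>2 - 2 * \<tau> * (norm z)\<^sup>2 + \<tau>\<^sup>2 * (N * norm z)\<^sup>2"
      using coercive[of z] \<tau> N(2)[of z]
      by (intro add_mono diff_mono mult_left_mono power_mono) auto
    also have "\<dots> = (1 - \<tau>) * (norm z)\<^sup>2"
    proof -
      have "\<tau>\<^sup>2 * (N * norm z)\<^sup>2 = \<tau> * (\<tau> * N\<^sup>2) * (norm z)\<^sup>2"
        by (simp add: power2_eq_square algebra_simps)
      then show ?thesis using \<tau>(3) by (simp add: algebra_simps)
    qed
    finally have "norm (z - \<tau> *\<^sub>R B z) \<le> sqrt ((1 - \<tau>) * (norm z)\<^sup>2)" by (rule real_le_rsqrt)
    then show ?thesis unfolding dist_norm eq using \<tau> by (simp add: real_sqrt_mult z_def)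
  qed
  have "\<exists>!x. G x = x"
    by (rule banach_fix_type[where c="sqrt (1 - \<tau>)"]) (use contr \<tau> in auto)
  moreover have "G x = x \<longleftrightarrow> B x = y" for x unfolding G_def using \<tau> by simp
  ultimately show ?thesis by simp
qed

section \<open>Contraction semigroups generated by m-dissipative relations\<close>

lemma eventually_at_right_mult_less:
  fixes C e :: real
  assumes "0 < e"
  shows "\<forall>\<^sub>F t in at_right 0. t * C < e"
proof (rule order_tendstoD(2))
  show "((\<lambda>t. t * C) \<longlongrightarrow> 0) (at_right 0)" by (rule tendsto_mult_left_zero) (rule tendsto_ident_at)
qed (rule assms)

lemma norm_triangle_three: "norm (a + b - c) \<le> norm a + norm b + norm (c :: 'a :: real_normed_vector)"
  using norm_triangle_ineq4[of "a + b" c] norm_triangle_ineq[of a b] by simp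

text \<open>The setting of the Lumer--Phillips theorem. The operator is kept as a graph, in
  accordance with \<open>generator_graph\<close>, so that domain conditions are mere membership;
  \<open>dissipative\<close> is the Banach space form of dissipativity.\<close>

locale m_dissipative =
  fixes X :: "'h::banach set" and \<Gamma> :: "('h \<times> 'h) set"
  assumes closed_X: "closed X" and subspace_X: "subspace X"
    and subspace_\<Gamma>: "subspace \<Gamma>" and \<Gamma>_subset: "\<Gamma> \<subseteq> X \<times> X"
    and dissipative: "(x, y) \<in> \<Gamma> \<Longrightarrow> 0 < h \<Longrightarrow> norm x \<le> norm (x - h *\<^sub>R y)"
    and range: "z \<in> X \<Longrightarrow> 0 < h \<Longrightarrow> \<exists>x y. (x, y) \<in> \<Gamma> \<and> x - h *\<^sub>R y = z"
    and dense: "X \<subseteq> closure (fst ` \<Gamma>)"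
begin

text \<open>The resolvent \<open>(I - h A)^(-1)\<close> of the operator with graph \<Gamma>, that
  is, one implicit Euler step of length \<open>h\<close>. Setting it to the identity at
  \<open>h = 0\<close> lets the estimates hold for all \<open>h \<ge> 0\<close>.\<close>

definition J :: "real \<Rightarrow> 'h \<Rightarrow> 'h" where
  "J h z = (if h = 0 then z else (THE x. \<exists>y. (x, y) \<in> \<Gamma> \<and> x - h *\<^sub>R y = z))"

lemma \<Gamma>_X: assumes "(x, y) \<in> \<Gamma>" shows "x \<in> X" "y \<in> X"
  using assms \<Gamma>_subset by auto

lemma \<Gamma>_add: "(x, y) \<in> \<Gamma> \<Longrightarrow> (x', y') \<in> \<Gamma> \<Longrightarrow> (x + x', y + y') \<in> \<Gamma>"
  using subspace_add[OF subspace_\<Gamma>, of "(x, y)" "(x', y')"] by simp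

lemma \<Gamma>_diff: "(x, y) \<in> \<Gamma> \<Longrightarrow> (x', y') \<in> \<Gamma> \<Longrightarrow> (x - x', y - y') \<in> \<Gamma>"
  using subspace_diff[OF subspace_\<Gamma>, of "(x, y)" "(x', y')"] by simp

lemma \<Gamma>_scale: "(x, y) \<in> \<Gamma> \<Longrightarrow> (c *\<^sub>R x, c *\<^sub>R y) \<in> \<Gamma>"
  using subspace_scale[OF subspace_\<Gamma>, of "(x, y)" c] by simp

lemma \<Gamma>_inj:
  assumes "(x, y) \<in> \<Gamma>" "(x', y') \<in> \<Gamma>" "x - h *\<^sub>R y = x' - h *\<^sub>R y'" "0 < h"
  shows "x = x'"
proof -
  have "norm (x - x') \<le> norm ((x - x') - h *\<^sub>R (y - y'))"
    using \<Gamma>_diff[OF assms(1,2)] assms(4) by (rule dissipative)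
  also have "(x - x') - h *\<^sub>R (y - y') = (x - h *\<^sub>R y) - (x' - h *\<^sub>R y')" by (simp add: algebra_simps)
  finally show ?thesis using assms(3) by simp
qed

lemma J_eq:
  assumes "(x, y) \<in> \<Gamma>" "0 < h"
  shows "J h (x - h *\<^sub>R y) = x"
  unfolding J_def using assms by (auto intro!: the_equality intro: \<Gamma>_inj)

lemma J_0 [simp]: "J 0 z = z" by (simp add: J_def)

lemma J_graph:
  assumes "z \<in> X" "0 < h"
  shows "(J h z, (1 / h) *\<^sub>R (J h z - z)) \<in> \<Gamma>"
proof -
  obtain x y where xy: "(x, y) \<in> \<Gamma>" "x - h *\<^sub>R y = z" using range[OF assms] by blast
  then have "J h z = x" using J_eq assms(2) by blast
  moreover have "(1 / h) *\<^sub>R (x - z) = y" using xy(2) assms(2) by auto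
  ultimately show ?thesis using xy(1) by simp
qed

lemma J_eqI:
  assumes "(x, y) \<in> \<Gamma>" "0 < h" "x - h *\<^sub>R y = z"
  shows "J h z = x"
  using J_eq[OF assms(1,2)] assms(3) by simp

lemma J_X [simp]: "z \<in> X \<Longrightarrow> 0 \<le> h \<Longrightarrow> J h z \<in> X"
  using J_graph[THEN \<Gamma>_X(1), of z h] by (cases "h = 0") auto

lemma J_add: assumes "z \<in> X" "z' \<in> X" "0 \<le> h" shows "J h (z + z') = J h z + J h z'"
proof (cases "h = 0")
  case False
  then have h: "0 < h" using assms by simp
  show ?thesis
    by (rule J_eqI[OF \<Gamma>_add[OF J_graph[OF assms(1) h] J_graph[OF assms(2) h]] h])
      (use h in \<open>simp add: algebra_simps\<close>)
qed simp

lemma J_scale: assumes "z \<in> X" "0 \<le> h" shows "J h (c *\<^sub>R z) = c *\<^sub>R J h z"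
proof (cases "h = 0")
  case False
  then have h: "0 < h" using assms by simp
  show ?thesis
    by (rule J_eqI[OF \<Gamma>_scale[OF J_graph[OF assms(1) h]] h])
      (use h in \<open>simp add: algebra_simps\<close>)
qed simp

lemma J_diff: assumes "z \<in> X" "z' \<in> X" "0 \<le> h" shows "J h (z - z') = J h z - J h z'"
  using J_add[OF assms(1) subspace_scale[OF subspace_X assms(2), of "-1"] assms(3)]
    J_scale[OF assms(2,3), of "-1"] by simp

lemma J_contraction: assumes "z \<in> X" "0 \<le> h" shows "norm (J h z) \<le> norm z"
proof (cases "h = 0")
  case False
  then have h: "0 < h" using assms by simp
  show ?thesis using dissipative[OF J_graph[OF assms(1) h] h] h by simp
qed simp

text \<open>The resolvent commutes with the operator: the quotient \<open>q\<close> and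
  \<open>y\<close> are related by one resolvent step, because the difference of two elements of the
  graph, scaled by \<open>1 / h\<close>, is again in the graph.\<close>

lemma J_step: assumes "(x, y) \<in> \<Gamma>" "0 \<le> h" shows "J h x - x = h *\<^sub>R J h y"
proof (cases "h = 0")
  case False
  then have h: "0 < h" using assms by simp
  define q where "q = (1 / h) *\<^sub>R (J h x - x)"
  have "(J h x, q) \<in> \<Gamma>" unfolding q_def using J_graph \<Gamma>_X(1)[OF assms(1)] h by blast
  from \<Gamma>_scale[OF \<Gamma>_diff[OF this assms(1)], of "1 / h"]
  have "(q, (1 / h) *\<^sub>R (q - y)) \<in> \<Gamma>" unfolding q_def by simp
  from J_eqI[OF this h, of y] h have "J h y = q" by simp
  then show ?thesis unfolding q_def using h by simp
qed simp

lemma J_\<Gamma>: assumes "(x, y) \<in> \<Gamma>" "0 \<le> h" shows "(J h x, J h y) \<in> \<Gamma>"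
proof (cases "h = 0")
  case False
  then have h: "0 < h" using assms by simp
  have "(1 / h) *\<^sub>R (J h x - x) = J h y" using J_step[OF assms] h by simp
  then show ?thesis using J_graph[OF \<Gamma>_X(1)[OF assms(1)] h] by simp
qed (use assms in simp)

lemma J_commute: assumes "z \<in> X" "0 \<le> a" "0 \<le> b" shows "J a (J b z) = J b (J a z)"
proof (cases "b = 0")
  case False
  then have b: "0 < b" using assms by simp
  have m: "(J b z, (1 / b) *\<^sub>R (J b z - z)) \<in> \<Gamma>" using J_graph assms(1) b by blast
  have "J b (J a z) = J a (J b z)"
  proof (rule J_eqI[OF J_\<Gamma>[OF m assms(2)] b])
    have "J a ((1 / b) *\<^sub>R (J b z - z)) = (1 / b) *\<^sub>R (J a (J b z) - J a z)"
      using assms by (simp add: J_scale J_diff subspace_diff[OF subspace_X])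
    then show "J a (J b z) - b *\<^sub>R J a ((1 / b) *\<^sub>R (J b z - z)) = J a z" using b by simp
  qed
  then show ?thesis by simp
qed simp

lemma J_pow_X [simp]: "z \<in> X \<Longrightarrow> 0 \<le> h \<Longrightarrow> (J h ^^ n) z \<in> X"
  by (induction n) auto

lemma J_pow_contraction: "z \<in> X \<Longrightarrow> 0 \<le> h \<Longrightarrow> norm ((J h ^^ n) z) \<le> norm z"
  by (induction n) (auto intro: order_trans[OF J_contraction])

lemma J_pow_add: "z \<in> X \<Longrightarrow> z' \<in> X \<Longrightarrow> 0 \<le> h \<Longrightarrow> (J h ^^ n) (z + z') = (J h ^^ n) z + (J h ^^ n) z'"
  by (induction n) (auto simp: J_add)

lemma J_pow_diff: "z \<in> X \<Longrightarrow> z' \<in> X \<Longrightarrow> 0 \<le> h \<Longrightarrow> (J h ^^ n) (z - z') = (J h ^^ n) z - (J h ^^ n) z'"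
  by (induction n) (auto simp: J_diff)

lemma J_pow_scale: "z \<in> X \<Longrightarrow> 0 \<le> h \<Longrightarrow> (J h ^^ n) (c *\<^sub>R z) = c *\<^sub>R (J h ^^ n) z"
  by (induction n) (auto simp: J_scale)

lemma J_pow_commute: "z \<in> X \<Longrightarrow> 0 \<le> a \<Longrightarrow> 0 \<le> b \<Longrightarrow> J a ((J b ^^ n) z) = (J b ^^ n) (J a z)"
proof (induction n)
  case (Suc n)
  then show ?case using J_commute[of "(J b ^^ n) z" a b] by simp
qed simp

text \<open>For commuting linear contractions the difference of \<open>n\<close>-th powers
  telescopes into \<open>n\<close> terms, each bounded by the one-step difference. It converts every
  local error into a global one: for refined step sizes, for the semigroup law, for comparison with
  the identity and for uniqueness.\<close>

lemma power_difference_le: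
  assumes x: "x \<in> X"
    and U: "\<And>z. z \<in> X \<Longrightarrow> U z \<in> X" "\<And>z z'. z \<in> X \<Longrightarrow> z' \<in> X \<Longrightarrow> U (z - z') = U z - U z'"
      "\<And>z. z \<in> X \<Longrightarrow> norm (U z) \<le> norm z"
    and V: "\<And>z. z \<in> X \<Longrightarrow> V z \<in> X" "\<And>z z'. z \<in> X \<Longrightarrow> z' \<in> X \<Longrightarrow> V (z - z') = V z - V z'"
      "\<And>z. z \<in> X \<Longrightarrow> norm (V z) \<le> norm z"
    and comm: "\<And>z. z \<in> X \<Longrightarrow> U (V z) = V (U z)"
  shows "norm ((U ^^ n) x - (V ^^ n) x) \<le> real n * norm (U x - V x)"
proof (induction n)
  case (Suc n)
  have UX: "(U ^^ n) z \<in> X" if "z \<in> X" for n z using that U(1) by (induction n) auto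
  have VX: "(V ^^ n) z \<in> X" if "z \<in> X" for n z using that V(1) by (induction n) auto
  have Vd: "(V ^^ n) (z - z') = (V ^^ n) z - (V ^^ n) z'" if "z \<in> X" "z' \<in> X" for n z z'
    using that by (induction n) (auto simp: V(2) VX)
  have Vn: "norm ((V ^^ n) z) \<le> norm z" if "z \<in> X" for n z
    using that by (induction n) (auto intro: order_trans[OF V(3)] simp: VX)
  have c: "U ((V ^^ n) z) = (V ^^ n) (U z)" if "z \<in> X" for n z
  proof (induction n)
    case (Suc n)
    then show ?case using comm[OF VX[OF that], of n] by simp
  qed simp
  have "(V ^^ Suc n) x = (V ^^ n) (V x)" by (simp add: funpow_swap1)
  then have "(U ^^ Suc n) x - (V ^^ Suc n) x
      = U ((U ^^ n) x - (V ^^ n) x) + (V ^^ n) (U x - V x)"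
    using c[OF x, of n] U(2)[OF UX[OF x] VX[OF x], of n n] Vd[OF U(1)[OF x] V(1)[OF x], of n] by simp
  also have "norm \<dots> \<le> norm ((U ^^ n) x - (V ^^ n) x) + norm (U x - V x)"
    using x by (intro norm_triangle_le add_mono U(3) Vn)
      (auto simp: subspace_diff[OF subspace_X] UX VX U(1) V(1))
  also have "\<dots> \<le> real (Suc n) * norm (U x - V x)"
    using Suc by (simp add: algebra_simps)
  finally show ?case .
qed simp

text \<open>For an element of the domain of the square of the generator the defect of the semigroup law
  is \<open>J a (J b x) - J (a + b) x = - a b J (a + b) (J a (J b w))\<close>.\<close>

lemma J_defect:
  assumes xy: "(x, y) \<in> \<Gamma>" and yw: "(y, w) \<in> \<Gamma>" and ab: "0 \<le> a" "0 \<le> b"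
  shows "norm (J a (J b x) - J (a + b) x) \<le> a * b * norm w"
proof -
  let ?c = "a + b"
  have c: "0 \<le> ?c" using ab by simp
  have X: "x \<in> X" "y \<in> X" "w \<in> X" using \<Gamma>_X[OF xy] \<Gamma>_X[OF yw] by auto
  have x: "x = J h x - h *\<^sub>R J h y" if "0 \<le> h" for h using J_step[OF xy that] by (simp add: algebra_simps)
  have y: "y = J h y - h *\<^sub>R J h w" if "0 \<le> h" for h using J_step[OF yw that] by (simp add: algebra_simps)
  note sX = subspace_diff[OF subspace_X] subspace_scale[OF subspace_X]
  \<comment> \<open>One step \<open>a + b\<close> expands \<open>x\<close> here, while
    \<open>x'\<close> below expands it by the steps \<open>b\<close> and \<open>a\<close>. After
    applying \<open>J (a + b)\<close> to \<open>x'\<close> the two expansions agree except for the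
    term with the factor \<open>a * b\<close>.\<close>
  have 1: "J a (J b x) = J a (J b (J ?c x)) - ?c *\<^sub>R J a (J b (J ?c y))"
    by (subst x[OF c]) (use X ab in \<open>simp add: J_diff J_scale sX\<close>)
  have Ja: "J a x = J a (J b x) - b *\<^sub>R J a (J b y)"
    by (subst x[OF ab(2)]) (use X ab in \<open>simp add: J_diff J_scale sX\<close>)
  have Jay: "J a y = J a (J b y) - b *\<^sub>R J a (J b w)"
    by (subst y[OF ab(2)]) (use X ab in \<open>simp add: J_diff J_scale sX\<close>)
  have "x = J a x - a *\<^sub>R J a y" by (rule x[OF ab(1)])
  also have "\<dots> = J a (J b x) - ?c *\<^sub>R J a (J b y) + (a * b) *\<^sub>R J a (J b w)"
    unfolding Ja Jay by (simp add: algebra_simps)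
  finally have x': "x = J a (J b x) - ?c *\<^sub>R J a (J b y) + (a * b) *\<^sub>R J a (J b w)" .
  have 2: "J ?c x = J ?c (J a (J b x)) - ?c *\<^sub>R J ?c (J a (J b y)) + (a * b) *\<^sub>R J ?c (J a (J b w))"
    by (subst x') (use X ab in \<open>simp add: J_diff J_add J_scale sX\<close>)
  have c3: "J ?c (J a (J b z)) = J a (J b (J ?c z))" if "z \<in> X" for z
    using that ab J_commute[of "J b z" ?c a] J_commute[of z ?c b] by simp
  have eq1: "J a (J b x) = J ?c (J a (J b x)) - ?c *\<^sub>R J ?c (J a (J b y))"
    unfolding c3[OF X(1)] c3[OF X(2)] by (rule 1)
  have "J a (J b x) - J ?c x = - ((a * b) *\<^sub>R J ?c (J a (J b w)))"
    by (rule trans[OF arg_cong2[OF eq1 2, of minus]]) simp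
  then have "norm (J a (J b x) - J ?c x) = a * b * norm (J ?c (J a (J b w)))" using ab by simp
  also have "\<dots> \<le> a * b * norm w"
    using ab X by (intro mult_left_mono) (auto intro!: order_trans[OF J_contraction])
  finally show ?thesis .
qed

text \<open>The steps are merged one at a time. Adding one to \<open>j\<close> merged steps costs
  \<open>d * (j * d) * norm w\<close> by \<open>J_defect\<close>, and the sum over
  \<open>j < n\<close> is at most \<open>(n * d)\<^sup>2 * norm w\<close>.\<close>

lemma J_pow_defect:
  assumes xy: "(x, y) \<in> \<Gamma>" and yw: "(y, w) \<in> \<Gamma>" and d: "0 \<le> d"
  shows "norm ((J d ^^ n) x - J (real n * d) x) \<le> (real n * d)\<^sup>2 * norm w"
proof (induction n)
  case (Suc n)
  have X: "x \<in> X" using \<Gamma>_X[OF xy] by auto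
  have nd: "0 \<le> real n * d" using d by simp
  have "(J d ^^ Suc n) x - J (real (Suc n) * d) x
     = J d ((J d ^^ n) x - J (real n * d) x) + (J d (J (real n * d) x) - J (d + real n * d) x)"
    using X d nd by (simp add: J_diff algebra_simps)
  also have "norm \<dots> \<le> (real n * d)\<^sup>2 * norm w + d * (real n * d) * norm w"
    by (intro norm_triangle_le add_mono order_trans[OF J_contraction Suc] J_defect[OF xy yw])
      (use X d nd in \<open>auto intro: subspace_diff[OF subspace_X]\<close>)
  also have "\<dots> = ((real n * d)\<^sup>2 + d * (real n * d)) * norm w" by (simp add: algebra_simps)
  also have "\<dots> \<le> (real (Suc n) * d)\<^sup>2 * norm w"
    using d by (intro mult_right_mono) (auto simp: power2_eq_square algebra_simps)
  finally show ?case .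
qed simp

section \<open>The semigroup as a limit of powers of resolvents\<close>

text \<open>The exponential formula \<open>(I - (t / m) A)^(-m)\<close> with
  \<open>m = n + 1\<close>; the shift excludes zero steps.\<close>

definition P :: "nat \<Rightarrow> real \<Rightarrow> 'h \<Rightarrow> 'h" where
  "P n t x = (J (t / real (Suc n)) ^^ Suc n) x"

definition S :: "real \<Rightarrow> 'h \<Rightarrow> 'h" where
  "S t x = lim (\<lambda>n. P n t x)"

lemma P_X [simp]: "x \<in> X \<Longrightarrow> 0 \<le> t \<Longrightarrow> P n t x \<in> X"
  unfolding P_def by (rule J_pow_X) auto
lemma P_contraction: "x \<in> X \<Longrightarrow> 0 \<le> t \<Longrightarrow> norm (P n t x) \<le> norm x"
  unfolding P_def by (rule J_pow_contraction) auto
lemma P_add: "x \<in> X \<Longrightarrow> y \<in> X \<Longrightarrow> 0 \<le> t \<Longrightarrow> P n t (x + y) = P n t x + P n t y"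
  unfolding P_def by (rule J_pow_add) auto
lemma P_diff: "x \<in> X \<Longrightarrow> y \<in> X \<Longrightarrow> 0 \<le> t \<Longrightarrow> P n t (x - y) = P n t x - P n t y"
  unfolding P_def by (rule J_pow_diff) auto
lemma P_scale: "x \<in> X \<Longrightarrow> 0 \<le> t \<Longrightarrow> P n t (c *\<^sub>R x) = c *\<^sub>R P n t x"
  unfolding P_def by (rule J_pow_scale) auto

text \<open>Splitting one step of length \<open>t / m\<close> into \<open>n\<close> parts costs at
  most \<open>(t / m)\<^sup>2 * norm w\<close>. The \<open>m\<close> steps together cost
  \<open>t\<^sup>2 * norm w / m\<close>, a bound in which \<open>n\<close> does not occur.\<close>

lemma P_refine:
  assumes xy: "(x, y) \<in> \<Gamma>" and yw: "(y, w) \<in> \<Gamma>" and t: "0 \<le> t" and mn: "0 < m" "0 < n"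
  shows "norm ((J (t / (real m * real n)) ^^ (m * n)) x - (J (t / real m) ^^ m) x) \<le> t\<^sup>2 * norm w / real m"
proof -
  let ?d = "t / (real m * real n)"
  have d: "0 \<le> ?d" using t by simp
  have X: "x \<in> X" using \<Gamma>_X[OF xy] by auto
  have "norm (((J ?d ^^ n) ^^ m) x - (J (t / real m) ^^ m) x) \<le> real m * norm ((J ?d ^^ n) x - J (t / real m) x)"
    by (rule power_difference_le)
      (use X t d in \<open>auto simp: J_pow_diff J_diff J_pow_contraction J_contraction J_pow_commute\<close>)
  also have "\<dots> \<le> real m * ((real n * ?d)\<^sup>2 * norm w)"
    using J_pow_defect[OF xy yw d, of n] mn by (intro mult_left_mono) auto
  also have "\<dots> = t\<^sup>2 * norm w / real m" using mn by (simp add: power2_eq_square)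
  finally show ?thesis by (simp add: funpow_mult mult.commute)
qed

text \<open>Both approximations are compared with their common refinement into
  \<open>Suc m * Suc n\<close> steps.\<close>

lemma P_Cauchy_estimate:
  assumes xy: "(x, y) \<in> \<Gamma>" and yw: "(y, w) \<in> \<Gamma>" and t: "0 \<le> t"
  shows "norm (P m t x - P n t x) \<le> t\<^sup>2 * norm w / real (Suc m) + t\<^sup>2 * norm w / real (Suc n)"
proof -
  let ?z = "(J (t / (real (Suc m) * real (Suc n))) ^^ (Suc m * Suc n)) x"
  have "norm (?z - P m t x) \<le> t\<^sup>2 * norm w / real (Suc m)"
    unfolding P_def by (rule P_refine[OF xy yw t]) auto
  moreover have "norm (?z - P n t x) \<le> t\<^sup>2 * norm w / real (Suc n)"
    using P_refine[OF xy yw t, of "Suc n" "Suc m"] unfolding P_def by (simp only: mult.commute zero_less_Suc)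
  ultimately show ?thesis using norm_triangle_ineq4[of "?z - P n t x" "?z - P m t x"]
    by (simp add: algebra_simps)
qed

lemma dense_approx:
  assumes "x \<in> X" "0 < e"
  obtains x' y' where "(x', y') \<in> \<Gamma>" "norm (x - x') < e"
proof -
  have "x \<in> closure (fst ` \<Gamma>)" using assms dense by auto
  then obtain z where "z \<in> fst ` \<Gamma>" "dist z x < e" using assms(2) unfolding closure_approachable by blast
  then obtain p where "p \<in> \<Gamma>" "z = fst p" by blast
  then show thesis using that[of z "snd p"] \<open>dist z x < e\<close> by (simp add: dist_norm norm_minus_commute)
qed

text \<open>On the domain the defect is at most \<open>h * norm y'\<close> by \<open>J_step\<close>;
  the contraction property carries the limit over to the closure of the domain.\<close>

lemma J_tendsto:
  assumes "x \<in> X"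
  shows "((\<lambda>h. J h x) \<longlongrightarrow> x) (at_right 0)"
proof (rule tendstoI)
  fix e :: real assume e: "0 < e"
  obtain x' y' where xy: "(x', y') \<in> \<Gamma>" "norm (x - x') < e / 4"
    using dense_approx[OF assms, of "e/4"] e by auto
  have X: "x' \<in> X" "y' \<in> X" using \<Gamma>_X[OF xy(1)] by auto
  have "\<forall>\<^sub>F h in at_right 0. h * norm y' < e / 4"
      by (rule eventually_at_right_mult_less) (use e in simp)
  moreover have "\<forall>\<^sub>F h::real in at_right 0. 0 < h" by (simp add: eventually_at_right_less)
  ultimately show "\<forall>\<^sub>F h in at_right 0. dist (J h x) x < e"
  proof eventually_elim
    case (elim h)
    have "norm (J h x' - x') = h * norm (J h y')" using J_step[OF xy(1), of h] elim by simp
    also have "\<dots> \<le> h * norm y'" using elim J_contraction[OF X(2), of h] by (intro mult_left_mono) auto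
    also have "\<dots> < e / 4" by (rule elim(1))
    finally have 1: "norm (J h x' - x') < e / 4" .
    have 2: "norm (J h x - J h x') \<le> norm (x - x')"
      using J_contraction[of "x - x'" h] assms X elim by (simp add: J_diff subspace_diff[OF subspace_X])
    have "J h x - x = (J h x - J h x') + (J h x' - x') - (x - x')" by simp
    then have "norm (J h x - x) \<le> norm (J h x - J h x') + norm (J h x' - x') + norm (x - x')"
      by (metis norm_triangle_three)
    then show ?case using 1 2 xy(2) e by (simp add: dist_norm)
  qed
qed

text \<open>The defect estimates need elements to which the generator can be applied twice, and
  these are the values \<open>J 1 (J 1 z)\<close>. The range of \<open>J 1\<close> contains the
  dense domain, and since \<open>J 1\<close> is a contraction the approximation can be
  iterated.\<close>

lemma dense_square_approx:
  assumes x: "x \<in> X" and e: "0 < e"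
  obtains z where "z \<in> X" "norm (x - J 1 (J 1 z)) < e"
proof -
  have "\<exists>z\<in>X. norm (x - J 1 z) < e" if x: "x \<in> X" and e: "0 < e" for x e
  proof -
    obtain x' y' where xy: "(x', y') \<in> \<Gamma>" "norm (x - x') < e" using dense_approx[OF x e] by blast
    then have "J 1 (x' - y') = x'" using J_eq[of x' y' 1] by simp
    then show ?thesis using xy \<Gamma>_X[OF xy(1)] by (metis subspace_diff[OF subspace_X])
  qed note * = this
  obtain u where u: "u \<in> X" "norm (x - J 1 u) < e / 2" using *[OF x, of "e/2"] e by auto
  obtain z where z: "z \<in> X" "norm (u - J 1 z) < e / 2" using *[OF u(1), of "e/2"] e by auto
  have "norm (J 1 u - J 1 (J 1 z)) \<le> norm (u - J 1 z)"
    using J_contraction[of "u - J 1 z" 1] u z by (simp add: J_diff subspace_diff[OF subspace_X])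
  then have "norm (x - J 1 (J 1 z)) < e"
    using norm_triangle_ineq[of "x - J 1 u" "J 1 u - J 1 (J 1 z)"] u z by simp
  then show thesis using that z by blast
qed

text \<open>The second image under the generator is bounded by \<open>4 * norm z\<close>, a quantity
  that does not involve \<Gamma>. This uniformity makes the error bounds usable for a whole sequence
  of generators.\<close>

lemma J_square_graph:
  assumes "z \<in> X"
  defines "u \<equiv> J 1 z - z"
  shows "(J 1 (J 1 z), J 1 u) \<in> \<Gamma>" "(J 1 u, J 1 u - u) \<in> \<Gamma>" "norm (J 1 u - u) \<le> 4 * norm z"
proof -
  have uX: "u \<in> X" unfolding u_def using assms by (simp add: subspace_diff[OF subspace_X])
  have "(J 1 z, u) \<in> \<Gamma>" using J_graph[OF assms(1), of 1] by (simp add: u_def)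
  from J_\<Gamma>[OF this, of 1] show "(J 1 (J 1 z), J 1 u) \<in> \<Gamma>" by simp
  show "(J 1 u, J 1 u - u) \<in> \<Gamma>" using J_graph[OF uX, of 1] by simp
  have "norm u \<le> 2 * norm z"
    unfolding u_def using norm_triangle_ineq4[of "J 1 z" z] J_contraction[OF assms(1), of 1] by simp
  moreover have "norm (J 1 u - u) \<le> 2 * norm u"
    using norm_triangle_ineq4[of "J 1 u" u] J_contraction[OF uX, of 1] by simp
  ultimately show "norm (J 1 u - u) \<le> 4 * norm z" by simp
qed

lemma P_convergent:
  assumes x: "x \<in> X" and t: "0 \<le> t"
  shows "(\<lambda>n. P n t x) \<longlonglongrightarrow> S t x"
proof -
  have "Cauchy (\<lambda>n. P n t x)"
  proof (rule metric_CauchyI)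
    fix e :: real assume e: "0 < e"
    obtain z where z: "z \<in> X" "norm (x - J 1 (J 1 z)) < e / 4"
      using dense_square_approx[OF x, of "e/4"] e by auto
    define x' where "x' = J 1 (J 1 z)"
    have x': "x' \<in> X" unfolding x'_def using z by simp
    obtain y w where yw: "(x', y) \<in> \<Gamma>" "(y, w) \<in> \<Gamma>" using J_square_graph[OF z(1)] unfolding x'_def by blast
    have "(\<lambda>n. t\<^sup>2 * norm w * inverse (real (Suc n))) \<longlonglongrightarrow> t\<^sup>2 * norm w * 0"
      by (intro tendsto_intros LIMSEQ_inverse_real_of_nat)
    from order_tendstoD(2)[OF this, of "e / 4"]
    have "\<forall>\<^sub>F n in sequentially. t\<^sup>2 * norm w * inverse (real (Suc n)) < e / 4" using e by simp
    then obtain M where M: "\<And>n. n \<ge> M \<Longrightarrow> t\<^sup>2 * norm w / real (Suc n) < e / 4"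
      unfolding eventually_sequentially divide_inverse by blast
    have d: "norm (P n t x - P n t x') < e / 4" for n
      using P_contraction[of "x - x'" t n] x x' t z(2)
      by (simp add: P_diff subspace_diff[OF subspace_X] x'_def)
    show "\<exists>M. \<forall>m\<ge>M. \<forall>n\<ge>M. dist (P m t x) (P n t x) < e"
    proof (intro exI allI impI)
      fix m n assume mn: "M \<le> m" "M \<le> n"
      have "P m t x - P n t x = (P m t x - P m t x') + (P m t x' - P n t x') - (P n t x - P n t x')" by simp
      then have "norm (P m t x - P n t x) \<le> norm (P m t x - P m t x') + norm (P m t x' - P n t x') + norm (P n t x - P n t x')"
        by (metis norm_triangle_three)
      then show "dist (P m t x) (P n t x) < e"
        using d[of m] d[of n] M[OF mn(1)] M[OF mn(2)] P_Cauchy_estimate[OF yw t, of m n]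
        unfolding dist_norm by linarith
    qed
  qed
  then show ?thesis unfolding S_def using Cauchy_convergent_iff convergent_LIMSEQ_iff by blast
qed

lemma S_X [simp]: "x \<in> X \<Longrightarrow> 0 \<le> t \<Longrightarrow> S t x \<in> X"
  using closed_sequentially[OF closed_X] P_convergent P_X by metis

lemma S_contraction: "x \<in> X \<Longrightarrow> 0 \<le> t \<Longrightarrow> norm (S t x) \<le> norm x"
  by (rule tendsto_upperbound[OF tendsto_norm[OF P_convergent]]) (auto intro!: always_eventually P_contraction)

lemma S_add: "x \<in> X \<Longrightarrow> y \<in> X \<Longrightarrow> 0 \<le> t \<Longrightarrow> S t (x + y) = S t x + S t y"
  using tendsto_add[OF P_convergent[of x t] P_convergent[of y t]]
    LIMSEQ_unique[OF P_convergent[of "x + y" t]] by (simp add: P_add subspace_add[OF subspace_X])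

lemma S_diff: "x \<in> X \<Longrightarrow> y \<in> X \<Longrightarrow> 0 \<le> t \<Longrightarrow> S t (x - y) = S t x - S t y"
  using tendsto_diff[OF P_convergent[of x t] P_convergent[of y t]]
    LIMSEQ_unique[OF P_convergent[of "x - y" t]] by (simp add: P_diff subspace_diff[OF subspace_X])

lemma S_scale: "x \<in> X \<Longrightarrow> 0 \<le> t \<Longrightarrow> S t (c *\<^sub>R x) = c *\<^sub>R S t x"
  using tendsto_scaleR[OF tendsto_const P_convergent[of x t], of c]
    LIMSEQ_unique[OF P_convergent[of "c *\<^sub>R x" t]] by (simp add: P_scale subspace_scale[OF subspace_X])

lemma S_0: "x \<in> X \<Longrightarrow> S 0 x = x"
proof -
  assume "x \<in> X"
  have "(J 0 ^^ n) x = x" for n by (induction n) auto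
  then have "P n 0 x = x" for n unfolding P_def by (metis div_0)
  then show ?thesis by (simp add: S_def)
qed

lemma S_P_estimate:
  assumes "(x, y) \<in> \<Gamma>" "(y, w) \<in> \<Gamma>" "0 \<le> t"
  shows "norm (S t x - P m t x) \<le> t\<^sup>2 * norm w / real (Suc m)"
proof (rule tendsto_le)
  show "(\<lambda>n. norm (P n t x - P m t x)) \<longlonglongrightarrow> norm (S t x - P m t x)"
    using \<Gamma>_X[OF assms(1)] assms(3) by (intro tendsto_intros P_convergent)
  have "(\<lambda>n. t\<^sup>2 * norm w * inverse (real (Suc n)) + t\<^sup>2 * norm w / real (Suc m))
      \<longlonglongrightarrow> t\<^sup>2 * norm w * 0 + t\<^sup>2 * norm w / real (Suc m)"
    by (intro tendsto_intros LIMSEQ_inverse_real_of_nat)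
  then show "(\<lambda>n. t\<^sup>2 * norm w / real (Suc n) + t\<^sup>2 * norm w / real (Suc m))
      \<longlonglongrightarrow> t\<^sup>2 * norm w / real (Suc m)" by (simp add: divide_inverse)
  show "\<forall>\<^sub>F n in sequentially. norm (P n t x - P m t x) \<le> t\<^sup>2 * norm w / real (Suc n) + t\<^sup>2 * norm w / real (Suc m)"
    using P_Cauchy_estimate[OF assms] by auto
qed simp

text \<open>With the same number \<open>N\<close> of steps for both times, the products for
  \<open>s\<close> and \<open>t\<close> are compared with the product for \<open>s + t\<close>.
  There are \<open>N\<close> defects of size \<open>(s / N) * (t / N) * norm w\<close>, so the error
  is of order \<open>1 / N\<close>. Density of the domain of the square extends the identity to
  \<open>X\<close>.\<close>

lemma S_semigroup:
  assumes x: "x \<in> X" and s: "0 \<le> s" and t: "0 \<le> t"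
  shows "S (s + t) x = S s (S t x)"
proof -
  have PP: "(\<lambda>n. P n s (P n t x)) \<longlonglongrightarrow> S s (S t x)" if x: "x \<in> X" for x
  proof -
    have "(\<lambda>n. P n s (P n t x) - P n s (S t x)) \<longlonglongrightarrow> 0"
    proof (rule Lim_null_comparison)
      show "\<forall>\<^sub>F n in sequentially. norm (P n s (P n t x) - P n s (S t x)) \<le> norm (P n t x - S t x)"
        using x s t P_contraction[of "P _ t x - S t x" s] by (auto simp: P_diff subspace_diff[OF subspace_X])
      show "(\<lambda>n. norm (P n t x - S t x)) \<longlonglongrightarrow> 0"
        using P_convergent[OF x t] by (simp add: LIM_zero tendsto_norm_zero)
    qed
    from tendsto_add[OF this P_convergent[of "S t x" s]] x s t show ?thesis by simp
  qed
  have main: "S (s + t) x = S s (S t x)" if xy: "(x, y) \<in> \<Gamma>" "(y, w) \<in> \<Gamma>" for x y w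
  proof -
    have X: "x \<in> X" using \<Gamma>_X[OF xy(1)] by simp
    have "(\<lambda>n. P n s (P n t x) - P n (s + t) x) \<longlonglongrightarrow> 0"
    proof (rule Lim_null_comparison)
      show "\<forall>\<^sub>F n in sequentially. norm (P n s (P n t x) - P n (s + t) x) \<le> s * t * norm w * inverse (real (Suc n))"
      proof (intro always_eventually allI)
        fix n
        define N where "N = Suc n"
        have N0: "real N \<noteq> 0" by (simp add: N_def)
        define a b where "a = s / real N" and "b = t / real N"
        have ab: "0 \<le> a" "0 \<le> b" "a + b = (s + t) / real N"
          unfolding a_def b_def using s t by (auto simp: add_divide_distrib)
        have pw: "((\<lambda>z. J a (J b z)) ^^ k) x = (J a ^^ k) ((J b ^^ k) x)" for k
        proof (induction k)
          case (Suc k)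
          have "J b ((J a ^^ k) ((J b ^^ k) x)) = (J a ^^ k) (J b ((J b ^^ k) x))"
            using X ab by (intro J_pow_commute) auto
          then show ?case using Suc by simp
        qed simp
        have comm: "J a (J b (J (a + b) z)) = J (a + b) (J a (J b z))" if "z \<in> X" for z
          using that ab(1,2) J_commute[of "J b z" "a + b" a] J_commute[of z "a + b" b] by simp
        have "norm (((\<lambda>z. J a (J b z)) ^^ N) x - (J (a + b) ^^ N) x)
            \<le> real N * norm (J a (J b x) - J (a + b) x)"
          by (rule power_difference_le)
            (use X ab(1,2) comm in \<open>auto simp: J_diff intro: order_trans[OF J_contraction] J_contraction\<close>)
        also have "\<dots> \<le> real N * (a * b * norm w)"
          using J_defect[OF xy ab(1,2)] by (intro mult_left_mono) auto
        also have "\<dots> = s * t * norm w * inverse (real N)"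
          unfolding a_def b_def using N0 by (simp add: field_simps)
        finally show "norm (P n s (P n t x) - P n (s + t) x) \<le> s * t * norm w * inverse (real (Suc n))"
          unfolding pw ab(3) unfolding P_def a_def b_def N_def by simp
      qed
      show "(\<lambda>n. s * t * norm w * inverse (real (Suc n))) \<longlonglongrightarrow> 0"
        by (intro tendsto_mult_right_zero LIMSEQ_inverse_real_of_nat)
    qed
    from tendsto_add[OF this P_convergent[of x "s + t"]] X s t
    have "(\<lambda>n. P n s (P n t x)) \<longlonglongrightarrow> S (s + t) x" by simp
    then show ?thesis using PP[OF X] LIMSEQ_unique by blast
  qed
  show ?thesis
  proof (rule ccontr)
    assume "S (s + t) x \<noteq> S s (S t x)"
    then have e: "0 < norm (S (s + t) x - S s (S t x)) / 2" by simp
    obtain z where z: "z \<in> X" "norm (x - J 1 (J 1 z)) < norm (S (s + t) x - S s (S t x)) / 2"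
      using dense_square_approx[OF x e] by blast
    define x' where "x' = J 1 (J 1 z)"
    have x': "x' \<in> X" unfolding x'_def using z by simp
    have eq: "S (s + t) x' = S s (S t x')" using main J_square_graph[OF z(1)] unfolding x'_def by blast
    have d: "x - x' \<in> X" using x x' by (simp add: subspace_diff[OF subspace_X])
    have "S (s + t) x - S s (S t x) = S (s + t) (x - x') - S s (S t (x - x'))"
      using x x' s t eq by (simp add: S_diff)
    also have "norm \<dots> \<le> norm (x - x') + norm (x - x')"
      by (rule order_trans[OF norm_triangle_ineq4 add_mono]) (use d s t in \<open>auto intro: S_contraction order_trans[OF S_contraction]\<close>)
    finally show False using z(2) unfolding x'_def by simp
  qed
qed

lemma S_minus_id_le:
  assumes "(x, y) \<in> \<Gamma>" "0 \<le> t"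
  shows "norm (S t x - x) \<le> t * norm y"
proof (rule tendsto_upperbound)
  have X: "x \<in> X" "y \<in> X" using \<Gamma>_X[OF assms(1)] by auto
  show "(\<lambda>n. norm (P n t x - x)) \<longlonglongrightarrow> norm (S t x - x)"
    using X assms by (intro tendsto_intros P_convergent)
  have "norm (P n t x - x) \<le> t * norm y" for n
  proof -
    define h where "h = t / real (Suc n)"
    have h: "0 \<le> h" "real (Suc n) * h = t" using assms(2) by (auto simp: h_def)
    have i: "((\<lambda>z. z) ^^ m) x = x" for m by (induction m) auto
    have "norm ((J h ^^ Suc n) x - ((\<lambda>z. z) ^^ Suc n) x) \<le> real (Suc n) * norm (J h x - x)"
      by (rule power_difference_le) (use X h in \<open>auto simp: J_diff J_contraction\<close>)
    also have "\<dots> \<le> real (Suc n) * (h * norm y)"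
      using J_step[OF assms(1) h(1)] J_contraction[OF X(2) h(1)] h by (intro mult_left_mono) (auto intro: mult_left_mono)
    finally show ?thesis using h(2) unfolding i P_def h_def by (simp add: mult.assoc[symmetric])
  qed
  then show "\<forall>\<^sub>F n in sequentially. norm (P n t x - x) \<le> t * norm y" by simp
qed simp

text \<open>Because \<open>J h x = x + h *\<^sub>R J h y\<close>, the increment over
  \<open>n\<close> steps is \<open>h\<close> times the sum of the powers \<open>(J h ^^ j) y\<close>
  for \<open>j\<close> from 1 to \<open>n\<close>, each of which is within \<open>C\<close> of
  \<open>y\<close>.\<close>

lemma S_pow_estimate:
  assumes xy: "(x, y) \<in> \<Gamma>" and h: "0 \<le> h" and C: "\<And>j. j \<le> n \<Longrightarrow> norm ((J h ^^ j) y - y) \<le> C"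
  shows "norm ((J h ^^ n) x - x - (real n * h) *\<^sub>R y) \<le> real n * h * C"
  using C
proof (induction n)
  case (Suc n)
  have X: "x \<in> X" "y \<in> X" using \<Gamma>_X[OF xy] by auto
  have "J h x = x + h *\<^sub>R J h y" using J_step[OF xy h] by (simp add: algebra_simps)
  then have "(J h ^^ Suc n) x = (J h ^^ n) (x + h *\<^sub>R J h y)" by (metis comp_apply funpow_Suc_right)
  also have "\<dots> = (J h ^^ n) x + h *\<^sub>R (J h ^^ n) (J h y)"
    using X h by (simp add: J_pow_add J_pow_scale subspace_scale[OF subspace_X])
  also have "(J h ^^ n) (J h y) = (J h ^^ Suc n) y" by (metis comp_apply funpow_Suc_right)
  finally have "(J h ^^ Suc n) x - x - (real (Suc n) * h) *\<^sub>R y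
     = ((J h ^^ n) x - x - (real n * h) *\<^sub>R y) + h *\<^sub>R ((J h ^^ Suc n) y - y)" by (simp add: algebra_simps)
  also have "norm \<dots> \<le> real n * h * C + h * C"
    by (intro norm_triangle_le add_mono Suc.IH) (use h Suc.prems mult_left_mono[OF Suc.prems[OF order.refl] h] in auto)
  finally show ?case by (simp add: algebra_simps)
qed simp

text \<open>While \<open>x\<close> lies in the domain, \<open>y\<close> is merely in
  \<open>X\<close>. It is approximated by a domain element \<open>y'\<close>, and then all powers of
  the resolvent move \<open>y\<close> by at most \<open>2 * norm (y - y') + t * norm w\<close>,
  whatever the number of steps.\<close>

lemma S_generator:
  assumes xy: "(x, y) \<in> \<Gamma>"
  shows "((\<lambda>t. norm ((1 / t) *\<^sub>R (S t x - x) - y)) \<longlongrightarrow> 0) (at_right 0)"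
proof (rule tendstoI)
  fix e :: real assume e: "0 < e"
  have X: "x \<in> X" "y \<in> X" using \<Gamma>_X[OF xy] by auto
  obtain y' w where yw: "(y', w) \<in> \<Gamma>" "norm (y - y') < e / 4"
    using dense_approx[OF X(2), of "e/4"] e by auto
  have X': "y' \<in> X" "w \<in> X" using \<Gamma>_X[OF yw(1)] by auto
  have "\<forall>\<^sub>F t in at_right 0. t * norm w < e / 4"
      by (rule eventually_at_right_mult_less) (use e in simp)
  moreover have "\<forall>\<^sub>F t::real in at_right 0. 0 < t" by (simp add: eventually_at_right_less)
  ultimately show "\<forall>\<^sub>F t in at_right 0. dist (norm ((1 / t) *\<^sub>R (S t x - x) - y)) 0 < e"
  proof eventually_elim
    case (elim t)
    note tw = elim(1)
    define C where "C = 2 * norm (y - y') + t * norm w"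
    have "norm (P n t x - x - t *\<^sub>R y) \<le> t * C" for n
    proof -
      define h where "h = t / real (Suc n)"
      have h: "0 \<le> h" "real (Suc n) * h = t" using elim(2) by (auto simp: h_def)
      have i: "((\<lambda>z. z) ^^ m) z = z" for m and z :: 'h by (induction m) auto
      have "norm ((J h ^^ j) y - y) \<le> C" if j: "j \<le> Suc n" for j
      proof -
        have "norm ((J h ^^ j) y' - ((\<lambda>z. z) ^^ j) y') \<le> real j * norm (J h y' - y')"
          by (rule power_difference_le) (use X' h in \<open>auto simp: J_diff J_contraction\<close>)
        also have "\<dots> \<le> real (Suc n) * (h * norm w)"
          using J_step[OF yw(1) h(1)] J_contraction[OF X'(2) h(1)] h j
          by (intro mult_mono) (auto intro: mult_left_mono)
        finally have 1: "norm ((J h ^^ j) y' - y') \<le> t * norm w"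
          using h(2) unfolding i by (simp add: mult.assoc[symmetric])
        have 2: "norm ((J h ^^ j) y - (J h ^^ j) y') \<le> norm (y - y')"
          using J_pow_contraction[of "y - y'" h j] X X' h by (simp add: J_pow_diff subspace_diff[OF subspace_X])
        have "(J h ^^ j) y - y = ((J h ^^ j) y - (J h ^^ j) y') + ((J h ^^ j) y' - y') - (y - y')" by simp
        then have "norm ((J h ^^ j) y - y) \<le> norm ((J h ^^ j) y - (J h ^^ j) y') + norm ((J h ^^ j) y' - y') + norm (y - y')"
          by (metis norm_triangle_three)
        then show ?thesis using 1 2 unfolding C_def by simp
      qed
      from S_pow_estimate[OF xy h(1) this, of "Suc n"]
      show ?thesis unfolding h(2) unfolding P_def h_def by blast
    qed
    moreover have "(\<lambda>n. norm (P n t x - x - t *\<^sub>R y)) \<longlonglongrightarrow> norm (S t x - x - t *\<^sub>R y)"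
      using X elim by (intro tendsto_intros P_convergent) auto
    ultimately have "norm (S t x - x - t *\<^sub>R y) \<le> t * C"
      using LIMSEQ_le_const2 by blast
    moreover have "(1 / t) *\<^sub>R (S t x - x) - y = (1 / t) *\<^sub>R (S t x - x - t *\<^sub>R y)"
      using elim by (simp add: algebra_simps)
    ultimately have "norm ((1 / t) *\<^sub>R (S t x - x) - y) \<le> C"
      using elim by (simp add: divide_le_eq mult.commute)
    then show ?case using yw(2) tw e unfolding C_def by simp
  qed
qed

lemma contraction_semigroup_S: "contraction_semigroup X norm S"
proof -
  have "((\<lambda>t. norm (S t x - x)) \<longlongrightarrow> 0) (at_right 0)" if x: "x \<in> X" for x
  proof (rule tendstoI)
    fix e :: real assume e: "0 < e"
    obtain x' y' where xy: "(x', y') \<in> \<Gamma>" "norm (x - x') < e / 4"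
      using dense_approx[OF x, of "e/4"] e by auto
    have X: "x' \<in> X" "y' \<in> X" using \<Gamma>_X[OF xy(1)] by auto
    have "\<forall>\<^sub>F h in at_right 0. h * norm y' < e / 4"
      by (rule eventually_at_right_mult_less) (use e in simp)
    moreover have "\<forall>\<^sub>F h::real in at_right 0. 0 < h" by (simp add: eventually_at_right_less)
    ultimately show "\<forall>\<^sub>F t in at_right 0. dist (norm (S t x - x)) 0 < e"
    proof eventually_elim
      case (elim h)
      have "norm (S h x' - x') \<le> h * norm y'" using S_minus_id_le[OF xy(1), of h] elim by simp
      also have "\<dots> < e / 4" by (rule elim(1))
      finally have 1: "norm (S h x' - x') < e / 4" .
      have 2: "norm (S h x - S h x') \<le> norm (x - x')"
        using S_contraction[of "x - x'" h] x X elim by (simp add: S_diff subspace_diff[OF subspace_X])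
      have "S h x - x = (S h x - S h x') + (S h x' - x') - (x - x')" by simp
      then have "norm (S h x - x) \<le> norm (S h x - S h x') + norm (S h x' - x') + norm (x - x')"
        by (metis norm_triangle_three)
      then show ?case using 1 2 xy(2) e by simp
    qed
  qed
  then show ?thesis
    unfolding contraction_semigroup_def
    by (auto simp: S_contraction S_add S_scale S_0 S_semigroup)
qed

end

section \<open>The generator determines the semigroup\<close>

text \<open>The difference quotient already satisfies the inequality:
  \<open>x - (h / t) *\<^sub>R (S t x - x)\<close> has norm at least
  \<open>(1 + h / t) * norm x - (h / t) * norm (S t x)\<close>, and \<open>S t\<close> is a
  contraction. The inequality survives \<open>t\<close> tending to 0.\<close>

lemma contraction_semigroup_dissipative:
  fixes S :: "real \<Rightarrow> 'h::real_normed_vector \<Rightarrow> 'h"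
  assumes S: "contraction_semigroup X norm S" and xy: "(x, y) \<in> generator_graph X norm S" and h: "0 < h"
  shows "norm x \<le> norm (x - h *\<^sub>R y)"
proof -
  have x: "x \<in> X" and lim: "((\<lambda>t. norm ((1 / t) *\<^sub>R (S t x - x) - y)) \<longlongrightarrow> 0) (at_right 0)"
    using xy by (auto simp: generator_graph_def)
  have lim': "((\<lambda>t. (1 / t) *\<^sub>R (S t x - x)) \<longlongrightarrow> y) (at_right 0)"
    using lim by (simp add: LIM_zero_iff tendsto_norm_zero_iff)
  show ?thesis
  proof (rule tendsto_lowerbound)
    show "((\<lambda>t. norm (x - h *\<^sub>R ((1 / t) *\<^sub>R (S t x - x)))) \<longlongrightarrow> norm (x - h *\<^sub>R y)) (at_right 0)"
      by (intro tendsto_intros lim')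
    have "\<forall>\<^sub>F t::real in at_right 0. 0 < t" by (simp add: eventually_at_right_less)
    then show "\<forall>\<^sub>F t in at_right 0. norm x \<le> norm (x - h *\<^sub>R ((1 / t) *\<^sub>R (S t x - x)))"
    proof eventually_elim
      case (elim t)
      have "norm (S t x) \<le> norm x" using S x elim unfolding contraction_semigroup_def by simp
      then have 1: "norm ((h / t) *\<^sub>R S t x) \<le> (h / t) * norm x" using h elim by (simp add: mult_left_mono divide_right_mono)
      have "x - h *\<^sub>R ((1 / t) *\<^sub>R (S t x - x)) = (1 + h / t) *\<^sub>R x - (h / t) *\<^sub>R S t x"
        by (simp add: algebra_simps)
      also have "norm \<dots> \<ge> norm ((1 + h / t) *\<^sub>R x) - norm ((h / t) *\<^sub>R S t x)" by (rule norm_triangle_ineq2)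
      moreover have "norm ((1 + h / t) *\<^sub>R x) = norm x + (h / t) * norm x"
        unfolding norm_scaleR using h elim by (simp add: distrib_right)
      ultimately show ?case using 1 by simp
    qed
  qed simp
qed

lemma contraction_semigroup_carrier:
  assumes "contraction_semigroup X nrm S" "x \<in> X" "0 \<le> t"
  shows "S t x \<in> X" "nrm (S t x) \<le> nrm x"
  using assms by (auto simp: contraction_semigroup_def)

lemma contraction_semigroup_diff:
  assumes S: "contraction_semigroup X nrm S" "subspace X" and "x \<in> X" "y \<in> X" "0 \<le> t"
  shows "S t (x - y) = S t x - S t y"
proof -
  have "S t (x + (-1) *\<^sub>R y) = S t x + S t ((-1) *\<^sub>R y)"
    using assms subspace_scale[OF S(2), of y "-1"] unfolding contraction_semigroup_def by blast
  also have "S t ((-1) *\<^sub>R y) = (-1) *\<^sub>R S t y" using assms unfolding contraction_semigroup_def by blast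
  finally show ?thesis by simp
qed

text \<open>\<open>S s\<close> commutes with the difference quotients and does not increase norms,
  so it maps a convergent quotient to a convergent one.\<close>

lemma generator_graph_invariant:
  assumes S: "contraction_semigroup X norm S" "subspace X"
    and uv: "(u, v) \<in> generator_graph X norm S" and s: "0 \<le> s"
  shows "(S s u, S s v) \<in> generator_graph X norm S"
proof -
  note SX = contraction_semigroup_carrier[OF S(1)]
  note Sdiff = contraction_semigroup_diff[OF S]
  have Sscale: "S t (c *\<^sub>R x) = c *\<^sub>R S t x" if "x \<in> X" "0 \<le> t" for x c t
    using S(1) that by (auto simp: contraction_semigroup_def)
  have Ssg: "S (s + t) x = S s (S t x)" if "x \<in> X" "0 \<le> s" "0 \<le> t" for x s t
    using S(1) that by (auto simp: contraction_semigroup_def)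
  have X: "u \<in> X" "v \<in> X" and l: "((\<lambda>t. norm ((1 / t) *\<^sub>R (S t u - u) - v)) \<longlongrightarrow> 0) (at_right 0)"
    using uv by (auto simp: generator_graph_def)
  note sX = subspace_diff[OF S(2)] subspace_scale[OF S(2)]
  have "((\<lambda>t. norm ((1 / t) *\<^sub>R (S t (S s u) - S s u) - S s v)) \<longlongrightarrow> 0) (at_right 0)"
  proof (rule Lim_null_comparison[OF _ l])
    have "\<forall>\<^sub>F t::real in at_right 0. 0 < t" by (simp add: eventually_at_right_less)
    then show "\<forall>\<^sub>F t in at_right 0. norm (norm ((1 / t) *\<^sub>R (S t (S s u) - S s u) - S s v)) \<le> norm ((1 / t) *\<^sub>R (S t u - u) - v)"
    proof eventually_elim
      case (elim t)
      have m: "(1 / t) *\<^sub>R (S t u - u) - v \<in> X" using X s elim by (simp add: sX SX)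
      have "S t (S s u) = S s (S t u)" using Ssg[of u s t] Ssg[of u t s] X s elim by (simp add: add.commute)
      then have "(1 / t) *\<^sub>R (S t (S s u) - S s u) - S s v = S s ((1 / t) *\<^sub>R (S t u - u) - v)"
        using X s elim by (simp add: Sdiff Sscale SX sX)
      then show ?case using SX[OF m s] by simp
    qed
  qed
  then show ?thesis unfolding generator_graph_def using X s by (auto simp: SX)
qed

context m_dissipative
begin

text \<open>Maximality of \<Gamma>: the generator extends it and is dissipative, so identity minus
  generator is injective, while identity minus \<Gamma> is already onto \<open>X\<close>. No element
  can be added.\<close>

lemma generator_graph_S: "generator_graph X norm S = \<Gamma>"
proof (intro equalityI subrelI)
  fix x y assume "(x, y) \<in> \<Gamma>"
  then show "(x, y) \<in> generator_graph X norm S"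
    unfolding generator_graph_def using S_generator \<Gamma>_X by auto
next
  fix x y assume xy: "(x, y) \<in> generator_graph X norm S"
  then have X: "x \<in> X" "y \<in> X" and l1: "((\<lambda>t. norm ((1 / t) *\<^sub>R (S t x - x) - y)) \<longlongrightarrow> 0) (at_right 0)"
    by (auto simp: generator_graph_def)
  obtain u v where uv: "(u, v) \<in> \<Gamma>" "u - 1 *\<^sub>R v = x - y"
    using range[of "x - y" 1] X by (auto simp: subspace_diff[OF subspace_X])
  have U: "u \<in> X" "v \<in> X" using \<Gamma>_X[OF uv(1)] by auto
  have l1': "((\<lambda>t. (1 / t) *\<^sub>R (S t x - x)) \<longlongrightarrow> y) (at_right 0)"
    using l1 by (simp add: LIM_zero_iff tendsto_norm_zero_iff)
  have l2': "((\<lambda>t. (1 / t) *\<^sub>R (S t u - u)) \<longlongrightarrow> v) (at_right 0)"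
    using S_generator[OF uv(1)] by (simp add: LIM_zero_iff tendsto_norm_zero_iff)
  have "((\<lambda>t. (1 / t) *\<^sub>R (S t (x - u) - (x - u))) \<longlongrightarrow> y - v) (at_right 0)"
  proof (rule Lim_transform_eventually[OF tendsto_diff[OF l1' l2']])
    have "\<forall>\<^sub>F t::real in at_right 0. 0 < t" by (simp add: eventually_at_right_less)
    then show "\<forall>\<^sub>F t in at_right 0. (1 / t) *\<^sub>R (S t x - x) - (1 / t) *\<^sub>R (S t u - u) = (1 / t) *\<^sub>R (S t (x - u) - (x - u))"
      by eventually_elim (use X U in \<open>simp add: S_diff algebra_simps\<close>)
  qed
  then have "(x - u, y - v) \<in> generator_graph X norm S"
    unfolding generator_graph_def using X U
    by (auto simp: subspace_diff[OF subspace_X] LIM_zero_iff tendsto_norm_zero_iff)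
  from contraction_semigroup_dissipative[OF contraction_semigroup_S this, of 1]
  have "norm (x - u) \<le> norm ((x - y) - (u - v))" by (simp add: algebra_simps)
  then have "x = u" using uv(2) by simp
  then show "(x, y) \<in> \<Gamma>" using uv by simp
qed

text \<open>The powers of \<open>S' h\<close> and of \<open>J h\<close> with
  \<open>h = t / m\<close> are compared by telescoping. The accumulated error is \<open>t\<close>
  times the norm of \<open>(1 / h) *\<^sub>R (S' h x - x) - J h y\<close>, where both terms tend to
  \<open>y\<close>. Since \<open>damped_semigroup\<close> is merely chosen by its properties, this
  is what identifies it.\<close>

lemma contraction_semigroup_unique:
  assumes S': "contraction_semigroup X norm S'" and gen: "generator_graph X norm S' = \<Gamma>"
    and x: "x \<in> X" and t: "0 \<le> t"
  shows "S' t x = S t x"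
proof -
  note sg = S'[unfolded contraction_semigroup_def]
  note SX = contraction_semigroup_carrier[OF S']
  note Sdiff = contraction_semigroup_diff[OF S' subspace_X]
  have Sscale: "S' t (c *\<^sub>R x) = c *\<^sub>R S' t x" if "x \<in> X" "0 \<le> t" for x c t using sg that by auto
  have Ssg: "S' (s + t) x = S' s (S' t x)" if "x \<in> X" "0 \<le> s" "0 \<le> t" for x s t using sg that by auto
  note inv = generator_graph_invariant[OF S' subspace_X, unfolded gen]
  have comm: "S' s (J h z) = J h (S' s z)" if "z \<in> X" "0 \<le> s" "0 \<le> h" for s h z
  proof (cases "h = 0")
    case False
    then have h: "0 < h" using that by simp
    have "J h (S' s z) = S' s (J h z)"
      by (rule J_eqI[OF inv[OF J_graph[OF that(1) h] that(2)] h])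
        (use that h in \<open>simp add: Sdiff Sscale subspace_diff[OF subspace_X]\<close>)
    then show ?thesis by simp
  qed simp
  have main: "S' t x = S t x" if xy: "(x, y) \<in> \<Gamma>" for x y
  proof (cases "t = 0")
    case True
    then show ?thesis using sg \<Gamma>_X[OF xy] S_0 by auto
  next
    case False
    then have t: "0 < t" using t by simp
    have X: "x \<in> X" "y \<in> X" using \<Gamma>_X[OF xy] by auto
    have pw: "(S' h ^^ n) x = S' (real n * h) x" if "0 \<le> h" for n h
    proof (induction n)
      case (Suc n)
      then show ?case using Ssg[of x h "real n * h"] that X by (simp add: algebra_simps)
    next
      case 0 then show ?case using sg X by simp
    qed
    have l: "((\<lambda>t. norm ((1 / t) *\<^sub>R (S' t x - x) - y)) \<longlongrightarrow> 0) (at_right 0)"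
      using xy unfolding gen[symmetric] by (simp add: generator_graph_def)
    then have "((\<lambda>t. (1 / t) *\<^sub>R (S' t x - x)) \<longlongrightarrow> y) (at_right 0)"
      by (simp add: LIM_zero_iff tendsto_norm_zero_iff)
    from tendsto_diff[OF this J_tendsto[OF X(2)]]
    have l: "((\<lambda>h. (1 / h) *\<^sub>R (S' h x - x) - J h y) \<longlongrightarrow> 0) (at_right 0)" by simp
    have flim: "filterlim (\<lambda>n. t / real (Suc n)) (at_right 0) sequentially"
      using t tendsto_mult_right_zero[OF LIMSEQ_inverse_real_of_nat, of t]
      by (auto simp: filterlim_at_right_to_0 filterlim_at divide_inverse intro!: always_eventually)
    from filterlim_compose[OF l flim]
    have l2: "(\<lambda>n. t * norm ((1 / (t / real (Suc n))) *\<^sub>R (S' (t / real (Suc n)) x - x) - J (t / real (Suc n)) y)) \<longlonglongrightarrow> 0"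
      by (intro tendsto_mult_right_zero tendsto_norm_zero)
    have "(\<lambda>n. S' t x - P n t x) \<longlonglongrightarrow> 0"
    proof (rule Lim_null_comparison[OF _ l2], intro always_eventually allI)
      fix n
      define h where "h = t / real (Suc n)"
      have h: "0 < h" "real (Suc n) * h = t" using t by (auto simp: h_def)
      have "S' t x - P n t x = (S' h ^^ Suc n) x - (J h ^^ Suc n) x"
        using pw[of h "Suc n"] h unfolding P_def h_def[symmetric] by simp
      also have "norm \<dots> \<le> real (Suc n) * norm (S' h x - J h x)"
        by (rule power_difference_le)
          (use X h in \<open>auto simp: Sdiff SX J_diff J_contraction comm\<close>)
      also have "S' h x - J h x = h *\<^sub>R ((1 / h) *\<^sub>R (S' h x - x) - J h y)"
        using J_step[OF xy, of h] h by (simp add: algebra_simps)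
      also have "real (Suc n) * norm \<dots> = t * norm ((1 / h) *\<^sub>R (S' h x - x) - J h y)"
        using h by (simp add: mult.assoc[symmetric])
      finally show "norm (S' t x - P n t x) \<le> t * norm ((1 / (t / real (Suc n))) *\<^sub>R (S' (t / real (Suc n)) x - x) - J (t / real (Suc n)) y)"
        unfolding h_def .
    qed
    from tendsto_diff[OF tendsto_const[of "S' t x"] this]
    have "(\<lambda>n. P n t x) \<longlonglongrightarrow> S' t x" by simp
    then show ?thesis using P_convergent[OF X(1), of t] t LIMSEQ_unique by fastforce
  qed
  show ?thesis
  proof (rule ccontr)
    assume "S' t x \<noteq> S t x"
    then have e: "0 < norm (S' t x - S t x) / 2" by simp
    obtain x' y' where xy: "(x', y') \<in> \<Gamma>" "norm (x - x') < norm (S' t x - S t x) / 2"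
      using dense_approx[OF x e] by blast
    have x': "x' \<in> X" using \<Gamma>_X[OF xy(1)] by simp
    have d: "x - x' \<in> X" using x x' by (simp add: subspace_diff[OF subspace_X])
    have "S' t x - S t x = S' t (x - x') - S t (x - x')"
      using x x' t main[OF xy(1)] by (simp add: S_diff Sdiff)
    also have "norm \<dots> \<le> norm (x - x') + norm (x - x')"
      by (rule order_trans[OF norm_triangle_ineq4 add_mono]) (use d t in \<open>auto intro: S_contraction SX\<close>)
    finally show False using xy(2) by simp
  qed
qed

end

section \<open>Dependence on the generator and a lower decay bound\<close>

text \<open>The Trotter--Kato theorem. For a fixed number of steps the products converge with the
  resolvents; the distance between product and semigroup is bounded by
  \<open>t\<^sup>2 * (4 * norm z) / Suc m\<close> for all generators at once, so a single
  \<open>m\<close> serves the whole sequence.\<close>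

lemma semigroup_convergence:
  assumes G: "m_dissipative X \<Gamma>" and Gn: "\<And>n. m_dissipative X (\<Gamma>n n)"
    and J: "\<And>z h. z \<in> X \<Longrightarrow> 0 < h \<Longrightarrow> (\<lambda>n. m_dissipative.J (\<Gamma>n n) h z) \<longlonglongrightarrow> m_dissipative.J \<Gamma> h z"
    and x: "x \<in> X" and t: "0 < t"
  shows "(\<lambda>n. m_dissipative.S (\<Gamma>n n) t x) \<longlonglongrightarrow> m_dissipative.S \<Gamma> t x"
proof -
  interpret A: m_dissipative X \<Gamma> by (rule G)
  interpret B: m_dissipative X "\<Gamma>n i" for i by (rule Gn)
  have J1: "(\<lambda>n. B.J n h (z n)) \<longlonglongrightarrow> A.J h z0" if z: "\<And>n. z n \<in> X" "z0 \<in> X" "z \<longlonglongrightarrow> z0" "0 < h" for h z z0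
  proof -
    have "(\<lambda>n. B.J n h (z n) - B.J n h z0) \<longlonglongrightarrow> 0"
    proof (rule Lim_null_comparison)
      show "\<forall>\<^sub>F n in sequentially. norm (B.J n h (z n) - B.J n h z0) \<le> norm (z n - z0)"
      proof (intro always_eventually allI)
        fix n
        have "norm (B.J n h (z n - z0)) \<le> norm (z n - z0)"
          using z by (intro B.J_contraction) (auto intro: subspace_diff[OF A.subspace_X])
        then show "norm (B.J n h (z n) - B.J n h z0) \<le> norm (z n - z0)" using z by (simp add: B.J_diff)
      qed
      show "(\<lambda>n. norm (z n - z0)) \<longlonglongrightarrow> 0" using z(3) by (simp add: LIM_zero tendsto_norm_zero)
    qed
    from tendsto_add[OF this J[OF z(2,4)]] show ?thesis by simp
  qed
  have Jk: "(\<lambda>n. (B.J n h ^^ k) (z n)) \<longlonglongrightarrow> (A.J h ^^ k) z0"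
    if z: "\<And>n. z n \<in> X" "z0 \<in> X" "z \<longlonglongrightarrow> z0" "0 < h" for h z z0 k
  proof (induction k)
    case (Suc k)
    show ?case using J1[OF _ _ Suc z(4)] z by simp
  qed (use z in simp)
  show ?thesis
  proof (rule tendstoI)
    fix e :: real assume e: "0 < e"
    obtain z where z: "z \<in> X" "norm (x - A.J 1 (A.J 1 z)) < e / 8"
      using A.dense_square_approx[OF x, of "e/8"] e by auto
    define x' where "x' = A.J 1 (A.J 1 z)"
    \<comment> \<open>The domain of the square may change with \<open>n\<close>, so
      \<open>x'\<close> itself need not be admissible for the \<open>n\<close>-th generator. The
      same \<open>z\<close> produces admissible elements that converge to \<open>x'\<close>.\<close>
    define xn where "xn n = B.J n 1 (B.J n 1 z)" for n
    have X: "x' \<in> X" "xn n \<in> X" for n using z by (auto simp: x'_def xn_def)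
    have lim: "xn \<longlonglongrightarrow> x'" unfolding xn_def x'_def
      by (intro J1 tendsto_const) (use z in auto)
    have "(\<lambda>n. t\<^sup>2 * (4 * norm z) * inverse (real (Suc n))) \<longlonglongrightarrow> 0"
      by (intro tendsto_mult_right_zero LIMSEQ_inverse_real_of_nat)
    from order_tendstoD(2)[OF this, of "e/8"] e
    have "\<forall>\<^sub>F n in sequentially. t\<^sup>2 * (4 * norm z) * inverse (real (Suc n)) < e/8" by simp
    then obtain m where m: "t\<^sup>2 * (4 * norm z) / real (Suc m) < e / 8"
      unfolding eventually_sequentially divide_inverse by blast
    have small: "t\<^sup>2 * norm w / real (Suc m) < e / 8" if "norm w \<le> 4 * norm z" for w
      by (rule le_less_trans[OF divide_right_mono[OF mult_left_mono[OF that]] m]) auto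
    have SP: "norm (A.S t x' - A.P m t x') < e / 8"
      using A.S_P_estimate[OF A.J_square_graph(1,2)[OF z(1)], of t m] small[OF A.J_square_graph(3)[OF z(1)]] t
      unfolding x'_def by linarith
    have SPn: "norm (B.S n t (xn n) - B.P n m t (xn n)) < e / 8" for n
      using B.S_P_estimate[OF B.J_square_graph(1,2)[OF z(1)], where i=n and t=t and m=m] small[OF B.J_square_graph(3)[OF z(1), where i=n]] t
      unfolding xn_def by linarith
    have "(\<lambda>n. B.P n m t (xn n)) \<longlonglongrightarrow> A.P m t x'"
      unfolding B.P_def A.P_def by (rule Jk) (use X lim t in auto)
    then have "\<forall>\<^sub>F n in sequentially. dist (B.P n m t (xn n)) (A.P m t x') < e / 8" using e by (intro tendstoD) auto
    moreover have "\<forall>\<^sub>F n in sequentially. dist (xn n) x' < e / 8" using lim e by (intro tendstoD) auto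
    ultimately show "\<forall>\<^sub>F n in sequentially. dist (B.S n t x) (A.S t x) < e"
    proof eventually_elim
      case (elim n)
      have d1: "norm (B.S n t x - B.S n t (xn n)) \<le> norm (x - xn n)"
        using B.S_contraction[of "x - xn n" t, where i=n] x X t by (simp add: B.S_diff subspace_diff[OF A.subspace_X])
      have d2: "norm (A.S t x - A.S t x') \<le> norm (x - x')"
        using A.S_contraction[of "x - x'" t] x X t by (simp add: A.S_diff subspace_diff[OF A.subspace_X])
      have d3: "norm (x - xn n) < e / 4"
        using norm_triangle_ineq4[of "x - x'" "xn n - x'"] elim(2) z(2) unfolding x'_def[symmetric] by (simp add: dist_norm)
      have "dist (B.S n t x) (A.S t x) \<le> dist (B.S n t x) (B.S n t (xn n)) + dist (B.S n t (xn n)) (B.P n m t (xn n))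
        + dist (B.P n m t (xn n)) (A.P m t x') + dist (A.P m t x') (A.S t x') + dist (A.S t x') (A.S t x)"
        by (meson add_right_mono dist_triangle order_trans)
      also have "\<dots> < e"
        using d1 d2 d3 SP SPn[of n] elim z(2) e unfolding x'_def[symmetric] dist_norm
        by (simp add: norm_minus_commute)
      finally show ?case .
    qed
  qed
qed

text \<open>A discrete Gronwall argument from below. A step of length \<open>h\<close> keeps at
  least the fraction \<open>1 - 2 * h * K\<close> of the squared norm up to an error
  \<open>2 * h * \<epsilon> h * norm x\<close>, where \<epsilon> does not depend on the time
  \<open>s\<close> because \<open>S s\<close> is a contraction. Iterating \<open>t / h\<close> times
  produces the exponential.\<close>

lemma contraction_semigroup_lower_bound:
  fixes S :: "real \<Rightarrow> 'h::real_inner \<Rightarrow> 'h"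
  assumes S: "contraction_semigroup X norm S" "subspace X"
    and K: "0 \<le> K" "\<And>x y. (x, y) \<in> generator_graph X norm S \<Longrightarrow> - K * (norm x)\<^sup>2 \<le> y \<bullet> x"
    and xy: "(x, y) \<in> generator_graph X norm S" and t: "0 < t"
  shows "exp (- 2 * K * t) * (norm x)\<^sup>2 \<le> (norm (S t x))\<^sup>2"
proof -
  note SX = contraction_semigroup_carrier[OF S(1)]
  note Sdiff = contraction_semigroup_diff[OF S]
  have Sscale: "S t (c *\<^sub>R x) = c *\<^sub>R S t x" if "x \<in> X" "0 \<le> t" for x c t
    using S(1) that by (auto simp: contraction_semigroup_def)
  have Ssg: "S (s + t) x = S s (S t x)" if "x \<in> X" "0 \<le> s" "0 \<le> t" for x s t
    using S(1) that by (auto simp: contraction_semigroup_def)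
  have X: "x \<in> X" "y \<in> X" and l: "((\<lambda>t. norm ((1 / t) *\<^sub>R (S t x - x) - y)) \<longlongrightarrow> 0) (at_right 0)"
    using xy by (auto simp: generator_graph_def)
  note sX = subspace_diff[OF S(2)] subspace_scale[OF S(2)]
  define \<epsilon> where "\<epsilon> h = norm ((1 / h) *\<^sub>R (S h x - x) - y)" for h
  have step: "(norm (S (s + h) x))\<^sup>2 \<ge> (1 - 2 * h * K) * (norm (S s x))\<^sup>2 - 2 * h * \<epsilon> h * norm x"
    if s: "0 \<le> s" and h: "0 < h" for s h
  proof -
    define r where "r = (1 / h) *\<^sub>R (S h x - x) - y"
    have rX: "r \<in> X" unfolding r_def using X h by (simp add: sX SX)
    define a where "a = S s x"
    have "S h x - x = h *\<^sub>R y + h *\<^sub>R r" unfolding r_def using h by (simp add: algebra_simps)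
    then have "S s (S h x) - S s x = S s (h *\<^sub>R y + h *\<^sub>R r)" using X s h by (simp add: Sdiff[symmetric] SX)
    also have "\<dots> = h *\<^sub>R S s y + h *\<^sub>R S s r"
      using S(1) X rX s h sX unfolding contraction_semigroup_def by auto
    finally have d: "S (s + h) x - a = h *\<^sub>R S s y + h *\<^sub>R S s r" unfolding a_def using Ssg X s h by simp
    have 1: "- K * (norm a)\<^sup>2 \<le> S s y \<bullet> a"
      unfolding a_def by (rule K(2)[OF generator_graph_invariant[OF S xy s]])
    have "\<bar>S s r \<bullet> a\<bar> \<le> norm (S s r) * norm a" by (rule Cauchy_Schwarz_ineq2)
    also have "\<dots> \<le> \<epsilon> h * norm x"
      unfolding a_def \<epsilon>_def r_def[symmetric] by (intro mult_mono SX) (use rX X s in auto)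
    finally have 2: "- (\<epsilon> h * norm x) \<le> S s r \<bullet> a" by linarith
    have e1: "(norm (S (s + h) x))\<^sup>2 = (norm a)\<^sup>2 + 2 * ((S (s + h) x - a) \<bullet> a) + (norm (S (s + h) x - a))\<^sup>2"
      unfolding power2_norm_eq_inner by (simp add: inner_diff_left inner_diff_right inner_commute)
    have e2: "(S (s + h) x - a) \<bullet> a = h * (S s y \<bullet> a) + h * (S s r \<bullet> a)"
      unfolding d by (simp add: inner_add_left)
    \<comment> \<open>The squared norm of the increment is nonnegative and is dropped, which is why
      only the one-sided bound on \<open>y \<bullet> x\<close> enters.\<close>
    have 3: "(norm a)\<^sup>2 + (2 * h * (S s y \<bullet> a) + 2 * h * (S s r \<bullet> a)) \<le> (norm (S (s + h) x))\<^sup>2"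
      unfolding e1 e2 by simp
    have "2 * h * (- K * (norm a)\<^sup>2) \<le> 2 * h * (S s y \<bullet> a)" "2 * h * (- (\<epsilon> h * norm x)) \<le> 2 * h * (S s r \<bullet> a)"
      by (rule mult_left_mono[OF 1], use h in simp) (rule mult_left_mono[OF 2], use h in simp)
    moreover have "(1 - 2 * h * K) * (norm a)\<^sup>2 - 2 * h * \<epsilon> h * norm x
        = (norm a)\<^sup>2 + 2 * h * (- K * (norm a)\<^sup>2) + 2 * h * (- (\<epsilon> h * norm x))"
      by (simp add: left_diff_distrib)
    ultimately show ?thesis using 3 unfolding a_def[symmetric] by linarith
  qed
  have iter: "(norm (S (real m * h) x))\<^sup>2 \<ge> (1 - 2 * h * K) ^ m * (norm x)\<^sup>2 - real m * (2 * h * \<epsilon> h * norm x)"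
    if h: "0 < h" "2 * h * K \<le> 1" for m h
  proof (induction m)
    case 0
    then show ?case using S(1) X by (simp add: contraction_semigroup_def)
  next
    case (Suc m)
    let ?q = "1 - 2 * h * K" and ?c = "2 * h * \<epsilon> h * norm x"
    have q: "0 \<le> ?q" "?q \<le> 1" using h K(1) by auto
    have c: "0 \<le> ?c" using h by (simp add: \<epsilon>_def)
    have "?q ^ Suc m * (norm x)\<^sup>2 - real (Suc m) * ?c \<le> ?q * (?q ^ m * (norm x)\<^sup>2 - real m * ?c) - ?c"
    proof -
      have "0 \<le> real m * ?c" by (rule mult_nonneg_nonneg) (use c in auto)
      from mult_right_mono[OF q(2) this] show ?thesis by (simp add: algebra_simps)
    qed
    also have "\<dots> \<le> ?q * (norm (S (real m * h) x))\<^sup>2 - ?c"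
      using mult_left_mono[OF Suc q(1)] by simp
    also have "\<dots> \<le> (norm (S (real m * h + h) x))\<^sup>2" using step[of "real m * h" h] h by simp
    finally show ?case by (simp add: algebra_simps)
  qed
  have "(\<lambda>n. (1 + (- 2 * K * t) / real n) ^ n) \<longlonglongrightarrow> exp (- 2 * K * t)"
    by (rule tendsto_exp_limit_sequentially)
  from LIMSEQ_Suc[OF this]
  have e: "(\<lambda>n. (1 + (- 2 * K * t) / real (Suc n)) ^ Suc n) \<longlonglongrightarrow> exp (- 2 * K * t)" .
  have flim: "filterlim (\<lambda>n. t / real (Suc n)) (at_right 0) sequentially"
    using t tendsto_mult_right_zero[OF LIMSEQ_inverse_real_of_nat, of t]
    by (auto simp: filterlim_at divide_inverse intro!: always_eventually)
  have eps: "(\<lambda>n. \<epsilon> (t / real (Suc n))) \<longlonglongrightarrow> 0"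
    unfolding \<epsilon>_def by (rule filterlim_compose[OF l flim])
  have "(\<lambda>n. (1 + (- 2 * K * t) / real (Suc n)) ^ Suc n * (norm x)\<^sup>2 - 2 * t * \<epsilon> (t / real (Suc n)) * norm x)
     \<longlonglongrightarrow> exp (- 2 * K * t) * (norm x)\<^sup>2 - 2 * t * 0 * norm x"
    by (intro tendsto_intros e eps)
  moreover have "\<forall>\<^sub>F n in sequentially. (1 + (- 2 * K * t) / real (Suc n)) ^ Suc n * (norm x)\<^sup>2 - 2 * t * \<epsilon> (t / real (Suc n)) * norm x
      \<le> (norm (S t x))\<^sup>2"
  proof -
    have "(\<lambda>n. (2 * t * K) * inverse (real (Suc n))) \<longlonglongrightarrow> 0"
      by (intro tendsto_mult_right_zero LIMSEQ_inverse_real_of_nat)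
    from order_tendstoD(2)[OF this, of 1]
    have "\<forall>\<^sub>F n in sequentially. (2 * t * K) * inverse (real (Suc n)) < 1" by simp
    then show ?thesis
    proof eventually_elim
      case (elim n)
      define h where "h = t / real (Suc n)"
      have h: "0 < h" "real (Suc n) * h = t" using t by (auto simp: h_def)
      have q: "2 * h * K \<le> 1" using elim by (simp add: h_def divide_inverse mult_ac)
      have eq: "1 + (- 2 * K * t) / real (Suc n) = 1 - 2 * h * K" by (simp add: h_def)
      have eq2: "real (Suc n) * (2 * h * \<epsilon> h * norm x) = 2 * t * \<epsilon> h * norm x"
        unfolding h(2)[symmetric] by (simp only: mult_ac)
      show ?case using iter[OF h(1) q, of "Suc n"] unfolding eq h(2) eq2 h_def[symmetric] by linarith
    qed
  qed
  ultimately have "exp (- 2 * K * t) * (norm x)\<^sup>2 - 2 * t * 0 * norm x \<le> (norm (S t x))\<^sup>2"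
    by (rule tendsto_upperbound) simp
  then show ?thesis by simp
qed

section \<open>The space of square integrable functions\<close>

lemma square_integrable_rep_L2 [simp, intro]: "square_integrable (rep_L2 f)"
  using Quotient3_rep_reflp[OF Quotient3_L2, of f] by simp

lemma rep_L2_abs_L2: "square_integrable f \<Longrightarrow> AE x in lebesgue. rep_L2 (abs_L2 f) x = f x"
  using rep_abs_rsp[OF Quotient3_L2, of f f] Quotient3_rel[OF Quotient3_L2, of "rep_L2 (abs_L2 f)" f]
    Quotient3_abs_rep[OF Quotient3_L2] Quotient3_rep_reflp[OF Quotient3_L2, of "abs_L2 f"]
  by (metis (mono_tags, lifting))

lemma abs_L2_rep_L2 [simp]: "abs_L2 (rep_L2 f) = f"
  by (rule Quotient3_abs_rep[OF Quotient3_L2])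

lemma abs_L2_eqI:
  "square_integrable f \<Longrightarrow> square_integrable g \<Longrightarrow> AE x in lebesgue. f x = g x \<Longrightarrow> abs_L2 f = abs_L2 g"
  using Quotient3_rel[OF Quotient3_L2, of f g] by simp

lemma L2_eqI: "AE x in lebesgue. rep_L2 f x = rep_L2 g x \<Longrightarrow> f = g"
  using abs_L2_eqI[of "rep_L2 f" "rep_L2 g"] by simp

lemma square_integrable_measurable [measurable_dest]: "square_integrable f \<Longrightarrow> f \<in> borel_measurable lebesgue"
  by (simp add: square_integrable_def)

lemma rep_L2_measurable [measurable]: "rep_L2 f \<in> borel_measurable lebesgue"
  by (rule square_integrable_measurable) simp

lemma rep_L2_add: "AE x in lebesgue. rep_L2 (f + g) x = rep_L2 f x + rep_L2 g x"
proof -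
  have "f + g = abs_L2 (\<lambda>x. rep_L2 f x + rep_L2 g x)"
    using plus_L2.abs_eq[of "rep_L2 f" "rep_L2 g"] by simp
  then show ?thesis using rep_L2_abs_L2[OF square_integrable_add[of "rep_L2 f" "rep_L2 g"]] by simp
qed

lemma rep_L2_diff: "AE x in lebesgue. rep_L2 (f - g) x = rep_L2 f x - rep_L2 g x"
proof -
  have "f - g = abs_L2 (\<lambda>x. rep_L2 f x - rep_L2 g x)"
    using minus_L2.abs_eq[of "rep_L2 f" "rep_L2 g"] by simp
  then show ?thesis using rep_L2_abs_L2[OF square_integrable_diff[of "rep_L2 f" "rep_L2 g"]] by simp
qed

lemma rep_L2_scale: "AE x in lebesgue. rep_L2 (c *\<^sub>R f) x = c * rep_L2 f x"
proof -
  have "c *\<^sub>R f = abs_L2 (\<lambda>x. c * rep_L2 f x)"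
    using scaleR_L2.abs_eq[of "rep_L2 f" c] by simp
  then show ?thesis using rep_L2_abs_L2[OF square_integrable_scale[of "rep_L2 f" c]] by simp
qed

lemma rep_L2_zero: "AE x in lebesgue. rep_L2 0 x = 0"
  using rep_L2_abs_L2[OF square_integrable_zero] by (simp add: zero_L2_def)

lemma inner_abs_L2:
  "square_integrable f \<Longrightarrow> square_integrable g \<Longrightarrow> abs_L2 f \<bullet> abs_L2 g = (LINT x|lebesgue. f x * g x)"
  by (rule inner_L2.abs_eq) auto

lemma inner_rep_abs_L2:
  "square_integrable g \<Longrightarrow> f \<bullet> abs_L2 g = (LINT x|lebesgue. rep_L2 f x * g x)"
  using inner_abs_L2[of "rep_L2 f" g] by simp

lemma norm_abs_L2: "square_integrable f \<Longrightarrow> (norm (abs_L2 f))\<^sup>2 = (LINT x|lebesgue. (f x)\<^sup>2)"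
  unfolding power2_norm_eq_inner by (simp add: inner_abs_L2 power2_eq_square)

lemma norm_L2_eq: "(norm f)\<^sup>2 = (LINT x|lebesgue. (rep_L2 f x)\<^sup>2)"
  using norm_abs_L2[of "rep_L2 f"] by simp

lemma nn_integral_L2_diff:
  "(\<integral>\<^sup>+x. ennreal ((rep_L2 f x - rep_L2 g x)\<^sup>2) \<partial>lebesgue) = ennreal ((norm (f - g))\<^sup>2)"
proof -
  have "(\<integral>\<^sup>+x. ennreal ((rep_L2 f x - rep_L2 g x)\<^sup>2) \<partial>lebesgue) = (\<integral>\<^sup>+x. ennreal ((rep_L2 (f - g) x)\<^sup>2) \<partial>lebesgue)"
    using rep_L2_diff[of f g] by (intro nn_integral_cong_AE) auto
  also have "\<dots> = ennreal (LINT x|lebesgue. (rep_L2 (f - g) x)\<^sup>2)"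
    using square_integrable_rep_L2[of "f - g"] unfolding square_integrable_def
    by (intro nn_integral_eq_integral) auto
  finally show ?thesis by (simp add: norm_L2_eq)
qed

lemma square_integrableI_nn_integral:
  assumes "f \<in> borel_measurable lebesgue" "(\<integral>\<^sup>+x. ennreal ((f x)\<^sup>2) \<partial>lebesgue) < \<infinity>"
  shows "square_integrable f"
  unfolding square_integrable_def
  using assms by (auto intro!: integrableI_bounded)

text \<open>Riesz--Fischer. Along a subsequence with \<open>\<parallel>f\<^sub>n\<^sub>+\<^sub>1 - f\<^sub>n\<parallel>\<^sup>2 \<le> 4\<^sup>-\<^sup>n\<close> the series of
  \<open>2\<^sup>n (f\<^sub>n\<^sub>+\<^sub>1 - f\<^sub>n)\<^sup>2\<close> is integrable, so the increments decay geometrically almost everywhere.\<close>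

instance L2 :: (euclidean_space) complete_space
proof
  fix F :: "nat \<Rightarrow> 'a L2" assume F: "Cauchy F"
  have "\<exists>N. \<forall>m\<ge>N. \<forall>n\<ge>N. norm (F m - F n) < (1/2) ^ k" for k
    using CauchyD[OF F, of "(1/2)^k"] by auto
  then obtain N where N: "\<And>k m n. N k \<le> m \<Longrightarrow> N k \<le> n \<Longrightarrow> norm (F m - F n) < (1/2) ^ k" by metis
  \<comment> \<open>Summing makes \<open>r\<close> monotone and at least \<open>N k\<close> at
    \<open>k\<close>; the extra summand gives \<open>k \<le> r k\<close>.\<close>
  define r where "r k = (\<Sum>i\<le>k. N i) + k" for k
  have rN: "N k \<le> r k" for k unfolding r_def using member_le_sum[of k "{..k}" N] by simp
  have rmono: "r k \<le> r (Suc k)" for k unfolding r_def by simp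
  have rge: "k \<le> r k" for k unfolding r_def by simp
  define G where "G k = rep_L2 (F (r k))" for k
  define D where "D k x = ennreal (2 ^ k * (G (Suc k) x - G k x)\<^sup>2)" for k x
  have [measurable]: "G k \<in> borel_measurable lebesgue" for k unfolding G_def by simp
  have intD: "(\<integral>\<^sup>+x. D k x \<partial>lebesgue) \<le> ennreal ((1/2) ^ k)" for k
  proof -
    have "(\<integral>\<^sup>+x. D k x \<partial>lebesgue) = ennreal (2 ^ k) * (\<integral>\<^sup>+x. ennreal ((G (Suc k) x - G k x)\<^sup>2) \<partial>lebesgue)"
      unfolding D_def by (subst nn_integral_cmult[symmetric]) (auto simp: ennreal_mult)
    also have "\<dots> = ennreal (2 ^ k * (norm (F (r (Suc k)) - F (r k)))\<^sup>2)"
      unfolding G_def nn_integral_L2_diff by (simp add: ennreal_mult)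
    also have "\<dots> \<le> ennreal (2 ^ k * ((1/2) ^ k)\<^sup>2)"
      using N[OF order_trans[OF rN rmono] rN, of k]
      by (intro ennreal_leI mult_left_mono power_mono) auto
    also have "2 ^ k * ((1/2::real) ^ k)\<^sup>2 = (1/2) ^ k"
      by (simp add: power2_eq_square power_divide)
    finally show ?thesis .
  qed
  have "(\<integral>\<^sup>+x. (\<Sum>k. D k x) \<partial>lebesgue) = (\<Sum>k. \<integral>\<^sup>+x. D k x \<partial>lebesgue)"
    unfolding D_def by (intro nn_integral_suminf) measurable
  also have "\<dots> \<le> (\<Sum>k. ennreal ((1/2) ^ k))" by (intro suminf_le intD) auto
  also have "\<dots> = ennreal (\<Sum>k. (1/2) ^ k)" by (intro suminf_ennreal2) auto
  finally have "(\<integral>\<^sup>+x. (\<Sum>k. D k x) \<partial>lebesgue) \<noteq> \<infinity>" by (auto simp: top_unique)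
  then have "AE x in lebesgue. (\<Sum>k. D k x) \<noteq> \<infinity>"
    by (intro nn_integral_PInf_AE) (auto simp: D_def)
  then have conv: "AE x in lebesgue. convergent (\<lambda>k. G k x)"
  proof eventually_elim
    case (elim x)
    have "summable (\<lambda>k. 2 ^ k * (G (Suc k) x - G k x)\<^sup>2)"
      using elim unfolding D_def by (intro summable_suminf_not_top) auto
    then have "Bseq (\<lambda>k. 2 ^ k * (G (Suc k) x - G k x)\<^sup>2)"
      by (intro convergent_imp_Bseq) (auto simp: convergent_def dest: summable_LIMSEQ_zero)
    then obtain C where C: "0 < C" "\<And>k. norm (2 ^ k * (G (Suc k) x - G k x)\<^sup>2) \<le> C"
      by (auto simp: Bseq_def)
    have bound: "norm (G (Suc k) x - G k x) \<le> sqrt C * (sqrt (1/2)) ^ k" for k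
    proof -
      have "(G (Suc k) x - G k x)\<^sup>2 \<le> C * (1/2) ^ k"
        using C(2)[of k] by (simp add: power_divide field_simps)
      then have "sqrt ((G (Suc k) x - G k x)\<^sup>2) \<le> sqrt (C * (1/2) ^ k)" by (rule real_sqrt_le_mono)
      then show ?thesis unfolding real_sqrt_abs real_sqrt_mult by (simp add: real_sqrt_power)
    qed
    have "summable (\<lambda>k. sqrt C * (sqrt (1/2)) ^ k)"
      by (intro summable_mult summable_geometric) (simp add: real_sqrt_divide)
    then have "summable (\<lambda>k. G (Suc k) x - G k x)"
      by (rule summable_comparison_test') (use bound in auto)
    then have "convergent (\<lambda>n. (\<Sum>k<n. G (Suc k) x - G k x))" by (simp add: summable_iff_convergent)
    then have "convergent (\<lambda>n. G n x - G 0 x)"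
      unfolding sum_lessThan_telescope[of "\<lambda>n. G n x"] by assumption
    then show ?case by (simp add: convergent_diff_const_right_iff)
  qed
  define f where "f x = lim (\<lambda>k. G k x)" for x
  have [measurable]: "f \<in> borel_measurable lebesgue" unfolding f_def by measurable
  have lim: "AE x in lebesgue. (\<lambda>k. G k x) \<longlonglongrightarrow> f x"
    using conv by eventually_elim (simp add: f_def convergent_LIMSEQ_iff)
  \<comment> \<open>Here \<open>m\<close> is an index of the full sequence and the subsequence index
    tends to infinity, so Fatou's lemma bounds the distance of \<open>f\<close> to the full
    sequence.\<close>
  have fatou: "(\<integral>\<^sup>+x. ennreal ((f x - rep_L2 (F m) x)\<^sup>2) \<partial>lebesgue) \<le> ennreal (((1/2) ^ j)\<^sup>2)"
    if m: "N j \<le> m" for j m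
  proof -
    have "(\<integral>\<^sup>+x. ennreal ((f x - rep_L2 (F m) x)\<^sup>2) \<partial>lebesgue)
        = (\<integral>\<^sup>+x. liminf (\<lambda>k. ennreal ((G k x - rep_L2 (F m) x)\<^sup>2)) \<partial>lebesgue)"
    proof (rule nn_integral_cong_AE)
      show "AE x in lebesgue. ennreal ((f x - rep_L2 (F m) x)\<^sup>2) = liminf (\<lambda>k. ennreal ((G k x - rep_L2 (F m) x)\<^sup>2))"
        using lim
      proof eventually_elim
        case (elim x)
        have "(\<lambda>k. ennreal ((G k x - rep_L2 (F m) x)\<^sup>2)) \<longlonglongrightarrow> ennreal ((f x - rep_L2 (F m) x)\<^sup>2)"
          by (intro tendsto_intros elim)
        then show ?case using lim_imp_Liminf[OF sequentially_bot] by metis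
      qed
    qed
    also have "\<dots> \<le> liminf (\<lambda>k. \<integral>\<^sup>+x. ennreal ((G k x - rep_L2 (F m) x)\<^sup>2) \<partial>lebesgue)"
      by (intro nn_integral_liminf) measurable
    also have "\<dots> \<le> limsup (\<lambda>k. \<integral>\<^sup>+x. ennreal ((G k x - rep_L2 (F m) x)\<^sup>2) \<partial>lebesgue)"
      by (intro Liminf_le_Limsup) simp
    also have "\<dots> \<le> ennreal (((1/2) ^ j)\<^sup>2)"
    proof (rule Limsup_bounded)
      have "\<forall>\<^sub>F k in sequentially. N j \<le> k" by (rule eventually_ge_at_top)
      then show "\<forall>\<^sub>F k in sequentially. (\<integral>\<^sup>+x. ennreal ((G k x - rep_L2 (F m) x)\<^sup>2) \<partial>lebesgue) \<le> ennreal (((1/2) ^ j)\<^sup>2)"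
      proof eventually_elim
        case (elim k)
        have "norm (F (r k) - F m) < (1/2) ^ j" using N[OF order_trans[OF elim rge] m] .
        then show ?case unfolding G_def nn_integral_L2_diff by (intro ennreal_leI power_mono) auto
      qed
    qed
    finally show ?thesis .
  qed
  have sq: "square_integrable (\<lambda>x. f x - rep_L2 (F m) x)" if "N j \<le> m" for j m
    by (rule square_integrableI_nn_integral) (use le_less_trans[OF fatou[OF that]] in auto)
  have sf: "square_integrable f"
    using square_integrable_add[OF sq[OF order.refl[of "N 0"]] square_integrable_rep_L2[of "F (N 0)"]] by simp
  have bound: "norm (abs_L2 f - F m) \<le> (1/2) ^ j" if m: "N j \<le> m" for j m
  proof -
    have "AE x in lebesgue. rep_L2 (abs_L2 f) x = f x" by (rule rep_L2_abs_L2[OF sf])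
    then have "(\<integral>\<^sup>+x. ennreal ((rep_L2 (abs_L2 f) x - rep_L2 (F m) x)\<^sup>2) \<partial>lebesgue)
      = (\<integral>\<^sup>+x. ennreal ((f x - rep_L2 (F m) x)\<^sup>2) \<partial>lebesgue)"
      by (intro nn_integral_cong_AE) auto
    also have "\<dots> \<le> ennreal (((1/2) ^ j)\<^sup>2)" by (rule fatou[OF m])
    finally have "(norm (abs_L2 f - F m))\<^sup>2 \<le> ((1/2) ^ j)\<^sup>2" unfolding nn_integral_L2_diff by simp
    then show ?thesis by (rule power2_le_imp_le) simp
  qed
  have "F \<longlonglongrightarrow> abs_L2 f"
  proof (rule LIMSEQ_I)
    fix e :: real assume "0 < e"
    then obtain j where "(1/2) ^ j < e" using real_arch_pow_inv[of e "1/2"] by auto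
    then show "\<exists>no. \<forall>n\<ge>no. norm (F n - abs_L2 f) < e"
      using bound[of j] by (auto simp: norm_minus_commute intro!: exI[of _ "N j"] intro: le_less_trans)
  qed
  then show "convergent F" by (auto simp: convergent_def)
qed

lemma subspace_L2_on: "subspace (L2_on \<Omega>)"
proof (rule subspaceI)
  show "0 \<in> L2_on \<Omega>" unfolding L2_on_def using rep_L2_zero by auto
next
  fix f g :: "'a L2" assume fg: "f \<in> L2_on \<Omega>" "g \<in> L2_on \<Omega>"
  have "AE x in lebesgue. x \<notin> \<Omega> \<longrightarrow> rep_L2 (f + g) x = 0"
    using rep_L2_add[of f g] fg[unfolded L2_on_def, simplified] by eventually_elim auto
  then show "f + g \<in> L2_on \<Omega>" by (simp add: L2_on_def)
next
  fix c and f :: "'a L2" assume f: "f \<in> L2_on \<Omega>"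
  have "AE x in lebesgue. x \<notin> \<Omega> \<longrightarrow> rep_L2 (c *\<^sub>R f) x = 0"
    using rep_L2_scale[of c f] f[unfolded L2_on_def, simplified] by eventually_elim auto
  then show "c *\<^sub>R f \<in> L2_on \<Omega>" by (simp add: L2_on_def)
qed

lemma square_integrable_restrict:
  assumes "square_integrable f" "S \<in> sets lebesgue"
  shows "square_integrable (\<lambda>x. if x \<in> S then f x else 0)"
proof -
  have eq: "(\<lambda>x. if x \<in> S then f x else 0) = (\<lambda>x. indicator S x * f x)" by (auto simp: indicator_def)
  have [measurable]: "f \<in> borel_measurable lebesgue" using assms by (simp add: square_integrable_def)
  show ?thesis unfolding eq square_integrable_def
  proof
    show [measurable]: "(\<lambda>x. indicator S x * f x) \<in> borel_measurable lebesgue" using assms(2) by measurable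
    show "integrable lebesgue (\<lambda>x. (indicator S x * f x)\<^sup>2)"
      by (rule Bochner_Integration.integrable_bound[of lebesgue "\<lambda>x. (f x)\<^sup>2"])
        (use assms in \<open>auto simp: square_integrable_def indicator_def\<close>)
  qed
qed

lemma L2_on_eqI:
  assumes "f \<in> L2_on \<Omega>" "g \<in> L2_on \<Omega>" "AE x in lebesgue. x \<in> \<Omega> \<longrightarrow> rep_L2 f x = rep_L2 g x"
  shows "f = g"
proof (rule L2_eqI)
  show "AE x in lebesgue. rep_L2 f x = rep_L2 g x"
    using assms(1,2)[unfolded L2_on_def, simplified] assms(3) by eventually_elim auto
qed

text \<open>The space is the orthogonal complement of all functions cut off to the complement of
  \<Omega>, hence an intersection of kernels of continuous functionals. For the converse inclusion
  \<open>f\<close> is tested with its own cut-off.\<close>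

lemma closed_L2_on:
  assumes \<Omega>: "\<Omega> \<in> sets lebesgue"
  shows "closed (L2_on \<Omega>)"
proof -
  have "L2_on \<Omega> = (\<Inter>g. {f. f \<bullet> abs_L2 (\<lambda>x. if x \<in> - \<Omega> then rep_L2 g x else 0) = 0})"
  proof (intro equalityI subsetI)
    fix f assume f: "f \<in> L2_on \<Omega>"
    have "f \<bullet> abs_L2 (\<lambda>x. if x \<in> - \<Omega> then rep_L2 g x else 0) = 0" for g
    proof -
      have "f \<bullet> abs_L2 (\<lambda>x. if x \<in> - \<Omega> then rep_L2 g x else 0)
          = (LINT x|lebesgue. rep_L2 f x * (if x \<in> - \<Omega> then rep_L2 g x else 0))"
        using \<Omega> by (intro inner_rep_abs_L2 square_integrable_restrict) (auto simp: Compl_in_sets_lebesgue)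
      also have "\<dots> = 0"
      proof (rule integral_eq_zero_AE)
        show "AE x in lebesgue. rep_L2 f x * (if x \<in> - \<Omega> then rep_L2 g x else 0) = 0"
          using f[unfolded L2_on_def, simplified] by eventually_elim auto
      qed
      finally show ?thesis by simp
    qed
    then show "f \<in> (\<Inter>g. {f. f \<bullet> abs_L2 (\<lambda>x. if x \<in> - \<Omega> then rep_L2 g x else 0) = 0})" by auto
  next
    fix f assume "f \<in> (\<Inter>g. {f. f \<bullet> abs_L2 (\<lambda>x. if x \<in> - \<Omega> then rep_L2 g x else 0) = 0})"
    then have 0: "f \<bullet> abs_L2 (\<lambda>x. if x \<in> - \<Omega> then rep_L2 f x else 0) = 0" by auto
    have sq: "square_integrable (\<lambda>x. if x \<in> - \<Omega> then rep_L2 f x else 0)"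
      using \<Omega> by (intro square_integrable_restrict) (auto simp: Compl_in_sets_lebesgue)
    have "(LINT x|lebesgue. (if x \<in> - \<Omega> then rep_L2 f x else 0)\<^sup>2) = f \<bullet> abs_L2 (\<lambda>x. if x \<in> - \<Omega> then rep_L2 f x else 0)"
      unfolding inner_rep_abs_L2[OF sq] by (intro Bochner_Integration.integral_cong) (auto simp: power2_eq_square)
    then have "(LINT x|lebesgue. (if x \<in> - \<Omega> then rep_L2 f x else 0)\<^sup>2) = 0" using 0 by simp
    then have "AE x in lebesgue. (if x \<in> - \<Omega> then rep_L2 f x else 0)\<^sup>2 = 0"
      using sq by (subst (asm) integral_nonneg_eq_0_iff_AE) (auto simp: square_integrable_def)
    then show "f \<in> L2_on \<Omega>" unfolding L2_on_def by (auto elim!: AE_mp)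
  qed
  moreover have "closed \<dots>"
    by (intro closed_INT ballI closed_Collect_eq continuous_intros)
  ultimately show ?thesis by simp
qed

text \<open>Dynkin's argument: boxes are stable under intersection and generate the Borel sets, and
  the total integral, needed for complements, is a limit over growing boxes. The sets where the
  function is positive or negative then finish the proof. The induction runs over Borel sets, hence
  the passage to a Borel version \<open>h\<close>.\<close>

lemma AE_zero_if_box_integrals_zero:
  fixes g :: "'a::euclidean_space \<Rightarrow> real"
  assumes g: "integrable lebesgue g" and box: "\<And>a b. (LINT x|lebesgue. indicator (box a b) x * g x) = 0"
  shows "AE x in lebesgue. g x = 0"
proof -
  obtain h where h [measurable]: "h \<in> borel_measurable borel" and gh: "AE x in lborel. g x = h x"
    using completion_ex_borel_measurable_real[of g lborel] g by auto
  have gh': "AE x in lebesgue. g x = h x" by (rule AE_completion[OF gh])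
  have [measurable]: "h \<in> borel_measurable lebesgue" by (rule measurable_completion) simp
  have [measurable]: "g \<in> borel_measurable lebesgue" using g by auto
  have "integrable lebesgue h"
    using g gh' by (subst integrable_cong_AE[of h lebesgue g]) (auto intro: AE_symmetric measurable_completion)
  then have inth: "integrable lborel h" by (simp add: integrable_completion)
  have bh: "(LINT x|lborel. indicator (box a b) x * h x) = 0" for a b
  proof -
    have "(LINT x|lborel. indicator (box a b) x * h x) = (LINT x|lebesgue. indicator (box a b) x * h x)"
      by (rule integral_completion[symmetric]) simp
    also have "\<dots> = (LINT x|lebesgue. indicator (box a b) x * g x)"
      using gh' by (intro integral_cong_AE borel_measurable_times borel_measurable_indicator) auto
    finally show ?thesis using box by simp
  qed
  have inti: "integrable lborel (\<lambda>x. indicator A x * h x)" if "A \<in> sets borel" for A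
    using integrable_real_mult_indicator[of A lborel h] inth that by (simp add: mult.commute)
  have total: "(LINT x|lborel. h x) = 0"
  proof -
    have "(\<lambda>n. LINT x|lborel. indicator (box (- (real n *\<^sub>R One)) (real n *\<^sub>R One)) x * h x)
      \<longlonglongrightarrow> (LINT x|lborel. h x)"
    proof (rule integral_dominated_convergence[where w="\<lambda>x. norm (h x)"])
      show "AE x in lborel. (\<lambda>n. indicator (box (- (real n *\<^sub>R One)) (real n *\<^sub>R One)) x * h x) \<longlonglongrightarrow> h x"
      proof (rule AE_I2)
        fix x :: 'a
        obtain N where N: "x \<in> box (- (real N *\<^sub>R One)) (real N *\<^sub>R One)" using UN_box_eq_UNIV by blast
        have iff: "x \<in> box (- (real n *\<^sub>R One)) (real n *\<^sub>R One) \<longleftrightarrow> (\<forall>i\<in>Basis. - real n < x \<bullet> i \<and> x \<bullet> i < real n)" for n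
          by (simp add: mem_box)
        have "x \<in> box (- (real n *\<^sub>R One)) (real n *\<^sub>R One)" if "N \<le> n" for n
          unfolding iff
        proof
          fix i :: 'a assume "i \<in> Basis"
          then have "- real N < x \<bullet> i" "x \<bullet> i < real N" using N unfolding iff by auto
          then show "- real n < x \<bullet> i \<and> x \<bullet> i < real n" using of_nat_mono[OF that, where ?'a=real] by linarith
        qed
        then have "\<forall>\<^sub>F n in sequentially. indicator (box (- (real n *\<^sub>R One)) (real n *\<^sub>R One)) x * h x = h x"
          by (auto simp: eventually_sequentially intro!: exI[of _ N])
        then show "(\<lambda>n. indicator (box (- (real n *\<^sub>R One)) (real n *\<^sub>R One)) x * h x) \<longlonglongrightarrow> h x"
          by (rule tendsto_eventually)
      qed
    qed (use inth in \<open>auto simp: indicator_def\<close>)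
    then show ?thesis unfolding bh using LIMSEQ_const_iff by metis
  qed
  have all: "(LINT x|lborel. indicator A x * h x) = 0" if "A \<in> sets borel" for A
  proof -
    have st: "Int_stable (range (\<lambda>(a, b). box a b :: 'a set))"
      by (auto simp: Int_stable_def box_Int_box)
    have pw: "(range (\<lambda>(a, b). box a b :: 'a set)) \<subseteq> Pow UNIV" by auto
    have "A \<in> sigma_sets UNIV (range (\<lambda>(a, b). box a b))"
       using that unfolding borel_eq_box by simp
    from st pw this show ?thesis
    proof (induction rule: sigma_sets_induct_disjoint)
      case (basic A) then show ?case using bh by auto
    next
      case empty then show ?case by simp
    next
      case (compl A)
      then have A: "A \<in> sets borel" by (simp add: borel_eq_box)
      have "(LINT x|lborel. indicator (UNIV - A) x * h x) = (LINT x|lborel. h x - indicator A x * h x)"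
        by (intro Bochner_Integration.integral_cong) (auto simp: indicator_def)
      also have "\<dots> = (LINT x|lborel. h x) - (LINT x|lborel. indicator A x * h x)"
        by (rule Bochner_Integration.integral_diff[OF inth inti[OF A]])
      finally show ?case using compl total by simp
    next
      case (union F)
      then have F: "\<And>i. F i \<in> sets borel" by (simp add: borel_eq_box subset_eq)
      have "(LINT x:(\<Union>i. F i)|lborel. h x) = (\<Sum>i. LINT x:F i|lborel. h x)"
      proof (rule lebesgue_integral_countable_add)
        show "\<And>i. F i \<in> sets lborel" using F by simp
        show "\<And>i j. i \<noteq> j \<Longrightarrow> F i \<inter> F j = {}" using union(1) by (auto simp: disjoint_family_on_def)
        show "set_integrable lborel (\<Union>i. F i) h"
          unfolding set_integrable_def using inti[of "\<Union>i. F i"] F by auto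
      qed
      then show ?case using union.IH unfolding set_lebesgue_integral_def by simp
    qed
  qed
  have "AE x in lborel. h x = 0"
  proof -
    have m: "{x. 0 < h x} \<in> sets borel" "{x. h x < 0} \<in> sets borel" by measurable
    have "(AE x in lborel. indicator {x. 0 < h x} x * h x = 0)"
      by (rule integral_nonneg_eq_0_iff_AE[OF inti[OF m(1)], THEN iffD1, OF _ all[OF m(1)]])
        (auto intro: AE_I2 simp: indicator_def)
    moreover have "(LINT x|lborel. - (indicator {x. h x < 0} x * h x)) = 0"
      using all[OF m(2)] by simp
    then have "AE x in lborel. - (indicator {x. h x < 0} x * h x) = 0"
      by (rule integral_nonneg_eq_0_iff_AE[OF Bochner_Integration.integrable_minus[OF inti[OF m(2)]], THEN iffD1, rotated])
        (auto intro: AE_I2 simp: indicator_def)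
    ultimately show ?thesis
      by eventually_elim (auto simp: indicator_def split: if_splits)
  qed
  then show ?thesis using gh' AE_completion[of "\<lambda>x. h x = 0" lborel] by auto
qed

section \<open>Test functions and the fundamental lemma\<close>

text \<open>A smooth function of one variable together with all its derivatives: \<open>F n\<close>
  is the \<open>n\<close>-th derivative of \<open>F 0\<close>. Explicit chains are easily
  translated, reflected and composed with a coordinate.\<close>

definition smooth_chain :: "(nat \<Rightarrow> real \<Rightarrow> real) \<Rightarrow> bool" where
  "smooth_chain F \<longleftrightarrow> (\<forall>n x. (F n has_real_derivative F (Suc n) x) (at x))"

text \<open>The classical flat function \<open>exp (- c / x)\<close>, times a polynomial in
  \<open>1 / x\<close> so that the class is closed under differentiation. The parameter
  \<open>c\<close> later tends to 0, making the function approach 1 on the positive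
  half-line.\<close>

definition exp_tail :: "real \<Rightarrow> real poly \<Rightarrow> real \<Rightarrow> real" where
  "exp_tail c p x = (if x \<le> 0 then 0 else poly p (1 / x) * exp (- c / x))"

text \<open>The product and chain rules give \<open>(1 / x\<^sup>2) * (c * p (1 / x) - p' (1 / x)) *
  exp (- c / x)\<close>, and \<open>monom 1 2\<close> is the factor
  \<open>1 / x\<^sup>2\<close>.\<close>

definition exp_tail_step :: "real \<Rightarrow> real poly \<Rightarrow> real poly" where
  "exp_tail_step c p = monom 1 2 * (smult c p - pderiv p)"

lemma poly_times_exp_tendsto_0:
  assumes "0 < c"
  shows "((\<lambda>y. poly p y * exp (- c * y)) \<longlongrightarrow> (0::real)) at_top"
proof -
  have "((\<lambda>y. y ^ i * exp (- c * y)) \<longlongrightarrow> 0) at_top" for i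
  proof -
    have "filterlim (\<lambda>y. c * y) at_top at_top"
      using assms by (intro filterlim_tendsto_pos_mult_at_top[OF tendsto_const]) (auto simp: filterlim_ident)
    from filterlim_compose[OF tendsto_power_div_exp_0[of i] this]
    have "((\<lambda>y. (1 / c ^ i) * ((c * y) ^ i / exp (c * y))) \<longlongrightarrow> (1 / c ^ i) * 0) at_top"
      by (intro tendsto_intros)
    moreover have "(1 / c ^ i) * ((c * y) ^ i / exp (c * y)) = y ^ i * exp (- c * y)" for y
      using assms by (simp add: power_mult_distrib exp_minus divide_inverse)
    ultimately show ?thesis by simp
  qed
  then have "((\<lambda>y. \<Sum>i\<le>degree p. coeff p i * (y ^ i * exp (- c * y))) \<longlongrightarrow> (\<Sum>i\<le>degree p. coeff p i * 0)) at_top"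
    by (intro tendsto_intros)
  then show ?thesis by (simp add: poly_altdef sum_distrib_right mult.assoc)
qed

lemma exp_tail_derivative:
  assumes c: "0 < c"
  shows "(exp_tail c p has_real_derivative exp_tail c (exp_tail_step c p) x) (at x)"
proof -
  consider "x < 0" | "x = 0" | "0 < x" by linarith
  then show ?thesis
  proof cases
    case 1
    have "((\<lambda>x. 0) has_real_derivative 0) (at x)" by simp
    then have "(exp_tail c p has_real_derivative 0) (at x)"
    proof (rule has_field_derivative_transform_within_open[where S="{..<0}"])
    qed (use 1 in \<open>auto simp: exp_tail_def\<close>)
    then show ?thesis using 1 by (simp add: exp_tail_def)
  next
    case 3
    have d: "((\<lambda>x. 1 / x) has_real_derivative - (1 / x\<^sup>2)) (at x)"
      using 3 by (auto intro!: derivative_eq_intros simp: power2_eq_square)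
    have d1: "((\<lambda>x. poly p (1 / x)) has_real_derivative poly (pderiv p) (1 / x) * - (1 / x\<^sup>2)) (at x)"
      by (rule DERIV_cong[OF DERIV_chain'[OF d poly_DERIV]]) simp
    have d2: "((\<lambda>x. exp (- c / x)) has_real_derivative exp (- c / x) * (c / x\<^sup>2)) (at x)"
      using 3 by (auto intro!: derivative_eq_intros simp: power2_eq_square)
    have "((\<lambda>x. poly p (1 / x) * exp (- c / x)) has_real_derivative
       poly (exp_tail_step c p) (1 / x) * exp (- c / x)) (at x)"
      by (rule DERIV_cong[OF DERIV_mult[OF d1 d2]])
        (simp add: exp_tail_step_def poly_monom algebra_simps power_one_over)
    then have "(exp_tail c p has_real_derivative poly (exp_tail_step c p) (1 / x) * exp (- c / x)) (at x)"
    proof (rule has_field_derivative_transform_within_open[where S="{0<..}"])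
    qed (use 3 in \<open>auto simp: exp_tail_def\<close>)
    then show ?thesis using 3 by (simp add: exp_tail_def)
  next
    case 2
    have "((\<lambda>h. exp_tail c p h / h) \<longlongrightarrow> 0) (at_left 0)"
      by (rule Lim_transform_eventually[OF tendsto_const])
        (auto simp: exp_tail_def eventually_at_left_field intro!: exI[of _ "-1"])
    moreover have "((\<lambda>h. exp_tail c p h / h) \<longlongrightarrow> 0) (at_right 0)"
    proof (rule Lim_transform_eventually)
      \<comment> \<open>With \<open>y = 1 / h\<close> the difference quotient at 0 is a polynomial
        in \<open>y\<close> times \<open>exp (- c * y)\<close>; the factor \<open>monom 1 1\<close>
        is the division by \<open>h\<close>.\<close>
      have "((\<lambda>y. poly (monom 1 1 * p) y * exp (- c * y)) \<longlongrightarrow> 0) at_top" by (rule poly_times_exp_tendsto_0[OF c])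
      from filterlim_compose[OF this filterlim_inverse_at_top_right]
      show "((\<lambda>h. poly (monom 1 1 * p) (inverse h) * exp (- c * inverse h)) \<longlongrightarrow> 0) (at_right 0)" .
      have "\<forall>\<^sub>F h::real in at_right 0. 0 < h" by (simp add: eventually_at_right_less)
      then show "\<forall>\<^sub>F h in at_right 0. poly (monom 1 1 * p) (inverse h) * exp (- c * inverse h) = exp_tail c p h / h"
        by eventually_elim (simp add: exp_tail_def poly_monom divide_inverse)
    qed
    ultimately have "((\<lambda>h. exp_tail c p h / h) \<longlongrightarrow> 0) (at 0)" by (simp add: filterlim_split_at)
    then show ?thesis using 2 by (simp add: DERIV_def exp_tail_def)
  qed
qed

lemma smooth_chain_exp_tail:
  "0 < c \<Longrightarrow> smooth_chain (\<lambda>n. exp_tail c ((exp_tail_step c ^^ n) p))"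
  unfolding smooth_chain_def by (auto intro: exp_tail_derivative)

lemma smooth_chain_shift:
  assumes "smooth_chain F"
  shows "smooth_chain (\<lambda>n x. F n (x - a))"
  unfolding smooth_chain_def
proof (intro allI)
  fix n x
  have "(F n has_real_derivative F (Suc n) (x - a)) (at (x - a))" using assms by (simp add: smooth_chain_def)
  moreover have "((\<lambda>x. x - a) has_real_derivative 1) (at x)" by (auto intro!: derivative_eq_intros)
  ultimately have "((\<lambda>x. F n (x - a)) has_real_derivative F (Suc n) (x - a) * 1) (at x)"
    by (rule DERIV_chain2)
  then show "((\<lambda>x. F n (x - a)) has_real_derivative F (Suc n) (x - a)) (at x)" by simp
qed

lemma smooth_chain_reflect:
  assumes "smooth_chain F"
  shows "smooth_chain (\<lambda>n x. (-1) ^ n * F n (b - x))"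
  unfolding smooth_chain_def
proof (intro allI)
  fix n x
  have "(F n has_real_derivative F (Suc n) (b - x)) (at (b - x))" using assms by (simp add: smooth_chain_def)
  moreover have "((\<lambda>x. b - x) has_real_derivative -1) (at x)" by (auto intro!: derivative_eq_intros)
  ultimately have "((\<lambda>x. F n (b - x)) has_real_derivative F (Suc n) (b - x) * -1) (at x)"
    by (rule DERIV_chain2)
  from DERIV_cmult[OF this, of "(-1) ^ n"]
  show "((\<lambda>x. (-1) ^ n * F n (b - x)) has_real_derivative (-1) ^ Suc n * F (Suc n) (b - x)) (at x)" by simp
qed

lemma partial_derivativeI:
  "(f has_derivative f') (at x) \<Longrightarrow> partial_derivative i f x = f' (axis i 1)"
  unfolding partial_derivative_def by (simp add: frechet_derivative_at[symmetric])

lemma C_k_differentiable: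
  "C_k (Suc m) f \<Longrightarrow> (f has_derivative frechet_derivative f (at x)) (at x)"
  by (simp add: differentiable_on_def frechet_derivative_works[symmetric])

lemma C_k_Suc_imp: "C_k (Suc m) f \<Longrightarrow> C_k m f"
proof (induction m arbitrary: f)
  case 0
  then show ?case by (auto intro: differentiable_imp_continuous_on)
next
  case (Suc m)
  then show ?case by (metis C_k.simps(2))
qed

lemma C_k_const: "C_k m (\<lambda>x. c)"
proof (induction m arbitrary: c)
  case (Suc m)
  have "partial_derivative i (\<lambda>x. c) = (\<lambda>x. 0)" for i :: 'a
    by (rule ext) (simp add: partial_derivativeI[OF has_derivative_const])
  then show ?case using Suc by simp
qed simp

lemma C_k_add: "C_k m f \<Longrightarrow> C_k m g \<Longrightarrow> C_k m (\<lambda>x. f x + g x)"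
proof (induction m arbitrary: f g)
  case (Suc m)
  have "partial_derivative i (\<lambda>x. f x + g x) = (\<lambda>x. partial_derivative i f x + partial_derivative i g x)" for i :: 'a
    by (rule ext, subst partial_derivativeI[OF has_derivative_add[OF C_k_differentiable[OF Suc(2)] C_k_differentiable[OF Suc(3)]]])
      (simp add: partial_derivative_def)
  then show ?case using Suc by (auto intro: differentiable_on_add)
qed (auto intro: continuous_on_add)

lemma C_k_mult: "C_k m f \<Longrightarrow> C_k m g \<Longrightarrow> C_k m (\<lambda>x. f x * g x)"
proof (induction m arbitrary: f g)
  case (Suc m)
  have "partial_derivative i (\<lambda>x. f x * g x) = (\<lambda>x. f x * partial_derivative i g x + partial_derivative i f x * g x)" for i :: 'a
    by (rule ext, subst partial_derivativeI[OF has_derivative_mult[OF C_k_differentiable[OF Suc(2)] C_k_differentiable[OF Suc(3)]]])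
      (simp add: partial_derivative_def)
  then show ?case using Suc C_k_Suc_imp[OF Suc(2)] C_k_Suc_imp[OF Suc(3)]
    by (auto intro!: differentiable_on_mult C_k_add)
qed (auto intro: continuous_on_mult)

lemma C_k_prod: "finite I \<Longrightarrow> (\<And>i. i \<in> I \<Longrightarrow> C_k m (f i)) \<Longrightarrow> C_k m (\<lambda>x. \<Prod>i\<in>I. f i x)"
  by (induction I rule: finite_induct) (auto intro: C_k_const C_k_mult)

lemma C_k_smooth_chain:
  assumes "smooth_chain F"
  shows "C_k m (\<lambda>x. F n (x $ i))"
proof (induction m arbitrary: n)
  case 0
  have "continuous_on UNIV (F n)" for n
    using assms unfolding smooth_chain_def by (auto intro!: continuous_at_imp_continuous_on DERIV_isCont)
  then have "continuous_on UNIV (F n \<circ> (\<lambda>x. x $ i))"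
    by (intro continuous_on_compose) (auto intro: continuous_intros continuous_on_subset)
  then show ?case by (simp add: o_def)
next
  case (Suc m)
  have d: "((\<lambda>x. F n (x $ i)) has_derivative (\<lambda>h. F (Suc n) (x $ i) * h $ i)) (at x)" for x
  proof -
    have "(F n has_derivative (*) (F (Suc n) (x $ i))) (at (x $ i))"
      using assms by (simp add: smooth_chain_def has_field_derivative_def)
    from has_derivative_compose[OF bounded_linear_imp_has_derivative[OF bounded_linear_vec_nth] this]
    show ?thesis .
  qed
  have "partial_derivative j (\<lambda>x. F n (x $ i)) = (\<lambda>x. (if j = i then 1 else 0) * F (Suc n) (x $ i))" for j
    by (rule ext) (auto simp: partial_derivativeI[OF d] axis_def)
  moreover have "(\<lambda>x. F n (x $ i)) differentiable_on UNIV"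
    using d by (auto simp: differentiable_on_def differentiable_def)
  ultimately show ?case using Suc by (auto intro!: C_k_mult C_k_const simp del: mult_cancel_right2)
qed

text \<open>For \<open>c > 0\<close> a smooth function with values between 0 and 1 that is positive
  exactly on the open box. Letting \<open>c\<close> tend to 0 produces the indicator of the box, so
  this family takes over the role of mollification.\<close>

definition bump :: "real \<Rightarrow> real^'n::finite \<Rightarrow> real^'n \<Rightarrow> real^'n \<Rightarrow> real" where
  "bump c a b x = (\<Prod>i\<in>UNIV. exp_tail c 1 (x $ i - a $ i) * exp_tail c 1 (b $ i - x $ i))"

lemma C_k_bump: "0 < c \<Longrightarrow> C_k m (bump c a b)"
  unfolding bump_def
  using C_k_smooth_chain[OF smooth_chain_shift[OF smooth_chain_exp_tail], of c m 0 1]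
    C_k_smooth_chain[OF smooth_chain_reflect[OF smooth_chain_exp_tail], of c m 0 1]
  by (intro C_k_prod C_k_mult) auto

lemma exp_tail_1_bounds: "0 < c \<Longrightarrow> 0 \<le> exp_tail c 1 x \<and> exp_tail c 1 x \<le> 1"
  by (auto simp: exp_tail_def)

lemma bump_bounds: "0 < c \<Longrightarrow> 0 \<le> bump c a b x" "0 < c \<Longrightarrow> bump c a b x \<le> 1"
  unfolding bump_def by (auto intro!: prod_nonneg prod_le_1 mult_le_one simp: exp_tail_1_bounds)

lemma bump_eq_0: "x \<notin> box a b \<Longrightarrow> bump c a b x = 0"
proof -
  assume "x \<notin> box a b"
  then obtain i where "\<not> (a $ i < x $ i \<and> x $ i < b $ i)" by (auto simp: mem_box_cart)
  then have "exp_tail c 1 (x $ i - a $ i) * exp_tail c 1 (b $ i - x $ i) = 0" by (auto simp: exp_tail_def)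
  then show ?thesis unfolding bump_def by (intro prod_zero) auto
qed

lemma bump_tendsto: "(\<lambda>n. bump (inverse (real (Suc n))) a b x) \<longlonglongrightarrow> indicator (box a b) x"
proof (cases "x \<in> box a b")
  case True
  have "(\<lambda>n. exp_tail (inverse (real (Suc n))) 1 y) \<longlonglongrightarrow> 1" if "0 < y" for y
  proof -
    have "(\<lambda>n. exp (- inverse (real (Suc n)) / y)) \<longlonglongrightarrow> exp (- 0 / y)"
      using that by (intro tendsto_intros LIMSEQ_inverse_real_of_nat) auto
    then show ?thesis using that by (simp add: exp_tail_def)
  qed
  then have "(\<lambda>n. bump (inverse (real (Suc n))) a b x) \<longlonglongrightarrow> (\<Prod>i\<in>(UNIV :: 'a set). 1 * 1)"
    unfolding bump_def using True
    by (intro tendsto_prod[of UNIV "\<lambda>i n. exp_tail (inverse (real (Suc n))) 1 (x $ i - a $ i) * exp_tail (inverse (real (Suc n))) 1 (b $ i - x $ i)" "\<lambda>i. 1 * 1"] tendsto_mult) (auto simp: mem_box_cart)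
  then show ?thesis using True by simp
qed (simp add: bump_eq_0)

lemma bump_test_function:
  assumes "0 < c" "cbox a b \<subseteq> \<Omega>"
  shows "bump c a b \<in> test_functions \<Omega>"
proof -
  have "{x. bump c a b x \<noteq> 0} \<subseteq> cbox a b" using bump_eq_0[of _ a b c] box_subset_cbox by blast
  then have "closure {x. bump c a b x \<noteq> 0} \<subseteq> cbox a b" by (intro closure_minimal) auto
  moreover from this have "compact (closure {x. bump c a b x \<noteq> 0})"
    by (meson bounded_cbox bounded_subset closed_closure compact_eq_bounded_closed)
  ultimately show ?thesis using assms C_k_bump by (auto simp: test_functions_def)
qed

text \<open>Bump functions are bounded by 1 and tend to indicators of boxes, so by dominated
  convergence the integrals of \<open>g\<close> over boxes inside a closed box in \<Omega> vanish,
  and \<open>g\<close> is zero almost everywhere there. Countably many closed boxes exhaust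
  \<Omega>.\<close>

lemma fundamental_lemma:
  fixes \<Omega> :: "(real^'n::finite) set" and g :: "real^'n \<Rightarrow> real"
  assumes \<Omega>: "open \<Omega>"
    and g: "\<And>K. compact K \<Longrightarrow> K \<subseteq> \<Omega> \<Longrightarrow> integrable (lebesgue_on K) g"
    and test: "\<And>\<phi>. \<phi> \<in> test_functions \<Omega> \<Longrightarrow> (LINT x|lebesgue_on \<Omega>. \<phi> x * g x) = 0"
  shows "AE x in lebesgue. x \<in> \<Omega> \<longrightarrow> g x = 0"
proof -
  have main: "AE x in lebesgue. x \<in> cbox p q \<longrightarrow> g x = 0" if pq: "cbox p q \<subseteq> \<Omega>" for p q
  proof -
    define h where "h x = indicator (box p q) x * g x" for x
    have ic: "integrable lebesgue (\<lambda>x. indicator (cbox p q) x * g x)"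
      using g[OF compact_cbox pq] by (simp add: integrable_restrict_space)
    have ih: "integrable lebesgue h"
    proof -
      have "integrable lebesgue (\<lambda>x. indicator (cbox p q) x * g x * indicator (box p q) x)"
        by (rule integrable_real_mult_indicator[OF _ ic]) simp
      moreover have "(\<lambda>x. indicator (cbox p q) x * g x * indicator (box p q) x) = h"
        by (rule ext) (use box_subset_cbox[of p q] in \<open>auto simp: h_def indicator_def\<close>)
      ultimately show ?thesis by simp
    qed
    have "(LINT x|lebesgue. indicator (box a b) x * h x) = 0" for a b
    proof -
      obtain a' b' where ab: "box a b \<inter> box p q = box a' b'" by (rule that[OF box_Int_box])
      show ?thesis
      proof (cases "box a' b' = {}")
        case True
        then have "(\<lambda>x. indicator (box a b) x * h x) = (\<lambda>x. 0)"
          by (intro ext) (use ab in \<open>auto simp: h_def indicator_def\<close>)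
        then show ?thesis by simp
      next
        case False
        have "box a' b' \<subseteq> box p q" using ab by auto
        then have "closure (box a' b') \<subseteq> closure (box p q)" by (rule closure_mono)
        then have cb: "cbox a' b' \<subseteq> cbox p q" using False by (metis closure_box closure_empty \<open>box a' b' \<subseteq> box p q\<close> subset_empty)
        define \<phi> where "\<phi> n = bump (inverse (real (Suc n))) a' b'" for n
        have \<phi>: "\<phi> n \<in> test_functions \<Omega>" for n
          unfolding \<phi>_def by (rule bump_test_function) (use cb pq in auto)
        have eq: "indicator \<Omega> x * (\<phi> n x * g x) = \<phi> n x * h x" for n x
          using bump_eq_0[of x a' b' "inverse (real (Suc n))"] ab pq box_subset_cbox[of p q]
          by (cases "x \<in> box a' b'") (auto simp: \<phi>_def h_def indicator_def)
        have "(LINT x|lebesgue. \<phi> n x * h x) = 0" for n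
          using test[OF \<phi>[of n]] \<Omega> by (subst (asm) integral_restrict_space) (auto simp: eq)
        moreover have "(\<lambda>n. LINT x|lebesgue. \<phi> n x * h x) \<longlonglongrightarrow> (LINT x|lebesgue. indicator (box a' b') x * h x)"
        proof (rule integral_dominated_convergence[where w="\<lambda>x. norm (h x)"])
          have "C_k 0 (\<phi> n)" for n using \<phi>[of n] by (simp add: test_functions_def)
          then have "continuous_on UNIV (\<phi> n)" for n by simp
          then have m: "\<phi> n \<in> borel_measurable lebesgue" for n
            by (intro measurable_completion) (simp add: borel_measurable_continuous_onI)
          show "(\<lambda>x. \<phi> n x * h x) \<in> borel_measurable lebesgue" for n
            using m ih by (intro borel_measurable_times) auto
          show "(\<lambda>x. indicator (box a' b') x * h x) \<in> borel_measurable lebesgue"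
            using ih by (intro borel_measurable_times borel_measurable_indicator) auto
          show "AE x in lebesgue. (\<lambda>n. \<phi> n x * h x) \<longlonglongrightarrow> indicator (box a' b') x * h x"
            unfolding \<phi>_def by (intro AE_I2 tendsto_intros bump_tendsto)
          show "AE x in lebesgue. norm (\<phi> n x * h x) \<le> norm (h x)" for n
            unfolding \<phi>_def using bump_bounds[of "inverse (real (Suc n))" a' b']
            by (auto simp: abs_mult intro!: mult_left_le_one_le)
        qed (use ih in simp)
        ultimately have "(LINT x|lebesgue. indicator (box a' b') x * h x) = 0"
          by (simp add: LIMSEQ_const_iff)
        moreover have "indicator (box a' b') x * h x = indicator (box a b) x * h x" for x
          using ab by (auto simp: h_def indicator_def)
        ultimately show ?thesis by simp
      qed
    qed
    from AE_zero_if_box_integrals_zero[OF ih this] have "AE x in lebesgue. h x = 0" .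
    moreover have "AE x in lebesgue. x \<notin> cbox p q - box p q"
    proof (rule AE_not_in)
      have "negligible (cbox p q - box p q)" by (rule negligible_frontier_interval)
      then show "cbox p q - box p q \<in> null_sets lebesgue" by (simp add: negligible_iff_null_sets)
    qed
    ultimately show ?thesis by eventually_elim (auto simp: h_def indicator_def split: if_splits)
  qed
  obtain \<D> where D: "countable \<D>" "\<D> \<subseteq> Pow \<Omega>" "\<And>X. X \<in> \<D> \<Longrightarrow> \<exists>a b. X = cbox a b" "\<Union>\<D> = \<Omega>"
    using open_countable_Union_open_cbox[OF \<Omega>] by metis
  have "AE x in lebesgue. \<forall>X\<in>\<D>. x \<in> X \<longrightarrow> g x = 0"
  proof (rule AE_ball_countable[THEN iffD2], rule D(1), rule ballI)
    fix X assume X: "X \<in> \<D>"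
    then obtain a b where ab: "X = cbox a b" using D(3) by blast
    then have "cbox a b \<subseteq> \<Omega>" using D(2) X by auto
    from main[OF this] show "AE x in lebesgue. x \<in> X \<longrightarrow> g x = 0" by (simp add: ab)
  qed
  then show ?thesis by (rule AE_mp) (use D(4) in auto)
qed

section \<open>Translations and compactness\<close>

lemma nn_integral_lborel_translation:
  fixes f :: "'a::euclidean_space \<Rightarrow> ennreal"
  assumes [measurable]: "f \<in> borel_measurable borel"
  shows "(\<integral>\<^sup>+x. f (x + c) \<partial>lborel) = (\<integral>\<^sup>+x. f x \<partial>lborel)"
proof -
  have "(\<integral>\<^sup>+x. f x \<partial>lborel) = (\<integral>\<^sup>+x. f x \<partial>distr lborel borel ((+) c))" by (simp add: lborel_distr_plus)
  also have "\<dots> = (\<integral>\<^sup>+x. f (c + x) \<partial>lborel)" by (rule nn_integral_distr) auto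
  finally show ?thesis by (simp add: add.commute)
qed

lemma lborel_integral_translation:
  fixes f :: "'a::euclidean_space \<Rightarrow> real"
  assumes [measurable]: "f \<in> borel_measurable borel"
  shows "(LINT x|lborel. f (x + c)) = (LINT x|lborel. f x)"
proof -
  have "(LINT x|lborel. f x) = (LINT x|distr lborel borel ((+) c). f x)" by (simp add: lborel_distr_plus)
  also have "\<dots> = (LINT x|lborel. f (c + x))" by (rule integral_distr) auto
  finally show ?thesis by (simp add: add.commute)
qed

lemma lborel_integrable_translation:
  fixes f :: "'a::euclidean_space \<Rightarrow> real"
  assumes f: "integrable lborel f"
  shows "integrable lborel (\<lambda>x. f (x + c))"
proof -
  have "integrable (distr lborel borel ((+) c)) f" using f by (simp add: lborel_distr_plus)
  then have "integrable lborel (\<lambda>x. f (c + x))" using f by (subst (asm) integrable_distr_eq) auto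
  then show ?thesis by (simp add: add.commute)
qed

text \<open>The Cauchy--Schwarz inequality on the segment from \<open>x\<close> to \<open>x + h e\<close>, with the weight
  distributed so that only the integral of its reciprocal \<open>v\<close> along lines enters.\<close>

lemma translation_estimate:
  fixes \<phi> d \<psi> v :: "'a::euclidean_space \<Rightarrow> real" and e :: 'a
  assumes deriv: "\<And>x s. ((\<lambda>s. \<phi> (x + s *\<^sub>R e)) has_real_derivative d (x + s *\<^sub>R e)) (at s)"
    and d: "continuous_on UNIV d" and [measurable]: "\<psi> \<in> borel_measurable borel" "v \<in> borel_measurable borel"
    and v: "\<And>y. 0 \<le> v y" and dv: "\<And>y. \<bar>d y\<bar> = \<bar>\<psi> y\<bar> * sqrt (v y)"
    and M: "\<And>x. (\<integral>\<^sup>+s. ennreal (v (x + s *\<^sub>R e)) \<partial>lborel) \<le> ennreal M" and M0: "0 \<le> M"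
    and \<phi>: "continuous_on UNIV \<phi>" and h: "0 \<le> h"
  shows "(\<integral>\<^sup>+x. ennreal ((\<phi> (x + h *\<^sub>R e) - \<phi> x)\<^sup>2) \<partial>lborel)
    \<le> ennreal (M * h) * (\<integral>\<^sup>+x. ennreal ((\<psi> x)\<^sup>2) \<partial>lborel)"
proof -
  have [measurable]: "\<phi> \<in> borel_measurable borel" "d \<in> borel_measurable borel"
    using \<phi> d by (auto intro: borel_measurable_continuous_onI)
  have pt: "ennreal ((\<phi> (x + h *\<^sub>R e) - \<phi> x)\<^sup>2)
      \<le> ennreal M * (\<integral>\<^sup>+s. indicator {0..h} s * ennreal ((\<psi> (x + s *\<^sub>R e))\<^sup>2) \<partial>lborel)" for x
  proof -
    have cd: "continuous_on {0..h} (\<lambda>s. d (x + s *\<^sub>R e))"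
      by (rule continuous_on_compose2[OF d]) (auto intro!: continuous_intros)
    have int: "integrable lborel (\<lambda>s. indicator {0..h} s *\<^sub>R d (x + s *\<^sub>R e))"
      by (rule borel_integrable_compact[OF compact_Icc cd])
    have "(LINT s|lborel. indicator {0..h} s *\<^sub>R d (x + s *\<^sub>R e)) = \<phi> (x + h *\<^sub>R e) - \<phi> (x + 0 *\<^sub>R e)"
    proof (rule integral_FTC_atLeastAtMost[OF h _ cd])
      fix s
      show "((\<lambda>s. \<phi> (x + s *\<^sub>R e)) has_vector_derivative d (x + s *\<^sub>R e)) (at s within {0..h})"
        using deriv[of x s] by (simp add: has_real_derivative_iff_has_vector_derivative has_vector_derivative_at_within)
    qed
    then have "ennreal \<bar>\<phi> (x + h *\<^sub>R e) - \<phi> x\<bar> \<le> (\<integral>\<^sup>+s. norm (indicator {0..h} s *\<^sub>R d (x + s *\<^sub>R e)) \<partial>lborel)"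
      using integral_norm_bound_ennreal[OF int] by simp
    also have "\<dots> = (\<integral>\<^sup>+s. (indicator {0..h} s * ennreal \<bar>\<psi> (x + s *\<^sub>R e)\<bar>) * ennreal (sqrt (v (x + s *\<^sub>R e))) \<partial>lborel)"
      by (intro nn_integral_cong) (auto simp: dv indicator_def ennreal_mult v)
    finally have "(ennreal \<bar>\<phi> (x + h *\<^sub>R e) - \<phi> x\<bar>)\<^sup>2
       \<le> (\<integral>\<^sup>+s. (indicator {0..h} s * ennreal \<bar>\<psi> (x + s *\<^sub>R e)\<bar>) * ennreal (sqrt (v (x + s *\<^sub>R e))) \<partial>lborel)\<^sup>2"
      by (rule power_mono) simp
    also have "\<dots> \<le> (\<integral>\<^sup>+s. (indicator {0..h} s * ennreal \<bar>\<psi> (x + s *\<^sub>R e)\<bar>)\<^sup>2 \<partial>lborel)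
        * (\<integral>\<^sup>+s. (ennreal (sqrt (v (x + s *\<^sub>R e))))\<^sup>2 \<partial>lborel)"
      by (rule Cauchy_Schwarz_nn_integral) auto
    also have "(\<integral>\<^sup>+s. (indicator {0..h} s * ennreal \<bar>\<psi> (x + s *\<^sub>R e)\<bar>)\<^sup>2 \<partial>lborel)
        = (\<integral>\<^sup>+s. indicator {0..h} s * ennreal ((\<psi> (x + s *\<^sub>R e))\<^sup>2) \<partial>lborel)"
      by (intro nn_integral_cong) (auto simp: indicator_def ennreal_power)
    also have "(\<integral>\<^sup>+s. (ennreal (sqrt (v (x + s *\<^sub>R e))))\<^sup>2 \<partial>lborel) = (\<integral>\<^sup>+s. ennreal (v (x + s *\<^sub>R e)) \<partial>lborel)"
      by (intro nn_integral_cong) (auto simp: ennreal_power v)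
    also have "(\<integral>\<^sup>+s. indicator {0..h} s * ennreal ((\<psi> (x + s *\<^sub>R e))\<^sup>2) \<partial>lborel) * \<dots>
      \<le> (\<integral>\<^sup>+s. indicator {0..h} s * ennreal ((\<psi> (x + s *\<^sub>R e))\<^sup>2) \<partial>lborel) * ennreal M"
      by (rule mult_left_mono[OF M]) simp
    finally show ?thesis by (simp add: ennreal_power mult.commute)
  qed
  have "(\<integral>\<^sup>+x. ennreal ((\<phi> (x + h *\<^sub>R e) - \<phi> x)\<^sup>2) \<partial>lborel)
      \<le> (\<integral>\<^sup>+x. ennreal M * (\<integral>\<^sup>+s. indicator {0..h} s * ennreal ((\<psi> (x + s *\<^sub>R e))\<^sup>2) \<partial>lborel) \<partial>lborel)"
    by (intro nn_integral_mono pt)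
  also have "\<dots> = ennreal M * (\<integral>\<^sup>+x. (\<integral>\<^sup>+s. indicator {0..h} s * ennreal ((\<psi> (x + s *\<^sub>R e))\<^sup>2) \<partial>lborel) \<partial>lborel)"
    by (rule nn_integral_cmult) measurable
  \<comment> \<open>After Tonelli, translation invariance gives every shift \<open>s\<close> the
    same inner integral, so integrating over \<open>{0..h}\<close> yields the factor
    \<open>h\<close>.\<close>
  also have "(\<integral>\<^sup>+x. (\<integral>\<^sup>+s. indicator {0..h} s * ennreal ((\<psi> (x + s *\<^sub>R e))\<^sup>2) \<partial>lborel) \<partial>lborel)
      = (\<integral>\<^sup>+s. (\<integral>\<^sup>+x. indicator {0..h} s * ennreal ((\<psi> (x + s *\<^sub>R e))\<^sup>2) \<partial>lborel) \<partial>lborel)"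
    by (rule pair_sigma_finite.Fubini'[symmetric, OF pair_sigma_finite.intro[OF lborel.sigma_finite_measure_axioms lborel.sigma_finite_measure_axioms]]) measurable
  also have "\<dots> = (\<integral>\<^sup>+s. indicator {0..h} s * (\<integral>\<^sup>+x. ennreal ((\<psi> x)\<^sup>2) \<partial>lborel) \<partial>lborel)"
  proof (rule nn_integral_cong)
    fix s :: real
    have "(\<integral>\<^sup>+x. indicator {0..h} s * ennreal ((\<psi> (x + s *\<^sub>R e))\<^sup>2) \<partial>lborel)
      = indicator {0..h} s * (\<integral>\<^sup>+x. ennreal ((\<psi> (x + s *\<^sub>R e))\<^sup>2) \<partial>lborel)"
      by (rule nn_integral_cmult) measurable
    then show "(\<integral>\<^sup>+x. indicator {0..h} s * ennreal ((\<psi> (x + s *\<^sub>R e))\<^sup>2) \<partial>lborel)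
      = indicator {0..h} s * (\<integral>\<^sup>+x. ennreal ((\<psi> x)\<^sup>2) \<partial>lborel)"
      using nn_integral_lborel_translation[of "\<lambda>x. ennreal ((\<psi> x)\<^sup>2)" "s *\<^sub>R e"] by simp
  qed
  also have "\<dots> = (\<integral>\<^sup>+s. indicator {0..h} s \<partial>lborel) * (\<integral>\<^sup>+x. ennreal ((\<psi> x)\<^sup>2) \<partial>lborel)"
    by (rule nn_integral_multc) auto
  also have "(\<integral>\<^sup>+s. indicator {0..h} s \<partial>lborel) = ennreal h" using h by simp
  finally show ?thesis using M0 h by (simp add: ennreal_mult mult.assoc)
qed

lemma compact_support_integrable:
  fixes f :: "'a::euclidean_space \<Rightarrow> real"
  assumes "continuous_on UNIV f" "compact K" "\<And>x. x \<notin> K \<Longrightarrow> f x = 0"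
  shows "integrable lborel f"
proof -
  have "integrable lborel (\<lambda>x. indicator K x *\<^sub>R f x)"
    using assms by (intro borel_integrable_compact) (auto intro: continuous_on_subset)
  moreover have "(\<lambda>x. indicator K x *\<^sub>R f x) = f"
    by (intro ext) (use assms(3) in \<open>auto simp: indicator_def\<close>)
  ultimately show ?thesis by simp
qed

lemma lebesgue_integral_borel:
  fixes f :: "'a::euclidean_space \<Rightarrow> real"
  shows "f \<in> borel_measurable borel \<Longrightarrow> (LINT x|lebesgue. f x) = (LINT x|lborel. f x)"
  by (rule integral_completion) simp

lemma square_integrable_borel:
  fixes f :: "'a::euclidean_space \<Rightarrow> real"
  assumes "f \<in> borel_measurable borel" "integrable lborel (\<lambda>x. (f x)\<^sup>2)"
  shows "square_integrable f"
  unfolding square_integrable_def using assms by (auto intro: measurable_completion simp: integrable_completion)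

lemma compact_support_square_integrable:
  fixes f :: "'a::euclidean_space \<Rightarrow> real"
  assumes "continuous_on UNIV f" "compact K" "\<And>x. x \<notin> K \<Longrightarrow> f x = 0"
  shows "square_integrable f"
proof (rule square_integrable_borel)
  show "f \<in> borel_measurable borel" using assms(1) by (rule borel_measurable_continuous_onI)
  show "integrable lborel (\<lambda>x. (f x)\<^sup>2)"
    by (rule compact_support_integrable[OF _ assms(2)]) (use assms in \<open>auto intro: continuous_intros\<close>)
qed

lemma square_integrable_translation:
  fixes f :: "'a::euclidean_space \<Rightarrow> real"
  assumes f: "square_integrable f" and [measurable]: "f \<in> borel_measurable borel"
  shows "square_integrable (\<lambda>x. f (x + y))"
proof (rule square_integrable_borel)
  have "integrable lborel (\<lambda>x. (f x)\<^sup>2)" using f by (simp add: square_integrable_def integrable_completion)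
  from lborel_integrable_translation[OF this] show "integrable lborel (\<lambda>x. (f (x + y))\<^sup>2)" .
qed measurable

lemma norm_abs_L2_borel:
  assumes "square_integrable f" "f \<in> borel_measurable borel"
  shows "(norm (abs_L2 f))\<^sup>2 = (LINT x|lborel. (f x)\<^sup>2)"
  using norm_abs_L2[OF assms(1)] lebesgue_integral_borel[of "\<lambda>x. (f x)\<^sup>2"] assms(2) by simp

lemma norm_translation:
  fixes f :: "'a::euclidean_space \<Rightarrow> real"
  assumes f: "square_integrable f" "f \<in> borel_measurable borel"
  shows "norm (abs_L2 (\<lambda>x. f (x + y))) = norm (abs_L2 f)"
proof -
  have [measurable]: "f \<in> borel_measurable borel" by (rule f(2))
  have "(norm (abs_L2 (\<lambda>x. f (x + y))))\<^sup>2 = (norm (abs_L2 f))\<^sup>2"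
    using lborel_integral_translation[of "\<lambda>x. (f x)\<^sup>2" y]
    by (simp add: norm_abs_L2_borel[OF f] norm_abs_L2_borel[OF square_integrable_translation[OF f]])
  then show ?thesis by (simp add: power2_eq_iff_nonneg)
qed

text \<open>The shifts are performed one after another. Each increment is a translate of a
  single-shift difference, and translation preserves the norm. Estimates along the axes thereby
  control all shifts.\<close>

lemma norm_translation_diff_sum:
  fixes f :: "'a::euclidean_space \<Rightarrow> real"
  assumes f: "square_integrable f" "f \<in> borel_measurable borel" and "finite I"
  shows "norm (abs_L2 (\<lambda>x. f (x + (\<Sum>i\<in>I. y i)) - f x)) \<le> (\<Sum>i\<in>I. norm (abs_L2 (\<lambda>x. f (x + y i) - f x)))"
  using \<open>finite I\<close>
proof (induction I rule: finite_induct)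
  case empty
  have "abs_L2 (\<lambda>x::'a. 0) = 0" by (simp add: zero_L2_def)
  then show ?case by simp
next
  case (insert j I)
  have [measurable]: "f \<in> borel_measurable borel" by (rule f(2))
  let ?z = "\<Sum>i\<in>I. y i"
  note sq = square_integrable_translation[OF f]
  let ?g = "\<lambda>x. f (x + ?z) - f x"
  have g: "square_integrable ?g" by (rule square_integrable_diff[OF sq f(1)])
  have g': "square_integrable (\<lambda>x. ?g (x + y j))" by (rule square_integrable_translation[OF g]) measurable
  have "abs_L2 (\<lambda>x. ?g (x + y j)) + abs_L2 (\<lambda>x. f (x + y j) - f x)
      = abs_L2 (\<lambda>x. ?g (x + y j) + (f (x + y j) - f x))"
    by (rule plus_L2.abs_eq) (use g' square_integrable_diff[OF sq f(1)] in auto)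
  also have "(\<lambda>x. ?g (x + y j) + (f (x + y j) - f x)) = (\<lambda>x. f (x + (\<Sum>i\<in>insert j I. y i)) - f x)"
    using insert by (simp add: add_ac)
  finally have "abs_L2 (\<lambda>x. f (x + (\<Sum>i\<in>insert j I. y i)) - f x) = abs_L2 (\<lambda>x. ?g (x + y j)) + abs_L2 (\<lambda>x. f (x + y j) - f x)" ..
  then have "norm (abs_L2 (\<lambda>x. f (x + (\<Sum>i\<in>insert j I. y i)) - f x))
     \<le> norm (abs_L2 (\<lambda>x. ?g (x + y j))) + norm (abs_L2 (\<lambda>x. f (x + y j) - f x))"
    by (simp add: norm_triangle_ineq)
  also have "norm (abs_L2 (\<lambda>x. ?g (x + y j))) = norm (abs_L2 ?g)" by (rule norm_translation[OF g]) measurable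
  finally show ?case using insert by simp
qed

text \<open>Fubini's theorem for the average of the autocorrelation over shifts in \<open>C\<close>.
  The integrand is continuous and vanishes off the compact set \<open>C \<times> K\<close> once cut
  off to \<open>C\<close>, which gives joint integrability.\<close>

lemma inner_translation_integral:
  fixes \<phi> :: "'a::euclidean_space \<Rightarrow> real"
  assumes c: "continuous_on UNIV \<phi>" and K: "compact K" "\<And>x. x \<notin> K \<Longrightarrow> \<phi> x = 0" and C: "compact C"
  shows "integrable lborel (\<lambda>y. indicator C y * (LINT x|lborel. \<phi> (x + y) * \<phi> x))"
    and "(LINT y|lborel. indicator C y * (LINT x|lborel. \<phi> (x + y) * \<phi> x))
      = (LINT x|lborel. \<phi> x * (LINT y|lborel. indicator C y * \<phi> (x + y)))"
proof -
  have [measurable]: "\<phi> \<in> borel_measurable borel" using c by (rule borel_measurable_continuous_onI)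
  have [measurable]: "C \<in> sets borel" using C by (simp add: borel_compact)
  let ?F = "\<lambda>(y, x). indicator C y * (\<phi> (x + y) * \<phi> x)"
  have "integrable lborel (\<lambda>p :: 'a \<times> 'a. indicator (C \<times> K) p *\<^sub>R (\<phi> (snd p + fst p) * \<phi> (snd p)))"
    by (rule borel_integrable_compact[OF compact_Times[OF C K(1)]])
      (auto intro!: continuous_intros continuous_on_compose2[OF c])
  moreover have "(\<lambda>p. indicator (C \<times> K) p *\<^sub>R (\<phi> (snd p + fst p) * \<phi> (snd p))) = ?F"
  proof (intro ext)
    fix p :: "'a \<times> 'a"
    show "indicator (C \<times> K) p *\<^sub>R (\<phi> (snd p + fst p) * \<phi> (snd p)) = ?F p"
      using K(2)[of "snd p"] by (cases p) (auto simp: indicator_def)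
  qed
  ultimately have int: "integrable (lborel \<Otimes>\<^sub>M lborel) ?F" by (simp add: lborel_prod)
  have c1: "(LINT x|lborel. indicator C y * (\<phi> (x + y) * \<phi> x)) = indicator C y * (LINT x|lborel. \<phi> (x + y) * \<phi> x)" for y
    by simp
  show "integrable lborel (\<lambda>y. indicator C y * (LINT x|lborel. \<phi> (x + y) * \<phi> x))"
    using lborel_pair.integrable_fst'[OF int] by simp
  have "(LINT y|lborel. indicator C y * (LINT x|lborel. \<phi> (x + y) * \<phi> x))
      = (LINT x|lborel. (LINT y|lborel. indicator C y * (\<phi> (x + y) * \<phi> x)))"
    using lborel_pair.Fubini_integral[OF int] unfolding c1 by simp
  also have "\<dots> = (LINT x|lborel. \<phi> x * (LINT y|lborel. indicator C y * \<phi> (x + y)))"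
  proof (rule Bochner_Integration.integral_cong[OF refl])
    fix x
    have "(LINT y|lborel. indicator C y * (\<phi> (x + y) * \<phi> x)) = (LINT y|lborel. \<phi> x * (indicator C y * \<phi> (x + y)))"
      by (intro Bochner_Integration.integral_cong) auto
    then show "(LINT y|lborel. indicator C y * (\<phi> (x + y) * \<phi> x)) = \<phi> x * (LINT y|lborel. indicator C y * \<phi> (x + y))"
      by simp
  qed
  finally show "(LINT y|lborel. indicator C y * (LINT x|lborel. \<phi> (x + y) * \<phi> x))
      = (LINT x|lborel. \<phi> x * (LINT y|lborel. indicator C y * \<phi> (x + y)))" .
qed

lemma square_integrable_indicator:
  "S \<in> sets lborel \<Longrightarrow> emeasure lborel S < \<infinity> \<Longrightarrow> square_integrable (indicator S)"
proof (rule square_integrable_borel)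
  assume S: "S \<in> sets lborel" "emeasure lborel S < \<infinity>"
  have "(\<lambda>x. (indicator S x)\<^sup>2) = (indicator S :: 'a \<Rightarrow> real)" by (auto simp: indicator_def)
  then show "integrable lborel (\<lambda>x. (indicator S x :: real)\<^sup>2)" using S by (simp add: integrable_real_indicator)
qed simp

text \<open>An average over the translate of \<open>C\<close> by \<open>x\<close> is an inner
  product, so weak convergence yields pointwise convergence of the averages; the norm of the
  translated indicator is the same for all \<open>x\<close>, which yields a uniform bound.\<close>

lemma translated_indicator_inner:
  fixes \<phi> :: "'a::euclidean_space \<Rightarrow> real"
  assumes \<phi>: "square_integrable \<phi>" "\<phi> \<in> borel_measurable borel" and C: "compact C"
  shows "(LINT y|lborel. indicator C y * \<phi> (x + y)) = abs_L2 \<phi> \<bullet> abs_L2 (indicator ((+) x ` C))"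
    and "norm (abs_L2 (indicator ((+) x ` C)) :: 'a L2) = sqrt (measure lborel C)"
proof -
  have [measurable]: "\<phi> \<in> borel_measurable borel" by (rule \<phi>(2))
  have cC: "compact ((+) x ` C)" using C by (rule compact_translation)
  then have m [measurable]: "(+) x ` C \<in> sets borel" by (rule borel_compact)
  have sq: "square_integrable (indicator ((+) x ` C) :: 'a \<Rightarrow> real)"
  proof (rule square_integrable_indicator)
    show "emeasure lborel ((+) x ` C) < \<infinity>" by (rule emeasure_bounded_finite[OF compact_imp_bounded[OF cC]])
  qed simp
  have i: "(indicator ((+) x ` C) (y + x) :: real) = indicator C y" for y by (auto simp: indicator_def add.commute)
  have "abs_L2 \<phi> \<bullet> abs_L2 (indicator ((+) x ` C)) = (LINT z|lborel. \<phi> z * indicator ((+) x ` C) z)"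
    unfolding inner_abs_L2[OF \<phi>(1) sq] by (rule lebesgue_integral_borel) measurable
  also have "\<dots> = (LINT z|lborel. \<phi> (z + x) * indicator ((+) x ` C) (z + x))"
    by (rule lborel_integral_translation[symmetric]) measurable
  finally show "(LINT y|lborel. indicator C y * \<phi> (x + y)) = abs_L2 \<phi> \<bullet> abs_L2 (indicator ((+) x ` C))"
    unfolding i by (simp add: mult.commute add.commute)
  have "(norm (abs_L2 (indicator ((+) x ` C)) :: 'a L2))\<^sup>2 = (LINT z|lborel. (indicator ((+) x ` C) z)\<^sup>2)"
    by (rule norm_abs_L2_borel[OF sq]) measurable
  also have "\<dots> = (LINT z|lborel. (indicator ((+) x ` C) (z + x))\<^sup>2)"
    by (rule lborel_integral_translation[symmetric]) measurable
  also have "\<dots> = (LINT z|lborel. indicator C z)"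
    unfolding i by (intro Bochner_Integration.integral_cong) (auto simp: indicator_def)
  also have "\<dots> = measure lborel C" by simp
  finally show "norm (abs_L2 (indicator ((+) x ` C)) :: 'a L2) = sqrt (measure lborel C)"
    by (simp add: real_sqrt_unique)
qed

text \<open>Averaging the autocorrelation \<open>\<integral> \<phi>\<^sub>n (x + y) \<phi>\<^sub>n x dx\<close> over a small cube of shifts \<open>y\<close> gives nearly
  \<open>\<parallel>\<phi>\<^sub>n\<parallel>\<^sup>2\<close> by equicontinuity, and tends to \<open>0\<close> by weak convergence.\<close>

lemma weakly_null_equicontinuous_imp_null:
  fixes \<phi> :: "nat \<Rightarrow> real^'n::finite \<Rightarrow> real"
  assumes cont: "\<And>n. continuous_on UNIV (\<phi> n)" and K: "compact K" and zero: "\<And>n x. x \<notin> K \<Longrightarrow> \<phi> n x = 0"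
    and weak: "\<And>f. (\<lambda>n. abs_L2 (\<phi> n) \<bullet> f) \<longlonglongrightarrow> 0"
    and bound: "\<And>n. norm (abs_L2 (\<phi> n)) \<le> B"
    and equi: "\<And>n i h. 0 \<le> h \<Longrightarrow> norm (abs_L2 (\<lambda>x. \<phi> n (x + h *\<^sub>R axis i 1) - \<phi> n x)) \<le> C * sqrt h"
  shows "(\<lambda>n. abs_L2 (\<phi> n)) \<longlonglongrightarrow> 0"
proof -
  have B0: "0 \<le> B" by (rule order_trans[OF norm_ge_zero bound[of 0]])
  \<comment> \<open>The hypothesis \<open>equi\<close> at \<open>h = 1\<close> along an arbitrary
    axis already forces \<open>C\<close> to be nonnegative.\<close>
  have C0: "0 \<le> C" using order_trans[OF norm_ge_zero equi[of 1 0 undefined]] by simp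
  have [measurable]: "\<phi> n \<in> borel_measurable borel" for n using cont by (rule borel_measurable_continuous_onI)
  have sq: "square_integrable (\<phi> n)" for n by (rule compact_support_square_integrable[OF cont K zero])
  have *: "\<forall>\<^sub>F n in sequentially. (norm (abs_L2 (\<phi> n)))\<^sup>2 < \<epsilon>" if \<epsilon>: "0 < \<epsilon>" for \<epsilon>
  proof -
    define N where "N = real CARD('n)"
    \<comment> \<open>The modulus of continuity is \<open>C * sqrt h\<close>, so the side of the
      cube is \<open>h = s\<^sup>2\<close>. Shifting along all \<open>N\<close> axes changes the
      function by at most \<open>\<delta> = N * C * s\<close>, and \<open>s\<close> is chosen to
      make \<open>\<delta> * B < \<epsilon> / 2\<close>; the \<open>+ 1\<close> keeps the
      denominator positive.\<close>
    define s where "s = \<epsilon> / (2 * (N * C * B + 1))"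
    define h where "h = s\<^sup>2"
    have NCB: "0 \<le> N * C * B" using B0 C0 by (simp add: N_def)
    have s: "0 < s" unfolding s_def using \<epsilon> NCB by simp
    have h: "0 < h" "sqrt h = s" using s by (auto simp: h_def)
    define \<delta> where "\<delta> = N * C * s"
    have \<delta>: "\<delta> * B < \<epsilon> / 2"
    proof -
      have "\<delta> * B = (N * C * B) * s" by (simp add: \<delta>_def)
      also have "\<dots> < (N * C * B + 1) * s" using s by simp
      also have "\<dots> = \<epsilon> / 2"
      proof -
        have "N * C * B + 1 \<noteq> 0" using NCB by linarith
        moreover have "a * (\<epsilon> / (2 * a)) = \<epsilon> / 2" if "a \<noteq> 0" for a using that by simp
        ultimately show ?thesis unfolding s_def by blast
      qed
      finally show ?thesis .
    qed
    define Q where "Q = cbox (0 :: real^'n) (\<chi> i. h)"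
    have Q: "compact Q" by (simp add: Q_def)
    have [measurable]: "Q \<in> sets borel" using Q by (rule borel_compact)
    define v where "v = measure lborel Q"
    have v: "0 < v"
      unfolding v_def Q_def by (rule content_pos_lt) (use h in \<open>auto simp: Basis_vec_def inner_axis\<close>)
    define G where "G n x = (LINT y|lborel. indicator Q y * \<phi> n (x + y))" for n x
    have G: "G n x = abs_L2 (\<phi> n) \<bullet> abs_L2 (indicator ((+) x ` Q))" for n x
      unfolding G_def by (rule translated_indicator_inner(1)[OF sq _ Q]) measurable
    have Gb: "\<bar>G n x\<bar> \<le> B * sqrt v" for n x
    proof -
      have "\<bar>G n x\<bar> \<le> norm (abs_L2 (\<phi> n)) * norm (abs_L2 (indicator ((+) x ` Q)) :: (real^'n) L2)"
        unfolding G by (rule Cauchy_Schwarz_ineq2)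
      also have "\<dots> \<le> B * sqrt v"
        using translated_indicator_inner(2)[OF sq _ Q, of n x] bound[of n]
        by (intro mult_mono B0) (auto simp: v_def)
      finally show ?thesis .
    qed
    have Glim: "(\<lambda>n. G n x) \<longlonglongrightarrow> 0" for x unfolding G by (rule weak)
    have [measurable]: "G n \<in> borel_measurable borel" for n unfolding G_def by measurable
    have [measurable]: "K \<in> sets borel" using K by (rule borel_compact)
    have intK: "integrable lborel (\<lambda>x. indicator K x * c :: real)" for c
      using emeasure_bounded_finite[OF compact_imp_bounded[OF K]] by (intro integrable_mult_left integrable_real_indicator) auto
    have sqG: "square_integrable (\<lambda>x. indicator K x * G n x)" for n
    proof (rule square_integrable_borel)
      show "integrable lborel (\<lambda>x. (indicator K x * G n x)\<^sup>2)"
        by (rule Bochner_Integration.integrable_bound[OF intK[of "(B * sqrt v)\<^sup>2"]])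
          (use Gb abs_le_square_iff[of "G n _" "B * sqrt v"] B0 v in \<open>auto simp: indicator_def intro!: AE_I2\<close>)
    qed measurable
    \<comment> \<open>The averages tend to 0 pointwise by weak convergence and are bounded by
      \<open>B * sqrt v\<close> on the compact set \<open>K\<close>, so they tend to 0 in norm
      there.\<close>
    have "(\<lambda>n. LINT x|lborel. (indicator K x * G n x)\<^sup>2) \<longlonglongrightarrow> (LINT x|(lborel :: (real^'n) measure). 0)"
    proof (rule integral_dominated_convergence[where w="\<lambda>x. indicator K x * (B * sqrt v)\<^sup>2"])
      show "AE x in lborel. (\<lambda>n. (indicator K x * G n x)\<^sup>2) \<longlonglongrightarrow> 0"
      proof (rule AE_I2)
        fix x
        have "(\<lambda>n. (indicator K x * G n x)\<^sup>2) \<longlonglongrightarrow> (indicator K x * 0)\<^sup>2" by (intro tendsto_intros Glim)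
        then show "(\<lambda>n. (indicator K x * G n x)\<^sup>2) \<longlonglongrightarrow> 0" by simp
      qed
      show "AE x in lborel. norm ((indicator K x * G n x)\<^sup>2) \<le> indicator K x * (B * sqrt v)\<^sup>2" for n
        using Gb abs_le_square_iff[of "G n _" "B * sqrt v"] B0 v by (auto simp: indicator_def intro!: AE_I2)
    qed (use intK in auto)
    then have nG: "(\<lambda>n. (norm (abs_L2 (\<lambda>x. indicator K x * G n x)))\<^sup>2) \<longlonglongrightarrow> 0"
      by (simp add: norm_abs_L2_borel[OF sqG])
    \<comment> \<open>The autocorrelation is at least the squared norm minus
      \<open>\<delta> * B\<close> for each shift in \<open>Q\<close>. Its integral over
      \<open>Q\<close> is the inner product of \<open>\<phi> n\<close> with the function
      \<open>G n\<close> cut off to \<open>K\<close>.\<close>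
    have lower: "v * ((norm (abs_L2 (\<phi> n)))\<^sup>2 - \<delta> * B) \<le> B * norm (abs_L2 (\<lambda>x. indicator K x * G n x))" for n
    proof -
      have corr: "(norm (abs_L2 (\<phi> n)))\<^sup>2 - \<delta> * B \<le> (LINT x|lborel. \<phi> n (x + y) * \<phi> n x)" if y: "y \<in> Q" for y
      proof -
        have y': "0 \<le> y $ i" "y $ i \<le> h" for i using y unfolding Q_def mem_box_cart by auto
        have ye: "y = (\<Sum>i\<in>UNIV. y $ i *\<^sub>R axis i 1)"
          by (simp add: vec_eq_iff axis_def if_distrib cong: if_cong)
        have sqy: "square_integrable (\<lambda>x. \<phi> n (x + y))" by (rule square_integrable_translation[OF sq]) measurable
        have "norm (abs_L2 (\<lambda>x. \<phi> n (x + y) - \<phi> n x)) \<le> (\<Sum>i\<in>UNIV. norm (abs_L2 (\<lambda>x. \<phi> n (x + y $ i *\<^sub>R axis i 1) - \<phi> n x)))"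
          by (subst ye) (rule norm_translation_diff_sum[OF sq], auto)
        also have "\<dots> \<le> (\<Sum>i\<in>(UNIV :: 'n set). C * s)"
        proof (rule sum_mono)
          fix i
          have "norm (abs_L2 (\<lambda>x. \<phi> n (x + y $ i *\<^sub>R axis i 1) - \<phi> n x)) \<le> C * sqrt (y $ i)" by (rule equi[OF y'(1)])
          also have "\<dots> \<le> C * s" unfolding h(2)[symmetric] by (intro mult_left_mono C0) (simp add: y')
          finally show "norm (abs_L2 (\<lambda>x. \<phi> n (x + y $ i *\<^sub>R axis i 1) - \<phi> n x)) \<le> C * s" .
        qed
        also have "\<dots> = \<delta>" by (simp add: \<delta>_def N_def)
        finally have d: "norm (abs_L2 (\<lambda>x. \<phi> n (x + y) - \<phi> n x)) \<le> \<delta>" .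
        have mi: "abs_L2 (\<lambda>x. \<phi> n (x + y) - \<phi> n x) = abs_L2 (\<lambda>x. \<phi> n (x + y)) - abs_L2 (\<phi> n)"
          by (rule minus_L2.abs_eq[symmetric]) (use sq sqy in auto)
        have "(LINT x|lborel. \<phi> n (x + y) * \<phi> n x) = abs_L2 (\<lambda>x. \<phi> n (x + y)) \<bullet> abs_L2 (\<phi> n)"
          unfolding inner_abs_L2[OF sqy sq] by (rule lebesgue_integral_borel[symmetric]) measurable
        also have "\<dots> = (norm (abs_L2 (\<phi> n)))\<^sup>2 + abs_L2 (\<lambda>x. \<phi> n (x + y) - \<phi> n x) \<bullet> abs_L2 (\<phi> n)"
          unfolding mi power2_norm_eq_inner by (simp add: inner_diff_left)
        finally have e: "(LINT x|lborel. \<phi> n (x + y) * \<phi> n x) = (norm (abs_L2 (\<phi> n)))\<^sup>2 + abs_L2 (\<lambda>x. \<phi> n (x + y) - \<phi> n x) \<bullet> abs_L2 (\<phi> n)" .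
        have "\<bar>abs_L2 (\<lambda>x. \<phi> n (x + y) - \<phi> n x) \<bullet> abs_L2 (\<phi> n)\<bar> \<le> norm (abs_L2 (\<lambda>x. \<phi> n (x + y) - \<phi> n x)) * norm (abs_L2 (\<phi> n))"
          by (rule Cauchy_Schwarz_ineq2)
        also have "\<dots> \<le> \<delta> * B" by (rule mult_mono[OF d bound]) (use order_trans[OF norm_ge_zero d] in auto)
        finally show ?thesis unfolding e by linarith
      qed
      have iQ: "integrable lborel (\<lambda>y. indicator Q y * c :: real)" for c
        using emeasure_bounded_finite[OF compact_imp_bounded[OF Q]] by (intro integrable_mult_left integrable_real_indicator) auto
      have "v * ((norm (abs_L2 (\<phi> n)))\<^sup>2 - \<delta> * B) = (LINT y|lborel. indicator Q y * ((norm (abs_L2 (\<phi> n)))\<^sup>2 - \<delta> * B))"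
        by (simp add: v_def)
      also have "\<dots> \<le> (LINT y|lborel. indicator Q y * (LINT x|lborel. \<phi> n (x + y) * \<phi> n x))"
        by (rule integral_mono[OF iQ inner_translation_integral(1)[OF cont K zero Q]])
          (use corr in \<open>auto simp: indicator_def\<close>)
      also have "\<dots> = (LINT x|lborel. \<phi> n x * G n x)"
        unfolding G_def by (rule inner_translation_integral(2)[OF cont K zero Q])
      also have "\<dots> = (LINT x|lborel. \<phi> n x * (indicator K x * G n x))"
        by (rule Bochner_Integration.integral_cong) (use zero[of _ n] in \<open>auto simp: indicator_def\<close>)
      also have "\<dots> = abs_L2 (\<phi> n) \<bullet> abs_L2 (\<lambda>x. indicator K x * G n x)"
        unfolding inner_abs_L2[OF sq sqG] by (rule lebesgue_integral_borel[symmetric]) measurable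
      also have "\<dots> \<le> norm (abs_L2 (\<phi> n)) * norm (abs_L2 (\<lambda>x. indicator K x * G n x))" by (rule norm_cauchy_schwarz)
      also have "\<dots> \<le> B * norm (abs_L2 (\<lambda>x. indicator K x * G n x))" by (rule mult_right_mono[OF bound]) simp
      finally show ?thesis .
    qed
    have "(\<lambda>n. sqrt ((norm (abs_L2 (\<lambda>x. indicator K x * G n x)))\<^sup>2)) \<longlonglongrightarrow> sqrt 0" by (intro tendsto_intros nG)
    then have "(\<lambda>n. B * norm (abs_L2 (\<lambda>x. indicator K x * G n x))) \<longlonglongrightarrow> 0"
      by (intro tendsto_mult_right_zero) simp
    from order_tendstoD(2)[OF this, of "v * (\<epsilon> / 2)"]
    have "\<forall>\<^sub>F n in sequentially. B * norm (abs_L2 (\<lambda>x. indicator K x * G n x)) < v * (\<epsilon> / 2)" using v \<epsilon> by simp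
    then show ?thesis
    proof eventually_elim
      case (elim n)
      then have "v * ((norm (abs_L2 (\<phi> n)))\<^sup>2 - \<delta> * B) < v * (\<epsilon> / 2)" using lower[of n] by linarith
      then have "(norm (abs_L2 (\<phi> n)))\<^sup>2 - \<delta> * B < \<epsilon> / 2" using v by simp
      then show ?case using \<delta> by linarith
    qed
  qed
  have "\<forall>\<^sub>F n in sequentially. norm (abs_L2 (\<phi> n)) < e" if "0 < e" for e
  proof -
    have "0 < e\<^sup>2" using that by simp
    then have "\<forall>\<^sub>F n in sequentially. (norm (abs_L2 (\<phi> n)))\<^sup>2 < e\<^sup>2" by (rule *)
    then show ?thesis by (rule eventually_mono) (use that in \<open>auto intro: power_less_imp_less_base\<close>)
  qed
  then show ?thesis by (auto simp: tendsto_iff dist_norm)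
qed

section \<open>Weak gradients\<close>

lemma closed_subset_compact:
  fixes K :: "'a::heine_borel set"
  shows "closed S \<Longrightarrow> S \<subseteq> K \<Longrightarrow> compact K \<Longrightarrow> compact S"
  by (metis compact_Int_closed inf.absorb2)

lemma test_function_C_k: "\<phi> \<in> test_functions \<Omega> \<Longrightarrow> C_k m \<phi>"
  by (simp add: test_functions_def)

lemma test_function_continuous: "\<phi> \<in> test_functions \<Omega> \<Longrightarrow> continuous_on UNIV \<phi>"
  using test_function_C_k[of \<phi> \<Omega> 0] by simp

lemma test_function_measurable: "\<phi> \<in> test_functions \<Omega> \<Longrightarrow> \<phi> \<in> borel_measurable borel"
  by (rule borel_measurable_continuous_onI[OF test_function_continuous])

lemma test_function_has_derivative:
  "\<phi> \<in> test_functions \<Omega> \<Longrightarrow> (\<phi> has_derivative frechet_derivative \<phi> (at x)) (at x)"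
  using C_k_differentiable[OF test_function_C_k[of \<phi> \<Omega> "Suc 0"]] .

lemma test_function_line_derivative:
  assumes "\<phi> \<in> test_functions \<Omega>"
  shows "((\<lambda>s. \<phi> (x + s *\<^sub>R axis i 1)) has_real_derivative partial_derivative i \<phi> (x + s *\<^sub>R axis i 1)) (at s)"
proof -
  have "((\<lambda>s. x + s *\<^sub>R axis i 1) has_derivative (\<lambda>s. s *\<^sub>R axis i 1)) (at s)"
    by (auto intro!: derivative_eq_intros)
  from has_derivative_compose[OF this test_function_has_derivative[OF assms]]
  have 1: "((\<lambda>s. \<phi> (x + s *\<^sub>R axis i 1)) has_derivative (\<lambda>t. frechet_derivative \<phi> (at (x + s *\<^sub>R axis i 1)) (t *\<^sub>R axis i 1))) (at s)" .
  have "frechet_derivative \<phi> (at y) (t *\<^sub>R axis i 1) = partial_derivative i \<phi> y * t" for y t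
    using linear_scale[OF has_derivative_linear[OF test_function_has_derivative[OF assms]]]
    by (simp add: partial_derivative_def)
  then have "(\<lambda>t. frechet_derivative \<phi> (at (x + s *\<^sub>R axis i 1)) (t *\<^sub>R axis i 1)) = (*) (partial_derivative i \<phi> (x + s *\<^sub>R axis i 1))"
    by auto
  then show ?thesis using 1 by (simp add: has_field_derivative_def)
qed

definition test_support :: "(real^'n::finite \<Rightarrow> real) \<Rightarrow> (real^'n) set" where
  "test_support \<phi> = closure {x. \<phi> x \<noteq> 0}"

lemma test_support:
  assumes "\<phi> \<in> test_functions \<Omega>"
  shows "compact (test_support \<phi>)" "test_support \<phi> \<subseteq> \<Omega>" "x \<notin> test_support \<phi> \<Longrightarrow> \<phi> x = 0"
  using assms closure_subset[of "{x. \<phi> x \<noteq> 0}"] by (auto simp: test_support_def test_functions_def)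

lemma partial_derivative_zero_outside:
  assumes "x \<notin> test_support \<phi>"
  shows "partial_derivative i \<phi> x = 0"
proof -
  have "((\<lambda>x. 0) has_derivative (\<lambda>h. 0)) (at x)" by simp
  then have "(\<phi> has_derivative (\<lambda>h. 0)) (at x)"
  proof (rule has_derivative_transform_within_open[where s="- test_support \<phi>"])
    show "open (- test_support \<phi>)" unfolding test_support_def by (rule open_Compl[OF closed_closure])
    show "0 = \<phi> y" if "y \<in> - test_support \<phi>" for y
      using that closure_subset[of "{x. \<phi> x \<noteq> 0}"] by (auto simp: test_support_def)
  qed (use assms in auto)
  then show ?thesis by (simp add: partial_derivativeI)
qed

lemma test_function_partial:
  assumes "\<phi> \<in> test_functions \<Omega>"
  shows "partial_derivative i \<phi> \<in> test_functions \<Omega>"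
proof -
  have "{x. partial_derivative i \<phi> x \<noteq> 0} \<subseteq> test_support \<phi>"
    using partial_derivative_zero_outside by blast
  then have sub: "closure {x. partial_derivative i \<phi> x \<noteq> 0} \<subseteq> test_support \<phi>"
    by (intro closure_minimal) (auto simp: test_support_def)
  moreover have "compact (closure {x. partial_derivative i \<phi> x \<noteq> 0})"
    by (rule closed_subset_compact[OF closed_closure sub test_support(1)[OF assms]])
  moreover have "C_k m (partial_derivative i \<phi>)" for m
    using test_function_C_k[OF assms, of "Suc m"] by simp
  ultimately show ?thesis using test_support(2)[OF assms] by (auto simp: test_functions_def)
qed

lemma test_function_zero_outside: "\<phi> \<in> test_functions \<Omega> \<Longrightarrow> x \<notin> \<Omega> \<Longrightarrow> \<phi> x = 0"
  using test_support(2,3) by blast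

lemma test_function_square_integrable: "\<phi> \<in> test_functions \<Omega> \<Longrightarrow> square_integrable \<phi>"
  by (rule compact_support_square_integrable[OF test_function_continuous test_support(1) test_support(3)])

lemma test_function_integrable: "\<phi> \<in> test_functions \<Omega> \<Longrightarrow> integrable lborel \<phi>"
  by (rule compact_support_integrable[OF test_function_continuous test_support(1) test_support(3)])

lemma test_function_bounded:
  assumes "\<phi> \<in> test_functions \<Omega>"
  obtains C where "0 < C" "\<And>x. \<bar>\<phi> x\<bar> \<le> C"
proof -
  have "compact (\<phi> ` test_support \<phi>)"
    using test_support(1)[OF assms] test_function_continuous[OF assms]
    by (intro compact_continuous_image) (auto intro: continuous_on_subset)
  then obtain C where C: "0 < C" "\<And>y. y \<in> \<phi> ` test_support \<phi> \<Longrightarrow> norm y \<le> C"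
    using compact_imp_bounded bounded_pos by metis
  have "\<bar>\<phi> x\<bar> \<le> C" for x
    using C(2)[of "\<phi> x"] C(1) test_support(3)[OF assms, of x] by (cases "x \<in> test_support \<phi>") auto
  then show thesis using that C(1) by blast
qed

lemma test_functionI_support:
  assumes "\<And>m. C_k m f" "{x. f x \<noteq> 0} \<subseteq> K" "compact K" "K \<subseteq> \<Omega>"
  shows "f \<in> test_functions \<Omega>"
proof -
  have "closure {x. f x \<noteq> 0} \<subseteq> K" using assms by (intro closure_minimal compact_imp_closed)
  moreover from closed_subset_compact[OF closed_closure this assms(3)]
  have "compact (closure {x. f x \<noteq> 0})" .
  ultimately show ?thesis using assms(1,4) unfolding test_functions_def by blast
qed

lemma test_function_add:
  assumes "\<phi> \<in> test_functions \<Omega>" "\<psi> \<in> test_functions \<Omega>"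
  shows "(\<lambda>x. \<phi> x + \<psi> x) \<in> test_functions \<Omega>"
proof (rule test_functionI_support)
  show "C_k m (\<lambda>x. \<phi> x + \<psi> x)" for m using assms by (intro C_k_add test_function_C_k)
  show "{x. \<phi> x + \<psi> x \<noteq> 0} \<subseteq> test_support \<phi> \<union> test_support \<psi>"
    using test_support(3)[OF assms(1)] test_support(3)[OF assms(2)] by fastforce
qed (use test_support(1,2)[OF assms(1)] test_support(1,2)[OF assms(2)] in auto)

lemma test_function_mult:
  assumes "\<phi> \<in> test_functions \<Omega>" "\<psi> \<in> test_functions \<Omega>"
  shows "(\<lambda>x. \<phi> x * \<psi> x) \<in> test_functions \<Omega>"
proof (rule test_functionI_support)
  show "C_k m (\<lambda>x. \<phi> x * \<psi> x)" for m using assms by (intro C_k_mult test_function_C_k)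
  show "{x. \<phi> x * \<psi> x \<noteq> 0} \<subseteq> test_support \<phi>"
    using test_support(3)[OF assms(1)] by fastforce
qed (use test_support(1,2)[OF assms(1)] in auto)

lemma test_function_scale:
  assumes "\<phi> \<in> test_functions \<Omega>"
  shows "(\<lambda>x. c * \<phi> x) \<in> test_functions \<Omega>"
proof (rule test_functionI_support)
  show "C_k m (\<lambda>x. c * \<phi> x)" for m using assms by (intro C_k_mult C_k_const test_function_C_k)
  show "{x. c * \<phi> x \<noteq> 0} \<subseteq> test_support \<phi>"
    using test_support(3)[OF assms(1)] by fastforce
qed (use test_support(1,2)[OF assms(1)] in auto)

lemma test_function_0: "(\<lambda>x. 0) \<in> test_functions \<Omega>"
  by (rule test_functionI_support[where K="{}"]) (auto intro: C_k_const)

lemma partial_derivative_add: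
  assumes "\<phi> \<in> test_functions \<Omega>" "\<psi> \<in> test_functions \<Omega>"
  shows "partial_derivative i (\<lambda>x. \<phi> x + \<psi> x) x = partial_derivative i \<phi> x + partial_derivative i \<psi> x"
  by (subst partial_derivativeI[OF has_derivative_add[OF assms[THEN test_function_has_derivative]]])
    (simp add: partial_derivative_def)

lemma partial_derivative_mult:
  assumes "\<phi> \<in> test_functions \<Omega>" "\<psi> \<in> test_functions \<Omega>"
  shows "partial_derivative i (\<lambda>x. \<phi> x * \<psi> x) x = \<phi> x * partial_derivative i \<psi> x + partial_derivative i \<phi> x * \<psi> x"
  by (subst partial_derivativeI[OF has_derivative_mult[OF assms[THEN test_function_has_derivative]]])
    (simp add: partial_derivative_def)

lemma partial_derivative_scale:
  assumes "\<phi> \<in> test_functions \<Omega>"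
  shows "partial_derivative i (\<lambda>x. c * \<phi> x) x = c * partial_derivative i \<phi> x"
  by (subst partial_derivativeI[OF has_derivative_mult_right[OF test_function_has_derivative[OF assms]]])
    (simp add: partial_derivative_def)

lemma partial_derivative_0: "partial_derivative i (\<lambda>x. 0) x = 0"
  by (simp add: partial_derivativeI[OF has_derivative_const])

text \<open>Difference quotients integrate to 0 by translation invariance and converge pointwise to
  the derivative; the mean value theorem dominates them by a constant on a compact set.\<close>

lemma integral_partial_derivative:
  assumes \<phi>: "\<phi> \<in> test_functions \<Omega>"
  shows "(LINT x|lborel. partial_derivative i \<phi> x) = 0"
proof -
  let ?e = "axis i 1 :: real^'a"
  let ?d = "partial_derivative i \<phi>"
  note d = test_function_partial[OF \<phi>, of i]
  have [measurable]: "\<phi> \<in> borel_measurable borel" "?d \<in> borel_measurable borel"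
    using \<phi> d by (auto intro: test_function_measurable)
  obtain C where C: "0 < C" "\<And>x. \<bar>?d x\<bar> \<le> C" using test_function_bounded[OF d] by blast
  \<comment> \<open>The support swept backwards along the axis: if a step of length at most 1 from
    \<open>x\<close> ends in the support, then \<open>x\<close> lies in this compact set. It carries
    all difference quotients with step at most 1.\<close>
  define K where "K = (\<lambda>(x, s). x - s *\<^sub>R ?e) ` (test_support \<phi> \<times> {0..1})"
  have K: "compact K"
    unfolding K_def using test_support(1)[OF \<phi>]
    by (intro compact_continuous_image compact_Times) (auto intro!: continuous_intros simp: case_prod_unfold)
  have KI: "x \<in> K" if "x + s *\<^sub>R ?e \<in> test_support \<phi>" "0 \<le> s" "s \<le> 1" for x s
    unfolding K_def using that by (intro image_eqI[of _ _ "(x + s *\<^sub>R ?e, s)"]) auto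
  define D where "D n x = (\<phi> (x + (1 / real (Suc n)) *\<^sub>R ?e) - \<phi> x) / (1 / real (Suc n))" for n x
  have D0: "(LINT x|lborel. D n x) = 0" for n
  proof -
    have "integrable lborel (\<lambda>x. \<phi> (x + (1 / real (Suc n)) *\<^sub>R ?e))"
      by (rule lborel_integrable_translation[OF test_function_integrable[OF \<phi>]])
    then have "(LINT x|lborel. D n x) = ((LINT x|lborel. \<phi> (x + (1 / real (Suc n)) *\<^sub>R ?e)) - (LINT x|lborel. \<phi> x)) / (1 / real (Suc n))"
      unfolding D_def using test_function_integrable[OF \<phi>] by simp
    also have "(LINT x|lborel. \<phi> (x + (1 / real (Suc n)) *\<^sub>R ?e)) = (LINT x|lborel. \<phi> x)"
      by (rule lborel_integral_translation) measurable
    finally show ?thesis by simp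
  qed
  have "(\<lambda>n. LINT x|lborel. D n x) \<longlonglongrightarrow> (LINT x|lborel. ?d x)"
  proof (rule integral_dominated_convergence[where w="\<lambda>x. indicator K x * C"])
    show "AE x in lborel. (\<lambda>n. D n x) \<longlonglongrightarrow> ?d x"
    proof (rule AE_I2)
      fix x
      have "((\<lambda>h. (\<phi> (x + (0 + h) *\<^sub>R ?e) - \<phi> (x + 0 *\<^sub>R ?e)) / h) \<longlongrightarrow> ?d (x + 0 *\<^sub>R ?e)) (at 0)"
        using test_function_line_derivative[OF \<phi>, of x i 0] unfolding DERIV_def .
      moreover have "filterlim (\<lambda>n. 1 / real (Suc n)) (at 0) sequentially"
        using LIMSEQ_inverse_real_of_nat by (auto simp: filterlim_at divide_inverse)
      ultimately have "((\<lambda>n. (\<phi> (x + (0 + 1 / real (Suc n)) *\<^sub>R ?e) - \<phi> (x + 0 *\<^sub>R ?e)) / (1 / real (Suc n))) \<longlongrightarrow> ?d (x + 0 *\<^sub>R ?e)) sequentially"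
        by (rule filterlim_compose)
      then show "(\<lambda>n. D n x) \<longlonglongrightarrow> ?d x" by (simp add: D_def)
    qed
    show "AE x in lborel. norm (D n x) \<le> indicator K x * C" for n
    proof (rule AE_I2)
      fix x
      let ?h = "1 / real (Suc n)"
      have h: "0 < ?h" "?h \<le> 1" by auto
      have "\<exists>z. 0 < z \<and> z < ?h \<and> \<phi> (x + ?h *\<^sub>R ?e) - \<phi> (x + 0 *\<^sub>R ?e) = (?h - 0) * ?d (x + z *\<^sub>R ?e)"
        by (rule MVT2) (use h test_function_line_derivative[OF \<phi>] in auto)
      then obtain z where z: "\<phi> (x + ?h *\<^sub>R ?e) - \<phi> x = ?h * ?d (x + z *\<^sub>R ?e)" by auto
      then have "D n x = ?d (x + z *\<^sub>R ?e)" unfolding D_def z using h(1) by simp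
      then have b: "norm (D n x) \<le> C" using C(2) by simp
      show "norm (D n x) \<le> indicator K x * C"
      proof (cases "x \<in> K")
        case False
        then have "x \<notin> test_support \<phi>" "x + ?h *\<^sub>R ?e \<notin> test_support \<phi>"
          using KI[of x 0] KI[of x ?h] h by auto
        then have "D n x = 0" using test_support(3)[OF \<phi>] by (simp add: D_def)
        then show ?thesis using False by simp
      qed (use b in simp)
    qed
    show "integrable lborel (\<lambda>x. indicator K x * C)"
      using K emeasure_bounded_finite[OF compact_imp_bounded[OF K]]
      by (intro integrable_mult_left integrable_real_indicator) (auto simp: borel_compact)
  qed (auto simp: D_def)
  then show ?thesis unfolding D0 by (simp add: LIMSEQ_const_iff)
qed

lemma test_function_integration_by_parts:
  assumes "\<phi> \<in> test_functions \<Omega>" "\<psi> \<in> test_functions \<Omega>"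
  shows "abs_L2 \<phi> \<bullet> abs_L2 (partial_derivative i \<psi>) = - (abs_L2 (partial_derivative i \<phi>) \<bullet> abs_L2 \<psi>)"
proof -
  note p = assms[THEN test_function_partial, of i]
  note sq = assms[THEN test_function_square_integrable] p[THEN test_function_square_integrable]
  note i1 = test_function_integrable[OF test_function_mult[OF assms(1) p(2)]]
  note i2 = test_function_integrable[OF test_function_mult[OF p(1) assms(2)]]
  note m [measurable] = assms[THEN test_function_measurable] p[THEN test_function_measurable]
  have "0 = (LINT x|lborel. partial_derivative i (\<lambda>x. \<phi> x * \<psi> x) x)"
    using integral_partial_derivative[OF test_function_mult[OF assms]] by simp
  also have "\<dots> = (LINT x|lborel. \<phi> x * partial_derivative i \<psi> x) + (LINT x|lborel. partial_derivative i \<phi> x * \<psi> x)"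
    unfolding partial_derivative_mult[OF assms] by (rule Bochner_Integration.integral_add[OF i1 i2])
  finally show ?thesis
    by (simp add: inner_abs_L2 sq lebesgue_integral_borel)
qed

lemma abs_L2_on:
  assumes "square_integrable f" "\<And>x. x \<notin> \<Omega> \<Longrightarrow> f x = 0"
  shows "abs_L2 f \<in> L2_on \<Omega>"
  unfolding L2_on_def using rep_L2_abs_L2[OF assms(1)] assms(2) by auto

lemma test_function_L2_on: "\<phi> \<in> test_functions \<Omega> \<Longrightarrow> abs_L2 \<phi> \<in> L2_on \<Omega>"
  by (intro abs_L2_on test_function_square_integrable test_function_zero_outside)

lemma integral_lebesgue_on_zero_outside:
  fixes f :: "'a::euclidean_space \<Rightarrow> real"
  assumes "open \<Omega>" "\<And>x. x \<notin> \<Omega> \<Longrightarrow> f x = 0"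
  shows "(LINT x|lebesgue_on \<Omega>. f x) = (LINT x|lebesgue. f x)"
proof -
  have "(LINT x|lebesgue_on \<Omega>. f x) = (LINT x|lebesgue. indicator \<Omega> x *\<^sub>R f x)"
    using assms(1) by (intro integral_restrict_space) auto
  also have "\<dots> = (LINT x|lebesgue. f x)"
    using assms(2) by (intro Bochner_Integration.integral_cong) (auto simp: indicator_def)
  finally show ?thesis .
qed

lemma test_times_locally_integrable:
  fixes f :: "real^'n::finite \<Rightarrow> 'b::{banach, second_countable_topology}"
  assumes \<Omega>: "open \<Omega>" and \<phi>: "\<phi> \<in> test_functions \<Omega>"
    and f: "\<And>K. compact K \<Longrightarrow> K \<subseteq> \<Omega> \<Longrightarrow> integrable (lebesgue_on K) f"
  shows "integrable (lebesgue_on \<Omega>) (\<lambda>x. \<phi> x *\<^sub>R f x)"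
proof -
  let ?K = "test_support \<phi>"
  have K: "?K \<in> sets lebesgue" using test_support(1)[OF \<phi>] by (simp add: borel_compact)
  have i: "integrable lebesgue (\<lambda>x. indicator ?K x *\<^sub>R f x)"
    using f[OF test_support(1,2)[OF \<phi>]] K by (simp add: integrable_restrict_space)
  obtain C where C: "0 < C" "\<And>x. \<bar>\<phi> x\<bar> \<le> C" using test_function_bounded[OF \<phi>] by blast
  have m: "\<phi> \<in> borel_measurable lebesgue" by (intro measurable_completion) (simp add: test_function_measurable[OF \<phi>])
  have "integrable lebesgue (\<lambda>x. \<phi> x *\<^sub>R (indicator ?K x *\<^sub>R f x))"
  proof (rule Bochner_Integration.integrable_bound)
    show "integrable lebesgue (\<lambda>x. C * norm (indicator ?K x *\<^sub>R f x))"
      by (intro integrable_mult_right integrable_norm i)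
    show "(\<lambda>x. \<phi> x *\<^sub>R (indicator ?K x *\<^sub>R f x)) \<in> borel_measurable lebesgue"
      by (rule borel_measurable_scaleR[OF m borel_measurable_integrable[OF i]])
    show "AE x in lebesgue. norm (\<phi> x *\<^sub>R (indicator ?K x *\<^sub>R f x)) \<le> norm (C * norm (indicator ?K x *\<^sub>R f x))"
    proof (rule AE_I2)
      fix x
      have "norm (\<phi> x *\<^sub>R z) \<le> norm (C * norm z)" for z :: 'b
        using mult_right_mono[OF C(2)[of x] norm_ge_zero[of z]] C(1) by simp
      then show "norm (\<phi> x *\<^sub>R (indicator ?K x *\<^sub>R f x)) \<le> norm (C * norm (indicator ?K x *\<^sub>R f x))" .
    qed
  qed
  moreover have "(\<lambda>x. \<phi> x *\<^sub>R (indicator ?K x *\<^sub>R f x)) = (\<lambda>x. indicator \<Omega> x *\<^sub>R (\<phi> x *\<^sub>R f x))"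
    using test_support(2,3)[OF \<phi>] by (intro ext) (auto simp: indicator_def)
  ultimately show ?thesis using \<Omega> by (simp add: integrable_restrict_space)
qed

text \<open>In components the defining identity has an \<open>L2\<close> inner product on the left,
  which is continuous in \<open>u\<close>, and a scalar integral on the right. Taking components out
  of the vector-valued integrals requires their integrability, which comes from the compact support
  of the test function.\<close>

lemma is_weak_gradient_iff:
  assumes \<Omega>: "open \<Omega>"
  shows "is_weak_gradient \<Omega> u g \<longleftrightarrow>
     g \<in> borel_measurable (lebesgue_on \<Omega>) \<and>
     (\<forall>K. compact K \<and> K \<subseteq> \<Omega> \<longrightarrow> integrable (lebesgue_on K) g) \<and>
     (\<forall>\<phi> \<in> test_functions \<Omega>. \<forall>i.
        u \<bullet> abs_L2 (partial_derivative i \<phi>) = - (LINT x|lebesgue. \<phi> x * g x $ i))"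
proof -
  have "(LINT x|lebesgue_on \<Omega>. rep_L2 u x *\<^sub>R gradient \<phi> x) = - (LINT x|lebesgue_on \<Omega>. \<phi> x *\<^sub>R g x)
     \<longleftrightarrow> (\<forall>i. u \<bullet> abs_L2 (partial_derivative i \<phi>) = - (LINT x|lebesgue. \<phi> x * g x $ i))"
    if g: "\<And>K. compact K \<Longrightarrow> K \<subseteq> \<Omega> \<Longrightarrow> integrable (lebesgue_on K) g" and \<phi>: "\<phi> \<in> test_functions \<Omega>" for \<phi>
  proof -
    have p: "partial_derivative i \<phi> \<in> test_functions \<Omega>" for i by (rule test_function_partial[OF \<phi>])
    have iu: "integrable lebesgue (\<lambda>x. rep_L2 u x * partial_derivative i \<phi> x)" for i
      by (rule square_integrable_mult[OF square_integrable_rep_L2 test_function_square_integrable[OF p]])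
    have eq: "(\<lambda>x. rep_L2 u x *\<^sub>R gradient \<phi> x) = (\<lambda>x. \<Sum>i\<in>UNIV. (rep_L2 u x * partial_derivative i \<phi> x) *\<^sub>R axis i 1)"
      by (auto simp: vec_eq_iff gradient_def axis_def if_distrib cong: if_cong)
    have "integrable lebesgue (\<lambda>x. rep_L2 u x *\<^sub>R gradient \<phi> x)"
      unfolding eq by (intro Bochner_Integration.integrable_sum integrable_scaleR_left iu)
    then have I1: "integrable (lebesgue_on \<Omega>) (\<lambda>x. rep_L2 u x *\<^sub>R gradient \<phi> x)"
      using \<Omega> by (subst integrable_restrict_space) (simp, intro integrable_mult_indicator, auto)
    have I2: "integrable (lebesgue_on \<Omega>) (\<lambda>x. \<phi> x *\<^sub>R g x)"
      by (rule test_times_locally_integrable[OF \<Omega> \<phi> g])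
    have 1: "(LINT x|lebesgue_on \<Omega>. rep_L2 u x *\<^sub>R gradient \<phi> x) $ i = u \<bullet> abs_L2 (partial_derivative i \<phi>)" for i
    proof -
      have "(LINT x|lebesgue_on \<Omega>. rep_L2 u x *\<^sub>R gradient \<phi> x) $ i = (LINT x|lebesgue_on \<Omega>. (rep_L2 u x *\<^sub>R gradient \<phi> x) $ i)"
        by (rule integral_bounded_linear[OF bounded_linear_vec_nth I1, symmetric])
      also have "\<dots> = (LINT x|lebesgue_on \<Omega>. rep_L2 u x * partial_derivative i \<phi> x)" by (simp add: gradient_def)
      also have "\<dots> = (LINT x|lebesgue. rep_L2 u x * partial_derivative i \<phi> x)"
        by (rule integral_lebesgue_on_zero_outside[OF \<Omega>]) (simp add: test_function_zero_outside[OF p])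
      also have "\<dots> = u \<bullet> abs_L2 (partial_derivative i \<phi>)"
        by (rule inner_rep_abs_L2[OF test_function_square_integrable[OF p], symmetric])
      finally show ?thesis .
    qed
    have 2: "(LINT x|lebesgue_on \<Omega>. \<phi> x *\<^sub>R g x) $ i = (LINT x|lebesgue. \<phi> x * g x $ i)" for i
    proof -
      have "(LINT x|lebesgue_on \<Omega>. \<phi> x *\<^sub>R g x) $ i = (LINT x|lebesgue_on \<Omega>. (\<phi> x *\<^sub>R g x) $ i)"
        by (rule integral_bounded_linear[OF bounded_linear_vec_nth I2, symmetric])
      also have "\<dots> = (LINT x|lebesgue_on \<Omega>. \<phi> x * g x $ i)" by simp
      also have "\<dots> = (LINT x|lebesgue. \<phi> x * g x $ i)"
        by (rule integral_lebesgue_on_zero_outside[OF \<Omega>]) (simp add: test_function_zero_outside[OF \<phi>])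
      finally show ?thesis .
    qed
    show ?thesis unfolding vec_eq_iff by (simp add: 1 2)
  qed
  then show ?thesis unfolding is_weak_gradient_def by auto
qed

lemma is_weak_gradient_diff:
  assumes \<Omega>: "open \<Omega>" and g: "is_weak_gradient \<Omega> u g" and h: "is_weak_gradient \<Omega> v h"
  shows "is_weak_gradient \<Omega> (u - v) (\<lambda>x. g x - h x)"
  unfolding is_weak_gradient_iff[OF \<Omega>]
proof (intro conjI allI impI ballI)
  show "(\<lambda>x. g x - h x) \<in> borel_measurable (lebesgue_on \<Omega>)"
    using g h by (auto simp: is_weak_gradient_def intro: borel_measurable_diff)
  show "integrable (lebesgue_on K) (\<lambda>x. g x - h x)" if "compact K \<and> K \<subseteq> \<Omega>" for K
    using g h that by (auto simp: is_weak_gradient_def)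
  fix \<phi> i assume \<phi>: "\<phi> \<in> test_functions \<Omega>"
  have i: "integrable lebesgue (\<lambda>x. \<phi> x * g x $ i)" if "is_weak_gradient \<Omega> u g" for u g
  proof -
    have "integrable (lebesgue_on \<Omega>) (\<lambda>x. \<phi> x *\<^sub>R g x)"
      using that by (intro test_times_locally_integrable[OF \<Omega> \<phi>]) (auto simp: is_weak_gradient_def)
    from integrable_bounded_linear[OF bounded_linear_vec_nth[of i] this]
    have "integrable lebesgue (\<lambda>x. indicator \<Omega> x * (\<phi> x * g x $ i))"
      using \<Omega> by (subst (asm) integrable_restrict_space) auto
    moreover have "(\<lambda>x. indicator \<Omega> x * (\<phi> x * g x $ i)) = (\<lambda>x. \<phi> x * g x $ i)"
      using test_function_zero_outside[OF \<phi>] by (intro ext) (auto simp: indicator_def)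
    ultimately show ?thesis by simp
  qed
  have "(u - v) \<bullet> abs_L2 (partial_derivative i \<phi>) = - ((LINT x|lebesgue. \<phi> x * g x $ i) - (LINT x|lebesgue. \<phi> x * h x $ i))"
    using g h \<phi> unfolding is_weak_gradient_iff[OF \<Omega>] by (simp add: inner_diff_left)
  also have "(LINT x|lebesgue. \<phi> x * g x $ i) - (LINT x|lebesgue. \<phi> x * h x $ i) = (LINT x|lebesgue. \<phi> x * (g x - h x) $ i)"
    by (subst Bochner_Integration.integral_diff[symmetric, OF i[OF g] i[OF h]]) (simp add: right_diff_distrib)
  finally show "(u - v) \<bullet> abs_L2 (partial_derivative i \<phi>) = - (LINT x|lebesgue. \<phi> x * (g x - h x) $ i)" .
qed

text \<open>The difference is a weak gradient of \<open>u - u\<close>, so the fundamental lemma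
  applies to each of its components.\<close>

lemma is_weak_gradient_unique:
  assumes \<Omega>: "open \<Omega>" and g: "is_weak_gradient \<Omega> u g" and h: "is_weak_gradient \<Omega> u h"
  shows "AE x in lebesgue. x \<in> \<Omega> \<longrightarrow> g x = h x"
proof -
  note d = is_weak_gradient_diff[OF \<Omega> g h]
  have "AE x in lebesgue. x \<in> \<Omega> \<longrightarrow> (g x - h x) $ i = 0" for i
  proof (rule fundamental_lemma[OF \<Omega>])
    show "integrable (lebesgue_on K) (\<lambda>x. (g x - h x) $ i)" if "compact K" "K \<subseteq> \<Omega>" for K
      using d that unfolding is_weak_gradient_def
      by (intro integrable_bounded_linear[OF bounded_linear_vec_nth]) auto
    fix \<phi> assume \<phi>: "\<phi> \<in> test_functions \<Omega>"
    have "(LINT x|lebesgue_on \<Omega>. \<phi> x * (g x - h x) $ i) = (LINT x|lebesgue. \<phi> x * (g x - h x) $ i)"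
      by (rule integral_lebesgue_on_zero_outside[OF \<Omega>]) (simp add: test_function_zero_outside[OF \<phi>])
    also have "\<dots> = - ((u - u) \<bullet> abs_L2 (partial_derivative i \<phi>))"
      using d \<phi> unfolding is_weak_gradient_iff[OF \<Omega>] by simp
    finally show "(LINT x|lebesgue_on \<Omega>. \<phi> x * (g x - h x) $ i) = 0" by simp
  qed
  then have "AE x in lebesgue. \<forall>i\<in>UNIV. x \<in> \<Omega> \<longrightarrow> (g x - h x) $ i = 0"
    by (intro AE_finite_allI) auto
  then show ?thesis by eventually_elim (auto simp: vec_eq_iff)
qed

text \<open>Density of the test functions, stated through orthogonality as the assumption
  \<open>E_dense\<close> of the abstract wave equation asks for it. It is the fundamental lemma
  applied to \<open>f\<close>.\<close>

lemma L2_on_orthogonal_test_functions: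
  assumes \<Omega>: "open \<Omega>" and f: "f \<in> L2_on \<Omega>" and orth: "\<And>\<phi>. \<phi> \<in> test_functions \<Omega> \<Longrightarrow> f \<bullet> abs_L2 \<phi> = 0"
  shows "f = 0"
proof -
  have "AE x in lebesgue. x \<in> \<Omega> \<longrightarrow> rep_L2 f x = 0"
  proof (rule fundamental_lemma[OF \<Omega>])
    fix K assume K: "compact K" "K \<subseteq> \<Omega>"
    have Km: "K \<in> sets borel" using K by (simp add: borel_compact)
    have "square_integrable (indicator K :: _ \<Rightarrow> real)"
      using K Km by (intro square_integrable_indicator emeasure_bounded_finite compact_imp_bounded) auto
    from square_integrable_mult[OF this square_integrable_rep_L2[of f]]
    show "integrable (lebesgue_on K) (rep_L2 f)"
      using Km by (subst integrable_restrict_space) auto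
  next
    fix \<phi> assume \<phi>: "\<phi> \<in> test_functions \<Omega>"
    have "(LINT x|lebesgue_on \<Omega>. \<phi> x * rep_L2 f x) = (LINT x|lebesgue. \<phi> x * rep_L2 f x)"
      by (rule integral_lebesgue_on_zero_outside[OF \<Omega>]) (simp add: test_function_zero_outside[OF \<phi>])
    also have "\<dots> = f \<bullet> abs_L2 \<phi>"
      by (subst inner_rep_abs_L2[OF test_function_square_integrable[OF \<phi>]]) (simp add: mult.commute)
    finally show "(LINT x|lebesgue_on \<Omega>. \<phi> x * rep_L2 f x) = 0" using orth[OF \<phi>] by simp
  qed
  then have "AE x in lebesgue. x \<in> \<Omega> \<longrightarrow> rep_L2 f x = rep_L2 0 x"
    using rep_L2_zero by eventually_elim auto
  then show ?thesis by (rule L2_on_eqI[OF f subspace_0[OF subspace_L2_on]])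
qed

text \<open>The bound is put on the product, so the multiplier may blow up where \<open>f\<close>
  vanishes, as the reciprocal weight does away from the support of a test function.\<close>

lemma square_integrable_bounded_mult:
  assumes f: "square_integrable f" and m: "m \<in> borel_measurable lebesgue" and C: "\<And>x. \<bar>m x * f x\<bar> \<le> C * \<bar>f x\<bar>"
  shows "square_integrable (\<lambda>x. m x * f x)"
  unfolding square_integrable_def
proof
  show mm: "(\<lambda>x. m x * f x) \<in> borel_measurable lebesgue"
    using f m by (intro borel_measurable_times) (auto simp: square_integrable_def)
  show "integrable lebesgue (\<lambda>x. (m x * f x)\<^sup>2)"
  proof (rule Bochner_Integration.integrable_bound)
    show "integrable lebesgue (\<lambda>x. C\<^sup>2 * (f x)\<^sup>2)"
      using f by (intro integrable_mult_right) (auto simp: square_integrable_def)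
    show "(\<lambda>x. (m x * f x)\<^sup>2) \<in> borel_measurable lebesgue" using mm by (rule borel_measurable_power)
    have "(m x * f x)\<^sup>2 \<le> C\<^sup>2 * (f x)\<^sup>2" for x
      using power_mono[OF C[of x], of 2] by (simp add: power_mult_distrib)
    then show "AE x in lebesgue. norm ((m x * f x)\<^sup>2) \<le> norm (C\<^sup>2 * (f x)\<^sup>2)" by (intro AE_I2) simp
  qed
qed

section \<open>The weighted Sobolev space\<close>

locale weighted_domain =
  fixes k :: "'n::finite" and \<alpha> :: real and \<Omega> :: "(real^'n) set"
  assumes open_\<Omega>: "open \<Omega>" and bounded_\<Omega>: "bounded \<Omega>"
    and pos: "x \<in> \<Omega> \<Longrightarrow> 0 < x $ k" and \<alpha>: "0 < \<alpha>" "\<alpha> < 1"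
begin

lemma \<Omega>_measurable [measurable]: "\<Omega> \<in> sets borel" "\<Omega> \<in> sets lebesgue"
  using open_\<Omega> by auto

lemma coordinate_bound:
  obtains B where "0 < B" "\<And>x i. x \<in> \<Omega> \<Longrightarrow> \<bar>x $ i\<bar> \<le> B"
proof -
  obtain B where B: "0 < B" "\<And>x. x \<in> \<Omega> \<Longrightarrow> norm x \<le> B" using bounded_\<Omega> bounded_pos by blast
  then show thesis using that component_le_norm_cart order_trans by blast
qed

text \<open>The diagonal entries of the square root of \<open>weight_matrix\<close>; multiplying the
  partial derivatives by them turns the energy form into a plain \<open>L2\<close> inner
  product.\<close>

definition swt :: "'n \<Rightarrow> real^'n \<Rightarrow> real" where
  "swt i x = (if i = k then sqrt ((x $ k) powr \<alpha>) else 1)"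

lemma swt_measurable [measurable]: "swt i \<in> borel_measurable borel"
proof -
  have "(\<lambda>x :: real^'n. sqrt ((x $ k) powr \<alpha>)) \<in> borel_measurable borel" by measurable
  then show ?thesis unfolding swt_def by (cases "i = k") auto
qed

lemma swt_lebesgue_measurable: "swt i \<in> borel_measurable lebesgue"
  by (intro measurable_completion) simp

lemma swt_pos: "x \<in> \<Omega> \<Longrightarrow> 0 < swt i x"
  using pos[of x] by (auto simp: swt_def)

lemma swt_nonneg: "0 \<le> swt i x"
  by (auto simp: swt_def)

lemma swt_upper: obtains C where "0 < C" "\<And>x i. x \<in> \<Omega> \<Longrightarrow> swt i x \<le> C"
proof -
  obtain B where B: "0 < B" "\<And>x i. x \<in> \<Omega> \<Longrightarrow> \<bar>x $ i\<bar> \<le> B" using coordinate_bound by blast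
  have "swt i x \<le> 1 + sqrt (B powr \<alpha>)" if "x \<in> \<Omega>" for x i
  proof -
    have "(x $ k) powr \<alpha> \<le> B powr \<alpha>" using B(2)[OF that, of k] pos[OF that] \<alpha> by (intro powr_mono2) auto
    then have "sqrt ((x $ k) powr \<alpha>) \<le> sqrt (B powr \<alpha>)" by simp
    moreover have "0 \<le> sqrt (B powr \<alpha>)" by simp
    ultimately show ?thesis unfolding swt_def by (auto simp del: real_sqrt_le_iff)
  qed
  moreover have "0 < 1 + sqrt (B powr \<alpha>)" by (intro add_pos_nonneg) auto
  ultimately show thesis using that by blast
qed

text \<open>The coordinate \<open>x $ k\<close> attains a positive minimum on a compact subset of
  \<Omega>, so the weight degenerates only towards the boundary.\<close>

lemma swt_lower:
  assumes "compact K" "K \<subseteq> \<Omega>"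
  obtains c where "0 < c" "\<And>x i. x \<in> K \<Longrightarrow> c \<le> swt i x"
proof (cases "K = {}")
  case True
  then show thesis using that[of 1] by simp
next
  case False
  have "continuous_on K (\<lambda>x. x $ k)" by (intro continuous_intros)
  then obtain x0 where x0: "x0 \<in> K" "\<And>x. x \<in> K \<Longrightarrow> x0 $ k \<le> x $ k"
    using continuous_attains_inf[OF assms(1) False] by blast
  then have p: "0 < x0 $ k" using pos assms(2) by auto
  have "min 1 (sqrt ((x0 $ k) powr \<alpha>)) \<le> swt i x" if "x \<in> K" for x i
  proof -
    have "(x0 $ k) powr \<alpha> \<le> (x $ k) powr \<alpha>" using x0(2)[OF that] p \<alpha> by (intro powr_mono2) auto
    then show ?thesis unfolding swt_def by (auto simp: min_def)
  qed
  moreover have "0 < min 1 (sqrt ((x0 $ k) powr \<alpha>))" using p by simp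
  ultimately show thesis using that by blast
qed

lemma weight_matrix_inner:
  "g \<bullet> (weight_matrix k \<alpha> x *v h) = (\<Sum>i\<in>UNIV. (swt i x * g $ i) * (swt i x * h $ i))"
proof -
  have "(weight_matrix k \<alpha> x *v h) $ i = (swt i x)\<^sup>2 * h $ i" for i
    unfolding weight_matrix_def matrix_vector_mult_def swt_def
    by (simp add: if_distrib[of "\<lambda>a. a * _"] cong: if_cong)
  then show ?thesis by (simp add: inner_vec_def power2_eq_square mult_ac)
qed

lemma test_gradient_square_integrable:
  assumes "\<phi> \<in> test_functions \<Omega>"
  shows "square_integrable (\<lambda>x. swt i x * partial_derivative i \<phi> x)"
proof -
  obtain C where C: "0 < C" "\<And>x i. x \<in> \<Omega> \<Longrightarrow> swt i x \<le> C" using swt_upper by blast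
  note p = test_function_partial[OF assms, of i]
  show ?thesis
  proof (rule square_integrable_bounded_mult[OF test_function_square_integrable[OF p] swt_lebesgue_measurable])
    fix x
    show "\<bar>swt i x * partial_derivative i \<phi> x\<bar> \<le> C * \<bar>partial_derivative i \<phi> x\<bar>"
      using C(2)[of x i] swt_nonneg[of i x] test_function_zero_outside[OF p, of x]
      by (cases "x \<in> \<Omega>") (auto simp: abs_mult intro: mult_right_mono)
  qed
qed

definition tgrad :: "(real^'n \<Rightarrow> real) \<Rightarrow> (real^'n) L2 ^ 'n" where
  "tgrad \<phi> = (\<chi> i. abs_L2 (\<lambda>x. swt i x * partial_derivative i \<phi> x))"

definition test_graph :: "((real^'n) L2 \<times> ((real^'n) L2 ^ 'n)) set" where
  "test_graph = (\<lambda>\<phi>. (abs_L2 \<phi>, tgrad \<phi>)) ` test_functions \<Omega>"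

text \<open>The graph of the weighted gradient on \<open>H10w\<close>, obtained as the closure of
  the graph over test functions. Taking the closure in the product space makes completeness
  immediate; that it is the graph of a function with genuine weak gradients is shown
  afterwards.\<close>

definition Z :: "((real^'n) L2 \<times> ((real^'n) L2 ^ 'n)) set" where
  "Z = closure test_graph"

lemma tgrad_add:
  assumes "\<phi> \<in> test_functions \<Omega>" "\<psi> \<in> test_functions \<Omega>"
  shows "tgrad (\<lambda>x. \<phi> x + \<psi> x) = tgrad \<phi> + tgrad \<psi>"
  unfolding vec_eq_iff tgrad_def
  by (auto simp: partial_derivative_add[OF assms] distrib_left plus_L2.abs_eq test_gradient_square_integrable assms)

lemma tgrad_scale:
  assumes "\<phi> \<in> test_functions \<Omega>"
  shows "tgrad (\<lambda>x. c * \<phi> x) = c *\<^sub>R tgrad \<phi>"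
  unfolding vec_eq_iff tgrad_def
  by (auto simp: partial_derivative_scale[OF assms] mult.left_commute scaleR_L2.abs_eq test_gradient_square_integrable assms)

lemma subspace_test_graph: "subspace test_graph"
proof (rule subspaceI)
  have "tgrad (\<lambda>x. 0) = 0"
    unfolding vec_eq_iff tgrad_def by (simp add: partial_derivative_0 zero_L2_def)
  then show "0 \<in> test_graph"
    unfolding test_graph_def by (intro image_eqI[OF _ test_function_0]) (simp add: zero_prod_def zero_L2_def)
next
  fix x y assume "x \<in> test_graph" "y \<in> test_graph"
  then obtain \<phi> \<psi> where *: "\<phi> \<in> test_functions \<Omega>" "x = (abs_L2 \<phi>, tgrad \<phi>)"
    "\<psi> \<in> test_functions \<Omega>" "y = (abs_L2 \<psi>, tgrad \<psi>)" by (auto simp: test_graph_def)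
  then show "x + y \<in> test_graph"
    unfolding test_graph_def
    by (intro image_eqI[OF _ test_function_add[OF *(1,3)]])
      (simp add: tgrad_add plus_L2.abs_eq test_function_square_integrable)
next
  fix c x assume "x \<in> test_graph"
  then obtain \<phi> where *: "\<phi> \<in> test_functions \<Omega>" "x = (abs_L2 \<phi>, tgrad \<phi>)" by (auto simp: test_graph_def)
  then show "c *\<^sub>R x \<in> test_graph"
    unfolding test_graph_def
    by (intro image_eqI[OF _ test_function_scale[OF *(1), of c]])
      (simp add: tgrad_scale scaleR_L2.abs_eq test_function_square_integrable)
qed

lemma subspace_Z: "subspace Z" and closed_Z: "closed Z"
  unfolding Z_def by (simp_all add: subspace_closure subspace_test_graph)

lemma test_in_Z: "\<phi> \<in> test_functions \<Omega> \<Longrightarrow> (abs_L2 \<phi>, tgrad \<phi>) \<in> Z"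
  unfolding Z_def by (rule subsetD[OF closure_subset]) (simp add: test_graph_def)

lemma Z_sequence:
  assumes "(u, g) \<in> Z"
  obtains \<phi> where "\<And>n. \<phi> n \<in> test_functions \<Omega>" "(\<lambda>n. abs_L2 (\<phi> n)) \<longlonglongrightarrow> u" "(\<lambda>n. tgrad (\<phi> n)) \<longlonglongrightarrow> g"
proof -
  obtain p where p: "\<And>n. p n \<in> test_graph" "p \<longlonglongrightarrow> (u, g)"
    using assms unfolding Z_def closure_sequential by blast
  then have "\<forall>n. \<exists>\<phi>. \<phi> \<in> test_functions \<Omega> \<and> p n = (abs_L2 \<phi>, tgrad \<phi>)" unfolding test_graph_def by blast
  then obtain \<phi> where \<phi>: "\<And>n. \<phi> n \<in> test_functions \<Omega>" "\<And>n. p n = (abs_L2 (\<phi> n), tgrad (\<phi> n))" by metis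
  show thesis
    using that[OF \<phi>(1)] tendsto_fst[OF p(2)] tendsto_snd[OF p(2)] by (simp add: \<phi>(2))
qed

lemma L2_on_closed: "closed (L2_on \<Omega>)"
  by (rule closed_L2_on) simp

lemma Z_L2_on:
  assumes "(u, g) \<in> Z"
  shows "u \<in> L2_on \<Omega>" "g $ i \<in> L2_on \<Omega>"
proof -
  obtain \<phi> where \<phi>: "\<And>n. \<phi> n \<in> test_functions \<Omega>" "(\<lambda>n. abs_L2 (\<phi> n)) \<longlonglongrightarrow> u" "(\<lambda>n. tgrad (\<phi> n)) \<longlonglongrightarrow> g"
    using Z_sequence[OF assms] by blast
  show "u \<in> L2_on \<Omega>" using closed_sequentially[OF L2_on_closed _ \<phi>(2)] test_function_L2_on[OF \<phi>(1)] by blast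
  have lim: "(\<lambda>n. tgrad (\<phi> n) $ i) \<longlonglongrightarrow> g $ i" by (rule tendsto_vec_nth[OF \<phi>(3)])
  have mem: "tgrad (\<phi> n) $ i \<in> L2_on \<Omega>" for n
    unfolding tgrad_def
    using test_function_zero_outside[OF test_function_partial[OF \<phi>(1)]]
    by (simp add: abs_L2_on test_gradient_square_integrable[OF \<phi>(1)])
  show "g $ i \<in> L2_on \<Omega>" by (rule closed_sequentially[OF L2_on_closed mem lim])
qed

text \<open>The test function divided by the weight: pairing a weighted gradient component with it
  undoes the weight. It is square integrable because the weight is bounded below on the support of
  the test function.\<close>

definition qt :: "'n \<Rightarrow> (real^'n \<Rightarrow> real) \<Rightarrow> real^'n \<Rightarrow> real" where
  "qt i \<psi> x = (if x \<in> \<Omega> then 1 / swt i x else 0) * \<psi> x"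

lemma qt_measurable: "(\<lambda>x. if x \<in> \<Omega> then 1 / swt i x else 0) \<in> borel_measurable borel"
  by (intro measurable_If) (measurable)

lemma qt_square_integrable:
  assumes \<psi>: "\<psi> \<in> test_functions \<Omega>"
  shows "square_integrable (qt i \<psi>)"
proof -
  obtain c where c: "0 < c" "\<And>x i. x \<in> test_support \<psi> \<Longrightarrow> c \<le> swt i x"
    using swt_lower[OF test_support(1,2)[OF \<psi>]] by blast
  have "square_integrable (\<lambda>x. (if x \<in> \<Omega> then 1 / swt i x else 0) * \<psi> x)"
  proof (rule square_integrable_bounded_mult[OF test_function_square_integrable[OF \<psi>]])
    show "(\<lambda>x. if x \<in> \<Omega> then 1 / swt i x else 0) \<in> borel_measurable lebesgue"
      by (intro measurable_completion) (simp add: qt_measurable)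
    fix x
    show "\<bar>(if x \<in> \<Omega> then 1 / swt i x else 0) * \<psi> x\<bar> \<le> (1 / c) * \<bar>\<psi> x\<bar>"
    proof (cases "x \<in> test_support \<psi>")
      case True
      then have "1 / swt i x \<le> 1 / c" using c by (intro divide_left_mono) (auto intro: mult_pos_pos less_le_trans)
      from mult_right_mono[OF this, of "\<bar>\<psi> x\<bar>"]
      show ?thesis using swt_nonneg[of i x] test_support(2)[OF \<psi>] True by (auto simp: abs_mult)
    next
      case False
      then show ?thesis using test_support(3)[OF \<psi>] c(1) by simp
    qed
  qed
  then show ?thesis by (simp add: qt_def[abs_def])
qed

text \<open>Integration by parts for two test functions, with the weight moved to \<psi>, is
  continuous in the pair \<open>(u, g)\<close> and passes to the closure.\<close>

lemma Z_weak_identity: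
  assumes Z: "(u, g) \<in> Z" and \<psi>: "\<psi> \<in> test_functions \<Omega>"
  shows "u \<bullet> abs_L2 (partial_derivative i \<psi>) = - (g $ i \<bullet> abs_L2 (qt i \<psi>))"
proof -
  obtain \<phi> where \<phi>: "\<And>n. \<phi> n \<in> test_functions \<Omega>" "(\<lambda>n. abs_L2 (\<phi> n)) \<longlonglongrightarrow> u" "(\<lambda>n. tgrad (\<phi> n)) \<longlonglongrightarrow> g"
    using Z_sequence[OF Z] by blast
  have eq: "abs_L2 (\<phi> n) \<bullet> abs_L2 (partial_derivative i \<psi>) = - (tgrad (\<phi> n) $ i \<bullet> abs_L2 (qt i \<psi>))" for n
  proof -
    note p = test_function_partial[OF \<phi>(1)[of n], of i]
    have "abs_L2 (partial_derivative i (\<phi> n)) \<bullet> abs_L2 \<psi> = (LINT x|lebesgue. partial_derivative i (\<phi> n) x * \<psi> x)"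
      by (rule inner_abs_L2[OF test_function_square_integrable[OF p] test_function_square_integrable[OF \<psi>]])
    also have "\<dots> = (LINT x|lebesgue. (swt i x * partial_derivative i (\<phi> n) x) * qt i \<psi> x)"
    proof (rule Bochner_Integration.integral_cong[OF refl])
      fix x
      show "partial_derivative i (\<phi> n) x * \<psi> x = (swt i x * partial_derivative i (\<phi> n) x) * qt i \<psi> x"
        using swt_pos[of x i] test_function_zero_outside[OF \<psi>, of x] by (cases "x \<in> \<Omega>") (auto simp: qt_def)
    qed
    also have "\<dots> = tgrad (\<phi> n) $ i \<bullet> abs_L2 (qt i \<psi>)"
      unfolding tgrad_def using inner_abs_L2[OF test_gradient_square_integrable[OF \<phi>(1)] qt_square_integrable[OF \<psi>]] by simp
    finally show ?thesis using test_function_integration_by_parts[OF \<phi>(1)[of n] \<psi>, of i] by simp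
  qed
  have "(\<lambda>n. abs_L2 (\<phi> n) \<bullet> abs_L2 (partial_derivative i \<psi>)) \<longlonglongrightarrow> u \<bullet> abs_L2 (partial_derivative i \<psi>)"
    by (intro tendsto_intros \<phi>)
  moreover have "(\<lambda>n. - (tgrad (\<phi> n) $ i \<bullet> abs_L2 (qt i \<psi>))) \<longlonglongrightarrow> - (g $ i \<bullet> abs_L2 (qt i \<psi>))"
    by (intro tendsto_intros \<phi>)
  ultimately show ?thesis unfolding eq using LIMSEQ_unique by blast
qed

definition recover :: "(real^'n) L2 ^ 'n \<Rightarrow> real^'n \<Rightarrow> real^'n" where
  "recover g x = (\<chi> i. (if x \<in> \<Omega> then 1 / swt i x else 0) * rep_L2 (g $ i) x)"

lemma vec_eq_sum_axis: "(x :: real^'n) = (\<Sum>i\<in>UNIV. (x $ i) *\<^sub>R axis i 1)"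
  by (simp add: vec_eq_iff axis_def if_distrib cong: if_cong)

text \<open>Dividing the weight out of \<open>g\<close> leaves a locally integrable field, because
  the weight is bounded below on compact subsets. The defining identity is
  \<open>Z_weak_identity\<close>.\<close>

lemma recover_weak_gradient:
  assumes Z: "(u, g) \<in> Z"
  shows "is_weak_gradient \<Omega> u (recover g)"
  unfolding is_weak_gradient_iff[OF open_\<Omega>]
proof (intro conjI allI impI ballI)
  have m: "(\<lambda>x. if x \<in> \<Omega> then 1 / swt i x else 0) \<in> borel_measurable lebesgue" for i
    by (intro measurable_completion) (simp add: qt_measurable)
  have eq: "recover g = (\<lambda>x. \<Sum>i\<in>UNIV. (recover g x $ i) *\<^sub>R axis i 1)"
    by (rule ext) (rule vec_eq_sum_axis)
  have c: "recover g x $ i = (if x \<in> \<Omega> then 1 / swt i x else 0) * rep_L2 (g $ i) x" for x i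
    by (simp add: recover_def)
  have cm: "(\<lambda>x. recover g x $ i) \<in> borel_measurable lebesgue" for i
    unfolding c by (intro borel_measurable_times m) simp
  have "recover g \<in> borel_measurable lebesgue"
    by (subst eq) (intro borel_measurable_sum borel_measurable_scaleR cm borel_measurable_const)
  then show "recover g \<in> borel_measurable (lebesgue_on \<Omega>)" by (rule measurable_restrict_space1)
  show "integrable (lebesgue_on K) (recover g)" if K: "compact K \<and> K \<subseteq> \<Omega>" for K
  proof -
    have Km: "K \<in> sets lebesgue" using K by (simp add: borel_compact)
    obtain b where b: "0 < b" "\<And>x i. x \<in> K \<Longrightarrow> b \<le> swt i x" using swt_lower K by blast
    have "integrable lebesgue (\<lambda>x. indicator K x * recover g x $ i)" for i
    proof (rule Bochner_Integration.integrable_bound)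
      have "square_integrable (indicator K :: _ \<Rightarrow> real)"
        using K by (intro square_integrable_indicator emeasure_bounded_finite compact_imp_bounded) (auto simp: borel_compact)
      from square_integrable_mult[OF this square_integrable_rep_L2[of "g $ i"]]
      show "integrable lebesgue (\<lambda>x. (1 / b) * (indicator K x * rep_L2 (g $ i) x))" by (rule integrable_mult_right)
      show "(\<lambda>x. indicator K x * recover g x $ i) \<in> borel_measurable lebesgue"
        using Km by (intro borel_measurable_times cm borel_measurable_indicator)
      show "AE x in lebesgue. norm (indicator K x * recover g x $ i) \<le> norm ((1 / b) * (indicator K x * rep_L2 (g $ i) x))"
      proof (rule AE_I2)
        fix x
        show "norm (indicator K x * recover g x $ i) \<le> norm ((1 / b) * (indicator K x * rep_L2 (g $ i) x))"
        proof (cases "x \<in> K")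
          case True
          then have "1 / swt i x \<le> 1 / b" using b by (intro divide_left_mono) (auto intro: mult_pos_pos less_le_trans)
          from mult_right_mono[OF this, of "\<bar>rep_L2 (g $ i) x\<bar>"]
          show ?thesis using True K swt_nonneg[of i x] b(1) by (auto simp: c abs_mult)
        qed simp
      qed
    qed
    then have i: "integrable (lebesgue_on K) (\<lambda>x. recover g x $ i)" for i
      using Km by (subst integrable_restrict_space) auto
    show ?thesis
      by (subst eq) (intro Bochner_Integration.integrable_sum integrable_scaleR_left i)
  qed
  fix \<psi> i assume \<psi>: "\<psi> \<in> test_functions \<Omega>"
  have "g $ i \<bullet> abs_L2 (qt i \<psi>) = (LINT x|lebesgue. rep_L2 (g $ i) x * qt i \<psi> x)"
    by (rule inner_rep_abs_L2[OF qt_square_integrable[OF \<psi>]])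
  also have "\<dots> = (LINT x|lebesgue. \<psi> x * recover g x $ i)"
    by (intro Bochner_Integration.integral_cong) (auto simp: qt_def c)
  finally show "u \<bullet> abs_L2 (partial_derivative i \<psi>) = - (LINT x|lebesgue. \<psi> x * recover g x $ i)"
    using Z_weak_identity[OF Z \<psi>, of i] by simp
qed

definition wcomp :: "(real^'n \<Rightarrow> real^'n) \<Rightarrow> 'n \<Rightarrow> real^'n \<Rightarrow> real" where
  "wcomp h i x = indicator \<Omega> x * (swt i x * h x $ i)"

definition lift_grad :: "(real^'n \<Rightarrow> real^'n) \<Rightarrow> (real^'n) L2 ^ 'n" where
  "lift_grad h = (\<chi> i. abs_L2 (wcomp h i))"

text \<open>The weighted gradient as an element of a power of \<open>L2\<close>. On
  \<open>H1w\<close> it does not depend on the representative chosen by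
  \<open>weak_gradient\<close>.\<close>

definition Gr :: "(real^'n) L2 \<Rightarrow> (real^'n) L2 ^ 'n" where
  "Gr u = lift_grad (weak_gradient \<Omega> u)"

lemma wcomp_square_integrable:
  assumes h: "h \<in> borel_measurable (lebesgue_on \<Omega>)"
    and e: "integrable (lebesgue_on \<Omega>) (\<lambda>x. h x \<bullet> (weight_matrix k \<alpha> x *v h x))"
  shows "square_integrable (wcomp h i)"
proof -
  have "(\<lambda>x. h x $ i) \<in> borel_measurable (lebesgue_on \<Omega>)"
    using measurable_compose[OF h borel_measurable_nth] .
  then have "(\<lambda>x. indicator \<Omega> x * h x $ i) \<in> borel_measurable lebesgue"
    by (subst (asm) borel_measurable_restrict_space_iff) auto
  then have "(\<lambda>x. swt i x * (indicator \<Omega> x * h x $ i)) \<in> borel_measurable lebesgue"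
    by (rule borel_measurable_times[OF swt_lebesgue_measurable])
  then have m: "wcomp h i \<in> borel_measurable lebesgue" by (simp add: wcomp_def[abs_def] mult_ac)
  have ie: "integrable lebesgue (\<lambda>x. indicator \<Omega> x * (\<Sum>i\<in>UNIV. (swt i x * h x $ i)\<^sup>2))"
    using e unfolding weight_matrix_inner by (subst (asm) integrable_restrict_space) (auto simp: power2_eq_square)
  have "integrable lebesgue (\<lambda>x. (wcomp h i x)\<^sup>2)"
  proof (rule Bochner_Integration.integrable_bound[OF ie])
    show "(\<lambda>x. (wcomp h i x)\<^sup>2) \<in> borel_measurable lebesgue" using m by (rule borel_measurable_power)
    have "(swt i x * h x $ i)\<^sup>2 \<le> (\<Sum>i\<in>UNIV. (swt i x * h x $ i)\<^sup>2)" for x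
      by (rule member_le_sum) auto
    then show "AE x in lebesgue. norm ((wcomp h i x)\<^sup>2) \<le> norm (indicator \<Omega> x * (\<Sum>i\<in>UNIV. (swt i x * h x $ i)\<^sup>2))"
      by (intro AE_I2) (auto simp: wcomp_def indicator_def sum_nonneg)
  qed
  with m show ?thesis by (simp add: square_integrable_def)
qed

lemma wcomp_cong_AE:
  assumes "AE x in lebesgue. x \<in> \<Omega> \<longrightarrow> g x = h x"
  shows "AE x in lebesgue. wcomp g i x = wcomp h i x"
  using assms by eventually_elim (auto simp: wcomp_def indicator_def)

lemma energy_cong_AE:
  assumes "g \<in> borel_measurable (lebesgue_on \<Omega>)" "h \<in> borel_measurable (lebesgue_on \<Omega>)"
    and "AE x in lebesgue. x \<in> \<Omega> \<longrightarrow> g x = h x"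
    and "integrable (lebesgue_on \<Omega>) (\<lambda>x. g x \<bullet> (weight_matrix k \<alpha> x *v g x))"
  shows "integrable (lebesgue_on \<Omega>) (\<lambda>x. h x \<bullet> (weight_matrix k \<alpha> x *v h x))"
proof -
  have [measurable]: "swt i \<in> borel_measurable (lebesgue_on \<Omega>)" for i
    by (rule measurable_restrict_space1[OF swt_lebesgue_measurable])
  have [measurable]: "(\<lambda>x. f x $ i) \<in> borel_measurable (lebesgue_on \<Omega>)" if "f \<in> borel_measurable (lebesgue_on \<Omega>)" for f :: "real^'n \<Rightarrow> real^'n" and i
    using measurable_compose[OF that borel_measurable_nth] .
  have m: "(\<lambda>x. f x \<bullet> (weight_matrix k \<alpha> x *v f x)) \<in> borel_measurable (lebesgue_on \<Omega>)"
    if "f \<in> borel_measurable (lebesgue_on \<Omega>)" for f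
    unfolding weight_matrix_inner using that by measurable
  have "AE x in lebesgue_on \<Omega>. g x \<bullet> (weight_matrix k \<alpha> x *v g x) = h x \<bullet> (weight_matrix k \<alpha> x *v h x)"
    using assms(3) by (subst AE_restrict_space_iff) (auto elim!: AE_mp)
  then show ?thesis using assms(4) m assms(1,2) by (subst integrable_cong_AE) (auto intro: AE_symmetric)
qed

text \<open>Membership in \<open>H1w\<close> provides some weak gradient of finite energy, whereas
  the definitions use a chosen one. Uniqueness almost everywhere transfers finiteness and the
  weighted gradient from one to the other.\<close>

lemma H1w_weak_gradient:
  assumes h: "is_weak_gradient \<Omega> u h" "integrable (lebesgue_on \<Omega>) (\<lambda>x. h x \<bullet> (weight_matrix k \<alpha> x *v h x))"
  shows "is_weak_gradient \<Omega> u (weak_gradient \<Omega> u)"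
    and "integrable (lebesgue_on \<Omega>) (\<lambda>x. weak_gradient \<Omega> u x \<bullet> (weight_matrix k \<alpha> x *v weak_gradient \<Omega> u x))"
    and "Gr u = lift_grad h"
proof -
  show w: "is_weak_gradient \<Omega> u (weak_gradient \<Omega> u)"
    unfolding weak_gradient_def by (rule someI[where P="is_weak_gradient \<Omega> u", OF h(1)])
  have ae: "AE x in lebesgue. x \<in> \<Omega> \<longrightarrow> h x = weak_gradient \<Omega> u x"
    by (rule is_weak_gradient_unique[OF open_\<Omega> h(1) w])
  show e: "integrable (lebesgue_on \<Omega>) (\<lambda>x. weak_gradient \<Omega> u x \<bullet> (weight_matrix k \<alpha> x *v weak_gradient \<Omega> u x))"
    by (rule energy_cong_AE[OF _ _ ae h(2)]) (use h w in \<open>auto simp: is_weak_gradient_def\<close>)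
  have "abs_L2 (wcomp (weak_gradient \<Omega> u) i) = abs_L2 (wcomp h i)" for i
  proof (rule abs_L2_eqI)
    show "square_integrable (wcomp (weak_gradient \<Omega> u) i)" "square_integrable (wcomp h i)"
      using h w e by (auto intro!: wcomp_square_integrable simp: is_weak_gradient_def)
    show "AE x in lebesgue. wcomp (weak_gradient \<Omega> u) i x = wcomp h i x"
      using wcomp_cong_AE[OF ae, of i] by auto
  qed
  then show "Gr u = lift_grad h" by (simp add: Gr_def lift_grad_def)
qed

lemma weighted_integral:
  assumes "\<And>i. square_integrable (wcomp g i)" "\<And>i. square_integrable (wcomp h i)"
  shows "lift_grad g \<bullet> lift_grad h = (LINT x|lebesgue_on \<Omega>. g x \<bullet> (weight_matrix k \<alpha> x *v h x))"
proof -
  have "lift_grad g \<bullet> lift_grad h = (\<Sum>i\<in>UNIV. (LINT x|lebesgue. wcomp g i x * wcomp h i x))"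
    by (simp add: inner_vec_def lift_grad_def inner_abs_L2 assms)
  also have "\<dots> = (LINT x|lebesgue. (\<Sum>i\<in>UNIV. wcomp g i x * wcomp h i x))"
    by (rule Bochner_Integration.integral_sum[symmetric]) (rule square_integrable_mult[OF assms])
  also have "\<dots> = (LINT x|lebesgue. indicator \<Omega> x *\<^sub>R (g x \<bullet> (weight_matrix k \<alpha> x *v h x)))"
    by (intro Bochner_Integration.integral_cong) (auto simp: wcomp_def weight_matrix_inner indicator_def)
  also have "\<dots> = (LINT x|lebesgue_on \<Omega>. g x \<bullet> (weight_matrix k \<alpha> x *v h x))"
    by (rule integral_restrict_space[symmetric]) auto
  finally show ?thesis .
qed

lemma H1wE:
  assumes "u \<in> H1w k \<alpha> \<Omega>"
  shows "is_weak_gradient \<Omega> u (weak_gradient \<Omega> u)" "square_integrable (wcomp (weak_gradient \<Omega> u) i)"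
    "integrable (lebesgue_on \<Omega>) (\<lambda>x. weak_gradient \<Omega> u x \<bullet> (weight_matrix k \<alpha> x *v weak_gradient \<Omega> u x))"
proof -
  obtain h where h: "is_weak_gradient \<Omega> u h" "integrable (lebesgue_on \<Omega>) (\<lambda>x. h x \<bullet> (weight_matrix k \<alpha> x *v h x))"
    using assms by (auto simp: H1w_def)
  show w: "is_weak_gradient \<Omega> u (weak_gradient \<Omega> u)"
    and e: "integrable (lebesgue_on \<Omega>) (\<lambda>x. weak_gradient \<Omega> u x \<bullet> (weight_matrix k \<alpha> x *v weak_gradient \<Omega> u x))"
    using H1w_weak_gradient[OF h] by auto
  show "square_integrable (wcomp (weak_gradient \<Omega> u) i)"
    using w e by (intro wcomp_square_integrable) (auto simp: is_weak_gradient_def)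
qed

lemma energy_form_eq:
  assumes "u \<in> H1w k \<alpha> \<Omega>" "v \<in> H1w k \<alpha> \<Omega>"
  shows "energy_form k \<alpha> \<Omega> u v = Gr u \<bullet> Gr v"
  unfolding energy_form_def Gr_def by (rule weighted_integral[symmetric]) (use assms H1wE in auto)

text \<open>Closability of the weighted gradient: dividing by the weight gives a weak gradient of
  \<open>u\<close>, and multiplying it by the weight again returns \<open>g\<close>. Thus the second
  component of an element of \<open>Z\<close> is determined by the first.\<close>

lemma Z_H1w:
  assumes Z: "(u, g) \<in> Z"
  shows "u \<in> H1w k \<alpha> \<Omega>" "Gr u = g"
proof -
  have w: "is_weak_gradient \<Omega> u (recover g)" by (rule recover_weak_gradient[OF Z])
  have c: "wcomp (recover g) i x = indicator \<Omega> x * rep_L2 (g $ i) x" for i x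
    using swt_pos[of x i] by (auto simp: wcomp_def recover_def indicator_def)
  have "integrable lebesgue (\<lambda>x. \<Sum>i\<in>UNIV. rep_L2 (g $ i) x * rep_L2 (g $ i) x)"
    by (intro Bochner_Integration.integrable_sum square_integrable_mult square_integrable_rep_L2)
  from integrable_mult_indicator[OF \<Omega>_measurable(2) this]
  have "integrable lebesgue (\<lambda>x. indicator \<Omega> x * (\<Sum>i\<in>UNIV. rep_L2 (g $ i) x * rep_L2 (g $ i) x))" by simp
  also have "(\<lambda>x. indicator \<Omega> x * (\<Sum>i\<in>UNIV. rep_L2 (g $ i) x * rep_L2 (g $ i) x))
      = (\<lambda>x. indicator \<Omega> x *\<^sub>R (recover g x \<bullet> (weight_matrix k \<alpha> x *v recover g x)))"
  proof
    fix x
    show "indicator \<Omega> x * (\<Sum>i\<in>UNIV. rep_L2 (g $ i) x * rep_L2 (g $ i) x)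
      = indicator \<Omega> x *\<^sub>R (recover g x \<bullet> (weight_matrix k \<alpha> x *v recover g x))"
    proof (cases "x \<in> \<Omega>")
      case True
      then have "swt i x * recover g x $ i = rep_L2 (g $ i) x" for i
        using swt_pos[OF True, of i] by (simp add: recover_def)
      then show ?thesis unfolding weight_matrix_inner by simp
    qed simp
  qed
  finally have e: "integrable (lebesgue_on \<Omega>) (\<lambda>x. recover g x \<bullet> (weight_matrix k \<alpha> x *v recover g x))"
    by (subst integrable_restrict_space) auto
  show "u \<in> H1w k \<alpha> \<Omega>" using w e Z_L2_on(1)[OF Z] by (auto simp: H1w_def)
  have "abs_L2 (wcomp (recover g) i) = g $ i" for i
  proof -
    have sq: "square_integrable (wcomp (recover g) i)"
      using w e by (intro wcomp_square_integrable) (auto simp: is_weak_gradient_def)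
    have "AE x in lebesgue. wcomp (recover g) i x = rep_L2 (g $ i) x"
      using Z_L2_on(2)[OF Z, of i, unfolded L2_on_def, simplified] by eventually_elim (auto simp: c indicator_def)
    from abs_L2_eqI[OF sq square_integrable_rep_L2 this] show ?thesis by simp
  qed
  then show "Gr u = g"
    unfolding H1w_weak_gradient(3)[OF w e] lift_grad_def by (simp add: vec_eq_iff)
qed

lemma Z_functional: "(u, g) \<in> Z \<Longrightarrow> (u, h) \<in> Z \<Longrightarrow> g = h"
  using Z_H1w(2) by metis

text \<open>Subtracting a test function is the one operation that the definition of
  \<open>H10w\<close> performs, so this much linearity suffices to identify that space with the
  projection of \<open>Z\<close>.\<close>

lemma Gr_diff_test:
  assumes u: "u \<in> H1w k \<alpha> \<Omega>" and \<phi>: "\<phi> \<in> test_functions \<Omega>"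
  shows "u - abs_L2 \<phi> \<in> H1w k \<alpha> \<Omega>" "Gr (u - abs_L2 \<phi>) = Gr u - tgrad \<phi>"
proof -
  let ?f = "abs_L2 \<phi>"
  let ?wu = "weak_gradient \<Omega> u" and ?wf = "weak_gradient \<Omega> ?f"
  have f: "?f \<in> H1w k \<alpha> \<Omega>" "Gr ?f = tgrad \<phi>" using Z_H1w[OF test_in_Z[OF \<phi>]] by auto
  have w: "is_weak_gradient \<Omega> (u - ?f) (\<lambda>x. ?wu x - ?wf x)"
    by (rule is_weak_gradient_diff[OF open_\<Omega> H1wE(1)[OF u] H1wE(1)[OF f(1)]])
  have c: "wcomp (\<lambda>x. ?wu x - ?wf x) i = (\<lambda>x. wcomp ?wu i x - wcomp ?wf i x)" for i
    by (auto simp: wcomp_def algebra_simps)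
  have sq: "square_integrable (wcomp (\<lambda>x. ?wu x - ?wf x) i)" for i
    unfolding c by (intro square_integrable_diff H1wE(2) u f)
  have "integrable lebesgue (\<lambda>x. \<Sum>i\<in>UNIV. wcomp (\<lambda>x. ?wu x - ?wf x) i x * wcomp (\<lambda>x. ?wu x - ?wf x) i x)"
    by (intro Bochner_Integration.integrable_sum square_integrable_mult sq)
  also have "(\<lambda>x. \<Sum>i\<in>UNIV. wcomp (\<lambda>x. ?wu x - ?wf x) i x * wcomp (\<lambda>x. ?wu x - ?wf x) i x)
     = (\<lambda>x. indicator \<Omega> x *\<^sub>R ((?wu x - ?wf x) \<bullet> (weight_matrix k \<alpha> x *v (?wu x - ?wf x))))"
    by (rule ext) (auto simp: wcomp_def weight_matrix_inner indicator_def)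
  finally have e: "integrable (lebesgue_on \<Omega>) (\<lambda>x. (?wu x - ?wf x) \<bullet> (weight_matrix k \<alpha> x *v (?wu x - ?wf x)))"
    by (subst integrable_restrict_space) auto
  have "u \<in> L2_on \<Omega>" "?f \<in> L2_on \<Omega>" using u f(1) by (auto simp: H1w_def)
  then have "u - ?f \<in> L2_on \<Omega>" by (rule subspace_diff[OF subspace_L2_on])
  then show "u - ?f \<in> H1w k \<alpha> \<Omega>"
    unfolding H1w_def using w e by (intro CollectI conjI exI[of _ "\<lambda>x. ?wu x - ?wf x"]) auto
  have "lift_grad (\<lambda>x. ?wu x - ?wf x) = lift_grad ?wu - lift_grad ?wf"
    unfolding lift_grad_def vec_eq_iff c by (auto simp: minus_L2.abs_eq H1wE(2) u f)
  then show "Gr (u - ?f) = Gr u - tgrad \<phi>"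
    unfolding H1w_weak_gradient(3)[OF w e] f(2)[symmetric] by (simp add: Gr_def)
qed

text \<open>The Sobolev norm of \<open>u - abs_L2 \<phi>\<close> is the product space distance from
  \<open>(u, Gr u)\<close> to the graph element of \<phi>, so approximability by test functions is
  membership in the closure.\<close>

lemma H10w_iff: "u \<in> H10w k \<alpha> \<Omega> \<longleftrightarrow> (\<exists>g. (u, g) \<in> Z)"
proof -
  have n: "H1w_norm k \<alpha> \<Omega> (u - abs_L2 \<phi>) = dist (u, Gr u) (abs_L2 \<phi>, tgrad \<phi>)"
    if "u \<in> H1w k \<alpha> \<Omega>" "\<phi> \<in> test_functions \<Omega>" for \<phi>
  proof -
    note d = Gr_diff_test[OF that]
    show ?thesis
      unfolding H1w_norm_def energy_form_eq[OF d(1) d(1)] d(2) dist_Pair_Pair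
      by (simp add: dist_norm power2_norm_eq_inner)
  qed
  show ?thesis
  proof
    assume u: "u \<in> H10w k \<alpha> \<Omega>"
    have "(u, Gr u) \<in> closure test_graph"
      unfolding closure_approachable
    proof (intro allI impI)
      fix e :: real assume "0 < e"
      then obtain \<phi> where \<phi>: "\<phi> \<in> test_functions \<Omega>" "H1w_norm k \<alpha> \<Omega> (u - abs_L2 \<phi>) < e"
        using u by (auto simp: H10w_def)
      then show "\<exists>y\<in>test_graph. dist y (u, Gr u) < e"
        using n[OF _ \<phi>(1)] u by (intro bexI[of _ "(abs_L2 \<phi>, tgrad \<phi>)"])
          (auto simp: H10w_def test_graph_def dist_commute)
    qed
    then show "\<exists>g. (u, g) \<in> Z" by (auto simp: Z_def)
  next
    assume "\<exists>g. (u, g) \<in> Z"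
    then obtain g where g: "(u, g) \<in> Z" by blast
    note u = Z_H1w[OF g]
    show "u \<in> H10w k \<alpha> \<Omega>"
      unfolding H10w_def
    proof (intro CollectI conjI allI impI u)
      fix e :: real assume "0 < e"
      then obtain p where "p \<in> test_graph" "dist p (u, g) < e"
        using g unfolding Z_def closure_approachable by blast
      then obtain \<phi> where "\<phi> \<in> test_functions \<Omega>" "dist (abs_L2 \<phi>, tgrad \<phi>) (u, g) < e"
        by (auto simp: test_graph_def)
      then show "\<exists>\<phi>\<in>test_functions \<Omega>. H1w_norm k \<alpha> \<Omega> (u - abs_L2 \<phi>) < e"
        using n[OF u(1)] u(2) by (intro bexI[of _ \<phi>]) (auto simp: dist_commute)
    qed
  qed
qed

lemma H10w_Z: "u \<in> H10w k \<alpha> \<Omega> \<Longrightarrow> (u, Gr u) \<in> Z"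
  using H10w_iff Z_H1w(2) by metis

lemma Z_H10w: "(u, g) \<in> Z \<Longrightarrow> u \<in> H10w k \<alpha> \<Omega>"
  using H10w_iff by blast

text \<open>Both sides of the distributional equation are continuous in the pair formed by the test
  function and its weighted gradient. They therefore agree on the closure \<open>Z\<close>, which is
  the variational form of the equation.\<close>

lemma has_neg_div_iff:
  assumes u: "u \<in> H10w k \<alpha> \<Omega>"
  shows "has_neg_div k \<alpha> \<Omega> u f \<longleftrightarrow> (\<forall>(w, h)\<in>Z. Gr u \<bullet> h = f \<bullet> w)"
proof -
  have uH: "u \<in> H1w k \<alpha> \<Omega>" using u by (simp add: H10w_def)
  have 1: "(LINT x|lebesgue_on \<Omega>. (weight_matrix k \<alpha> x *v weak_gradient \<Omega> u x) \<bullet> gradient \<phi> x) = Gr u \<bullet> tgrad \<phi>"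
    if \<phi>: "\<phi> \<in> test_functions \<Omega>" for \<phi>
  proof -
    have c: "wcomp (gradient \<phi>) i = (\<lambda>x. swt i x * partial_derivative i \<phi> x)" for i
      using test_function_zero_outside[OF test_function_partial[OF \<phi>]]
      by (intro ext) (auto simp: wcomp_def gradient_def indicator_def)
    have "tgrad \<phi> \<bullet> Gr u = (LINT x|lebesgue_on \<Omega>. gradient \<phi> x \<bullet> (weight_matrix k \<alpha> x *v weak_gradient \<Omega> u x))"
      using weighted_integral[of "gradient \<phi>" "weak_gradient \<Omega> u"] H1wE(2)[OF uH] test_gradient_square_integrable[OF \<phi>]
      by (simp add: lift_grad_def c tgrad_def Gr_def)
    then show ?thesis by (simp add: inner_commute)
  qed
  have 2: "(LINT x|lebesgue_on \<Omega>. rep_L2 f x * \<phi> x) = f \<bullet> abs_L2 \<phi>" if \<phi>: "\<phi> \<in> test_functions \<Omega>" for \<phi>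
    unfolding inner_rep_abs_L2[OF test_function_square_integrable[OF \<phi>]]
    by (rule integral_lebesgue_on_zero_outside[OF open_\<Omega>]) (simp add: test_function_zero_outside[OF \<phi>])
  have "has_neg_div k \<alpha> \<Omega> u f \<longleftrightarrow> (\<forall>p\<in>test_graph. Gr u \<bullet> snd p = f \<bullet> fst p)"
    unfolding has_neg_div_def test_graph_def by (simp add: 1 2)
  also have "\<dots> \<longleftrightarrow> (\<forall>p\<in>Z. Gr u \<bullet> snd p = f \<bullet> fst p)"
  proof
    assume *: "\<forall>p\<in>test_graph. Gr u \<bullet> snd p = f \<bullet> fst p"
    have "Z \<subseteq> {p. Gr u \<bullet> snd p = f \<bullet> fst p}"
      unfolding Z_def using * by (intro closure_minimal closed_Collect_eq continuous_intros) auto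
    then show "\<forall>p\<in>Z. Gr u \<bullet> snd p = f \<bullet> fst p" by blast
  qed (use closure_subset[of test_graph] in \<open>auto simp: Z_def\<close>)
  finally show ?thesis by (simp add: case_prod_unfold)
qed

end

section \<open>Translation estimate, Poincare inequality and compact embedding\<close>

context weighted_domain
begin

text \<open>The reciprocal of the weight, cut off to \<Omega>; it is the function \<open>v\<close>
  of \<open>translation_estimate\<close>.\<close>

definition wrec :: "'n \<Rightarrow> real^'n \<Rightarrow> real" where
  "wrec i y = (if y \<in> \<Omega> then 1 / (swt i y)\<^sup>2 else 0)"

lemma wrec_measurable [measurable]: "wrec i \<in> borel_measurable borel"
  unfolding wrec_def by (intro measurable_If) measurable

text \<open>In direction \<open>k\<close> the reciprocal weight is \<open>t powr - \<alpha>\<close>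
  at height \<open>t\<close>, which has integral
  \<open>B powr (1 - \<alpha>) / (1 - \<alpha>)\<close> over \<open>{0..B}\<close> since \<alpha> <
  1. In the other directions the weight is 1 and a line spends at most the length
  \<open>2 * B\<close> in \<Omega>.\<close>

lemma wrec_line_integral:
  obtains M where "0 < M" "\<And>i x. (\<integral>\<^sup>+s. ennreal (wrec i (x + s *\<^sub>R axis i 1)) \<partial>lborel) \<le> ennreal M"
proof -
  obtain B where B: "0 < B" "\<And>x i. x \<in> \<Omega> \<Longrightarrow> \<bar>x $ i\<bar> \<le> B" using coordinate_bound by blast
  define I where "I = B powr (1 - \<alpha>) / (1 - \<alpha>)"
  have I: "0 \<le> I" unfolding I_def using \<alpha> by simp
  have comp: "(x + s *\<^sub>R axis i 1) $ i = x $ i + s" for x :: "real^'n" and s i by (simp add: axis_def)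
  have "(\<integral>\<^sup>+s. ennreal (wrec i (x + s *\<^sub>R axis i 1)) \<partial>lborel) \<le> ennreal (2 * B + I)" for i x
  proof (cases "i = k")
    case False
    have "(\<integral>\<^sup>+s. ennreal (wrec i (x + s *\<^sub>R axis i 1)) \<partial>lborel) \<le> (\<integral>\<^sup>+s. indicator {- B - x $ i .. B - x $ i} s \<partial>lborel)"
    proof (rule nn_integral_mono)
      fix s
      show "ennreal (wrec i (x + s *\<^sub>R axis i 1)) \<le> indicator {- B - x $ i .. B - x $ i} s"
        using B(2)[of "x + s *\<^sub>R axis i 1" i] False unfolding comp
        by (cases "x + s *\<^sub>R axis i 1 \<in> \<Omega>") (auto simp: wrec_def swt_def indicator_def)
    qed
    also have "\<dots> = ennreal (2 * B)" using B(1) by simp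
    also have "\<dots> \<le> ennreal (2 * B + I)" using I by (intro ennreal_leI) simp
    finally show ?thesis .
  next
    case True
    define F where "F t = ennreal (t powr - \<alpha>) * indicator {0..B} t" for t :: real
    have Fm: "F \<in> borel_measurable borel" unfolding F_def by measurable
    have "(\<integral>\<^sup>+s. ennreal (wrec i (x + s *\<^sub>R axis i 1)) \<partial>lborel) \<le> (\<integral>\<^sup>+s. F (s + x $ k) \<partial>lborel)"
    proof (rule nn_integral_mono)
      fix s
      show "ennreal (wrec i (x + s *\<^sub>R axis i 1)) \<le> F (s + x $ k)"
      proof (cases "x + s *\<^sub>R axis i 1 \<in> \<Omega>")
        case in\<Omega>: True
        then have "0 < x $ k + s" "x $ k + s \<le> B"
          using pos[OF in\<Omega>] B(2)[OF in\<Omega>, of k] comp[of x s k] True by auto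
        then show ?thesis
          using in\<Omega> True comp[of x s k]
          by (auto simp: wrec_def swt_def F_def powr_minus divide_inverse add.commute intro!: ennreal_leI)
      qed (simp add: wrec_def)
    qed
    also have "\<dots> = (\<integral>\<^sup>+t. F t \<partial>lborel)" by (rule nn_integral_lborel_translation[OF Fm])
    also have "\<dots> = ennreal I"
      unfolding F_def
    proof (rule nn_integral_has_integral_lebesgue')
      show "((\<lambda>t. t powr - \<alpha>) has_integral I) {0..B}"
        unfolding I_def using has_integral_powr_from_0[of "- \<alpha>" B] \<alpha> B(1) by simp
    qed simp
    also have "\<dots> \<le> ennreal (2 * B + I)" using B(1) by (intro ennreal_leI) simp
    finally show ?thesis .
  qed
  moreover have "0 < 2 * B + I" using B(1) I by linarith
  ultimately show thesis using that by blast
qed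

text \<open>The splitting in \<open>translation_estimate\<close> is the partial derivative as
  weighted derivative times the square root of the reciprocal weight. The factor \<open>h\<close>
  becomes a modulus of continuity of order \<open>sqrt h\<close>.\<close>

lemma test_function_translation_estimate:
  obtains M where "0 < M"
    "\<And>\<phi> i h. \<phi> \<in> test_functions \<Omega> \<Longrightarrow> 0 \<le> h \<Longrightarrow>
      (norm (abs_L2 (\<lambda>x. \<phi> (x + h *\<^sub>R axis i 1) - \<phi> x)))\<^sup>2 \<le> M * h * (norm (tgrad \<phi>))\<^sup>2"
proof -
  obtain M where M: "0 < M" "\<And>i x. (\<integral>\<^sup>+s. ennreal (wrec i (x + s *\<^sub>R axis i 1)) \<partial>lborel) \<le> ennreal M"
    using wrec_line_integral by blast
  have "(norm (abs_L2 (\<lambda>x. \<phi> (x + h *\<^sub>R axis i 1) - \<phi> x)))\<^sup>2 \<le> M * h * (norm (tgrad \<phi>))\<^sup>2"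
    if \<phi>: "\<phi> \<in> test_functions \<Omega>" and h: "0 \<le> h" for \<phi> i h
  proof -
    note p = test_function_partial[OF \<phi>, of i]
    let ?\<psi> = "\<lambda>x. swt i x * partial_derivative i \<phi> x"
    let ?D = "\<lambda>x. \<phi> (x + h *\<^sub>R axis i 1) - \<phi> x"
    have [measurable]: "\<phi> \<in> borel_measurable borel" "partial_derivative i \<phi> \<in> borel_measurable borel"
      using \<phi> p by (auto intro: test_function_measurable)
    have sqD: "square_integrable ?D"
      by (intro square_integrable_diff square_integrable_translation test_function_square_integrable[OF \<phi>]) measurable
    have sq\<psi>: "square_integrable ?\<psi>" by (rule test_gradient_square_integrable[OF \<phi>])
    have nn: "(\<integral>\<^sup>+x. ennreal ((f x)\<^sup>2) \<partial>lborel) = ennreal ((norm (abs_L2 f))\<^sup>2)"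
      if "square_integrable f" "f \<in> borel_measurable borel" for f :: "real^'n \<Rightarrow> real"
    proof -
      have "integrable lborel (\<lambda>x. (f x)\<^sup>2)" using that by (simp add: square_integrable_def integrable_completion)
      then show ?thesis unfolding norm_abs_L2_borel[OF that] by (intro nn_integral_eq_integral) auto
    qed
    have "(\<integral>\<^sup>+x. ennreal ((?D x)\<^sup>2) \<partial>lborel) \<le> ennreal (M * h) * (\<integral>\<^sup>+x. ennreal ((?\<psi> x)\<^sup>2) \<partial>lborel)"
    proof (rule translation_estimate[where d="partial_derivative i \<phi>" and v="wrec i"])
      show "\<bar>partial_derivative i \<phi> y\<bar> = \<bar>?\<psi> y\<bar> * sqrt (wrec i y)" for y
        using swt_pos[of y i] test_function_zero_outside[OF p, of y]
        by (cases "y \<in> \<Omega>") (auto simp: wrec_def abs_mult real_sqrt_divide)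
    qed (use \<phi> p M h in \<open>auto simp: wrec_def intro: test_function_line_derivative test_function_continuous\<close>)
    then have "ennreal ((norm (abs_L2 ?D))\<^sup>2) \<le> ennreal (M * h * (norm (abs_L2 ?\<psi>))\<^sup>2)"
      using M h by (simp add: nn sqD sq\<psi> ennreal_mult)
    then have "(norm (abs_L2 ?D))\<^sup>2 \<le> M * h * (norm (abs_L2 ?\<psi>))\<^sup>2"
      using M h by (subst (asm) ennreal_le_iff) auto
    also have "norm (abs_L2 ?\<psi>) \<le> norm (tgrad \<phi>)"
      using Finite_Cartesian_Product.norm_nth_le[of "tgrad \<phi>" i] by (simp add: tgrad_def)
    then have "M * h * (norm (abs_L2 ?\<psi>))\<^sup>2 \<le> M * h * (norm (tgrad \<phi>))\<^sup>2"
      using M h by (intro mult_left_mono power_mono) auto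
    finally show ?thesis .
  qed
  then show thesis using that M(1) by blast
qed

text \<open>A shift by \<open>h = 2 * B + 1\<close> in direction \<open>k\<close> exceeds the width
  of \<Omega>, so the shifted test function vanishes on \<Omega>. The translation difference then
  dominates the function itself, and the translation estimate applies.\<close>

lemma poincare:
  obtains C where "0 < C" "\<And>u g. (u, g) \<in> Z \<Longrightarrow> norm u \<le> C * norm g"
proof -
  obtain B where B: "0 < B" "\<And>x i. x \<in> \<Omega> \<Longrightarrow> \<bar>x $ i\<bar> \<le> B" using coordinate_bound by blast
  obtain M where M: "0 < M" "\<And>\<phi> i h. \<phi> \<in> test_functions \<Omega> \<Longrightarrow> 0 \<le> h \<Longrightarrow>
      (norm (abs_L2 (\<lambda>x. \<phi> (x + h *\<^sub>R axis i 1) - \<phi> x)))\<^sup>2 \<le> M * h * (norm (tgrad \<phi>))\<^sup>2"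
    using test_function_translation_estimate by blast
  define h where "h = 2 * B + 1"
  have h: "0 < h" using B(1) by (simp add: h_def)
  define C where "C = sqrt (M * h)"
  have C: "0 < C" using M(1) h by (simp add: C_def)
  have test: "norm (abs_L2 \<phi>) \<le> C * norm (tgrad \<phi>)" if \<phi>: "\<phi> \<in> test_functions \<Omega>" for \<phi>
  proof -
    let ?D = "\<lambda>x. \<phi> (x + h *\<^sub>R axis k 1) - \<phi> x"
    have [measurable]: "\<phi> \<in> borel_measurable borel" by (rule test_function_measurable[OF \<phi>])
    note sq = test_function_square_integrable[OF \<phi>]
    have sqD: "square_integrable ?D"
      by (intro square_integrable_diff square_integrable_translation sq) measurable
    have "(\<phi> x)\<^sup>2 \<le> (?D x)\<^sup>2" for x
    proof (cases "x \<in> \<Omega>")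
      case True
      have "x + h *\<^sub>R axis k 1 \<notin> \<Omega>"
        using B(2)[OF True, of k] B(2)[of "x + h *\<^sub>R axis k 1" k] by (auto simp: axis_def h_def)
      then show ?thesis using test_function_zero_outside[OF \<phi>] by simp
    qed (simp add: test_function_zero_outside[OF \<phi>])
    then have "(LINT x|lborel. (\<phi> x)\<^sup>2) \<le> (LINT x|lborel. (?D x)\<^sup>2)"
      using sq sqD by (intro integral_mono) (auto simp: square_integrable_def integrable_completion)
    then have "(norm (abs_L2 \<phi>))\<^sup>2 \<le> (norm (abs_L2 ?D))\<^sup>2"
      by (simp add: norm_abs_L2_borel sq sqD)
    also have "\<dots> \<le> M * h * (norm (tgrad \<phi>))\<^sup>2" by (rule M(2)[OF \<phi>]) (use h in simp)
    also have "\<dots> = (C * norm (tgrad \<phi>))\<^sup>2" using M(1) h by (simp add: C_def power_mult_distrib)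
    finally show ?thesis by (rule power2_le_imp_le) (use C in simp)
  qed
  have "norm u \<le> C * norm g" if Z: "(u, g) \<in> Z" for u g
  proof -
    obtain \<phi> where \<phi>: "\<And>n. \<phi> n \<in> test_functions \<Omega>" "(\<lambda>n. abs_L2 (\<phi> n)) \<longlonglongrightarrow> u" "(\<lambda>n. tgrad (\<phi> n)) \<longlonglongrightarrow> g"
      using Z_sequence[OF Z] by blast
    show ?thesis
    proof (rule LIMSEQ_le[OF tendsto_norm[OF \<phi>(2)]])
      show "(\<lambda>n. C * norm (tgrad (\<phi> n))) \<longlonglongrightarrow> C * norm g" by (intro tendsto_intros \<phi>)
    qed (use test \<phi>(1) in auto)
  qed
  then show thesis using that C by blast
qed

text \<open>Rellich's theorem for sequences. Each element is replaced by a test function at distance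
  below \<open>inverse (Suc n)\<close> in the graph norm; weak nullity, boundedness and the
  equicontinuity from the translation estimate survive this replacement.\<close>

lemma Z_compact:
  assumes Z: "\<And>n. (u n, g n) \<in> Z" and bound: "\<And>n. norm (g n) \<le> R"
    and weak: "\<And>f. (\<lambda>n. u n \<bullet> f) \<longlonglongrightarrow> 0"
  shows "u \<longlonglongrightarrow> 0"
proof -
  have "\<exists>\<phi>\<in>test_functions \<Omega>. dist (abs_L2 \<phi>, tgrad \<phi>) (u n, g n) < inverse (real (Suc n))" for n
  proof -
    have "0 < inverse (real (Suc n))" by simp
    then obtain p where "p \<in> test_graph" "dist p (u n, g n) < inverse (real (Suc n))"
      using Z[of n] unfolding Z_def closure_approachable by blast
    then show ?thesis by (auto simp: test_graph_def)
  qed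
  then obtain \<phi> where \<phi>: "\<And>n. \<phi> n \<in> test_functions \<Omega>"
    "\<And>n. dist (abs_L2 (\<phi> n), tgrad (\<phi> n)) (u n, g n) < inverse (real (Suc n))" by metis
  have du: "norm (abs_L2 (\<phi> n) - u n) < inverse (real (Suc n))" for n
    using le_less_trans[OF dist_fst_le \<phi>(2)[of n]] by (simp add: dist_norm)
  have dg: "norm (tgrad (\<phi> n) - g n) < inverse (real (Suc n))" for n
    using le_less_trans[OF dist_snd_le \<phi>(2)[of n]] by (simp add: dist_norm)
  have le1: "inverse (real (Suc n)) \<le> 1" for n by (simp add: inverse_eq_divide)
  have bg: "norm (tgrad (\<phi> n)) \<le> R + 1" for n
    using norm_triangle_ineq[of "tgrad (\<phi> n) - g n" "g n"] dg[of n] bound[of n] le1[of n] by simp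
  have dlim: "(\<lambda>n. abs_L2 (\<phi> n) - u n) \<longlonglongrightarrow> 0"
    by (rule Lim_null_comparison[OF _ LIMSEQ_inverse_real_of_nat]) (use du in \<open>auto intro!: always_eventually less_imp_le\<close>)
  obtain C where C: "0 < C" "\<And>u g. (u, g) \<in> Z \<Longrightarrow> norm u \<le> C * norm g" using poincare by blast
  obtain M where M: "0 < M" "\<And>\<phi> i h. \<phi> \<in> test_functions \<Omega> \<Longrightarrow> 0 \<le> h \<Longrightarrow>
      (norm (abs_L2 (\<lambda>x. \<phi> (x + h *\<^sub>R axis i 1) - \<phi> x)))\<^sup>2 \<le> M * h * (norm (tgrad \<phi>))\<^sup>2"
    using test_function_translation_estimate by blast
  have R0: "0 \<le> R + 1" by (rule order_trans[OF norm_ge_zero bg[of 0]])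
  have "(\<lambda>n. abs_L2 (\<phi> n)) \<longlonglongrightarrow> 0"
  proof (rule weakly_null_equicontinuous_imp_null)
    show "compact (closure \<Omega>)" using bounded_\<Omega> by (simp add: compact_closure)
    show "continuous_on UNIV (\<phi> n)" for n by (rule test_function_continuous[OF \<phi>(1)])
    show "\<phi> n x = 0" if "x \<notin> closure \<Omega>" for n x
      using that closure_subset[of \<Omega>] test_function_zero_outside[OF \<phi>(1)] by blast
    show "(\<lambda>n. abs_L2 (\<phi> n) \<bullet> f) \<longlonglongrightarrow> 0" for f
    proof -
      have "(\<lambda>n. (abs_L2 (\<phi> n) - u n) \<bullet> f + u n \<bullet> f) \<longlonglongrightarrow> 0 \<bullet> f + 0"
        by (intro tendsto_intros dlim weak)
      then show ?thesis by (simp add: inner_diff_left)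
    qed
    show "norm (abs_L2 (\<phi> n)) \<le> C * (R + 1)" for n
      using C(2)[OF test_in_Z[OF \<phi>(1)[of n]]] mult_left_mono[OF bg[of n], of C] C(1) by linarith
    show "norm (abs_L2 (\<lambda>x. \<phi> n (x + h *\<^sub>R axis i 1) - \<phi> n x)) \<le> (sqrt M * (R + 1)) * sqrt h" if h: "0 \<le> h" for n i h
    proof (rule power2_le_imp_le)
      have "(norm (abs_L2 (\<lambda>x. \<phi> n (x + h *\<^sub>R axis i 1) - \<phi> n x)))\<^sup>2 \<le> M * h * (norm (tgrad (\<phi> n)))\<^sup>2"
        by (rule M(2)[OF \<phi>(1) h])
      also have "\<dots> \<le> M * h * (R + 1)\<^sup>2" using bg[of n] M(1) h by (intro mult_left_mono power_mono) auto
      also have "\<dots> = ((sqrt M * (R + 1)) * sqrt h)\<^sup>2" using M(1) h by (simp add: power_mult_distrib)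
      finally show "(norm (abs_L2 (\<lambda>x. \<phi> n (x + h *\<^sub>R axis i 1) - \<phi> n x)))\<^sup>2 \<le> ((sqrt M * (R + 1)) * sqrt h)\<^sup>2" .
      show "0 \<le> sqrt M * (R + 1) * sqrt h" using R0 M(1) h by simp
    qed
  qed
  from tendsto_diff[OF this dlim] show ?thesis by simp
qed

end

section \<open>Damped wave equations\<close>

text \<open>An abstract damped wave equation \<open>g' = k\<close>, \<open>E k = v\<close>, \<open>v' = - w - V v\<close>, \<open>Es w = g\<close>. In the
  application \<open>E\<close> recovers a function from its weighted gradient, so that \<open>Es\<close> is, up to this
  identification, the inverse of the degenerate elliptic operator, and no unbounded operator is needed.\<close>

locale energy_pair =
  fixes G :: "'g::{real_inner,banach} set" and L :: "'l::{real_inner,banach} set"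
    and E :: "'g \<Rightarrow> 'l" and Es :: "'l \<Rightarrow> 'g"
  assumes G: "closed G" "subspace G" and L: "closed L" "subspace L"
    and E_lin: "bounded_linear E" and Es_lin: "bounded_linear Es"
    and adj: "E g \<bullet> f = g \<bullet> Es f"
    and E_L: "E g \<in> L" and Es_G: "Es f \<in> G"
    and E_inj: "g \<in> G \<Longrightarrow> E g = 0 \<Longrightarrow> g = 0"
    and E_dense: "f \<in> L \<Longrightarrow> (\<And>g. g \<in> G \<Longrightarrow> E g \<bullet> f = 0) \<Longrightarrow> f = 0"
begin

definition damping :: "('l \<Rightarrow> 'l) \<Rightarrow> bool" where
  "damping V \<longleftrightarrow> bounded_linear V \<and> (\<forall>f. V f \<in> L) \<and> (\<forall>f. 0 \<le> V f \<bullet> f)"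

text \<open>Parametrization of the generator by bounded maps: \<open>p\<close> consists of the
  gradient \<kappa> of the velocity and of the elliptic term \<open>w\<close>. The state is
  \<open>(Es w, E \<kappa>)\<close> and its time derivative is
  \<open>(\<kappa>, - w - V (E \<kappa>))\<close>.\<close>

definition wave_pair :: "('l \<Rightarrow> 'l) \<Rightarrow> 'g \<times> 'l \<Rightarrow> ('g \<times> 'l) \<times> ('g \<times> 'l)" where
  "wave_pair V p = ((Es (snd p), E (fst p)), (fst p, - snd p - V (E (fst p))))"

definition wave_graph :: "('l \<Rightarrow> 'l) \<Rightarrow> (('g \<times> 'l) \<times> ('g \<times> 'l)) set" where
  "wave_graph V = wave_pair V ` (G \<times> L)"

text \<open>The terms \<open>\<kappa> \<bullet> Es w\<close> and
  \<open>w \<bullet> E \<kappa>\<close> cancel because \<open>E\<close> and \<open>Es\<close> are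
  adjoint; only the damping dissipates energy.\<close>

lemma wave_inner:
  assumes "(x, y) \<in> wave_graph V"
  shows "y \<bullet> x = - (V (snd x) \<bullet> snd x)"
  using assms by (auto simp: wave_graph_def wave_pair_def inner_diff_left inner_diff_right adj[symmetric] inner_commute)

lemma linear_wave_pair: "damping V \<Longrightarrow> linear (wave_pair V)"
  unfolding damping_def wave_pair_def
  by (intro linearI)
    (auto simp: linear_add[OF bounded_linear.linear] linear_scale[OF bounded_linear.linear] E_lin Es_lin algebra_simps)

text \<open>The resolvent equation says \<open>Es w - h *\<^sub>R \<kappa> = p\<close> and
  \<open>E \<kappa> + h *\<^sub>R w + h *\<^sub>R V (E \<kappa>) = q\<close>; eliminating
  \<open>w\<close> leaves this equation for \<kappa>. By adjointness the added terms are
  nonnegative, so the operator is coercive with constant 1 for every damping.\<close>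

lemma wave_system_solvable:
  assumes V: "damping V" and h: "0 < h"
  shows "\<exists>!\<kappa>. \<kappa> + (1 / h\<^sup>2) *\<^sub>R Es (E \<kappa>) + (1 / h) *\<^sub>R Es (V (E \<kappa>)) = r"
proof (rule lax_milgram)
  have V': "bounded_linear V" using V by (simp add: damping_def)
  show "bounded_linear (\<lambda>\<kappa>. \<kappa> + (1 / h\<^sup>2) *\<^sub>R Es (E \<kappa>) + (1 / h) *\<^sub>R Es (V (E \<kappa>)))"
    by (intro bounded_linear_intros bounded_linear_compose[OF Es_lin] bounded_linear_compose[OF V'] E_lin)
  fix \<kappa>
  have "(\<kappa> + (1 / h\<^sup>2) *\<^sub>R Es (E \<kappa>) + (1 / h) *\<^sub>R Es (V (E \<kappa>))) \<bullet> \<kappa>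
      = (norm \<kappa>)\<^sup>2 + (1 / h\<^sup>2) * (E \<kappa> \<bullet> E \<kappa>) + (1 / h) * (V (E \<kappa>) \<bullet> E \<kappa>)"
    using adj[of \<kappa> "E \<kappa>"] adj[of \<kappa> "V (E \<kappa>)"]
    by (simp add: inner_add_left inner_add_right power2_norm_eq_inner inner_commute)
  moreover have "0 \<le> (1 / h\<^sup>2) * (E \<kappa> \<bullet> E \<kappa>)" by simp
  moreover have "0 \<le> (1 / h) * (V (E \<kappa>) \<bullet> E \<kappa>)" using V h by (simp add: damping_def)
  ultimately show "(norm \<kappa>)\<^sup>2 \<le> (\<kappa> + (1 / h\<^sup>2) *\<^sub>R Es (E \<kappa>) + (1 / h) *\<^sub>R Es (V (E \<kappa>))) \<bullet> \<kappa>" by linarith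
qed

lemma wave_resolvent:
  assumes V: "damping V" and h: "0 < h" and pq: "p \<in> G" "q \<in> L"
    and \<kappa>: "\<kappa> + (1 / h\<^sup>2) *\<^sub>R Es (E \<kappa>) + (1 / h) *\<^sub>R Es (V (E \<kappa>)) = (1 / h) *\<^sub>R ((1 / h) *\<^sub>R Es q - p)"
  defines "w \<equiv> (1 / h) *\<^sub>R (q - E \<kappa>) - V (E \<kappa>)"
  shows "(\<kappa>, w) \<in> G \<times> L" "Es w = p + h *\<^sub>R \<kappa>"
    "(Es w, E \<kappa>) - h *\<^sub>R (\<kappa>, - w - V (E \<kappa>)) = (p, q)"
proof -
  have "\<kappa> = (1 / h) *\<^sub>R ((1 / h) *\<^sub>R Es q - p) - (1 / h\<^sup>2) *\<^sub>R Es (E \<kappa>) - (1 / h) *\<^sub>R Es (V (E \<kappa>))"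
    using \<kappa> by (simp add: algebra_simps)
  also have "\<dots> \<in> G" using G(2) pq Es_G by (intro subspace_diff subspace_scale)
  finally have "\<kappa> \<in> G" .
  moreover have "w \<in> L" unfolding w_def using L(2) pq E_L V by (intro subspace_diff subspace_scale) (auto simp: damping_def)
  ultimately show "(\<kappa>, w) \<in> G \<times> L" by simp
  note Es = linear_diff[OF bounded_linear.linear[OF Es_lin]] linear_scale[OF bounded_linear.linear[OF Es_lin]]
  have "h *\<^sub>R (\<kappa> + (1 / h\<^sup>2) *\<^sub>R Es (E \<kappa>) + (1 / h) *\<^sub>R Es (V (E \<kappa>))) = (1 / h) *\<^sub>R Es q - p"
    unfolding \<kappa> using h by simp
  then have "h *\<^sub>R \<kappa> + (1 / h) *\<^sub>R Es (E \<kappa>) + Es (V (E \<kappa>)) = (1 / h) *\<^sub>R Es q - p"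
    using h by (simp add: scaleR_add_right power2_eq_square)
  then show e: "Es w = p + h *\<^sub>R \<kappa>"
    unfolding w_def Es by (simp add: algebra_simps)
  have "h *\<^sub>R w = q - E \<kappa> - h *\<^sub>R V (E \<kappa>)" unfolding w_def using h by (simp add: algebra_simps)
  then show "(Es w, E \<kappa>) - h *\<^sub>R (\<kappa>, - w - V (E \<kappa>)) = (p, q)"
    unfolding e by (simp add: algebra_simps)
qed

text \<open>Dissipativity follows from the sign of \<open>y \<bullet> x\<close> in
  \<open>wave_inner\<close>, and the range condition from the reduced equation for \<kappa>. The
  domain is a product, so its density is checked by orthogonality in each factor.\<close>

lemma m_dissipative_wave:
  assumes V: "damping V"
  shows "m_dissipative (G \<times> L) (wave_graph V)"
proof
  show "closed (G \<times> L)" using G L by (intro closed_Times)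
  show "subspace (G \<times> L)" using G L by (intro subspace_Times)
  then show "subspace (wave_graph V)"
    unfolding wave_graph_def by (rule linear_subspace_image[OF linear_wave_pair[OF V]])
  show "wave_graph V \<subseteq> (G \<times> L) \<times> (G \<times> L)"
    using V L(2) E_L Es_G
    by (auto simp: wave_graph_def wave_pair_def damping_def intro!: subspace_diff subspace_neg)
  show "norm x \<le> norm (x - h *\<^sub>R y)" if "(x, y) \<in> wave_graph V" "0 < h" for x y h
  proof (rule power2_le_imp_le)
    have a: "0 \<le> - (y \<bullet> x)" using wave_inner[OF that(1)] V by (simp add: damping_def)
    have "0 \<le> 2 * h * - (y \<bullet> x)" by (rule mult_nonneg_nonneg[OF _ a]) (use that(2) in simp)
    moreover have "(norm (x - h *\<^sub>R y))\<^sup>2 = (norm x)\<^sup>2 + 2 * h * - (y \<bullet> x) + (norm (h *\<^sub>R y))\<^sup>2"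
      unfolding power2_norm_eq_inner by (simp add: inner_diff_left inner_diff_right inner_commute)
    moreover have "0 \<le> (norm (h *\<^sub>R y))\<^sup>2" by simp
    ultimately show "(norm x)\<^sup>2 \<le> (norm (x - h *\<^sub>R y))\<^sup>2" by linarith
  qed simp
  show "\<exists>x y. (x, y) \<in> wave_graph V \<and> x - h *\<^sub>R y = z" if z: "z \<in> G \<times> L" and h: "0 < h" for z h
  proof -
    obtain p q where pq: "z = (p, q)" "p \<in> G" "q \<in> L" using z by auto
    obtain \<kappa> where \<kappa>: "\<kappa> + (1 / h\<^sup>2) *\<^sub>R Es (E \<kappa>) + (1 / h) *\<^sub>R Es (V (E \<kappa>)) = (1 / h) *\<^sub>R ((1 / h) *\<^sub>R Es q - p)"
      using wave_system_solvable[OF V h] by blast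
    note r = wave_resolvent[OF V h pq(2,3) \<kappa>]
    have "((Es w, E \<kappa>), (\<kappa>, - w - V (E \<kappa>))) \<in> wave_graph V"
      if "w = (1 / h) *\<^sub>R (q - E \<kappa>) - V (E \<kappa>)" for w
      using imageI[OF r(1), of "wave_pair V"] unfolding that by (simp add: wave_graph_def wave_pair_def)
    from this[OF refl] r(3) show ?thesis unfolding pq(1) by blast
  qed
  have "fst ` wave_graph V = (Es ` L) \<times> (E ` G)"
    by (force simp: wave_graph_def wave_pair_def image_iff)
  moreover have "G \<subseteq> closure (Es ` L)"
  proof (rule subset_closure_if_orthogonal_trivial)
    show "subspace (Es ` L)" by (rule linear_subspace_image[OF bounded_linear.linear[OF Es_lin] L(2)])
    show "z = 0" if "z \<in> G" "\<And>y. y \<in> Es ` L \<Longrightarrow> z \<bullet> y = 0" for z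
    proof -
      \<comment> \<open>Orthogonality is tested on the element \<open>Es (E z)\<close>, and
        adjointness moves \<open>Es\<close> back to \<open>E\<close>.\<close>
      have "E z \<bullet> E z = 0" unfolding adj using that(2) E_L by blast
      then show ?thesis using E_inj that(1) by simp
    qed
  qed (use G Es_G in auto)
  moreover have "L \<subseteq> closure (E ` G)"
  proof (rule subset_closure_if_orthogonal_trivial)
    show "subspace (E ` G)" by (rule linear_subspace_image[OF bounded_linear.linear[OF E_lin] G(2)])
    show "z = 0" if "z \<in> L" "\<And>y. y \<in> E ` G \<Longrightarrow> z \<bullet> y = 0" for z
      using E_dense[OF that(1)] that(2) by (simp add: inner_commute)
  qed (use L E_L in auto)
  ultimately show "G \<times> L \<subseteq> closure (fst ` wave_graph V)"
    by (auto simp: closure_Times)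
qed

lemma wave_J:
  assumes V: "damping V" and h: "0 < h" and pq: "p \<in> G" "q \<in> L"
    and \<kappa>: "\<kappa> + (1 / h\<^sup>2) *\<^sub>R Es (E \<kappa>) + (1 / h) *\<^sub>R Es (V (E \<kappa>)) = (1 / h) *\<^sub>R ((1 / h) *\<^sub>R Es q - p)"
  shows "m_dissipative.J (wave_graph V) h (p, q) = (p + h *\<^sub>R \<kappa>, E \<kappa>)"
proof -
  note r = wave_resolvent[OF V h pq \<kappa>]
  let ?w = "(1 / h) *\<^sub>R (q - E \<kappa>) - V (E \<kappa>)"
  have "((Es ?w, E \<kappa>), (\<kappa>, - ?w - V (E \<kappa>))) \<in> wave_graph V"
    using imageI[OF r(1), of "wave_pair V"] by (simp add: wave_graph_def wave_pair_def)
  from m_dissipative.J_eqI[OF m_dissipative_wave[OF V] this h r(3)]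
  show ?thesis unfolding r(2) .
qed

text \<open>The difference of the two solutions solves the coercive equation of \<open>Vn n\<close>
  with right-hand side \<open>- (1 / h) *\<^sub>R Es (Vn n (E \<kappa>) - V (E \<kappa>))\<close>.
  The dampings act there on the one fixed vector \<open>E \<kappa>\<close>, so the assumed pointwise
  convergence behind \<open>Es\<close> is enough.\<close>

lemma wave_J_convergence:
  assumes V: "damping V" and Vn: "\<And>n. damping (Vn n)" and h: "0 < h" and z: "z \<in> G \<times> L"
    and conv: "\<And>f. (\<lambda>n. Es (Vn n f - V f)) \<longlonglongrightarrow> 0"
  shows "(\<lambda>n. m_dissipative.J (wave_graph (Vn n)) h z) \<longlonglongrightarrow> m_dissipative.J (wave_graph V) h z"
proof -
  obtain p q where pq: "z = (p, q)" "p \<in> G" "q \<in> L" using z by auto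
  define r where "r = (1 / h) *\<^sub>R ((1 / h) *\<^sub>R Es q - p)"
  define B where "B V \<kappa> = \<kappa> + (1 / h\<^sup>2) *\<^sub>R Es (E \<kappa>) + (1 / h) *\<^sub>R Es (V (E \<kappa>))" for V \<kappa>
  obtain \<kappa> where \<kappa>: "B V \<kappa> = r" using wave_system_solvable[OF V h] unfolding B_def by blast
  have "\<exists>\<kappa>. B (Vn n) \<kappa> = r" for n using wave_system_solvable[OF Vn h] unfolding B_def by blast
  then obtain \<kappa>n where \<kappa>n: "\<And>n. B (Vn n) (\<kappa>n n) = r" by metis
  have bound: "norm (\<kappa>n n - \<kappa>) \<le> (1 / h) * norm (Es (Vn n (E \<kappa>) - V (E \<kappa>)))" for n
  proof (cases "\<kappa>n n = \<kappa>")
    case False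
    define d where "d = \<kappa>n n - \<kappa>"
    have V': "bounded_linear (Vn n)" using Vn by (simp add: damping_def)
    note lin = linear_diff[OF bounded_linear.linear[OF Es_lin]] linear_diff[OF bounded_linear.linear[OF E_lin]]
      linear_diff[OF bounded_linear.linear[OF V']]
    have "B (Vn n) d = B (Vn n) (\<kappa>n n) - B (Vn n) \<kappa>"
      unfolding B_def d_def lin by (simp add: algebra_simps)
    also have "\<dots> = B V \<kappa> - B (Vn n) \<kappa>" using \<kappa> \<kappa>n by simp
    also have "\<dots> = - ((1 / h) *\<^sub>R Es (Vn n (E \<kappa>) - V (E \<kappa>)))"
      unfolding B_def lin(1) by (simp add: algebra_simps)
    finally have Bd: "B (Vn n) d = - ((1 / h) *\<^sub>R Es (Vn n (E \<kappa>) - V (E \<kappa>)))" .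
    have "B (Vn n) d \<bullet> d = (norm d)\<^sup>2 + (1 / h\<^sup>2) * (E d \<bullet> E d) + (1 / h) * (Vn n (E d) \<bullet> E d)"
      using adj[of d "E d"] adj[of d "Vn n (E d)"] unfolding B_def
      by (simp add: inner_add_left inner_add_right power2_norm_eq_inner inner_commute)
    moreover have "0 \<le> (1 / h\<^sup>2) * (E d \<bullet> E d)" by simp
    moreover have "0 \<le> (1 / h) * (Vn n (E d) \<bullet> E d)" using Vn h by (simp add: damping_def)
    ultimately have "norm d * norm d \<le> B (Vn n) d \<bullet> d" by (simp add: power2_eq_square)
    also have "\<dots> \<le> norm (B (Vn n) d) * norm d" by (rule norm_cauchy_schwarz)
    finally have "norm d \<le> norm (B (Vn n) d)" using False by (simp add: d_def)
    also have "\<dots> = (1 / h) * norm (Es (Vn n (E \<kappa>) - V (E \<kappa>)))" unfolding Bd using h by simp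
    finally show ?thesis unfolding d_def .
  qed (use h in simp)
  have "(\<lambda>n. \<kappa>n n - \<kappa>) \<longlonglongrightarrow> 0"
    by (rule Lim_null_comparison[OF always_eventually[OF allI[OF bound]]])
      (intro tendsto_mult_right_zero tendsto_norm_zero conv)
  then have lim: "\<kappa>n \<longlonglongrightarrow> \<kappa>" by (simp add: LIM_zero_iff)
  have J: "m_dissipative.J (wave_graph V) h z = (p + h *\<^sub>R \<kappa>, E \<kappa>)"
    unfolding pq(1) by (rule wave_J[OF V h pq(2,3)]) (use \<kappa> in \<open>simp add: B_def r_def\<close>)
  have Jn: "m_dissipative.J (wave_graph (Vn n)) h z = (p + h *\<^sub>R \<kappa>n n, E (\<kappa>n n))" for n
    unfolding pq(1) by (rule wave_J[OF Vn h pq(2,3)]) (use \<kappa>n in \<open>simp add: B_def r_def\<close>)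
  show ?thesis unfolding J Jn
    by (intro tendsto_intros lim bounded_linear.tendsto[OF E_lin])
qed

lemma wave_semigroup_convergence:
  assumes "damping V" "\<And>n. damping (Vn n)" "x \<in> G \<times> L" "0 < t"
    and "\<And>f. (\<lambda>n. Es (Vn n f - V f)) \<longlonglongrightarrow> 0"
  shows "(\<lambda>n. m_dissipative.S (wave_graph (Vn n)) t x) \<longlonglongrightarrow> m_dissipative.S (wave_graph V) t x"
  by (rule semigroup_convergence[where X="G \<times> L"])
    (use assms in \<open>auto intro!: m_dissipative_wave wave_J_convergence\<close>)

text \<open>The lower decay bound is available on the domain. A domain element that is closer to
  \<open>(0, f)\<close> than the norm of \<open>(0, f)\<close> cannot be 0, and its trajectory stays
  away from 0.\<close>

lemma wave_semigroup_nonzero: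
  assumes V: "damping V" and K: "0 \<le> K" "\<And>f. V f \<bullet> f \<le> K * (norm f)\<^sup>2" and t: "0 < t"
    and L0: "\<exists>f\<in>L. f \<noteq> 0"
  shows "\<exists>x\<in>G \<times> L. m_dissipative.S (wave_graph V) t x \<noteq> 0"
proof -
  interpret m_dissipative "G \<times> L" "wave_graph V" by (rule m_dissipative_wave[OF V])
  obtain f where f: "f \<in> L" "f \<noteq> 0" using L0 by blast
  have m: "(0, f) \<in> G \<times> L" using f subspace_0[OF G(2)] by simp
  have n: "0 < norm (0 :: 'g, f)" using f(2) by simp
  obtain x y where xy: "(x, y) \<in> wave_graph V" "norm ((0, f) - x) < norm (0 :: 'g, f)"
    by (rule dense_approx[OF m n])
  have x0: "x \<noteq> 0" using xy(2) by auto
  have "exp (- 2 * K * t) * (norm x)\<^sup>2 \<le> (norm (S t x))\<^sup>2"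
  proof (rule contraction_semigroup_lower_bound[OF contraction_semigroup_S subspace_X K(1) _ _ t])
    show "(x, y) \<in> generator_graph (G \<times> L) norm S" unfolding generator_graph_S by (rule xy(1))
    fix x y assume "(x, y) \<in> generator_graph (G \<times> L) norm S"
    then have "(x, y) \<in> wave_graph V" unfolding generator_graph_S .
    then have "y \<bullet> x = - (V (snd x) \<bullet> snd x)" by (rule wave_inner)
    moreover have "K * (norm (snd x))\<^sup>2 \<le> K * (norm x)\<^sup>2"
      using norm_snd_le[of "snd x" "fst x"] K(1) by (intro mult_left_mono power_mono) auto
    ultimately show "- K * (norm x)\<^sup>2 \<le> y \<bullet> x" using K(2)[of "snd x"] by simp
  qed
  moreover have "0 < exp (- 2 * K * t) * (norm x)\<^sup>2" using x0 by simp
  ultimately have "S t x \<noteq> 0" by auto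
  then show ?thesis using \<Gamma>_X(1)[OF xy(1)] by blast
qed

end

instance L2 :: (euclidean_space) banach ..

section \<open>The inverse gradient, its adjoint and the energy space\<close>

context weighted_domain
begin

definition G :: "((real^'n) L2 ^ 'n) set" where "G = snd ` Z"

definition inv_grad :: "(real^'n) L2 ^ 'n \<Rightarrow> (real^'n) L2" where
  "inv_grad g = (THE u. (u, g) \<in> Z)"

lemma Z_0: "(0, 0) \<in> Z"
  using subspace_0[OF subspace_Z] by (simp add: zero_prod_def)

lemma Z_inj: assumes "(u, g) \<in> Z" "(u', g) \<in> Z" shows "u = u'"
proof -
  obtain C where "0 < C" "\<And>u g. (u, g) \<in> Z \<Longrightarrow> norm u \<le> C * norm g" using poincare by blast
  moreover have "(u - u', 0) \<in> Z" using subspace_diff[OF subspace_Z assms] by simp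
  ultimately have "norm (u - u') \<le> C * norm (0 :: (real^'n) L2 ^ 'n)" by blast
  then show ?thesis by simp
qed

lemma inv_grad_eq: "(u, g) \<in> Z \<Longrightarrow> inv_grad g = u"
  unfolding inv_grad_def using Z_inj by blast

lemma inv_grad_Z: "g \<in> G \<Longrightarrow> (inv_grad g, g) \<in> Z"
  unfolding G_def using inv_grad_eq by auto

lemma subspace_G: "subspace G"
  unfolding G_def by (rule linear_subspace_image[OF bounded_linear.linear[OF bounded_linear_snd] subspace_Z])

text \<open>Along a convergent sequence of weighted gradients the functions themselves are Cauchy by
  the Poincare inequality, and \<open>Z\<close> is closed.\<close>

lemma closed_G: "closed G"
  unfolding closed_sequential_limits
proof (intro allI impI, elim conjE)
  fix g l assume g: "\<forall>n. g n \<in> G" "g \<longlonglongrightarrow> l"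
  obtain C where C: "0 < C" "\<And>u g. (u, g) \<in> Z \<Longrightarrow> norm u \<le> C * norm g" using poincare by blast
  define u where "u n = inv_grad (g n)" for n
  have Z: "(u n, g n) \<in> Z" for n unfolding u_def using g(1) inv_grad_Z by blast
  have "Cauchy u"
  proof (rule metric_CauchyI)
    fix e :: real assume "0 < e"
    then have "0 < e / C" using C(1) by simp
    moreover have "Cauchy g" using g(2) by (rule LIMSEQ_imp_Cauchy)
    ultimately obtain M where M: "\<And>m n. M \<le> m \<Longrightarrow> M \<le> n \<Longrightarrow> dist (g m) (g n) < e / C"
      using metric_CauchyD by blast
    have "dist (u m) (u n) < e" if "M \<le> m" "M \<le> n" for m n
    proof -
      have "(u m - u n, g m - g n) \<in> Z" using subspace_diff[OF subspace_Z Z Z] by simp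
      then have "norm (u m - u n) \<le> C * norm (g m - g n)" by (rule C(2))
      also have "\<dots> < C * (e / C)" using M[OF that] C(1) by (intro mult_strict_left_mono) (simp_all add: dist_norm)
      finally show ?thesis using C(1) by (simp add: dist_norm)
    qed
    then show "\<exists>M. \<forall>m\<ge>M. \<forall>n\<ge>M. dist (u m) (u n) < e" by blast
  qed
  then obtain w where "u \<longlonglongrightarrow> w" using Cauchy_convergent_iff convergent_def by blast
  then have lim: "(\<lambda>n. (u n, g n)) \<longlonglongrightarrow> (w, l)" using g(2) by (intro tendsto_Pair)
  have "(w, l) \<in> Z" by (rule closed_sequentially[OF closed_Z Z lim])
  then show "l \<in> G" unfolding G_def by force
qed

lemma Es_exists: "\<exists>r\<in>G. \<forall>h\<in>G. r \<bullet> h = f \<bullet> inv_grad h"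
proof -
  obtain C where C: "0 < C" "\<And>u g. (u, g) \<in> Z \<Longrightarrow> norm u \<le> C * norm g" using poincare by blast
  show ?thesis
  proof (rule riesz_closed_subspace[OF closed_G subspace_G])
    fix x y assume "x \<in> G" "y \<in> G"
    then have "(inv_grad x + inv_grad y, x + y) \<in> Z"
      using subspace_add[OF subspace_Z inv_grad_Z inv_grad_Z] by simp
    then show "f \<bullet> inv_grad (x + y) = f \<bullet> inv_grad x + f \<bullet> inv_grad y"
      by (simp add: inv_grad_eq inner_add_right)
  next
    fix c x assume "x \<in> G"
    then have "(c *\<^sub>R inv_grad x, c *\<^sub>R x) \<in> Z" using subspace_scale[OF subspace_Z inv_grad_Z] by simp
    then show "f \<bullet> inv_grad (c *\<^sub>R x) = c * (f \<bullet> inv_grad x)" by (simp add: inv_grad_eq)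
  next
    fix x assume "x \<in> G"
    have "\<bar>f \<bullet> inv_grad x\<bar> \<le> norm f * norm (inv_grad x)" by (rule Cauchy_Schwarz_ineq2)
    also have "\<dots> \<le> norm f * (C * norm x)" using C(2)[OF inv_grad_Z[OF \<open>x \<in> G\<close>]] by (intro mult_left_mono) auto
    finally show "\<bar>f \<bullet> inv_grad x\<bar> \<le> (norm f * C) * norm x" by (simp add: mult.assoc)
  qed
qed

text \<open>The weighted gradient of the weak solution of the Dirichlet problem with right-hand side
  \<open>f\<close>, obtained as a Riesz representative in the space \<open>G\<close> of weighted
  gradients.\<close>

definition Es :: "(real^'n) L2 \<Rightarrow> (real^'n) L2 ^ 'n" where
  "Es f = (SOME r. r \<in> G \<and> (\<forall>h\<in>G. r \<bullet> h = f \<bullet> inv_grad h))"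

lemma Es: "Es f \<in> G" "h \<in> G \<Longrightarrow> Es f \<bullet> h = f \<bullet> inv_grad h"
proof -
  have "Es f \<in> G \<and> (\<forall>h\<in>G. Es f \<bullet> h = f \<bullet> inv_grad h)"
    unfolding Es_def by (rule someI_ex) (use Es_exists in blast)
  then show "Es f \<in> G" "h \<in> G \<Longrightarrow> Es f \<bullet> h = f \<bullet> inv_grad h" by auto
qed

lemma Es_eqI:
  assumes "r \<in> G" "\<And>h. h \<in> G \<Longrightarrow> r \<bullet> h = f \<bullet> inv_grad h"
  shows "Es f = r"
proof -
  have d: "Es f - r \<in> G" using Es(1) assms(1) by (rule subspace_diff[OF subspace_G])
  have "(Es f - r) \<bullet> (Es f - r) = 0"
    using Es(2)[OF d] assms(2)[OF d] by (simp add: inner_diff_left)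
  then show ?thesis by simp
qed

definition proj_G :: "(real^'n) L2 ^ 'n \<Rightarrow> (real^'n) L2 ^ 'n" where
  "proj_G p = (SOME q. q \<in> G \<and> (\<forall>y\<in>G. q \<bullet> y = p \<bullet> y))"

lemma proj_G: "proj_G p \<in> G" "y \<in> G \<Longrightarrow> proj_G p \<bullet> y = p \<bullet> y"
proof -
  have "proj_G p \<in> G \<and> (\<forall>y\<in>G. proj_G p \<bullet> y = p \<bullet> y)"
    unfolding proj_G_def by (rule someI_ex) (use orthogonal_projection_exists[OF closed_G subspace_G] in blast)
  then show "proj_G p \<in> G" "y \<in> G \<Longrightarrow> proj_G p \<bullet> y = p \<bullet> y" by auto
qed

lemma proj_G_id: assumes "g \<in> G" shows "proj_G g = g"
proof -
  have "proj_G g - g \<in> G" using proj_G(1) assms by (rule subspace_diff[OF subspace_G])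
  from proj_G(2)[OF this, of g] have "(proj_G g - g) \<bullet> (proj_G g - g) = 0" by (simp add: inner_diff_left)
  then show ?thesis by simp
qed

text \<open>The projection extends the inverse gradient from \<open>G\<close> to the whole space.
  The adjointness with \<open>Es\<close> then holds for all arguments, and \<open>E\<close> is a
  bounded linear map on the type, as \<open>energy_pair\<close> demands.\<close>

definition E :: "(real^'n) L2 ^ 'n \<Rightarrow> (real^'n) L2" where
  "E p = inv_grad (proj_G p)"

lemma E_Es_adjoint: "E p \<bullet> f = p \<bullet> Es f"
proof -
  have "E p \<bullet> f = Es f \<bullet> proj_G p" unfolding E_def Es(2)[OF proj_G(1)] by (rule inner_commute)
  also have "\<dots> = p \<bullet> Es f" using proj_G(2)[OF Es(1)] by (simp add: inner_commute)
  finally show ?thesis .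
qed

lemma E_Z: "g \<in> G \<Longrightarrow> (E g, g) \<in> Z"
  unfolding E_def by (simp add: proj_G_id inv_grad_Z)

lemma E_eq: assumes "(u, g) \<in> Z" shows "E g = u"
proof -
  have "g \<in> G" using assms unfolding G_def by force
  then show ?thesis using E_Z Z_inj assms by blast
qed

lemma E_L2_on: "E p \<in> L2_on \<Omega>"
  unfolding E_def using Z_L2_on(1)[OF inv_grad_Z[OF proj_G(1)]] .

lemma Es_add: "Es (f + f') = Es f + Es f'"
  by (rule Es_eqI) (auto simp: Es inner_add_left intro: subspace_add[OF subspace_G])

lemma Es_scale: "Es (c *\<^sub>R f) = c *\<^sub>R Es f"
  by (rule Es_eqI) (auto simp: Es intro: subspace_scale[OF subspace_G])

lemma Es_E_bounded_linear: "bounded_linear Es" "bounded_linear E"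
proof -
  obtain C where C: "0 < C" "\<And>u g. (u, g) \<in> Z \<Longrightarrow> norm u \<le> C * norm g" using poincare by blast
  have Es_bound: "norm (Es f) \<le> norm f * C" for f
  proof (cases "Es f = 0")
    case False
    have "norm (Es f) * norm (Es f) = f \<bullet> inv_grad (Es f)"
      using Es(2)[OF Es(1), of f f] by (simp add: power2_norm_eq_inner flip: power2_eq_square)
    also have "\<dots> \<le> norm f * norm (inv_grad (Es f))" by (rule norm_cauchy_schwarz)
    also have "\<dots> \<le> norm f * (C * norm (Es f))" using C(2)[OF inv_grad_Z[OF Es(1)]] by (intro mult_left_mono) auto
    finally show ?thesis using False by (simp add: mult.assoc[symmetric])
  qed (use C in simp)
  show "bounded_linear Es"
    by (rule bounded_linear_intro[OF Es_add Es_scale Es_bound])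
  \<comment> \<open>A vector is determined by its inner products, so linearity of \<open>E\<close>
    can be read off the adjoint identity.\<close>
  have eqI: "a = b" if "\<And>f. a \<bullet> f = b \<bullet> f" for a b :: "(real^'n) L2"
    using that vector_eq_rdot[of a b] by blast
  have "norm (E p) \<le> norm p * C" for p
  proof (cases "E p = 0")
    case False
    have "norm (E p) * norm (E p) = p \<bullet> Es (E p)"
      unfolding E_Es_adjoint[symmetric] by (simp add: power2_norm_eq_inner flip: power2_eq_square)
    also have "\<dots> \<le> norm p * norm (Es (E p))" by (rule norm_cauchy_schwarz)
    also have "\<dots> \<le> norm p * (norm (E p) * C)" by (intro mult_left_mono Es_bound) auto
    finally show ?thesis using False by (simp add: mult_ac)
  qed (use C in simp)
  then show "bounded_linear E"
    by (intro bounded_linear_intro[where K=C] eqI) (auto simp: E_Es_adjoint inner_add_left)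
qed

sublocale energy_pair G "L2_on \<Omega>" E Es
proof (rule energy_pair.intro)
  show "g = 0" if "g \<in> G" "E g = 0" for g
    using E_Z[OF that(1)] that(2) Z_0 Z_functional by metis
  show "f = 0" if f: "f \<in> L2_on \<Omega>" and *: "\<And>g. g \<in> G \<Longrightarrow> E g \<bullet> f = 0" for f
  proof (rule L2_on_orthogonal_test_functions[OF open_\<Omega> f])
    fix \<phi> assume \<phi>: "\<phi> \<in> test_functions \<Omega>"
    note Z = test_in_Z[OF \<phi>]
    have "tgrad \<phi> \<in> G" using Z unfolding G_def by force
    then show "f \<bullet> abs_L2 \<phi> = 0" using *[of "tgrad \<phi>"] E_eq[OF Z] by (simp add: inner_commute)
  qed
qed (use closed_G subspace_G L2_on_closed subspace_L2_on Es_E_bounded_linear E_Es_adjoint E_L2_on Es(1) in auto)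

text \<open>Compactness of the embedding makes \<open>Es\<close> map bounded weakly null sequences to null sequences.\<close>

lemma Es_weakly_null:
  assumes bound: "\<And>n. norm (f n) \<le> B" and weak: "\<And>\<psi>. (\<lambda>n. f n \<bullet> \<psi>) \<longlonglongrightarrow> 0"
  shows "(\<lambda>n. Es (f n)) \<longlonglongrightarrow> 0"
proof -
  obtain C where C: "0 < C" "\<And>f. norm (Es f) \<le> norm f * C"
    using bounded_linear.pos_bounded[OF Es_E_bounded_linear(1)] by blast
  have u: "(\<lambda>n. E (Es (f n))) \<longlonglongrightarrow> 0"
  proof (rule Z_compact)
    show "(E (Es (f n)), Es (f n)) \<in> Z" for n by (rule E_Z[OF Es(1)])
    show "norm (Es (f n)) \<le> B * C" for n
      using C(2)[of "f n"] mult_right_mono[OF bound[of n], of C] C(1) by linarith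
    show "(\<lambda>n. E (Es (f n)) \<bullet> \<psi>) \<longlonglongrightarrow> 0" for \<psi>
    proof -
      \<comment> \<open>The composition of \<open>E\<close> with its adjoint is symmetric, so it
        maps weakly null sequences to weakly null ones.\<close>
      have "E (Es (f n)) \<bullet> \<psi> = f n \<bullet> E (Es \<psi>)" for n by (metis E_Es_adjoint inner_commute)
      then show ?thesis using weak[of "E (Es \<psi>)"] by simp
    qed
  qed
  have "(\<lambda>n. (norm (Es (f n)))\<^sup>2) \<longlonglongrightarrow> 0"
  proof (rule Lim_null_comparison)
    show "\<forall>\<^sub>F n in sequentially. norm ((norm (Es (f n)))\<^sup>2) \<le> B * norm (E (Es (f n)))"
    proof (intro always_eventually allI)
      fix n
      \<comment> \<open>Adjointness bounds the energy norm squared by the \<open>L2\<close> norm of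
        the solution times that of the data, which lifts the compactness from \<open>L2\<close> to
        the energy norm.\<close>
      have "(norm (Es (f n)))\<^sup>2 = E (Es (f n)) \<bullet> f n" unfolding E_Es_adjoint by (simp add: power2_norm_eq_inner)
      also have "\<dots> \<le> norm (E (Es (f n))) * norm (f n)" by (rule norm_cauchy_schwarz)
      also have "\<dots> \<le> norm (E (Es (f n))) * B" by (intro mult_left_mono bound) simp
      finally show "norm ((norm (Es (f n)))\<^sup>2) \<le> B * norm (E (Es (f n)))" by (simp add: mult.commute)
    qed
    show "(\<lambda>n. B * norm (E (Es (f n)))) \<longlonglongrightarrow> 0"
      by (intro tendsto_mult_right_zero tendsto_norm_zero u)
  qed
  from tendsto_real_sqrt[OF this] have "(\<lambda>n. norm (Es (f n))) \<longlonglongrightarrow> 0" by simp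
  then show ?thesis by (rule tendsto_norm_zero_cancel)
qed

lemma Gr_G: "u \<in> H10w k \<alpha> \<Omega> \<Longrightarrow> Gr u \<in> G"
  using H10w_Z unfolding G_def by force

lemma E_Gr: "u \<in> H10w k \<alpha> \<Omega> \<Longrightarrow> E (Gr u) = u"
  by (rule E_eq[OF H10w_Z])

lemma E_H10w: "g \<in> G \<Longrightarrow> E g \<in> H10w k \<alpha> \<Omega>"
  by (rule Z_H10w[OF E_Z])

lemma Gr_E: "g \<in> G \<Longrightarrow> Gr (E g) = g"
  using Z_H1w(2)[OF E_Z] .

lemma subspace_H10w: "subspace (H10w k \<alpha> \<Omega>)"
proof -
  have "H10w k \<alpha> \<Omega> = fst ` Z" using H10w_iff by force
  then show ?thesis using linear_subspace_image[OF bounded_linear.linear[OF bounded_linear_fst] subspace_Z] by simp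
qed

lemma Gr_add: assumes "u \<in> H10w k \<alpha> \<Omega>" "v \<in> H10w k \<alpha> \<Omega>" shows "Gr (u + v) = Gr u + Gr v"
  using Z_H1w(2)[of "u + v" "Gr u + Gr v"] subspace_add[OF subspace_Z H10w_Z[OF assms(1)] H10w_Z[OF assms(2)]] by simp

lemma Gr_scale: assumes "u \<in> H10w k \<alpha> \<Omega>" shows "Gr (c *\<^sub>R u) = c *\<^sub>R Gr u"
  using Z_H1w(2)[of "c *\<^sub>R u" "c *\<^sub>R Gr u"] subspace_scale[OF subspace_Z H10w_Z[OF assms(1)], of c] by simp

text \<open>The variational form of the equation is the property that characterizes
  \<open>Es f\<close> among weighted gradients. Hence \<open>Es\<close> composed with
  \<open>deg_op\<close> is the weighted gradient on the domain of the operator.\<close>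

lemma has_neg_div_Es:
  assumes u: "u \<in> H10w k \<alpha> \<Omega>"
  shows "has_neg_div k \<alpha> \<Omega> u f \<longleftrightarrow> Gr u = Es f"
proof
  assume "has_neg_div k \<alpha> \<Omega> u f"
  then have *: "\<And>w h. (w, h) \<in> Z \<Longrightarrow> Gr u \<bullet> h = f \<bullet> w" using has_neg_div_iff[OF u] by auto
  show "Gr u = Es f" by (rule Es_eqI[symmetric, OF Gr_G[OF u] *[OF inv_grad_Z]])
next
  assume e: "Gr u = Es f"
  have "Es f \<bullet> h = f \<bullet> w" if "(w, h) \<in> Z" for w h
  proof -
    have "h \<in> G" using that unfolding G_def by force
    then show ?thesis using Es(2) inv_grad_eq[OF that] by simp
  qed
  then show "has_neg_div k \<alpha> \<Omega> u f" unfolding has_neg_div_iff[OF u] e by auto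
qed

lemma Es_inj: assumes "f \<in> L2_on \<Omega>" "f' \<in> L2_on \<Omega>" "Es f = Es f'" shows "f = f'"
proof -
  have "f - f' = 0"
  proof (rule E_dense)
    show "f - f' \<in> L2_on \<Omega>" using assms by (intro subspace_diff[OF subspace_L2_on])
    show "E g \<bullet> (f - f') = 0" for g using assms(3) by (simp add: inner_diff_right E_Es_adjoint)
  qed
  then show ?thesis by simp
qed

lemma dom_op_iff: "u \<in> dom_op k \<alpha> \<Omega> \<longleftrightarrow> u \<in> H10w k \<alpha> \<Omega> \<and> (\<exists>f\<in>L2_on \<Omega>. Gr u = Es f)"
  unfolding dom_op_def by (auto simp: has_neg_div_Es)

lemma deg_op_eq:
  assumes "u \<in> H10w k \<alpha> \<Omega>" "f \<in> L2_on \<Omega>" "Gr u = Es f"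
  shows "deg_op k \<alpha> \<Omega> u = f"
  unfolding deg_op_def has_neg_div_Es[OF assms(1)]
proof (rule the_equality)
  show "f \<in> L2_on \<Omega> \<and> Gr u = Es f" using assms(2,3) by (rule conjI)
  fix f' assume f': "f' \<in> L2_on \<Omega> \<and> Gr u = Es f'"
  show "f' = f" by (rule Es_inj[OF conjunct1[OF f'] assms(2) trans[OF sym[OF conjunct2[OF f']] assms(3)]])
qed

definition to_state :: "'n state \<Rightarrow> ((real^'n) L2 ^ 'n) \<times> (real^'n) L2" where
  "to_state x = (Gr (fst x), snd x)"

definition from_state :: "((real^'n) L2 ^ 'n) \<times> (real^'n) L2 \<Rightarrow> 'n state" where
  "from_state y = (E (fst y), snd y)"

lemma to_state: "x \<in> energy_space k \<alpha> \<Omega> \<Longrightarrow> to_state x \<in> G \<times> L2_on \<Omega>"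
  "x \<in> energy_space k \<alpha> \<Omega> \<Longrightarrow> from_state (to_state x) = x"
  by (auto simp: to_state_def from_state_def energy_space_def Gr_G E_Gr)

lemma from_state: "y \<in> G \<times> L2_on \<Omega> \<Longrightarrow> from_state y \<in> energy_space k \<alpha> \<Omega>"
  "y \<in> G \<times> L2_on \<Omega> \<Longrightarrow> to_state (from_state y) = y"
  by (auto simp: to_state_def from_state_def energy_space_def E_H10w Gr_E)

lemma energy_norm_to_state: "x \<in> energy_space k \<alpha> \<Omega> \<Longrightarrow> energy_norm k \<alpha> \<Omega> x = norm (to_state x)"
  by (auto simp: energy_norm_def energy_inner_def energy_space_def to_state_def norm_eq_sqrt_inner energy_form_eq H10w_def)

lemma subspace_energy_space: "subspace (energy_space k \<alpha> \<Omega>)"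
  unfolding energy_space_def by (intro subspace_Times subspace_H10w subspace_L2_on)

lemma to_state_linear:
  "x \<in> energy_space k \<alpha> \<Omega> \<Longrightarrow> y \<in> energy_space k \<alpha> \<Omega> \<Longrightarrow> to_state (x + y) = to_state x + to_state y"
  "x \<in> energy_space k \<alpha> \<Omega> \<Longrightarrow> to_state (c *\<^sub>R x) = c *\<^sub>R to_state x"
  by (auto simp: energy_space_def to_state_def Gr_add Gr_scale)

lemma from_state_linear:
  "from_state (x + y) = from_state x + from_state y" "from_state (c *\<^sub>R x) = c *\<^sub>R from_state x"
  using linear_add[OF bounded_linear.linear[OF Es_E_bounded_linear(2)]]
    linear_scale[OF bounded_linear.linear[OF Es_E_bounded_linear(2)]]
  by (auto simp: from_state_def)

text \<open>The correspondence is \<open>\<kappa> = Gr v\<close> and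
  \<open>w = deg_op k \<alpha> \<Omega> u\<close>, with inverse \<open>u = E (Es w)\<close> and
  \<open>v = E \<kappa>\<close>; the minus sign in front of \<open>damped_op\<close> yields the
  second component of \<open>wave_pair\<close>.\<close>

lemma damped_graph_to_state:
  assumes V: "damping (mult_L2 \<Omega> V)"
  shows "(\<lambda>p. (to_state (fst p), to_state (snd p))) ` {(x, - damped_op k \<alpha> \<Omega> V x) | x. x \<in> dom_op k \<alpha> \<Omega> \<times> H10w k \<alpha> \<Omega>}
    = wave_graph (mult_L2 \<Omega> V)"
proof (intro equalityI subsetI)
  fix p assume "p \<in> (\<lambda>p. (to_state (fst p), to_state (snd p))) ` {(x, - damped_op k \<alpha> \<Omega> V x) | x. x \<in> dom_op k \<alpha> \<Omega> \<times> H10w k \<alpha> \<Omega>}"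
  then obtain u v where uv: "u \<in> dom_op k \<alpha> \<Omega>" "v \<in> H10w k \<alpha> \<Omega>"
    and p: "p = (to_state (u, v), to_state (- damped_op k \<alpha> \<Omega> V (u, v)))" by auto
  obtain f where f: "u \<in> H10w k \<alpha> \<Omega>" "f \<in> L2_on \<Omega>" "Gr u = Es f" using uv(1) by (auto simp: dom_op_iff)
  have "p = wave_pair (mult_L2 \<Omega> V) (Gr v, f)"
    unfolding p by (simp add: to_state_def wave_pair_def damped_op_def deg_op_eq[OF f] f(3) E_Gr[OF uv(2)])
  then show "p \<in> wave_graph (mult_L2 \<Omega> V)"
    unfolding wave_graph_def using Gr_G[OF uv(2)] f(2) by auto
next
  fix p assume "p \<in> wave_graph (mult_L2 \<Omega> V)"
  then obtain \<kappa> w where kw: "\<kappa> \<in> G" "w \<in> L2_on \<Omega>" "p = wave_pair (mult_L2 \<Omega> V) (\<kappa>, w)"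
    by (auto simp: wave_graph_def)
  have u: "E (Es w) \<in> H10w k \<alpha> \<Omega>" "Gr (E (Es w)) = Es w" using E_H10w Gr_E Es(1) by auto
  have d: "E (Es w) \<in> dom_op k \<alpha> \<Omega>" unfolding dom_op_iff using u kw(2) by auto
  have pe: "p = (to_state (E (Es w), E \<kappa>), to_state (- damped_op k \<alpha> \<Omega> V (E (Es w), E \<kappa>)))"
    unfolding kw(3) by (simp add: to_state_def wave_pair_def damped_op_def deg_op_eq[OF u(1) kw(2) u(2)] u(2) Gr_E[OF kw(1)])
  have "(E (Es w), E \<kappa>) \<in> dom_op k \<alpha> \<Omega> \<times> H10w k \<alpha> \<Omega>" using d E_H10w[OF kw(1)] by simp
  then have m: "((E (Es w), E \<kappa>), - damped_op k \<alpha> \<Omega> V (E (Es w), E \<kappa>))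
      \<in> {(x, - damped_op k \<alpha> \<Omega> V x) | x. x \<in> dom_op k \<alpha> \<Omega> \<times> H10w k \<alpha> \<Omega>}" by blast
  show "p \<in> (\<lambda>p. (to_state (fst p), to_state (snd p))) ` {(x, - damped_op k \<alpha> \<Omega> V x) | x. x \<in> dom_op k \<alpha> \<Omega> \<times> H10w k \<alpha> \<Omega>}"
    by (rule rev_image_eqI[OF m]) (simp add: pe)
qed

end

text \<open>Semigroups and generators are carried along a linear isometry with linear inverse. It is
  applied in both directions: to obtain a semigroup on the energy space, and to bring the chosen one
  back for the uniqueness argument.\<close>

lemma semigroup_transport:
  assumes S: "contraction_semigroup X nX S" and X: "subspace X"
    and \<Phi>: "\<And>x. x \<in> X \<Longrightarrow> \<Phi> x \<in> Y" "\<And>x. x \<in> X \<Longrightarrow> \<Psi> (\<Phi> x) = x"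
    and \<Psi>: "\<And>y. y \<in> Y \<Longrightarrow> \<Psi> y \<in> X" "\<And>y. y \<in> Y \<Longrightarrow> \<Phi> (\<Psi> y) = y"
    and nrm: "\<And>x. x \<in> X \<Longrightarrow> nX x = nY (\<Phi> x)"
    and lin: "\<And>x x'. x \<in> X \<Longrightarrow> x' \<in> X \<Longrightarrow> \<Phi> (x + x') = \<Phi> x + \<Phi> x'"
      "\<And>c x. x \<in> X \<Longrightarrow> \<Phi> (c *\<^sub>R x) = c *\<^sub>R \<Phi> x"
    and lin': "\<And>x x'. x \<in> Y \<Longrightarrow> x' \<in> Y \<Longrightarrow> \<Psi> (x + x') = \<Psi> x + \<Psi> x'"
      "\<And>c x. x \<in> Y \<Longrightarrow> \<Psi> (c *\<^sub>R x) = c *\<^sub>R \<Psi> x"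
  shows "contraction_semigroup Y nY (\<lambda>t y. \<Phi> (S t (\<Psi> y)))"
    and "generator_graph Y nY (\<lambda>t y. \<Phi> (S t (\<Psi> y))) = (\<lambda>p. (\<Phi> (fst p), \<Phi> (snd p))) ` generator_graph X nX S"
proof -
  have SX: "S t x \<in> X" if "x \<in> X" "0 \<le> t" for t x using S that by (auto simp: contraction_semigroup_def)
  have d: "\<Phi> (x - x') = \<Phi> x - \<Phi> x'" if "x \<in> X" "x' \<in> X" for x x'
    using lin(1)[OF that(1) subspace_scale[OF X that(2), of "-1"]] lin(2)[OF that(2), of "-1"] by simp
  have sX: "x - x' \<in> X" "c *\<^sub>R x \<in> X" if "x \<in> X" "x' \<in> X" for x x' c
    using that X by (auto intro: subspace_diff subspace_scale)
  have pos: "\<forall>\<^sub>F t::real in at_right 0. 0 < t" by (simp add: eventually_at_right_less)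
  show "contraction_semigroup Y nY (\<lambda>t y. \<Phi> (S t (\<Psi> y)))"
    unfolding contraction_semigroup_def
  proof (intro conjI allI impI ballI)
    fix t :: real and x assume t: "0 \<le> t" and x: "x \<in> Y"
    show "\<Phi> (S t (\<Psi> x)) \<in> Y" by (rule \<Phi>(1)[OF SX[OF \<Psi>(1)[OF x] t]])
    have "nX (S t (\<Psi> x)) \<le> nX (\<Psi> x)" using S t \<Psi>(1)[OF x] by (auto simp: contraction_semigroup_def)
    then show "nY (\<Phi> (S t (\<Psi> x))) \<le> nY x"
      using nrm[OF SX[OF \<Psi>(1)[OF x] t]] nrm[OF \<Psi>(1)[OF x]] \<Psi>(2)[OF x] by simp
  next
    fix t :: real and x y assume t: "0 \<le> t" and x: "x \<in> Y" and y: "y \<in> Y"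
    have "S t (\<Psi> x + \<Psi> y) = S t (\<Psi> x) + S t (\<Psi> y)"
      using S t \<Psi>(1)[OF x] \<Psi>(1)[OF y] by (auto simp: contraction_semigroup_def)
    then show "\<Phi> (S t (\<Psi> (x + y))) = \<Phi> (S t (\<Psi> x)) + \<Phi> (S t (\<Psi> y))"
      using lin(1)[OF SX[OF \<Psi>(1)[OF x] t] SX[OF \<Psi>(1)[OF y] t]] lin'(1)[OF x y] by simp
  next
    fix t c :: real and x assume t: "0 \<le> t" and x: "x \<in> Y"
    have "S t (c *\<^sub>R \<Psi> x) = c *\<^sub>R S t (\<Psi> x)" using S t \<Psi>(1)[OF x] by (auto simp: contraction_semigroup_def)
    then show "\<Phi> (S t (\<Psi> (c *\<^sub>R x))) = c *\<^sub>R \<Phi> (S t (\<Psi> x))"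
      using lin(2)[OF SX[OF \<Psi>(1)[OF x] t]] lin'(2)[OF x] by simp
  next
    fix x assume x: "x \<in> Y"
    have "S 0 (\<Psi> x) = \<Psi> x" using S \<Psi>(1)[OF x] by (auto simp: contraction_semigroup_def)
    then show "\<Phi> (S 0 (\<Psi> x)) = x" using \<Psi>(2)[OF x] by simp
  next
    fix s t :: real and x assume st: "0 \<le> s" "0 \<le> t" and x: "x \<in> Y"
    have "S (s + t) (\<Psi> x) = S s (S t (\<Psi> x))" using S st \<Psi>(1)[OF x] by (auto simp: contraction_semigroup_def)
    then show "\<Phi> (S (s + t) (\<Psi> x)) = \<Phi> (S s (\<Psi> (\<Phi> (S t (\<Psi> x)))))"
      using \<Phi>(2)[OF SX[OF \<Psi>(1)[OF x] st(2)]] by simp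
  next
    fix x assume x: "x \<in> Y"
    note \<Psi>x = \<Psi>(1)[OF x]
    have l: "((\<lambda>t. nX (S t (\<Psi> x) - \<Psi> x)) \<longlongrightarrow> 0) (at_right 0)" using S \<Psi>x by (auto simp: contraction_semigroup_def)
    have ev: "\<forall>\<^sub>F t in at_right 0. nX (S t (\<Psi> x) - \<Psi> x) = nY (\<Phi> (S t (\<Psi> x)) - x)"
      using pos
    proof eventually_elim
      case (elim t)
      then have "S t (\<Psi> x) \<in> X" by (intro SX \<Psi>x) simp
      then show ?case using nrm[OF sX(1)[OF _ \<Psi>x]] d[OF _ \<Psi>x] \<Psi>(2)[OF x] by simp
    qed
    show "((\<lambda>t. nY (\<Phi> (S t (\<Psi> x)) - x)) \<longlongrightarrow> 0) (at_right 0)"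
      by (rule Lim_transform_eventually[OF l ev])
  qed
  have key: "((\<lambda>t. nX ((1 / t) *\<^sub>R (S t x - x) - y)) \<longlongrightarrow> 0) (at_right 0)
     \<longleftrightarrow> ((\<lambda>t. nY ((1 / t) *\<^sub>R (\<Phi> (S t (\<Psi> (\<Phi> x))) - \<Phi> x) - \<Phi> y)) \<longlongrightarrow> 0) (at_right 0)" if x: "x \<in> X" and y: "y \<in> X" for x y
  proof (rule filterlim_cong[OF refl refl])
    show "\<forall>\<^sub>F t in at_right 0. nX ((1 / t) *\<^sub>R (S t x - x) - y) = nY ((1 / t) *\<^sub>R (\<Phi> (S t (\<Psi> (\<Phi> x))) - \<Phi> x) - \<Phi> y)"
      using pos
    proof eventually_elim
      case (elim t)
      then have a: "S t x \<in> X" by (intro SX x) simp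
      have b: "S t x - x \<in> X" "(1 / t) *\<^sub>R (S t x - x) \<in> X" using sX a x by auto
      show ?case
        using nrm[OF sX(1)[OF b(2) y]] d[OF b(2) y] lin(2)[OF b(1), of "1 / t"] d[OF a x] \<Phi>(2)[OF x] by simp
    qed
  qed
  show "generator_graph Y nY (\<lambda>t y. \<Phi> (S t (\<Psi> y))) = (\<lambda>p. (\<Phi> (fst p), \<Phi> (snd p))) ` generator_graph X nX S"
  proof (intro equalityI subrelI)
    fix x y assume "(x, y) \<in> generator_graph Y nY (\<lambda>t y. \<Phi> (S t (\<Psi> y)))"
    then have Y: "x \<in> Y" "y \<in> Y" and l: "((\<lambda>t. nY ((1 / t) *\<^sub>R (\<Phi> (S t (\<Psi> x)) - x) - y)) \<longlongrightarrow> 0) (at_right 0)"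
      by (auto simp: generator_graph_def)
    have "(\<Psi> x, \<Psi> y) \<in> generator_graph X nX S"
      unfolding generator_graph_def using key[OF \<Psi>(1)[OF Y(1)] \<Psi>(1)[OF Y(2)]] l Y by (simp add: \<Psi>)
    then show "(x, y) \<in> (\<lambda>p. (\<Phi> (fst p), \<Phi> (snd p))) ` generator_graph X nX S"
      by (rule rev_image_eqI) (simp add: \<Psi> Y)
  next
    fix x y assume "(x, y) \<in> (\<lambda>p. (\<Phi> (fst p), \<Phi> (snd p))) ` generator_graph X nX S"
    then obtain a b where ab: "(a, b) \<in> generator_graph X nX S" "x = \<Phi> a" "y = \<Phi> b" by auto
    then have "a \<in> X" "b \<in> X" "((\<lambda>t. nX ((1 / t) *\<^sub>R (S t a - a) - b)) \<longlongrightarrow> 0) (at_right 0)"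
      by (auto simp: generator_graph_def)
    then show "(x, y) \<in> generator_graph Y nY (\<lambda>t y. \<Phi> (S t (\<Psi> y)))"
      unfolding generator_graph_def ab using key[of a b] by (simp add: \<Phi>(1))
  qed
qed

section \<open>Admissible dampings\<close>

lemma square_integrable_AE_bounded_mult:
  assumes f: "square_integrable f" and m: "m \<in> borel_measurable lebesgue" and C: "AE x in lebesgue. \<bar>m x\<bar> \<le> C"
  shows "square_integrable (\<lambda>x. m x * f x)"
  unfolding square_integrable_def
proof
  show mm: "(\<lambda>x. m x * f x) \<in> borel_measurable lebesgue"
    using f m by (intro borel_measurable_times) (auto simp: square_integrable_def)
  show "integrable lebesgue (\<lambda>x. (m x * f x)\<^sup>2)"
  proof (rule Bochner_Integration.integrable_bound)
    show "integrable lebesgue (\<lambda>x. C\<^sup>2 * (f x)\<^sup>2)"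
      using f by (intro integrable_mult_right) (auto simp: square_integrable_def)
    show "(\<lambda>x. (m x * f x)\<^sup>2) \<in> borel_measurable lebesgue" using mm by (rule borel_measurable_power)
    show "AE x in lebesgue. norm ((m x * f x)\<^sup>2) \<le> norm (C\<^sup>2 * (f x)\<^sup>2)"
      using C
    proof eventually_elim
      case (elim x)
      have "(m x)\<^sup>2 \<le> C\<^sup>2" using power_mono[OF elim, of 2] by simp
      then show ?case by (simp add: power_mult_distrib mult_right_mono)
    qed
  qed
qed

context weighted_domain
begin

definition cut :: "(real^'n \<Rightarrow> real) \<Rightarrow> real^'n \<Rightarrow> real" where
  "cut V x = indicator \<Omega> x * V x"

text \<open>The constant 1 on \<Omega>. Multiplying it by a damping embeds the dampings in
  \<open>L2\<close>, where bounded sequences have weakly convergent subsequences.\<close>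

definition one :: "(real^'n) L2" where
  "one = abs_L2 (indicator \<Omega>)"

lemma indicator_square_integrable:
  assumes "A \<in> sets lebesgue" "A \<subseteq> \<Omega>"
  shows "square_integrable (indicator A :: real^'n \<Rightarrow> real)"
proof -
  have i: "square_integrable (indicator \<Omega> :: real^'n \<Rightarrow> real)"
    using bounded_\<Omega> by (intro square_integrable_indicator emeasure_bounded_finite) auto
  have "(\<lambda>x. if x \<in> A then indicator \<Omega> x else 0) = (indicator A :: real^'n \<Rightarrow> real)"
    by (rule ext) (use assms(2) in \<open>auto simp: indicator_def\<close>)
  with square_integrable_restrict[OF i assms(1)] show ?thesis by simp
qed

lemma one_L2_on: "one \<in> L2_on \<Omega>"
  unfolding one_def by (intro abs_L2_on indicator_square_integrable) auto

lemma one_nonzero: assumes "\<Omega> \<noteq> {}" shows "one \<noteq> 0"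
proof
  assume "one = 0"
  then have "AE x in lebesgue. (indicator \<Omega> x :: real) = 0"
    using rep_L2_abs_L2[OF indicator_square_integrable[of \<Omega>]] rep_L2_zero unfolding one_def by auto
  then have "AE x in lebesgue. x \<notin> \<Omega>" by eventually_elim (auto simp: indicator_def)
  then have "\<Omega> \<in> null_sets lebesgue" by (simp add: AE_iff_null_sets)
  then have "negligible \<Omega>" by (simp add: negligible_iff_null_sets)
  then show False using open_not_negligible[OF open_\<Omega> assms] by simp
qed

lemma mult_L2_cut: "mult_L2 \<Omega> V f = abs_L2 (\<lambda>x. cut V x * rep_L2 f x)"
proof -
  have "(\<lambda>x. if x \<in> \<Omega> then V x * rep_L2 f x else 0) = (\<lambda>x. cut V x * rep_L2 f x)"
    by (rule ext) (auto simp: cut_def indicator_def)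
  then show ?thesis by (simp add: mult_L2_def)
qed

end

locale admissible_parameters = weighted_domain k \<alpha> \<Omega>
  for k :: "'n::finite" and \<alpha> :: real and \<Omega> :: "(real^'n) set" +
  fixes H K \<beta> :: real
  assumes HK: "0 < H" "H < K" and \<beta>: "H < \<beta>" "\<beta> < K" and nonempty: "\<Omega> \<noteq> {}"
begin

abbreviation Adm where "Adm \<equiv> admissible_dampings \<Omega> H K \<beta>"

lemma admissible_cut:
  assumes "V \<in> Adm"
  shows "cut V \<in> borel_measurable lebesgue" "AE x in lebesgue. 0 \<le> cut V x \<and> cut V x \<le> K"
    "AE x in lebesgue. x \<in> \<Omega> \<longrightarrow> H \<le> cut V x" "AE x in lebesgue. \<bar>cut V x\<bar> \<le> K"
    "(LINT x|lebesgue. cut V x) = \<beta> * measure lebesgue \<Omega>"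
proof -
  have V: "V \<in> borel_measurable (lebesgue_on \<Omega>)" "AE x in lebesgue_on \<Omega>. H \<le> V x \<and> V x \<le> K"
    "(LINT x|lebesgue_on \<Omega>. V x) = \<beta> * measure lebesgue \<Omega>"
    using assms by (auto simp: admissible_dampings_def)
  show "cut V \<in> borel_measurable lebesgue"
    using V(1) by (subst (asm) borel_measurable_restrict_space_iff) (auto simp: cut_def[abs_def])
  have ae: "AE x in lebesgue. x \<in> \<Omega> \<longrightarrow> H \<le> V x \<and> V x \<le> K"
    using V(2) by (subst (asm) AE_restrict_space_iff) auto
  then show b: "AE x in lebesgue. 0 \<le> cut V x \<and> cut V x \<le> K"
    by eventually_elim (use HK in \<open>auto simp: cut_def indicator_def\<close>)
  then show "AE x in lebesgue. \<bar>cut V x\<bar> \<le> K" by eventually_elim auto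
  show "AE x in lebesgue. x \<in> \<Omega> \<longrightarrow> H \<le> cut V x"
    using ae by eventually_elim (auto simp: cut_def)
  have "(LINT x|lebesgue_on \<Omega>. V x) = (LINT x|lebesgue. indicator \<Omega> x *\<^sub>R V x)"
    by (rule integral_restrict_space) auto
  then show "(LINT x|lebesgue. cut V x) = \<beta> * measure lebesgue \<Omega>" using V(3) by (simp add: cut_def)
qed

lemma admissible_square_integrable:
  assumes "V \<in> Adm" "square_integrable f"
  shows "square_integrable (\<lambda>x. cut V x * f x)"
  by (rule square_integrable_AE_bounded_mult[OF assms(2) admissible_cut(1)[OF assms(1)] admissible_cut(4)[OF assms(1)]])

lemma inner_mult_L2:
  assumes V: "V \<in> Adm"
  shows "mult_L2 \<Omega> V f \<bullet> \<psi> = (LINT x|lebesgue. cut V x * (rep_L2 f x * rep_L2 \<psi> x))"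
  using inner_rep_abs_L2[OF admissible_square_integrable[OF V square_integrable_rep_L2], of \<psi> f]
  unfolding mult_L2_cut by (simp add: inner_commute mult_ac)

lemma mult_L2_symmetric: "V \<in> Adm \<Longrightarrow> mult_L2 \<Omega> V f \<bullet> \<psi> = f \<bullet> mult_L2 \<Omega> V \<psi>"
  using inner_mult_L2[of V f \<psi>] inner_mult_L2[of V \<psi> f] by (simp add: inner_commute mult_ac)

lemma integrable_cut_mult:
  assumes V: "V \<in> Adm" and \<eta>: "integrable lebesgue \<eta>"
  shows "integrable lebesgue (\<lambda>x. cut V x * \<eta> x)"
proof (rule Bochner_Integration.integrable_bound)
  show "integrable lebesgue (\<lambda>x. K * norm (\<eta> x))" using \<eta> by (intro integrable_mult_right integrable_norm)
  show "(\<lambda>x. cut V x * \<eta> x) \<in> borel_measurable lebesgue"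
    using \<eta> by (intro borel_measurable_times admissible_cut(1)[OF V]) auto
  show "AE x in lebesgue. norm (cut V x * \<eta> x) \<le> norm (K * norm (\<eta> x))"
    using admissible_cut(4)[OF V] by eventually_elim (use HK in \<open>auto simp: abs_mult intro!: mult_right_mono\<close>)
qed

lemma mult_L2_norm: assumes V: "V \<in> Adm" shows "norm (mult_L2 \<Omega> V f) \<le> norm f * K"
proof (rule power2_le_imp_le)
  note sq = admissible_square_integrable[OF V square_integrable_rep_L2[of f]]
  have "(norm (mult_L2 \<Omega> V f))\<^sup>2 = (LINT x|lebesgue. (cut V x * rep_L2 f x)\<^sup>2)"
    unfolding mult_L2_cut by (rule norm_abs_L2[OF sq])
  also have "\<dots> \<le> (LINT x|lebesgue. K\<^sup>2 * (rep_L2 f x)\<^sup>2)"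
  proof (rule integral_mono_AE)
    show "integrable lebesgue (\<lambda>x. K\<^sup>2 * (rep_L2 f x)\<^sup>2)"
      using square_integrable_rep_L2[of f] by (intro integrable_mult_right) (simp add: square_integrable_def)
    show "AE x in lebesgue. (cut V x * rep_L2 f x)\<^sup>2 \<le> K\<^sup>2 * (rep_L2 f x)\<^sup>2"
      using admissible_cut(4)[OF V]
    proof eventually_elim
      case (elim x)
      then show ?case using power_mono[OF elim, of 2] by (simp add: power_mult_distrib mult_right_mono)
    qed
  qed (use sq in \<open>simp add: square_integrable_def\<close>)
  also have "\<dots> = (norm f * K)\<^sup>2" by (simp add: norm_L2_eq power_mult_distrib)
  finally show "(norm (mult_L2 \<Omega> V f))\<^sup>2 \<le> (norm f * K)\<^sup>2" .
  show "0 \<le> norm f * K" using HK by simp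
qed

lemma mult_L2_form_bounds:
  assumes V: "V \<in> Adm"
  shows "0 \<le> mult_L2 \<Omega> V f \<bullet> f" "mult_L2 \<Omega> V f \<bullet> f \<le> K * (norm f)\<^sup>2"
proof -
  have i: "integrable lebesgue (\<lambda>x. rep_L2 f x * rep_L2 f x)"
    by (rule square_integrable_mult) auto
  show "0 \<le> mult_L2 \<Omega> V f \<bullet> f"
    unfolding inner_mult_L2[OF V]
    by (rule integral_nonneg_AE) (use admissible_cut(2)[OF V] in \<open>eventually_elim, auto\<close>)
  have "mult_L2 \<Omega> V f \<bullet> f \<le> (LINT x|lebesgue. K * (rep_L2 f x * rep_L2 f x))"
    unfolding inner_mult_L2[OF V]
    by (rule integral_mono_AE[OF integrable_cut_mult[OF V i] integrable_mult_right[OF i]])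
      (use admissible_cut(2)[OF V] in \<open>eventually_elim, auto intro!: mult_right_mono\<close>)
  then show "mult_L2 \<Omega> V f \<bullet> f \<le> K * (norm f)\<^sup>2"
    using norm_L2_eq[of f] by (simp add: power2_eq_square)
qed

lemma mult_L2_damping: assumes V: "V \<in> Adm" shows "damping (mult_L2 \<Omega> V)"
  unfolding damping_def
proof (intro conjI allI)
  \<comment> \<open>As for \<open>E\<close>, linearity comes from inner products, this time through
    the symmetry of the multiplication operator.\<close>
  have eqI: "a = b" if "\<And>f. a \<bullet> f = b \<bullet> f" for a b :: "(real^'n) L2"
    using that vector_eq_rdot[of a b] by blast
  show "bounded_linear (mult_L2 \<Omega> V)"
    by (rule bounded_linear_intro[OF eqI eqI mult_L2_norm[OF V]])
      (simp_all add: mult_L2_symmetric[OF V] inner_add_left)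
  show "mult_L2 \<Omega> V f \<in> L2_on \<Omega>" for f
    unfolding mult_L2_cut
    by (rule abs_L2_on[OF admissible_square_integrable[OF V]]) (auto simp: cut_def)
qed (rule mult_L2_form_bounds[OF V])

lemma constant_admissible: "(\<lambda>x. \<beta>) \<in> Adm"
proof -
  have "\<Omega> \<in> lmeasurable" using bounded_\<Omega> open_\<Omega> by (simp add: lmeasurable_open)
  then show ?thesis using \<beta> by (simp add: admissible_dampings_def measure_restrict_space space_restrict_space mult.commute)
qed

section \<open>Weak compactness of the admissible dampings\<close>

text \<open>Integrals over a measurable set \<open>A\<close> inside \<Omega> converge, so those of
  the limit stay between \<open>H\<close> and \<open>K\<close> times the measure of
  \<open>A\<close>. On the set where a bound fails this forces measure zero. The prescribed mean is
  the case where \<open>A\<close> is \<Omega>.\<close>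

lemma weak_limit_admissible:
  assumes V: "\<And>n. V n \<in> Adm"
    and lim: "\<And>y. (\<lambda>n. mult_L2 \<Omega> (V n) one \<bullet> y) \<longlonglongrightarrow> l \<bullet> y"
  shows "rep_L2 l \<in> Adm"
proof -
  have sqA: "square_integrable (indicator A :: real^'n \<Rightarrow> real)" if "A \<in> sets lebesgue" "A \<subseteq> \<Omega>" for A
    by (rule indicator_square_integrable[OF that])
  have ae1: "AE x in lebesgue. rep_L2 one x = indicator \<Omega> x"
    unfolding one_def by (rule rep_L2_abs_L2[OF sqA]) auto
  have iA: "integrable lebesgue (indicator A :: real^'n \<Rightarrow> real)" if A: "A \<in> sets lebesgue" "A \<subseteq> \<Omega>" for A
  proof -
    have "(\<lambda>x. (indicator A x)\<^sup>2) = (indicator A :: real^'n \<Rightarrow> real)" by (auto simp: indicator_def)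
    then show ?thesis using sqA[OF A] by (simp add: square_integrable_def)
  qed
  have inner_A: "mult_L2 \<Omega> (V n) one \<bullet> abs_L2 (indicator A) = (LINT x|lebesgue. cut (V n) x * indicator A x)"
    if A: "A \<in> sets lebesgue" "A \<subseteq> \<Omega>" for A n
  proof -
    have "mult_L2 \<Omega> (V n) one \<bullet> abs_L2 (indicator A) = (LINT x|lebesgue. rep_L2 (mult_L2 \<Omega> (V n) one) x * indicator A x)"
      by (rule inner_rep_abs_L2[OF sqA[OF A]])
    also have "\<dots> = (LINT x|lebesgue. cut (V n) x * indicator A x)"
    proof (rule integral_cong_AE)
      show "(\<lambda>x. rep_L2 (mult_L2 \<Omega> (V n) one) x * indicator A x) \<in> borel_measurable lebesgue"
        using A by (intro borel_measurable_times borel_measurable_indicator) auto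
      show "(\<lambda>x. cut (V n) x * indicator A x) \<in> borel_measurable lebesgue"
        using A by (intro borel_measurable_times borel_measurable_indicator admissible_cut(1)[OF V]) auto
      have "AE x in lebesgue. rep_L2 (mult_L2 \<Omega> (V n) one) x = cut (V n) x * rep_L2 one x"
        unfolding mult_L2_cut by (rule rep_L2_abs_L2[OF admissible_square_integrable[OF V square_integrable_rep_L2]])
      with ae1 show "AE x in lebesgue. rep_L2 (mult_L2 \<Omega> (V n) one) x * indicator A x = cut (V n) x * indicator A x"
        by eventually_elim (use A(2) in \<open>auto simp: indicator_def\<close>)
    qed
    finally show ?thesis .
  qed
  have l_A: "l \<bullet> abs_L2 (indicator A) = (LINT x|lebesgue. rep_L2 l x * indicator A x)"
    if A: "A \<in> sets lebesgue" "A \<subseteq> \<Omega>" for A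
    by (rule inner_rep_abs_L2[OF sqA[OF A]])
  have il: "integrable lebesgue (\<lambda>x. rep_L2 l x * indicator A x)" if A: "A \<in> sets lebesgue" "A \<subseteq> \<Omega>" for A
    by (rule square_integrable_mult[OF square_integrable_rep_L2 sqA[OF A]])
  have lower: "(LINT x|lebesgue. H * indicator A x) \<le> (LINT x|lebesgue. rep_L2 l x * indicator A x)"
    and upper: "(LINT x|lebesgue. rep_L2 l x * indicator A x) \<le> (LINT x|lebesgue. K * indicator A x)"
    if A: "A \<in> sets lebesgue" "A \<subseteq> \<Omega>" for A
  proof -
    note L = lim[of "abs_L2 (indicator A)", unfolded inner_A[OF A] l_A[OF A]]
    note i1 = integrable_mult_right[OF iA[OF A]] and i2 = integrable_cut_mult[OF V iA[OF A]]
    have "(LINT x|lebesgue. H * indicator A x) \<le> (LINT x|lebesgue. cut (V n) x * indicator A x)" for n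
      by (rule integral_mono_AE[OF i1 i2])
        (use admissible_cut(3)[OF V[of n]] in \<open>eventually_elim, use A(2) in \<open>auto simp: indicator_def\<close>\<close>)
    then show "(LINT x|lebesgue. H * indicator A x) \<le> (LINT x|lebesgue. rep_L2 l x * indicator A x)"
      using LIMSEQ_le_const[OF L] by blast
    have "(LINT x|lebesgue. cut (V n) x * indicator A x) \<le> (LINT x|lebesgue. K * indicator A x)" for n
      by (rule integral_mono_AE[OF i2 i1])
        (use admissible_cut(2)[OF V[of n]] in \<open>eventually_elim, auto simp: indicator_def\<close>)
    then show "(LINT x|lebesgue. rep_L2 l x * indicator A x) \<le> (LINT x|lebesgue. K * indicator A x)"
      using LIMSEQ_le_const2[OF L] by blast
  qed
  have m: "rep_L2 l \<in> borel_measurable lebesgue" by simp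
  have ae_H: "AE x in lebesgue. x \<in> \<Omega> \<longrightarrow> H \<le> rep_L2 l x"
  proof -
    \<comment> \<open>On the set where the lower bound fails the nonnegative function
      \<open>H - rep_L2 l\<close> has integral at most 0, so it vanishes almost everywhere
      there.\<close>
    define A where "A = {x \<in> space lebesgue. rep_L2 l x < H} \<inter> \<Omega>"
    have A: "A \<in> sets lebesgue" "A \<subseteq> \<Omega>" unfolding A_def using borel_measurable_less[OF m borel_measurable_const[of H]] by auto
    have int: "integrable lebesgue (\<lambda>x. H * indicator A x - rep_L2 l x * indicator A x)"
      by (intro Bochner_Integration.integrable_diff integrable_mult_right iA il A)
    have nn: "AE x in lebesgue. 0 \<le> H * indicator A x - rep_L2 l x * indicator A x"
      by (rule AE_I2) (auto simp: A_def indicator_def)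
    have "(LINT x|lebesgue. H * indicator A x - rep_L2 l x * indicator A x) \<le> 0"
      using lower[OF A] by (subst Bochner_Integration.integral_diff[OF integrable_mult_right[OF iA[OF A]] il[OF A]]) simp
    then have "(LINT x|lebesgue. H * indicator A x - rep_L2 l x * indicator A x) = 0"
      using integral_nonneg_AE[OF nn] by simp
    then have "AE x in lebesgue. H * indicator A x - rep_L2 l x * indicator A x = 0"
      using integral_nonneg_eq_0_iff_AE[OF int nn] by simp
    then show ?thesis by eventually_elim (auto simp: A_def indicator_def not_less split: if_splits)
  qed
  have ae_K: "AE x in lebesgue. x \<in> \<Omega> \<longrightarrow> rep_L2 l x \<le> K"
  proof -
    define A where "A = {x \<in> space lebesgue. K < rep_L2 l x} \<inter> \<Omega>"
    have A: "A \<in> sets lebesgue" "A \<subseteq> \<Omega>" unfolding A_def using borel_measurable_less[OF borel_measurable_const[of K] m] by auto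
    have int: "integrable lebesgue (\<lambda>x. rep_L2 l x * indicator A x - K * indicator A x)"
      by (intro Bochner_Integration.integrable_diff integrable_mult_right iA il A)
    have nn: "AE x in lebesgue. 0 \<le> rep_L2 l x * indicator A x - K * indicator A x"
      by (rule AE_I2) (auto simp: A_def indicator_def)
    have "(LINT x|lebesgue. rep_L2 l x * indicator A x - K * indicator A x) \<le> 0"
      using upper[OF A] by (subst Bochner_Integration.integral_diff[OF il[OF A] integrable_mult_right[OF iA[OF A]]]) simp
    then have "(LINT x|lebesgue. rep_L2 l x * indicator A x - K * indicator A x) = 0"
      using integral_nonneg_AE[OF nn] by simp
    then have "AE x in lebesgue. rep_L2 l x * indicator A x - K * indicator A x = 0"
      using integral_nonneg_eq_0_iff_AE[OF int nn] by simp
    then show ?thesis by eventually_elim (auto simp: A_def indicator_def not_less split: if_splits)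
  qed
  have "(LINT x|lebesgue. cut (V n) x * indicator \<Omega> x) = \<beta> * measure lebesgue \<Omega>" for n
  proof -
    have "(\<lambda>x. cut (V n) x * indicator \<Omega> x) = cut (V n)" by (rule ext) (auto simp: cut_def indicator_def)
    then show ?thesis using admissible_cut(5)[OF V[of n]] by simp
  qed
  then have "(LINT x|lebesgue. rep_L2 l x * indicator \<Omega> x) = \<beta> * measure lebesgue \<Omega>"
    using lim[of "abs_L2 (indicator \<Omega>)", unfolded inner_A[OF \<Omega>_measurable(2) subset_refl] l_A[OF \<Omega>_measurable(2) subset_refl]]
    by (simp add: LIMSEQ_const_iff)
  moreover have "(LINT x|lebesgue_on \<Omega>. rep_L2 l x) = (LINT x|lebesgue. indicator \<Omega> x *\<^sub>R rep_L2 l x)"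
    by (rule integral_restrict_space) auto
  ultimately have int: "(LINT x|lebesgue_on \<Omega>. rep_L2 l x) = \<beta> * measure lebesgue \<Omega>" by (simp add: mult.commute)
  have "AE x in lebesgue_on \<Omega>. H \<le> rep_L2 l x \<and> rep_L2 l x \<le> K"
    using ae_H ae_K by (subst AE_restrict_space_iff) (auto elim: eventually_elim2)
  then show ?thesis
    using int measurable_restrict_space1[OF m] by (simp add: admissible_dampings_def)
qed

text \<open>The product \<eta> of \<open>f\<close> and \<psi> is integrable but in general not
  square integrable, so weak \<open>L2\<close> convergence does not apply to it directly. Truncating
  where its modulus exceeds \<open>M\<close> gives a function in \<open>L2\<close>, and the common
  bound \<open>K\<close> of the dampings controls the remainder: weak convergence becomes weak-star
  convergence.\<close>

lemma weak_limit_multiplication: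
  assumes V: "\<And>n. V n \<in> Adm"
    and lim: "\<And>y. (\<lambda>n. mult_L2 \<Omega> (V n) one \<bullet> y) \<longlonglongrightarrow> l \<bullet> y"
  shows "(\<lambda>n. mult_L2 \<Omega> (V n) f \<bullet> \<psi>) \<longlonglongrightarrow> mult_L2 \<Omega> (rep_L2 l) f \<bullet> \<psi>"
proof -
  note W = weak_limit_admissible[OF V lim]
  define \<eta> where "\<eta> x = rep_L2 f x * rep_L2 \<psi> x" for x
  have \<eta>: "integrable lebesgue \<eta>" unfolding \<eta>_def by (rule square_integrable_mult) auto
  then have \<eta>m: "\<eta> \<in> borel_measurable lebesgue" by auto
  define A where "A M = {x \<in> space lebesgue. \<bar>\<eta> x\<bar> \<le> real M} \<inter> \<Omega>" for M :: nat
  have A: "A M \<in> sets lebesgue" "A M \<subseteq> \<Omega>" for M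
    unfolding A_def using borel_measurable_le[OF borel_measurable_abs[OF \<eta>m] borel_measurable_const[of "real M"]] by auto
  define tr where "tr M x = \<eta> x * indicator (A M) x" for M x
  have sq: "square_integrable (tr M)" for M
  proof -
    \<comment> \<open>The indicator is doubled to exhibit \<open>tr M\<close> as a multiplier
      bounded by \<open>M\<close> times an indicator that is square integrable, \<Omega> being
      bounded.\<close>
    have "square_integrable (\<lambda>x. (\<eta> x * indicator (A M) x) * indicator (A M) x)"
    proof (rule square_integrable_AE_bounded_mult[OF indicator_square_integrable[OF A]])
      show "(\<lambda>x. \<eta> x * indicator (A M) x) \<in> borel_measurable lebesgue"
        using A by (intro borel_measurable_times \<eta>m borel_measurable_indicator)
      show "AE x in lebesgue. \<bar>\<eta> x * indicator (A M) x\<bar> \<le> real M"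
        by (rule AE_I2) (auto simp: A_def indicator_def)
    qed
    moreover have "(\<lambda>x. (\<eta> x * indicator (A M) x) * indicator (A M) x) = tr M"
      by (rule ext) (auto simp: tr_def indicator_def)
    ultimately show ?thesis by simp
  qed
  have itr: "integrable lebesgue (tr M)" for M
    unfolding tr_def by (rule integrable_real_mult_indicator[OF A(1) \<eta>])
  define \<zeta> where "\<zeta> M x = indicator \<Omega> x * (\<eta> x - tr M x)" for M x
  have i\<zeta>: "integrable lebesgue (\<zeta> M)" for M
    unfolding \<zeta>_def using integrable_real_mult_indicator[OF \<Omega>_measurable(2) Bochner_Integration.integrable_diff[OF \<eta> itr]]
    by (simp add: mult.commute)
  have "(\<lambda>M. LINT x|lebesgue. \<bar>\<zeta> M x\<bar>) \<longlonglongrightarrow> (LINT x|(lebesgue :: (real^'n) measure). 0)"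
  proof (rule integral_dominated_convergence[where w="\<lambda>x. \<bar>\<eta> x\<bar>"])
    show "AE x in lebesgue. (\<lambda>M. \<bar>\<zeta> M x\<bar>) \<longlonglongrightarrow> 0"
    proof (rule AE_I2)
      fix x
      obtain M0 :: nat where M0: "\<bar>\<eta> x\<bar> \<le> real M0" using real_arch_simple by blast
      have "\<forall>M\<ge>M0. \<bar>\<zeta> M x\<bar> = 0"
        using M0 by (auto simp: \<zeta>_def tr_def A_def indicator_def)
      then have "\<forall>\<^sub>F M in sequentially. \<bar>\<zeta> M x\<bar> = 0" unfolding eventually_sequentially by blast
      then show "(\<lambda>M. \<bar>\<zeta> M x\<bar>) \<longlonglongrightarrow> 0" by (rule tendsto_eventually)
    qed
    show "AE x in lebesgue. norm \<bar>\<zeta> M x\<bar> \<le> \<bar>\<eta> x\<bar>" for M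
      by (rule AE_I2) (auto simp: \<zeta>_def tr_def indicator_def)
    show "(\<lambda>x. \<bar>\<zeta> M x\<bar>) \<in> borel_measurable lebesgue" for M using i\<zeta>[of M] by (intro borel_measurable_abs) auto
  qed (use \<eta> in auto)
  then have small: "(\<lambda>M. LINT x|lebesgue. \<bar>\<zeta> M x\<bar>) \<longlonglongrightarrow> 0" by simp
  have err: "\<bar>mult_L2 \<Omega> U f \<bullet> \<psi> - (LINT x|lebesgue. cut U x * tr M x)\<bar> \<le> K * (LINT x|lebesgue. \<bar>\<zeta> M x\<bar>)"
    if U: "U \<in> Adm" for U M
  proof -
    have "mult_L2 \<Omega> U f \<bullet> \<psi> - (LINT x|lebesgue. cut U x * tr M x) = (LINT x|lebesgue. cut U x * \<zeta> M x)"
      unfolding inner_mult_L2[OF U] \<eta>_def[symmetric]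
      by (subst Bochner_Integration.integral_diff[symmetric, OF integrable_cut_mult[OF U \<eta>] integrable_cut_mult[OF U itr]],
          rule Bochner_Integration.integral_cong) (auto simp: \<zeta>_def cut_def indicator_def algebra_simps)
    also have "\<bar>\<dots>\<bar> \<le> (LINT x|lebesgue. \<bar>cut U x * \<zeta> M x\<bar>)"
      using integral_norm_bound[of lebesgue "\<lambda>x. cut U x * \<zeta> M x"] by simp
    also have "\<dots> \<le> (LINT x|lebesgue. K * \<bar>\<zeta> M x\<bar>)"
    proof (rule integral_mono_AE)
      show "integrable lebesgue (\<lambda>x. \<bar>cut U x * \<zeta> M x\<bar>)"
        using integrable_cut_mult[OF U i\<zeta>] by (rule integrable_abs)
      show "integrable lebesgue (\<lambda>x. K * \<bar>\<zeta> M x\<bar>)" by (intro integrable_mult_right integrable_abs i\<zeta>)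
      show "AE x in lebesgue. \<bar>cut U x * \<zeta> M x\<bar> \<le> K * \<bar>\<zeta> M x\<bar>"
        using admissible_cut(4)[OF U] by eventually_elim (auto simp: abs_mult intro!: mult_right_mono)
    qed
    finally show ?thesis by simp
  qed
  have ae1: "AE x in lebesgue. rep_L2 one x = indicator \<Omega> x"
    unfolding one_def by (rule rep_L2_abs_L2[OF indicator_square_integrable]) auto
  have tr_n: "mult_L2 \<Omega> (V n) one \<bullet> abs_L2 (tr M) = (LINT x|lebesgue. cut (V n) x * tr M x)" for n M
  proof -
    have "mult_L2 \<Omega> (V n) one \<bullet> abs_L2 (tr M) = (LINT x|lebesgue. (cut (V n) x * rep_L2 one x) * tr M x)"
      unfolding mult_L2_cut by (rule inner_abs_L2[OF admissible_square_integrable[OF V square_integrable_rep_L2] sq])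
    also have "\<dots> = (LINT x|lebesgue. cut (V n) x * tr M x)"
    proof (rule integral_cong_AE)
      show "(\<lambda>x. (cut (V n) x * rep_L2 one x) * tr M x) \<in> borel_measurable lebesgue"
        using itr[of M] by (intro borel_measurable_times admissible_cut(1)[OF V]) auto
      show "(\<lambda>x. cut (V n) x * tr M x) \<in> borel_measurable lebesgue"
        using itr[of M] by (intro borel_measurable_times admissible_cut(1)[OF V]) auto
      show "AE x in lebesgue. (cut (V n) x * rep_L2 one x) * tr M x = cut (V n) x * tr M x"
        using ae1 by eventually_elim (auto simp: cut_def indicator_def)
    qed
    finally show ?thesis .
  qed
  have tr_l: "l \<bullet> abs_L2 (tr M) = (LINT x|lebesgue. cut (rep_L2 l) x * tr M x)" for M
    unfolding inner_rep_abs_L2[OF sq]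
    by (rule Bochner_Integration.integral_cong) (auto simp: cut_def tr_def A_def indicator_def)
  show ?thesis
  proof (rule tendstoI)
    fix e :: real assume e: "0 < e"
    have "(\<lambda>M. K * (LINT x|lebesgue. \<bar>\<zeta> M x\<bar>)) \<longlonglongrightarrow> 0" by (rule tendsto_mult_right_zero[OF small])
    from order_tendstoD(2)[OF this, of "e / 3"] e
    have "\<forall>\<^sub>F M in sequentially. K * (LINT x|lebesgue. \<bar>\<zeta> M x\<bar>) < e / 3" by simp
    then obtain M where M: "K * (LINT x|lebesgue. \<bar>\<zeta> M x\<bar>) < e / 3"
      unfolding eventually_sequentially by blast
    have "\<forall>\<^sub>F n in sequentially. dist (mult_L2 \<Omega> (V n) one \<bullet> abs_L2 (tr M)) (l \<bullet> abs_L2 (tr M)) < e / 3"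
      using lim e by (intro tendstoD) auto
    then show "\<forall>\<^sub>F n in sequentially. dist (mult_L2 \<Omega> (V n) f \<bullet> \<psi>) (mult_L2 \<Omega> (rep_L2 l) f \<bullet> \<psi>) < e"
    proof eventually_elim
      case (elim n)
      then show ?case using err[OF V[of n], of M] err[OF W, of M] M unfolding tr_n tr_l dist_real_def by linarith
    qed
  qed
qed

text \<open>For each fixed \<open>f\<close> the products converge weakly along the subsequence and
  are bounded, so \<open>Es\<close> turns their convergence into norm convergence. This is exactly
  what the resolvent comparison requires.\<close>

lemma admissible_compact:
  assumes V: "\<And>n. V n \<in> Adm"
  shows "\<exists>r W. strict_mono (r :: nat \<Rightarrow> nat) \<and> W \<in> Adm \<and>
    (\<forall>f. (\<lambda>n. Es (mult_L2 \<Omega> (V (r n)) f - mult_L2 \<Omega> W f)) \<longlonglongrightarrow> 0)"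
proof -
  obtain r l where r: "strict_mono r" "\<And>y. (\<lambda>n. mult_L2 \<Omega> (V (r n)) one \<bullet> y) \<longlonglongrightarrow> l \<bullet> y"
    using bounded_imp_weakly_convergent_subsequence[of "\<lambda>n. mult_L2 \<Omega> (V n) one", OF mult_L2_norm[OF V]] by blast
  note W = weak_limit_admissible[of "\<lambda>n. V (r n)", OF V r(2)]
  have "(\<lambda>n. Es (mult_L2 \<Omega> (V (r n)) f - mult_L2 \<Omega> (rep_L2 l) f)) \<longlonglongrightarrow> 0" for f
  proof (rule Es_weakly_null)
    show "norm (mult_L2 \<Omega> (V (r n)) f - mult_L2 \<Omega> (rep_L2 l) f) \<le> norm f * K + norm f * K" for n
      by (rule order_trans[OF norm_triangle_ineq4 add_mono[OF mult_L2_norm[OF V] mult_L2_norm[OF W]]])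
    show "(\<lambda>n. (mult_L2 \<Omega> (V (r n)) f - mult_L2 \<Omega> (rep_L2 l) f) \<bullet> \<psi>) \<longlonglongrightarrow> 0" for \<psi>
      unfolding inner_diff_left
      using weak_limit_multiplication[of "\<lambda>n. V (r n)", OF V r(2), of f \<psi>] by (simp add: LIM_zero)
  qed
  then show ?thesis using r(1) W by blast
qed

section \<open>The damped semigroup and its operator norm\<close>

abbreviation wave_S where "wave_S V \<equiv> m_dissipative.S (wave_graph (mult_L2 \<Omega> V))"

text \<open>A definition by choice has its properties only when a witness exists. The witness is the
  wave semigroup, transported to the energy space.\<close>

lemma damped_semigroup_spec:
  assumes V: "V \<in> Adm"
  shows "contraction_semigroup (energy_space k \<alpha> \<Omega>) (energy_norm k \<alpha> \<Omega>) (damped_semigroup k \<alpha> \<Omega> V)"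
    and "generator_graph (energy_space k \<alpha> \<Omega>) (energy_norm k \<alpha> \<Omega>) (damped_semigroup k \<alpha> \<Omega> V)
       = {(x, - damped_op k \<alpha> \<Omega> V x) | x. x \<in> dom_op k \<alpha> \<Omega> \<times> H10w k \<alpha> \<Omega>}" (is "_ = ?D")
proof -
  note dV = mult_L2_damping[OF V]
  interpret m_dissipative "G \<times> L2_on \<Omega>" "wave_graph (mult_L2 \<Omega> V)" by (rule m_dissipative_wave[OF dV])
  have nrm: "norm y = energy_norm k \<alpha> \<Omega> (from_state y)" if "y \<in> G \<times> L2_on \<Omega>" for y
    using energy_norm_to_state[OF from_state(1)[OF that]] from_state(2)[OF that] by simp
  let ?S = "\<lambda>t y. from_state (S t (to_state y))"
  have tr1: "contraction_semigroup (energy_space k \<alpha> \<Omega>) (energy_norm k \<alpha> \<Omega>) ?S"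
    by (rule semigroup_transport(1)[OF contraction_semigroup_S subspace_X, where \<Phi>=from_state and \<Psi>=to_state];
      (rule from_state to_state nrm from_state_linear to_state_linear; assumption))
  have tr2: "generator_graph (energy_space k \<alpha> \<Omega>) (energy_norm k \<alpha> \<Omega>) ?S
      = (\<lambda>p. (from_state (fst p), from_state (snd p))) ` generator_graph (G \<times> L2_on \<Omega>) norm S"
    by (rule semigroup_transport(2)[OF contraction_semigroup_S subspace_X, where \<Phi>=from_state and \<Psi>=to_state];
      (rule from_state to_state nrm from_state_linear to_state_linear; assumption))
  have H10_L2: "v \<in> L2_on \<Omega>" if "v \<in> H10w k \<alpha> \<Omega>" for v using that by (auto simp: H10w_def H1w_def)
  \<comment> \<open>Since \<open>from_state\<close> undoes \<open>to_state\<close> only on the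
    energy space, both components of the graph have to lie there.\<close>
  have D: "x \<in> energy_space k \<alpha> \<Omega> \<and> y \<in> energy_space k \<alpha> \<Omega>" if xy: "(x, y) \<in> ?D" for x y
  proof -
    obtain u v where uv: "u \<in> dom_op k \<alpha> \<Omega>" "v \<in> H10w k \<alpha> \<Omega>" "x = (u, v)" "y = - damped_op k \<alpha> \<Omega> V (u, v)"
      using xy by auto
    obtain f where f: "u \<in> H10w k \<alpha> \<Omega>" "f \<in> L2_on \<Omega>" "Gr u = Es f" using uv(1) by (auto simp: dom_op_iff)
    have "y = (v, - (f + mult_L2 \<Omega> V v))" unfolding uv(4) by (simp add: damped_op_def deg_op_eq[OF f])
    moreover have "- (f + mult_L2 \<Omega> V v) \<in> L2_on \<Omega>"
      using dV f(2) by (intro subspace_neg[OF subspace_L2_on] subspace_add[OF subspace_L2_on]) (auto simp: damping_def)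
    ultimately show ?thesis using uv(2,3) f(1) H10_L2[OF uv(2)] by (simp add: energy_space_def)
  qed
  have "generator_graph (energy_space k \<alpha> \<Omega>) (energy_norm k \<alpha> \<Omega>) ?S
      = (\<lambda>p. (from_state (fst p), from_state (snd p))) ` wave_graph (mult_L2 \<Omega> V)"
    using tr2 unfolding generator_graph_S .
  also have "\<dots> = (\<lambda>p. (from_state (to_state (fst p)), from_state (to_state (snd p)))) ` ?D"
    unfolding damped_graph_to_state[OF dV, symmetric] image_image by simp
  also have "\<dots> = (\<lambda>p. p) ` ?D"
  proof (rule image_cong[OF refl])
    fix p assume p: "p \<in> ?D"
    obtain x y where xy: "p = (x, y)" by (cases p)
    have "x \<in> energy_space k \<alpha> \<Omega>" "y \<in> energy_space k \<alpha> \<Omega>" using D[of x y] p unfolding xy by blast+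
    then show "(from_state (to_state (fst p)), from_state (to_state (snd p))) = p" by (simp add: xy to_state(2))
  qed
  finally have "generator_graph (energy_space k \<alpha> \<Omega>) (energy_norm k \<alpha> \<Omega>) ?S = ?D" by simp
  then have "\<exists>S. contraction_semigroup (energy_space k \<alpha> \<Omega>) (energy_norm k \<alpha> \<Omega>) S \<and>
      generator_graph (energy_space k \<alpha> \<Omega>) (energy_norm k \<alpha> \<Omega>) S = ?D"
    using tr1 by blast
  from someI_ex[OF this]
  show "contraction_semigroup (energy_space k \<alpha> \<Omega>) (energy_norm k \<alpha> \<Omega>) (damped_semigroup k \<alpha> \<Omega> V)"
    "generator_graph (energy_space k \<alpha> \<Omega>) (energy_norm k \<alpha> \<Omega>) (damped_semigroup k \<alpha> \<Omega> V) = ?D"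
    unfolding damped_semigroup_def by auto
qed

text \<open>Transported to the space of weighted gradients, the chosen semigroup has the wave graph
  as generator, and uniqueness applies.\<close>

lemma damped_semigroup_wave:
  assumes V: "V \<in> Adm" and y: "y \<in> G \<times> L2_on \<Omega>" and t: "0 \<le> t"
  shows "to_state (damped_semigroup k \<alpha> \<Omega> V t (from_state y)) = wave_S V t y"
proof -
  note dV = mult_L2_damping[OF V]
  note spec = damped_semigroup_spec[OF V]
  interpret m_dissipative "G \<times> L2_on \<Omega>" "wave_graph (mult_L2 \<Omega> V)" by (rule m_dissipative_wave[OF dV])
  let ?S = "\<lambda>t y. to_state (damped_semigroup k \<alpha> \<Omega> V t (from_state y))"
  have tr1: "contraction_semigroup (G \<times> L2_on \<Omega>) norm ?S"
    by (rule semigroup_transport(1)[OF spec(1) subspace_energy_space, where \<Phi>=to_state and \<Psi>=from_state];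
      (rule to_state from_state energy_norm_to_state to_state_linear from_state_linear; assumption))
  have "generator_graph (G \<times> L2_on \<Omega>) norm ?S = (\<lambda>p. (to_state (fst p), to_state (snd p))) `
      generator_graph (energy_space k \<alpha> \<Omega>) (energy_norm k \<alpha> \<Omega>) (damped_semigroup k \<alpha> \<Omega> V)"
    by (rule semigroup_transport(2)[OF spec(1) subspace_energy_space, where \<Phi>=to_state and \<Psi>=from_state];
      (rule to_state from_state energy_norm_to_state to_state_linear from_state_linear; assumption))
  then have "generator_graph (G \<times> L2_on \<Omega>) norm ?S = wave_graph (mult_L2 \<Omega> V)"
    unfolding spec(2) damped_graph_to_state[OF dV] .
  from contraction_semigroup_unique[OF tr1 this y t] show ?thesis .
qed

lemma semigroup_norm_wave:
  assumes V: "V \<in> Adm" and T: "0 \<le> T"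
  shows "semigroup_norm k \<alpha> \<Omega> T V = (SUP y\<in>{y \<in> G \<times> L2_on \<Omega>. norm y \<le> 1}. norm (wave_S V T y))"
proof -
  note S_X = contraction_semigroup_carrier(1)[OF damped_semigroup_spec(1)[OF V] _ T]
  have "(\<lambda>x. energy_norm k \<alpha> \<Omega> (damped_semigroup k \<alpha> \<Omega> V T x)) ` {x \<in> energy_space k \<alpha> \<Omega>. energy_norm k \<alpha> \<Omega> x \<le> 1}
      = (\<lambda>y. norm (wave_S V T y)) ` {y \<in> G \<times> L2_on \<Omega>. norm y \<le> 1}"
  proof (intro equalityI image_subsetI)
    fix x assume x: "x \<in> {x \<in> energy_space k \<alpha> \<Omega>. energy_norm k \<alpha> \<Omega> x \<le> 1}"
    then have y: "to_state x \<in> {y \<in> G \<times> L2_on \<Omega>. norm y \<le> 1}"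
      using to_state(1)[of x] energy_norm_to_state[of x] by auto
    have "energy_norm k \<alpha> \<Omega> (damped_semigroup k \<alpha> \<Omega> V T x) = norm (wave_S V T (to_state x))"
      using damped_semigroup_wave[OF V _ T, of "to_state x"] y x energy_norm_to_state[OF S_X] to_state(2)[of x] by auto
    then show "energy_norm k \<alpha> \<Omega> (damped_semigroup k \<alpha> \<Omega> V T x) \<in> (\<lambda>y. norm (wave_S V T y)) ` {y \<in> G \<times> L2_on \<Omega>. norm y \<le> 1}"
      by (rule image_eqI[OF _ y])
  next
    fix y assume y: "y \<in> {y \<in> G \<times> L2_on \<Omega>. norm y \<le> 1}"
    then have yX: "y \<in> G \<times> L2_on \<Omega>" by simp
    have x: "from_state y \<in> {x \<in> energy_space k \<alpha> \<Omega>. energy_norm k \<alpha> \<Omega> x \<le> 1}"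
      using y from_state[OF yX] energy_norm_to_state[OF from_state(1)[OF yX]] by auto
    have "norm (wave_S V T y) = energy_norm k \<alpha> \<Omega> (damped_semigroup k \<alpha> \<Omega> V T (from_state y))"
      using damped_semigroup_wave[OF V yX T] energy_norm_to_state[OF S_X[OF from_state(1)[OF yX]]] by simp
    then show "norm (wave_S V T y) \<in> (\<lambda>x. energy_norm k \<alpha> \<Omega> (damped_semigroup k \<alpha> \<Omega> V T x)) ` {x \<in> energy_space k \<alpha> \<Omega>. energy_norm k \<alpha> \<Omega> x \<le> 1}"
      by (rule image_eqI[OF _ x])
  qed
  then show ?thesis by (simp add: semigroup_norm_def operator_norm_def)
qed

lemma wave_S_le_semigroup_norm:
  assumes V: "V \<in> Adm" and T: "0 \<le> T" and y: "y \<in> G \<times> L2_on \<Omega>" "norm y \<le> 1"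
  shows "norm (wave_S V T y) \<le> semigroup_norm k \<alpha> \<Omega> T V"
proof -
  interpret m_dissipative "G \<times> L2_on \<Omega>" "wave_graph (mult_L2 \<Omega> V)" by (rule m_dissipative_wave[OF mult_L2_damping[OF V]])
  have "bdd_above ((\<lambda>y. norm (S T y)) ` {y \<in> G \<times> L2_on \<Omega>. norm y \<le> 1})"
    by (rule bdd_aboveI2[of _ _ 1]) (use S_contraction[OF _ T] in \<open>auto intro: order_trans\<close>)
  then show ?thesis unfolding semigroup_norm_wave[OF V T] using y by (intro cSUP_upper) auto
qed

text \<open>A nonzero value of \<open>S T\<close>, normalized to the unit ball, bounds the supremum
  from below. Positivity makes the quotient under \<open>ln\<close> a genuine positive number, so
  that the second functional is strictly decreasing in the norm.\<close>

lemma semigroup_norm_pos: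
  assumes V: "V \<in> Adm" and T: "0 < T"
  shows "0 < semigroup_norm k \<alpha> \<Omega> T V"
proof -
  note dV = mult_L2_damping[OF V]
  interpret m_dissipative "G \<times> L2_on \<Omega>" "wave_graph (mult_L2 \<Omega> V)" by (rule m_dissipative_wave[OF dV])
  have "\<exists>x\<in>G \<times> L2_on \<Omega>. S T x \<noteq> 0"
    by (rule wave_semigroup_nonzero[OF dV _ mult_L2_form_bounds(2)[OF V] T])
      (use HK one_L2_on one_nonzero[OF nonempty] in auto)
  then obtain x where x: "x \<in> G \<times> L2_on \<Omega>" "S T x \<noteq> 0" by blast
  have x0: "x \<noteq> 0" using x(2) S_contraction[OF x(1), of T] T by auto
  define y where "y = (1 / norm x) *\<^sub>R x"
  have y: "y \<in> G \<times> L2_on \<Omega>" "norm y \<le> 1"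
    unfolding y_def using subspace_scale[OF subspace_X x(1)] x0 by auto
  have "S T y = (1 / norm x) *\<^sub>R S T x" unfolding y_def using S_scale[OF x(1)] T by simp
  then have "0 < norm (S T y)" using x(2) x0 by simp
  also have "\<dots> \<le> semigroup_norm k \<alpha> \<Omega> T V" by (rule wave_S_le_semigroup_norm[OF V _ y]) (use T in simp)
  finally show ?thesis .
qed

text \<open>Direct method: along a minimizing sequence a subsequence converges in the sense of
  \<open>admissible_compact\<close>. For each \<open>y\<close> in the unit ball strong convergence
  bounds the limit by the infimum, and the supremum over \<open>y\<close> is taken only
  afterwards.\<close>

lemma semigroup_norm_minimizer:
  assumes T: "0 < T"
  shows "\<exists>V\<in>Adm. \<forall>W\<in>Adm. semigroup_norm k \<alpha> \<Omega> T V \<le> semigroup_norm k \<alpha> \<Omega> T W"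
proof -
  let ?N = "semigroup_norm k \<alpha> \<Omega> T"
  define m where "m = Inf (?N ` Adm)"
  have bdd: "bdd_below (?N ` Adm)" by (rule bdd_belowI2[of _ 0]) (use semigroup_norm_pos[OF _ T] in \<open>auto intro: less_imp_le\<close>)
  have mle: "m \<le> ?N W" if "W \<in> Adm" for W unfolding m_def by (rule cINF_lower[OF bdd that])
  have "\<exists>V\<in>Adm. ?N V < m + inverse (real (Suc n))" for n
  proof -
    have "\<exists>y\<in>?N ` Adm. y < m + inverse (real (Suc n))"
      unfolding m_def by (rule cInf_lessD) (use constant_admissible in auto)
    then show ?thesis by blast
  qed
  then obtain V where V: "\<And>n. V n \<in> Adm" "\<And>n. ?N (V n) < m + inverse (real (Suc n))" by metis
  obtain r W where r: "strict_mono r" and W: "W \<in> Adm"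
    and conv: "\<And>f. (\<lambda>n. Es (mult_L2 \<Omega> (V (r n)) f - mult_L2 \<Omega> W f)) \<longlonglongrightarrow> 0"
    using admissible_compact[of V, OF V(1)] by blast
  have bnd: "norm (wave_S W T y) \<le> m" if y: "y \<in> G \<times> L2_on \<Omega>" "norm y \<le> 1" for y
  proof (rule LIMSEQ_le)
    show "(\<lambda>n. norm (wave_S (V (r n)) T y)) \<longlonglongrightarrow> norm (wave_S W T y)"
      by (intro tendsto_norm wave_semigroup_convergence[OF mult_L2_damping[OF W] mult_L2_damping[OF V(1)] y(1) T conv])
    have "(\<lambda>n. inverse (real (Suc (r n)))) \<longlonglongrightarrow> 0"
      using LIMSEQ_subseq_LIMSEQ[OF LIMSEQ_inverse_real_of_nat r] by (simp add: o_def)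
    from tendsto_add[OF tendsto_const this]
    show "(\<lambda>n. m + inverse (real (Suc (r n)))) \<longlonglongrightarrow> m" by simp
    have "norm (wave_S (V (r n)) T y) \<le> m + inverse (real (Suc (r n)))" for n
      using wave_S_le_semigroup_norm[OF V(1)[of "r n"] less_imp_le[OF T] y] V(2)[of "r n"] by linarith
    then show "\<exists>N. \<forall>n\<ge>N. norm (wave_S (V (r n)) T y) \<le> m + inverse (real (Suc (r n)))" by blast
  qed
  have "(0, 0) \<in> {y \<in> G \<times> L2_on \<Omega>. norm y \<le> 1}"
    using subspace_0[OF subspace_G] subspace_0[OF subspace_L2_on] by (simp add: norm_Pair)
  then have ne: "{y \<in> G \<times> L2_on \<Omega>. norm y \<le> 1} \<noteq> {}" by blast
  have "?N W \<le> m"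
    unfolding semigroup_norm_wave[OF W less_imp_le[OF T]] by (rule cSUP_least[OF ne]) (use bnd in blast)
  then show ?thesis using W mle order_trans by blast
qed

text \<open>Each functional is a strictly decreasing function of the positive semigroup norm, so its
  maximizers are the minimizers of the norm.\<close>

lemma maximizers_characterization:
  assumes T: "0 < T" and C\<^sub>0: "0 < C\<^sub>0"
  shows "maximizes_on (J_functional k \<alpha> \<Omega> T) Adm V \<longleftrightarrow>
      V \<in> Adm \<and> (\<forall>W\<in>Adm. semigroup_norm k \<alpha> \<Omega> T V \<le> semigroup_norm k \<alpha> \<Omega> T W)"
    and "maximizes_on (omega_functional k \<alpha> \<Omega> C\<^sub>0 T) Adm V \<longleftrightarrow>
      V \<in> Adm \<and> (\<forall>W\<in>Adm. semigroup_norm k \<alpha> \<Omega> T V \<le> semigroup_norm k \<alpha> \<Omega> T W)"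
proof -
  let ?N = "semigroup_norm k \<alpha> \<Omega> T"
  have J: "J_functional k \<alpha> \<Omega> T W \<le> J_functional k \<alpha> \<Omega> T V \<longleftrightarrow> ?N V \<le> ?N W" if "V \<in> Adm" "W \<in> Adm" for V W
    using semigroup_norm_pos[OF that(1) T] semigroup_norm_pos[OF that(2) T]
    by (simp add: J_functional_def power_mono_iff)
  have w: "omega_functional k \<alpha> \<Omega> C\<^sub>0 T W \<le> omega_functional k \<alpha> \<Omega> C\<^sub>0 T V \<longleftrightarrow> ?N V \<le> ?N W" if "V \<in> Adm" "W \<in> Adm" for V W
  proof -
    note p = semigroup_norm_pos[OF that(1) T] semigroup_norm_pos[OF that(2) T]
    have "omega_functional k \<alpha> \<Omega> C\<^sub>0 T W \<le> omega_functional k \<alpha> \<Omega> C\<^sub>0 T V \<longleftrightarrow> ln (C\<^sub>0 / ?N W) \<le> ln (C\<^sub>0 / ?N V)"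
      unfolding omega_functional_def using T by (simp add: divide_le_cancel)
    also have "\<dots> \<longleftrightarrow> C\<^sub>0 / ?N W \<le> C\<^sub>0 / ?N V" using p C\<^sub>0 by (intro ln_le_cancel_iff divide_pos_pos)
    also have "\<dots> \<longleftrightarrow> ?N V \<le> ?N W" using p C\<^sub>0 by (simp add: field_simps)
    finally show ?thesis .
  qed
  show "maximizes_on (J_functional k \<alpha> \<Omega> T) Adm V \<longleftrightarrow> V \<in> Adm \<and> (\<forall>W\<in>Adm. ?N V \<le> ?N W)"
    unfolding maximizes_on_def using J by blast
  show "maximizes_on (omega_functional k \<alpha> \<Omega> C\<^sub>0 T) Adm V \<longleftrightarrow> V \<in> Adm \<and> (\<forall>W\<in>Adm. ?N V \<le> ?N W)"
    unfolding maximizes_on_def using w by blast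
qed

end

text \<open>An open set inside the closed half-space misses the bounding hyperplane: around each
  point there is room to move down by \<open>e / 2\<close> in direction \<open>k\<close> while the
  coordinate stays nonnegative.\<close>

lemma admissible_domain_weighted:
  assumes "admissible_domain k \<Omega>" "0 < \<alpha>" "\<alpha> < 1"
  shows "weighted_domain k \<alpha> \<Omega>" "\<Omega> \<noteq> {}"
proof -
  have \<Omega>: "open \<Omega>" "bounded \<Omega>" "\<Omega> \<subseteq> closure {x. x $ k > 0}" "\<Omega> \<noteq> {}"
    using assms(1) by (auto simp: admissible_domain_def C2_domain_def)
  have "closure {x :: real^'a. x $ k > 0} \<subseteq> {x. 0 \<le> x $ k}"
    by (intro closure_minimal closed_Collect_le continuous_intros) auto
  then have nonneg: "0 \<le> x $ k" if "x \<in> \<Omega>" for x using \<Omega>(3) that by blast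
  have "0 < x $ k" if x: "x \<in> \<Omega>" for x
  proof -
    obtain e where e: "0 < e" "ball x e \<subseteq> \<Omega>" using \<Omega>(1) x open_contains_ball by blast
    have "x - (e / 2) *\<^sub>R axis k 1 \<in> ball x e" using e(1) by (simp add: dist_norm norm_axis_1)
    then have "0 \<le> (x - (e / 2) *\<^sub>R axis k 1) $ k" using nonneg e(2) by blast
    then show ?thesis using e(1) by (simp add: axis_def)
  qed
  then show "weighted_domain k \<alpha> \<Omega>" using \<Omega> assms by unfold_locales auto
  show "\<Omega> \<noteq> {}" by (rule \<Omega>(4))
qed

theorem theorem4p7:
  fixes k :: "'n::finite"
    and \<Omega> :: "(real^'n) set"
    and \<alpha> H K \<beta> C\<^sub>0 T :: real
  assumes "admissible_domain k \<Omega>"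
    and "0 < \<alpha>" and "\<alpha> < 1"
    and "0 < H" and "H < K"
    and "H < \<beta>" and "\<beta> < K"
    and "C\<^sub>0 > 1"
    and "T > 0"
  shows "(\<exists>V. maximizes_on (J_functional k \<alpha> \<Omega> T) (admissible_dampings \<Omega> H K \<beta>) V) \<and>
    (\<exists>V. maximizes_on (omega_functional k \<alpha> \<Omega> C\<^sub>0 T) (admissible_dampings \<Omega> H K \<beta>) V) \<and>
    (\<forall>V. maximizes_on (J_functional k \<alpha> \<Omega> T) (admissible_dampings \<Omega> H K \<beta>) V \<longleftrightarrow>
         maximizes_on (omega_functional k \<alpha> \<Omega> C\<^sub>0 T) (admissible_dampings \<Omega> H K \<beta>) V)"
proof -
  interpret weighted_domain k \<alpha> \<Omega> by (rule admissible_domain_weighted[OF assms(1-3)])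
  interpret admissible_parameters k \<alpha> \<Omega> H K \<beta>
    by unfold_locales (use assms admissible_domain_weighted(2)[OF assms(1-3)] in auto)
  have "0 < C\<^sub>0" using assms(8) by simp
  note ch = maximizers_characterization[OF assms(9) this]
  show ?thesis unfolding ch using semigroup_norm_minimizer[OF assms(9)] by blast
qed

end
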